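(* Fix $c>0$ and $k\in(0,\sqrt c/2)$, and let $\mathcal{L}$, $\widetilde{\mathcal{L}}$, $\omega_0$, $f$ be as in the context. The spectrum of $\mathcal{L}$ is bounded from below by a negative number and $$\sigma(\mathcal{L})\subset[\sigma_1,\infty),\qquad \sigma_1:=\lambda_-(\widetilde{\mathcal{L}})+2\omega_0(1-f_0)<0,$$ where $f_0=f(0)$ and $\lambda_-(\widetilde{\mathcal{L}})$ is the unique negative eigenvalue of the operator $\widetilde{\mathcal{L}}$.
   Context: Setting: for fixed $c>0$ and $k\in(0,\sqrt c/2)$, set $a=k(c-k^2)^{3/2}$ and $E=\frac{k^2(c-2k^2)}{2c}$; $\phi=\phi(\cdot;k)$ denotes the unique nonconstant smooth even function on $\mathbb{R}$ with $\phi'(0)=0$, $\phi(x)\to k$ as $x\to\pm\infty$ (exponentially fast, together with decay of all derivatives), $\phi^2<c$, and $\phi-\phi''=a(c-\phi^2)^{-3/2}$; it is decreasing on $(0,\infty)$, satisfies $\frac12(\phi')^2=E+\frac12\phi^2-\frac{a\phi}{c\sqrt{c-\phi^2}}$, and is the profile of a smooth solitary wave $u(x,t)=\phi(x-ct)$ of the Novikov equation $u_t-u_{xxt}=u^2u_{xxx}-4u^2u_x+3uu_xu_{xx}$. Put $\mu=\phi-\phi''>0$, $\omega_0=-9a^{-2/3}$, $\omega_1=9c\,a^{-4/3}(2E+c)$. On $L^2(\mathbb{R})$ with domain $H^2(\mathbb{R})$, $$\mathcal{L}_0=\frac23\left(-3\,\partial_x\left(\mu^{-8/3}\partial_x\right)+8\mu''\mu^{-11/3}-\frac{44}{3}(\mu')^2\mu^{-14/3}+15\mu^{-8/3}\right)-\frac{2\omega_1}{9}\mu^{-4/3},$$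 $$\mathcal{L}=\mathcal{L}_0+2\omega_0(1-\partial_x^2)^{-1},\qquad \widetilde{\mathcal{L}}=\mathcal{L}_0+2\omega_0f,\qquad f=\frac{a^{2/3}}{3\phi\,\mu^{5/3}}=\frac{(c-\phi^2)^{5/2}}{3a\phi},$$ where $(1-\partial_x^2)^{-1}$ is convolution with $\frac12e^{-|x|}$ and $f$ acts by multiplication. The Sturm–Liouville operator $\widetilde{\mathcal{L}}$ has exactly one negative eigenvalue, denoted $\lambda_-(\widetilde{\mathcal{L}})$. *)

theory Defs
  imports "HOL-Analysis.Analysis"
begin

definition smooth :: "(real \<Rightarrow> real) \<Rightarrow> bool" where
  "smooth g \<longleftrightarrow> (\<forall>n x. ((deriv ^^ n) g) differentiable (at x))"

definition test_function :: "(real \<Rightarrow> real) \<Rightarrow> bool" where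
  "test_function \<eta> \<longleftrightarrow> smooth \<eta> \<and> (\<exists>R. \<forall>x. \<bar>x\<bar> > R \<longrightarrow> \<eta> x = 0)"


text \<open>
  Elements of the complex Hilbert space of square-integrable functions on the line are handled
  through representatives; equality of elements is equality almost everywhere.
\<close>

definition L2 :: "(real \<Rightarrow> complex) set" where
  "L2 = {u. u \<in> borel_measurable lborel \<and> integrable lborel (\<lambda>x. (norm (u x))\<^sup>2)}"

definition L2_norm :: "(real \<Rightarrow> complex) \<Rightarrow> real" where
  "L2_norm u = sqrt (LINT x|lborel. (norm (u x))\<^sup>2)"

definition locally_integrable :: "(real \<Rightarrow> complex) \<Rightarrow> bool" where
  "locally_integrable u \<longleftrightarrow> (\<forall>s t. set_integrable lborel {s..t} u)"

definition has_weak_deriv :: "(real \<Rightarrow> complex) \<Rightarrow> (real \<Rightarrow> complex) \<Rightarrow> bool" where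
  "has_weak_deriv u v \<longleftrightarrow>
     locally_integrable u \<and> locally_integrable v \<and>
     (\<forall>\<eta>. test_function \<eta> \<longrightarrow>
        (LINT x|lborel. deriv \<eta> x *\<^sub>R u x) = - (LINT x|lborel. \<eta> x *\<^sub>R v x))"

text \<open>
  A weak derivative is determined up to a null set, and every notion below depends on it
  only up to null sets; the choice of the representative is therefore immaterial.
\<close>

definition weak_deriv :: "(real \<Rightarrow> complex) \<Rightarrow> (real \<Rightarrow> complex)" where
  "weak_deriv u = (SOME v. has_weak_deriv u v)"

definition H2 :: "(real \<Rightarrow> complex) set" where
  "H2 = {u \<in> L2. \<exists>v\<in>L2. \<exists>w\<in>L2. has_weak_deriv u v \<and> has_weak_deriv v w}"


text \<open>
  An unbounded operator on the space above is a domain \<open>D\<close> with an action \<open>T\<close> on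
  representatives. A point \<open>z\<close> is in the resolvent set iff \<open>T - z\<close> is a bijection
  from \<open>D\<close> onto the whole space (modulo null sets) with bounded inverse.
\<close>

definition resolvent_set ::
  "(real \<Rightarrow> complex) set \<Rightarrow> ((real \<Rightarrow> complex) \<Rightarrow> (real \<Rightarrow> complex)) \<Rightarrow> complex set" where
  "resolvent_set D T = {z.
     (\<forall>g\<in>L2. \<exists>u\<in>D. (AE x in lborel. T u x - z * u x = g x) \<and>
        (\<forall>v\<in>D. (AE x in lborel. T v x - z * v x = g x) \<longrightarrow> (AE x in lborel. v x = u x))) \<and>
     (\<exists>C. \<forall>u\<in>D. L2_norm u \<le> C * L2_norm (\<lambda>x. T u x - z * u x))}"

definition spectrum ::
  "(real \<Rightarrow> complex) set \<Rightarrow> ((real \<Rightarrow> complex) \<Rightarrow> (real \<Rightarrow> complex)) \<Rightarrow> complex set" where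
  "spectrum D T = - resolvent_set D T"

definition is_eigenvalue ::
  "(real \<Rightarrow> complex) set \<Rightarrow> ((real \<Rightarrow> complex) \<Rightarrow> (real \<Rightarrow> complex)) \<Rightarrow> complex \<Rightarrow> bool" where
  "is_eigenvalue D T z \<longleftrightarrow>
     (\<exists>u\<in>D. \<not> (AE x in lborel. u x = 0) \<and> (AE x in lborel. T u x = z * u x))"


definition nov_a :: "real \<Rightarrow> real \<Rightarrow> real" where
  "nov_a c k = k * (c - k\<^sup>2) powr (3/2)"

definition nov_E :: "real \<Rightarrow> real \<Rightarrow> real" where
  "nov_E c k = k\<^sup>2 * (c - 2 * k\<^sup>2) / (2 * c)"

text \<open>
  For \<open>c > 0\<close> and \<open>0 < k < sqrt c / 2\<close> these conditions determine \<open>\<phi>\<close>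
  uniquely; its monotonicity, the first integral and the exponential decay follow from them.
\<close>

definition solitary_profile :: "real \<Rightarrow> real \<Rightarrow> (real \<Rightarrow> real) \<Rightarrow> bool" where
  "solitary_profile c k \<phi> \<longleftrightarrow>
     smooth \<phi> \<and>
     \<not> (\<exists>C. \<forall>x. \<phi> x = C) \<and>
     (\<forall>x. \<phi> (- x) = \<phi> x) \<and>
     deriv \<phi> 0 = 0 \<and>
     (\<phi> \<longlongrightarrow> k) at_top \<and> (\<phi> \<longlongrightarrow> k) at_bot \<and>
     (\<forall>x. (\<phi> x)\<^sup>2 < c) \<and>
     (\<forall>x. \<phi> x - deriv (deriv \<phi>) x = nov_a c k * (c - (\<phi> x)\<^sup>2) powr (-3/2))"

definition nov_mu :: "(real \<Rightarrow> real) \<Rightarrow> real \<Rightarrow> real" where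
  "nov_mu \<phi> x = \<phi> x - deriv (deriv \<phi>) x"

definition omega0 :: "real \<Rightarrow> real \<Rightarrow> real" where
  "omega0 c k = - 9 * nov_a c k powr (-2/3)"

definition omega1 :: "real \<Rightarrow> real \<Rightarrow> real" where
  "omega1 c k = 9 * c * nov_a c k powr (-4/3) * (2 * nov_E c k + c)"

definition nov_f :: "real \<Rightarrow> real \<Rightarrow> (real \<Rightarrow> real) \<Rightarrow> real \<Rightarrow> real" where
  "nov_f c k \<phi> x = nov_a c k powr (2/3) / (3 * \<phi> x * nov_mu \<phi> x powr (5/3))"

definition op_L0 ::
  "real \<Rightarrow> real \<Rightarrow> (real \<Rightarrow> real) \<Rightarrow> (real \<Rightarrow> complex) \<Rightarrow> (real \<Rightarrow> complex)" where
  "op_L0 c k \<phi> u = (let \<mu> = nov_mu \<phi> in (\<lambda>x.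
     (2/3) *\<^sub>R
       ((-3) *\<^sub>R weak_deriv (\<lambda>y. (\<mu> y powr (-8/3)) *\<^sub>R weak_deriv u y) x
        + (8 * deriv (deriv \<mu>) x * \<mu> x powr (-11/3)
           - (44/3) * (deriv \<mu> x)\<^sup>2 * \<mu> x powr (-14/3)
           + 15 * \<mu> x powr (-8/3)) *\<^sub>R u x)
     - (2 * omega1 c k / 9 * \<mu> x powr (-4/3)) *\<^sub>R u x))"

definition inv_helmholtz :: "(real \<Rightarrow> complex) \<Rightarrow> (real \<Rightarrow> complex)" where
  "inv_helmholtz u x = (LINT y|lborel. (exp (- \<bar>x - y\<bar>) / 2) *\<^sub>R u y)"

definition op_L ::
  "real \<Rightarrow> real \<Rightarrow> (real \<Rightarrow> real) \<Rightarrow> (real \<Rightarrow> complex) \<Rightarrow> (real \<Rightarrow> complex)" where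
  "op_L c k \<phi> u x = op_L0 c k \<phi> u x + (2 * omega0 c k) *\<^sub>R inv_helmholtz u x"

definition op_Ltilde ::
  "real \<Rightarrow> real \<Rightarrow> (real \<Rightarrow> real) \<Rightarrow> (real \<Rightarrow> complex) \<Rightarrow> (real \<Rightarrow> complex)" where
  "op_Ltilde c k \<phi> u x = op_L0 c k \<phi> u x + (2 * omega0 c k * nov_f c k \<phi> x) *\<^sub>R u x"

definition lambda_minus :: "real \<Rightarrow> real \<Rightarrow> (real \<Rightarrow> real) \<Rightarrow> real" where
  "lambda_minus c k \<phi> =
     (THE l. l < 0 \<and> is_eigenvalue H2 (op_Ltilde c k \<phi>) (complex_of_real l))"

definition sigma1 :: "real \<Rightarrow> real \<Rightarrow> (real \<Rightarrow> real) \<Rightarrow> real" where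
  "sigma1 c k \<phi> = lambda_minus c k \<phi> + 2 * omega0 c k * (1 - nov_f c k \<phi> 0)"

end

theory Submission
  imports Defs
begin

text \<open>
  Write the modified operator as \<open>- \<partial> P \<partial> + Q\<close>. The derivative of \<open>\<mu>\<close> lies in its kernel and
  vanishes only at the origin, so a shooting argument on the half-line produces a positive even
  decaying solution for some eigenvalue \<open>\<lambda> < 0\<close>. The logarithmic derivative of this solution solves a
  Riccati equation, and completing the square with it shows that the quadratic form is bounded below
  by \<open>\<lambda>\<close>. Completing the square with the derivative of \<open>\<mu>\<close> instead shows that the form is nonnegative
  on functions vanishing at the origin, a subspace of codimension one; hence \<open>\<lambda>\<close> is the only
  negative eigenvalue.

  Since \<open>\<omega>\<^sub>0 < 0\<close>, the convolution operator is a contraction and \<open>f\<close> is minimal at the crest of the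
  wave, the form of the full operator is bounded below by \<open>\<sigma>\<^sub>1\<close>, and \<open>f 0 < 1\<close> gives \<open>\<sigma>\<^sub>1 < 0\<close>.
  Away from \<open>[\<sigma>\<^sub>1, \<infinity>)\<close> the form bound is an a priori estimate for the resolvent equation, which is
  then solved by the method of continuity, starting from an operator that factorises into two
  explicitly invertible first-order ones.
\<close>

subsection \<open>Square-integrable functions\<close>

text \<open>The multiplier \<open>f\<close> comes from translation invariance: since
  \<open>\<mu> = \<phi> - \<phi>''\<close>, the convolution operator maps \<open>\<mu>'\<close> to
  \<open>\<phi>'\<close>, and \<open>\<phi>' = f \<mu>'\<close>. The full and the modified operator
  therefore agree on the translation mode \<open>\<mu>'\<close>, but only the modified one is local
  and open to oscillation arguments. The price for trading the convolution, of norm at most 1, for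
  \<open>f\<close> is the correction term of \<open>sigma1\<close>. The obstacle is surjectivity: a
  form bound yields injectivity and a bounded inverse on the range, whereas
  \<open>resolvent_set\<close> also asks for a solution to every right-hand side. No
  self-adjointness is established; the path of operators replaces it. The operators are built from a
  chosen \<open>weak_deriv\<close> and are known only up to null sets, so every computation is
  carried out on regular representatives with explicit derivatives. With
  \<open>r = sqrt (c - \<phi>^2)\<close> one has \<open>\<mu> = a / r^3\<close>; all fractional
  powers of \<open>\<mu>\<close> in the coefficients become integral powers of
  \<open>r\<close>.\<close>

lemma L2_measurable: "u \<in> L2 \<Longrightarrow> u \<in> borel_measurable borel"
  by (simp add: L2_def)

lemma L2_integrable_norm_sq: "u \<in> L2 \<Longrightarrow> integrable lborel (\<lambda>x. (norm (u x))\<^sup>2)"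
  by (simp add: L2_def)

lemma L2_bound:
  assumes "v \<in> borel_measurable borel" "u \<in> L2" "AE x in lborel. norm (v x) \<le> C * norm (u x)"
  shows "v \<in> L2"
proof -
  have "integrable lborel (\<lambda>x. C\<^sup>2 * (norm (u x))\<^sup>2)"
    using L2_integrable_norm_sq[OF assms(2)] by simp
  then have "integrable lborel (\<lambda>x. (norm (v x))\<^sup>2)"
  proof (rule Bochner_Integration.integrable_bound)
    show "(\<lambda>x. (norm (v x))\<^sup>2) \<in> borel_measurable lborel"
      using assms(1) by simp
    show "AE x in lborel. norm ((norm (v x))\<^sup>2) \<le> norm (C\<^sup>2 * (norm (u x))\<^sup>2)"
      using assms(3)
    proof eventually_elim
      case (elim x)
      then have "(norm (v x))\<^sup>2 \<le> (C * norm (u x))\<^sup>2"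
        by (intro power_mono) auto
      then show ?case by (simp add: power_mult_distrib)
    qed
  qed
  then show ?thesis using assms(1) by (simp add: L2_def)
qed

lemma L2_cong_AE:
  assumes "u \<in> L2" "v \<in> borel_measurable borel" "AE x in lborel. v x = u x"
  shows "v \<in> L2"
  by (rule L2_bound[OF assms(2,1), of 1]) (use assms(3) in auto)

lemma L2_norm_cong_AE:
  assumes "u \<in> borel_measurable borel" "v \<in> borel_measurable borel" "AE x in lborel. v x = u x"
  shows "L2_norm v = L2_norm u"
  unfolding L2_norm_def by (rule arg_cong[of _ _ sqrt], rule integral_cong_AE) (use assms in auto)

lemma L2_add: 
  assumes "u \<in> L2" "v \<in> L2" shows "(\<lambda>x. u x + v x) \<in> L2"
proof -
  have "integrable lborel (\<lambda>x. 2 * (norm (u x))\<^sup>2 + 2 * (norm (v x))\<^sup>2)"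
    using L2_integrable_norm_sq assms by simp
  then have "integrable lborel (\<lambda>x. (norm (u x + v x))\<^sup>2)"
  proof (rule Bochner_Integration.integrable_bound)
    show "(\<lambda>x. (norm (u x + v x))\<^sup>2) \<in> borel_measurable lborel"
      using assms[THEN L2_measurable] by simp
    have "(norm (u x + v x))\<^sup>2 \<le> 2 * (norm (u x))\<^sup>2 + 2 * (norm (v x))\<^sup>2" for x
    proof -
      have "(norm (u x + v x))\<^sup>2 \<le> (norm (u x) + norm (v x))\<^sup>2"
        by (intro power_mono norm_triangle_ineq) auto
      also have "\<dots> \<le> 2 * (norm (u x))\<^sup>2 + 2 * (norm (v x))\<^sup>2"
        using zero_le_power2[of "norm (u x) - norm (v x)"] by (simp add: power2_eq_square algebra_simps)
      finally show ?thesis .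
    qed
    then show "AE x in lborel. norm ((norm (u x + v x))\<^sup>2) \<le> norm (2 * (norm (u x))\<^sup>2 + 2 * (norm (v x))\<^sup>2)"
      by simp
  qed
  then show ?thesis using assms[THEN L2_measurable] by (simp add: L2_def)
qed

lemma L2_zero: "(\<lambda>x. 0) \<in> L2"
  by (simp add: L2_def)

lemma L2_mult_bounded:
  fixes u h :: "real \<Rightarrow> complex"
  assumes "u \<in> L2" "h \<in> borel_measurable borel" "\<And>x. norm (h x) \<le> C"
  shows "(\<lambda>x. h x * u x) \<in> L2"
  by (rule L2_bound[OF _ assms(1), of _ C])
    (use assms(2,3) L2_measurable[OF assms(1)] in \<open>auto simp: norm_mult intro!: mult_right_mono\<close>)

lemma L2_scaleR_bounded:
  fixes u :: "real \<Rightarrow> complex" and h :: "real \<Rightarrow> real"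
  assumes "u \<in> L2" "h \<in> borel_measurable borel" "\<And>x. \<bar>h x\<bar> \<le> C"
  shows "(\<lambda>x. h x *\<^sub>R u x) \<in> L2"
  using L2_mult_bounded[OF assms(1), of "\<lambda>x. of_real (h x)" C] assms(2,3)
  by (simp add: scaleR_conv_of_real)

lemma L2_cmult: "u \<in> L2 \<Longrightarrow> (\<lambda>x. a * u x) \<in> L2"
  by (rule L2_mult_bounded[where C = "norm a"]) auto

lemma L2_uminus: "u \<in> L2 \<Longrightarrow> (\<lambda>x. - u x) \<in> L2"
  using L2_cmult[of u "-1"] by simp

lemma L2_diff: "u \<in> L2 \<Longrightarrow> v \<in> L2 \<Longrightarrow> (\<lambda>x. u x - v x) \<in> L2"
  using L2_add[OF _ L2_uminus, of u v] by simp

lemma L2_cnj: "u \<in> L2 \<Longrightarrow> (\<lambda>x. cnj (u x)) \<in> L2"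
  by (rule L2_bound[of _ u 1])
    (auto intro!: measurable_compose[OF L2_measurable[of u] borel_measurable_continuous_onI[of cnj]] continuous_intros)

lemma L2_of_real_norm: "u \<in> L2 \<Longrightarrow> (\<lambda>x. complex_of_real (norm (u x))) \<in> L2"
  by (rule L2_bound[of _ u 1]) (auto dest: L2_measurable)

lemma L2_sum: "(\<And>n. n \<in> A \<Longrightarrow> g n \<in> L2) \<Longrightarrow> (\<lambda>x. \<Sum>n\<in>A. g n x) \<in> L2"
  by (induction A rule: infinite_finite_induct) (auto intro: L2_add L2_zero)

lemma L2_integrable_norm_mult:
  assumes "u \<in> L2" "v \<in> L2" shows "integrable lborel (\<lambda>x. norm (u x) * norm (v x))"
proof -
  have "integrable lborel (\<lambda>x. (norm (u x))\<^sup>2 + (norm (v x))\<^sup>2)"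
    using L2_integrable_norm_sq assms by simp
  then show ?thesis
  proof (rule Bochner_Integration.integrable_bound)
    show "(\<lambda>x. norm (u x) * norm (v x)) \<in> borel_measurable lborel"
      using assms[THEN L2_measurable] by simp
    have "norm (u x) * norm (v x) \<le> (norm (u x))\<^sup>2 + (norm (v x))\<^sup>2" for x
      using sum_squares_bound[of "norm (u x)" "norm (v x)"] zero_le_power2[of "norm (u x)"]
        zero_le_power2[of "norm (v x)"] mult_nonneg_nonneg[of "norm (u x)" "norm (v x)"] by linarith
    then show "AE x in lborel. norm (norm (u x) * norm (v x)) \<le> norm ((norm (u x))\<^sup>2 + (norm (v x))\<^sup>2)"
      by simp
  qed
qed

lemma L2_integrable_mult:
  assumes "u \<in> L2" "v \<in> L2" shows "integrable lborel (\<lambda>x. u x * v x)"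
  by (rule Bochner_Integration.integrable_bound[OF L2_integrable_norm_mult[OF assms]])
    (use assms[THEN L2_measurable] in \<open>auto simp: norm_mult\<close>)

lemma L2_integrable_mult_cnj:
  assumes "u \<in> L2" "v \<in> L2" shows "integrable lborel (\<lambda>x. u x * cnj (v x))"
  using L2_integrable_mult[OF assms(1) L2_cnj[OF assms(2)]] .

lemma L2_norm_nonneg [simp]: "0 \<le> L2_norm u"
  by (simp add: L2_norm_def integral_nonneg_AE)

lemma L2_norm_sq: "(L2_norm u)\<^sup>2 = (LINT x|lborel. (norm (u x))\<^sup>2)"
  by (simp add: L2_norm_def integral_nonneg_AE)

lemma L2_norm_eq_0_iff: "u \<in> L2 \<Longrightarrow> L2_norm u = 0 \<longleftrightarrow> (AE x in lborel. u x = 0)"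
  using integral_nonneg_eq_0_iff_AE[OF L2_integrable_norm_sq, of u]
  by (simp add: L2_norm_def)

section \<open>Cauchy-Schwarz, norm inequalities and completeness\<close>

lemma quadratic_nonneg_discriminant:
  fixes A B C :: real
  assumes "\<And>t. 0 \<le> A - 2 * t * C + t\<^sup>2 * B" "0 \<le> B"
  shows "C\<^sup>2 \<le> A * B"
proof (cases "B = 0")
  case True
  have "C = 0"
  proof (rule ccontr)
    assume "C \<noteq> 0"
    \<comment> \<open>For \<open>B = 0\<close> this \<open>t\<close> gives the quadratic the value
      -1.\<close>
    with assms(1)[of "(A + 1) / (2 * C)"] True show False by (simp add: field_simps)
  qed
  with True show ?thesis by simp
next
  case False
  with assms(1)[of "C / B"] assms(2) show ?thesis
    by (simp add: field_simps power2_eq_square)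
qed

lemma L2_Cauchy_Schwarz_norm:
  assumes "u \<in> L2" "v \<in> L2"
  shows "(LINT x|lborel. norm (u x) * norm (v x)) \<le> L2_norm u * L2_norm v"
proof -
  let ?C = "LINT x|lborel. norm (u x) * norm (v x)"
  have "?C\<^sup>2 \<le> (L2_norm u)\<^sup>2 * (L2_norm v)\<^sup>2"
  proof (rule quadratic_nonneg_discriminant)
    fix t :: real
    have "0 \<le> (LINT x|lborel. (norm (u x) - t * norm (v x))\<^sup>2)"
      by (rule integral_nonneg_AE) auto
    also have "\<dots> = (LINT x|lborel. (norm (u x))\<^sup>2 - 2 * t * (norm (u x) * norm (v x)) + t\<^sup>2 * (norm (v x))\<^sup>2)"
      by (rule Bochner_Integration.integral_cong) (auto simp: power2_eq_square algebra_simps)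
    also have "\<dots> = (L2_norm u)\<^sup>2 - 2 * t * ?C + t\<^sup>2 * (L2_norm v)\<^sup>2"
      using L2_integrable_norm_sq[OF assms(1)] L2_integrable_norm_sq[OF assms(2)] L2_integrable_norm_mult[OF assms]
      by (simp add: L2_norm_sq)
    finally show "0 \<le> (L2_norm u)\<^sup>2 - 2 * t * ?C + t\<^sup>2 * (L2_norm v)\<^sup>2" .
  qed auto
  then have "?C\<^sup>2 \<le> (L2_norm u * L2_norm v)\<^sup>2" by (simp add: power_mult_distrib)
  then show ?thesis by (rule power2_le_imp_le) simp
qed

lemma L2_Cauchy_Schwarz:
  assumes "u \<in> L2" "v \<in> L2"
  shows "norm (LINT x|lborel. u x * cnj (v x)) \<le> L2_norm u * L2_norm v"
proof -
  have "norm (LINT x|lborel. u x * cnj (v x)) \<le> (LINT x|lborel. norm (u x * cnj (v x)))"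
    by (rule integral_norm_bound)
  also have "\<dots> \<le> L2_norm u * L2_norm v"
    using L2_Cauchy_Schwarz_norm[OF assms] by (simp add: norm_mult)
  finally show ?thesis .
qed

lemma L2_norm_mono:
  assumes "v \<in> L2" "u \<in> borel_measurable borel" "AE x in lborel. norm (u x) \<le> C * norm (v x)" "0 \<le> C"
  shows "L2_norm u \<le> C * L2_norm v"
proof -
  have u: "u \<in> L2" by (rule L2_bound[OF assms(2,1,3)])
  have "(LINT x|lborel. (norm (u x))\<^sup>2) \<le> (LINT x|lborel. C\<^sup>2 * (norm (v x))\<^sup>2)"
  proof (rule integral_mono_AE)
    show "AE x in lborel. (norm (u x))\<^sup>2 \<le> C\<^sup>2 * (norm (v x))\<^sup>2"
      using assms(3)
    proof eventually_elim
      case (elim x)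
      then have "(norm (u x))\<^sup>2 \<le> (C * norm (v x))\<^sup>2" by (intro power_mono) auto
      then show ?case by (simp add: power_mult_distrib)
    qed
  qed (use L2_integrable_norm_sq u assms(1) in auto)
  then have "(L2_norm u)\<^sup>2 \<le> (C * L2_norm v)\<^sup>2"
    by (simp add: L2_norm_sq power_mult_distrib)
  then show ?thesis using assms(4) by (intro power2_le_imp_le[of "L2_norm u"]) auto
qed

lemma L2_norm_triangle:
  assumes "u \<in> L2" "v \<in> L2"
  shows "L2_norm (\<lambda>x. u x + v x) \<le> L2_norm u + L2_norm v"
proof -
  have "(L2_norm (\<lambda>x. u x + v x))\<^sup>2 \<le> (LINT x|lborel. (norm (u x))\<^sup>2 + 2 * (norm (u x) * norm (v x)) + (norm (v x))\<^sup>2)"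
    unfolding L2_norm_sq
  proof (rule integral_mono)
    show "integrable lborel (\<lambda>x. (norm (u x + v x))\<^sup>2)"
      using L2_integrable_norm_sq[OF L2_add[OF assms]] .
    show "integrable lborel (\<lambda>x. (norm (u x))\<^sup>2 + 2 * (norm (u x) * norm (v x)) + (norm (v x))\<^sup>2)"
      using assms L2_integrable_norm_sq L2_integrable_norm_mult by auto
    fix x
    have "(norm (u x + v x))\<^sup>2 \<le> (norm (u x) + norm (v x))\<^sup>2"
      by (intro power_mono norm_triangle_ineq) auto
    then show "(norm (u x + v x))\<^sup>2 \<le> (norm (u x))\<^sup>2 + 2 * (norm (u x) * norm (v x)) + (norm (v x))\<^sup>2"
      by (simp add: power2_eq_square algebra_simps)
  qed
  also have "\<dots> = (L2_norm u)\<^sup>2 + 2 * (LINT x|lborel. norm (u x) * norm (v x)) + (L2_norm v)\<^sup>2"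
    using assms L2_integrable_norm_sq L2_integrable_norm_mult by (simp add: L2_norm_sq)
  also have "\<dots> \<le> (L2_norm u + L2_norm v)\<^sup>2"
    using L2_Cauchy_Schwarz_norm[OF assms] by (simp add: power2_eq_square algebra_simps)
  finally show ?thesis by (rule power2_le_imp_le) simp
qed

lemma L2_norm_cmult: "L2_norm (\<lambda>x. a * u x) = norm a * L2_norm u"
  by (simp add: L2_norm_def norm_mult power_mult_distrib real_sqrt_mult)

lemma L2_norm_sum:
  assumes "finite A" "\<And>n. n \<in> A \<Longrightarrow> g n \<in> L2"
  shows "L2_norm (\<lambda>x. \<Sum>n\<in>A. g n x) \<le> (\<Sum>n\<in>A. L2_norm (g n))"
  using assms
proof (induction A rule: finite_induct)
  case empty
  then show ?case by (simp add: L2_norm_def)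
next
  case (insert a A)
  have "L2_norm (\<lambda>x. \<Sum>n\<in>insert a A. g n x) = L2_norm (\<lambda>x. g a x + (\<Sum>n\<in>A. g n x))"
    using insert by simp
  also have "\<dots> \<le> L2_norm (g a) + L2_norm (\<lambda>x. \<Sum>n\<in>A. g n x)"
    by (rule L2_norm_triangle) (use insert in \<open>auto intro: L2_sum\<close>)
  finally show ?case using insert by simp
qed

lemma L2_geometric_series_converges:
  fixes g :: "nat \<Rightarrow> real \<Rightarrow> complex"
  assumes g: "\<And>n. g n \<in> L2" and bd: "\<And>n. L2_norm (g n) \<le> K * (1/2) ^ n"
  obtains G where "G \<in> L2" "(\<lambda>N. L2_norm (\<lambda>x. G x - (\<Sum>n<N. g n x))) \<longlonglongrightarrow> 0"
proof -
  define h where "h N x = (\<Sum>n<N. norm (g n x))" for N x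
  have K: "0 \<le> K" using order_trans[OF L2_norm_nonneg bd[of 0]] by simp
  have gm [measurable]: "g n \<in> borel_measurable borel" for n using L2_measurable[OF g] .
  have hm [measurable]: "h N \<in> borel_measurable borel" for N unfolding h_def by measurable
  have hL2: "(\<lambda>x. complex_of_real (h N x)) \<in> L2" for N
  proof -
    have "(\<lambda>x. \<Sum>n<N. complex_of_real (norm (g n x))) \<in> L2"
      by (rule L2_sum) (use g in \<open>auto intro: L2_of_real_norm\<close>)
    then show ?thesis by (simp add: h_def)
  qed
  have hb: "L2_norm (\<lambda>x. complex_of_real (h N x)) \<le> 2 * K" for N
  proof -
    have "L2_norm (\<lambda>x. \<Sum>n<N. complex_of_real (norm (g n x))) \<le> (\<Sum>n<N. L2_norm (\<lambda>x. complex_of_real (norm (g n x))))"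
      by (rule L2_norm_sum) (use g in \<open>auto intro: L2_of_real_norm\<close>)
    also have "\<dots> = (\<Sum>n<N. L2_norm (g n))" by (simp add: L2_norm_def)
    also have "\<dots> \<le> (\<Sum>n<N. K * (1/2) ^ n)" by (intro sum_mono bd)
    also have "\<dots> = K * (\<Sum>n<N. (1/2) ^ n)" by (simp add: sum_distrib_left)
    also have "\<dots> \<le> K * 2"
      using K sum_le_suminf[OF summable_geometric[of "1/2::real"], of "{..<N}"] suminf_geometric[of "1/2::real"]
      by (intro mult_left_mono) auto
    finally show ?thesis by (simp add: h_def)
  qed
  have hinc: "h N x \<le> h (Suc N) x" for N x by (simp add: h_def)
  have h0: "0 \<le> h N x" for N x by (simp add: h_def sum_nonneg)
  \<comment> \<open>Taken in \<open>ennreal\<close>, the supremum exists at every point; that it is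
    finite almost everywhere is a consequence of its finite integral.\<close>
  define H where "H x = (SUP N. ennreal ((h N x)\<^sup>2))" for x
  have Hm [measurable]: "H \<in> borel_measurable borel" unfolding H_def by measurable
  have "(\<integral>\<^sup>+x. H x \<partial>lborel) = (SUP N. \<integral>\<^sup>+x. ennreal ((h N x)\<^sup>2) \<partial>lborel)"
    unfolding H_def
  proof (rule nn_integral_monotone_convergence_SUP)
    show "incseq (\<lambda>i x. ennreal ((h i x)\<^sup>2))"
      by (intro incseq_SucI le_funI ennreal_leI power_mono hinc h0)
  qed measurable
  also have "\<dots> \<le> ennreal ((2 * K)\<^sup>2)"
  proof (rule SUP_least)
    fix N
    have "(\<integral>\<^sup>+x. ennreal ((h N x)\<^sup>2) \<partial>lborel) = ennreal (LINT x|lborel. (h N x)\<^sup>2)"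
      by (rule nn_integral_eq_integral) (use L2_integrable_norm_sq[OF hL2[of N]] in auto)
    also have "(LINT x|lborel. (h N x)\<^sup>2) = (L2_norm (\<lambda>x. complex_of_real (h N x)))\<^sup>2"
      unfolding L2_norm_sq by (simp add: power2_eq_square)
    also have "ennreal \<dots> \<le> ennreal ((2 * K)\<^sup>2)"
      by (intro ennreal_leI power_mono hb) auto
    finally show "(\<integral>\<^sup>+x. ennreal ((h N x)\<^sup>2) \<partial>lborel) \<le> ennreal ((2 * K)\<^sup>2)" .
  qed
  finally have Hfin: "(\<integral>\<^sup>+x. H x \<partial>lborel) < \<infinity>" by (simp add: le_less_trans)
  then have AEfin: "AE x in lborel. H x \<noteq> \<infinity>"
    by (intro nn_integral_noteq_infinite) auto
  have summ: "AE x in lborel. summable (\<lambda>n. norm (g n x)) \<and> (\<forall>N. (h N x)\<^sup>2 \<le> enn2real (H x))"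
    using AEfin
  proof eventually_elim
    case (elim x)
    have *: "(h N x)\<^sup>2 \<le> enn2real (H x)" for N
    proof -
      have "ennreal ((h N x)\<^sup>2) \<le> H x" unfolding H_def by (rule SUP_upper) simp
      then show ?thesis using elim
        using enn2real_mono[of "ennreal ((h N x)\<^sup>2)" "H x"] by (simp add: less_top[symmetric])
    qed
    have "summable (\<lambda>n. norm (g n x))"
    proof (rule summableI_nonneg_bounded[where x = "sqrt (enn2real (H x))"])
      show "(\<Sum>i<N. norm (g i x)) \<le> sqrt (enn2real (H x))" for N
        using real_le_rsqrt[OF *[of N]] by (simp add: h_def)
    qed simp
    with * show ?case by auto
  qed
  \<comment> \<open>Where the series diverges, \<open>suminf\<close> has an unspecified value. This
    happens on a null set only, and \<open>G\<close> is measurable all the same.\<close>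
  define G where "G x = (\<Sum>n. g n x)" for x
  have Gm [measurable]: "G \<in> borel_measurable borel" unfolding G_def by measurable
  have Hint: "integrable lborel (\<lambda>x. enn2real (H x))"
  proof (rule integrableI_nonneg)
    have "(\<integral>\<^sup>+x. ennreal (enn2real (H x)) \<partial>lborel) = (\<integral>\<^sup>+x. H x \<partial>lborel)"
    proof (rule nn_integral_cong_AE)
      show "AE x in lborel. ennreal (enn2real (H x)) = H x"
        using AEfin by eventually_elim (simp add: less_top[symmetric])
    qed
    then show "(\<integral>\<^sup>+x. ennreal (enn2real (H x)) \<partial>lborel) < \<infinity>" using Hfin by simp
  qed auto
  have tail: "AE x in lborel. \<forall>N. (norm (G x - (\<Sum>n<N. g n x)))\<^sup>2 \<le> enn2real (H x)"
    using summ
  proof eventually_elim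
    case (elim x)
    show ?case
    proof
      fix N
      have s: "summable (\<lambda>n. norm (g n x))" using elim by blast
      have "norm (G x - (\<Sum>n<N. g n x)) = norm (\<Sum>n. g (n + N) x)"
        unfolding G_def using suminf_minus_initial_segment[OF summable_norm_cancel[OF s], of N] by simp
      also have "\<dots> \<le> (\<Sum>n. norm (g (n + N) x))"
        by (rule summable_norm) (use s summable_iff_shift[of "\<lambda>n. norm (g n x)" N] in simp)
      also have "\<dots> \<le> (\<Sum>n. norm (g n x))"
        using suminf_minus_initial_segment[OF s, of N] by (simp add: sum_nonneg)
      also have "\<dots> \<le> sqrt (enn2real (H x))"
        by (rule suminf_le_const[OF s]) (use elim in \<open>auto simp: h_def intro!: real_le_rsqrt\<close>)
      finally have "norm (G x - (\<Sum>n<N. g n x)) \<le> sqrt (enn2real (H x))" .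
      then have "(norm (G x - (\<Sum>n<N. g n x)))\<^sup>2 \<le> (sqrt (enn2real (H x)))\<^sup>2"
        by (rule power_mono) simp
      then show "(norm (G x - (\<Sum>n<N. g n x)))\<^sup>2 \<le> enn2real (H x)" by simp
    qed
  qed
  have "(\<lambda>N. LINT x|lborel. (norm (G x - (\<Sum>n<N. g n x)))\<^sup>2) \<longlonglongrightarrow> (LINT x::real|lborel. (0::real))"
  proof (rule integral_dominated_convergence[where w = "\<lambda>x. enn2real (H x)"])
    show "AE x in lborel. (\<lambda>N. (norm (G x - (\<Sum>n<N. g n x)))\<^sup>2) \<longlonglongrightarrow> 0"
      using summ
    proof eventually_elim
      case (elim x)
      then have "(\<lambda>N. \<Sum>n<N. g n x) \<longlonglongrightarrow> G x"
        unfolding G_def by (metis summable_LIMSEQ summable_norm_cancel)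
      then have "(\<lambda>N. (norm (G x - (\<Sum>n<N. g n x)))\<^sup>2) \<longlonglongrightarrow> (norm (G x - G x))\<^sup>2"
        by (intro tendsto_power tendsto_norm tendsto_diff tendsto_const)
      then show ?case by simp
    qed
    show "AE x in lborel. norm ((norm (G x - (\<Sum>n<N. g n x)))\<^sup>2) \<le> enn2real (H x)" for N
      using tail by eventually_elim simp
  qed (use Hint in auto)
  then have "(\<lambda>N. sqrt (LINT x|lborel. (norm (G x - (\<Sum>n<N. g n x)))\<^sup>2)) \<longlonglongrightarrow> sqrt 0"
    by (intro tendsto_real_sqrt) simp
  then have lim: "(\<lambda>N. L2_norm (\<lambda>x. G x - (\<Sum>n<N. g n x))) \<longlonglongrightarrow> 0"
    by (simp add: L2_norm_def)
  have "integrable lborel (\<lambda>x. (norm (G x))\<^sup>2)"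
  proof (rule Bochner_Integration.integrable_bound[OF Hint])
    show "AE x in lborel. norm ((norm (G x))\<^sup>2) \<le> norm (enn2real (H x))"
      using tail
    proof eventually_elim
      case (elim x)
      from spec[OF elim, of 0] show ?case by simp
    qed
  qed auto
  then have "G \<in> L2" by (simp add: L2_def)
  with lim show thesis by (rule that[rotated])
qed

subsection \<open>The exponential kernel and the inverse of the Helmholtz operator\<close>

lemma nn_integral_exp_kernel_le:
  fixes m :: real
  assumes m: "m > 0"
  shows "(\<integral>\<^sup>+y. ennreal (exp (- m * \<bar>x - y\<bar>)) \<partial>lborel) \<le> ennreal (2 / m)"
proof -
  have half: "(\<integral>\<^sup>+y. ennreal (exp (- m * y)) * indicator {0..} y \<partial>lborel) = ennreal (1 / m)"
  proof -
    have "(\<integral>\<^sup>+y. ennreal (exp (- m * y)) * indicator {0..} y \<partial>lborel) = 0 - (- exp (- m * 0) / m)"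
    proof (rule nn_integral_FTC_atLeast)
      show "((\<lambda>y. - exp (- m * y) / m) has_real_derivative exp (- m * y)) (at y)" for y
        using m by (auto intro!: derivative_eq_intros)
      have "((\<lambda>y. exp (- m * y)) \<longlongrightarrow> 0) at_top"
        using m by (intro filterlim_compose[OF exp_at_bot] filterlim_tendsto_neg_mult_at_bot[OF tendsto_const _ filterlim_ident]) auto
      then show "((\<lambda>y. - exp (- m * y) / m) \<longlongrightarrow> 0) at_top"
        using tendsto_divide[OF tendsto_minus tendsto_const, of "\<lambda>y. exp (- m * y)" 0 at_top m] m by simp
    qed auto
    then show ?thesis by simp
  qed
  have "(\<integral>\<^sup>+y. ennreal (exp (- m * \<bar>x - y\<bar>)) \<partial>lborel) = (\<integral>\<^sup>+y. ennreal (exp (- m * \<bar>y\<bar>)) \<partial>lborel)"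
    using nn_integral_real_affine[of "\<lambda>y. ennreal (exp (- m * \<bar>x - y\<bar>))" 1 x] by simp
  \<comment> \<open>Both half-lines contain 0, which does no harm to an upper bound.\<close>
  also have "\<dots> \<le> (\<integral>\<^sup>+y. ennreal (exp (- m * y)) * indicator {0..} y
                        + ennreal (exp (m * y)) * indicator {..0} y \<partial>lborel)"
    by (rule nn_integral_mono) (auto simp: indicator_def abs_if)
  also have "\<dots> = (\<integral>\<^sup>+y. ennreal (exp (- m * y)) * indicator {0..} y \<partial>lborel)
                        + (\<integral>\<^sup>+y. ennreal (exp (m * y)) * indicator {..0} y \<partial>lborel)"
    by (rule nn_integral_add) auto
  also have "(\<integral>\<^sup>+y. ennreal (exp (m * y)) * indicator {..0} y \<partial>lborel) =
      (\<integral>\<^sup>+y. ennreal (exp (- m * y)) * indicator {0..} y \<partial>lborel)"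
    using nn_integral_real_affine[of "\<lambda>y. ennreal (exp (m * y)) * indicator {..0} y" "-1" 0]
    by (simp add: indicator_def)
  finally show ?thesis
    unfolding half using m by (simp flip: ennreal_plus)
qed

lemma integrable_exp_kernel:
  fixes m :: real
  assumes m: "m > 0"
  shows "integrable lborel (\<lambda>y. exp (- m * \<bar>x - y\<bar>))" 
    and "(LINT y|lborel. exp (- m * \<bar>x - y\<bar>)) \<le> 2 / m"
proof -
  show 1: "integrable lborel (\<lambda>y. exp (- m * \<bar>x - y\<bar>))"
    using nn_integral_exp_kernel_le[OF m, of x]
    by (intro integrableI_nonneg) (auto simp: le_less_trans)
  have "ennreal (LINT y|lborel. exp (- m * \<bar>x - y\<bar>)) \<le> ennreal (2 / m)"
    using nn_integral_exp_kernel_le[OF m, of x] nn_integral_eq_integral[OF 1] by simp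
  then show "(LINT y|lborel. exp (- m * \<bar>x - y\<bar>)) \<le> 2 / m"
    using m by (subst (asm) ennreal_le_iff) auto
qed

text \<open>The first half of Schur's test: the kernel is split into two equal square roots, one of
  which is kept with \<open>g\<close>, and Cauchy-Schwarz is applied to the two factors.\<close>

lemma exp_kernel_integrable_mult:
  assumes m: "m > 0" and g: "g \<in> L2"
  shows "integrable lborel (\<lambda>y. exp (- m * \<bar>x - y\<bar>) * norm (g y))"
    and "(LINT y|lborel. exp (- m * \<bar>x - y\<bar>) * norm (g y))\<^sup>2
      \<le> 2 / m * (LINT y|lborel. exp (- m * \<bar>x - y\<bar>) * (norm (g y))\<^sup>2)"
    and "integrable lborel (\<lambda>y. exp (- m * \<bar>x - y\<bar>) * (norm (g y))\<^sup>2)"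
proof -
  define r where "r y = complex_of_real (exp (- m / 2 * \<bar>x - y\<bar>))" for y
  have gm [measurable]: "g \<in> borel_measurable borel" using L2_measurable[OF g] .
  have rm [measurable]: "r \<in> borel_measurable borel" unfolding r_def by measurable
  have nr: "norm (r y) = exp (- m / 2 * \<bar>x - y\<bar>)" for y by (simp add: r_def)
  have rr: "exp (- m / 2 * \<bar>x - y\<bar>) * exp (- m / 2 * \<bar>x - y\<bar>) = exp (- m * \<bar>x - y\<bar>)" for y
    by (simp flip: exp_add add: field_simps)
  have rsq: "(norm (r y))\<^sup>2 = exp (- m * \<bar>x - y\<bar>)" for y
    by (simp only: nr power2_eq_square rr)
  have rle: "norm (r y) \<le> 1" for y using m by (simp add: nr)
  have rL: "r \<in> L2" by (simp only: L2_def mem_Collect_eq rsq) (simp add: integrable_exp_kernel[OF m, simplified])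
  have rg: "(\<lambda>y. r y * g y) \<in> L2" by (rule L2_mult_bounded[OF g rm rle])
  have e1: "norm (r y) * norm (r y * g y) = exp (- m * \<bar>x - y\<bar>) * norm (g y)" for y
    by (simp only: norm_mult nr mult.assoc[symmetric] rr)
  have e2: "(norm (r y * g y))\<^sup>2 = exp (- m * \<bar>x - y\<bar>) * (norm (g y))\<^sup>2" for y
    by (simp only: norm_mult power_mult_distrib rsq)
  show "integrable lborel (\<lambda>y. exp (- m * \<bar>x - y\<bar>) * norm (g y))"
    using L2_integrable_norm_mult[OF rL rg] by (simp only: e1)
  show "integrable lborel (\<lambda>y. exp (- m * \<bar>x - y\<bar>) * (norm (g y))\<^sup>2)"
    using L2_integrable_norm_sq[OF rg] by (simp only: e2)
  have "(LINT y|lborel. exp (- m * \<bar>x - y\<bar>) * norm (g y))\<^sup>2 \<le> (L2_norm r * L2_norm (\<lambda>y. r y * g y))\<^sup>2"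
    using L2_Cauchy_Schwarz_norm[OF rL rg] by (intro power_mono) (auto simp: e1 intro!: integral_nonneg_AE)
  also have "\<dots> = (LINT y|lborel. exp (- m * \<bar>x - y\<bar>)) * (LINT y|lborel. exp (- m * \<bar>x - y\<bar>) * (norm (g y))\<^sup>2)"
    by (simp only: power_mult_distrib L2_norm_sq rsq e2)
  also have "\<dots> \<le> 2 / m * (LINT y|lborel. exp (- m * \<bar>x - y\<bar>) * (norm (g y))\<^sup>2)"
    by (intro mult_right_mono integrable_exp_kernel m integral_nonneg_AE) auto
  finally show "(LINT y|lborel. exp (- m * \<bar>x - y\<bar>) * norm (g y))\<^sup>2
      \<le> 2 / m * (LINT y|lborel. exp (- m * \<bar>x - y\<bar>) * (norm (g y))\<^sup>2)" .
qed

text \<open>Young's inequality for a kernel of mass \<open>2 / m\<close>: the pointwise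
  Cauchy-Schwarz bound is integrated in \<open>x\<close>, and Tonelli allows the kernel to be
  integrated in \<open>x\<close> first. The rate \<open>m = 1\<close> serves the convolution
  operator, a general rate the first-order equations.\<close>

lemma exp_kernel_L2:
  assumes m: "m > 0" and g: "g \<in> L2"
  defines "w \<equiv> \<lambda>x. complex_of_real (LINT y|lborel. exp (- m * \<bar>x - y\<bar>) * norm (g y))"
  shows "w \<in> L2" and "L2_norm w \<le> 2 / m * L2_norm g"
proof -
  have gm [measurable]: "g \<in> borel_measurable borel" using L2_measurable[OF g] .
  have wm [measurable]: "w \<in> borel_measurable borel" unfolding w_def by measurable
  have "(\<integral>\<^sup>+x. ennreal ((norm (w x))\<^sup>2) \<partial>lborel)
      \<le> (\<integral>\<^sup>+x. ennreal (2 / m) * (\<integral>\<^sup>+y. ennreal (exp (- m * \<bar>x - y\<bar>) * (norm (g y))\<^sup>2) \<partial>lborel) \<partial>lborel)"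
  proof (rule nn_integral_mono)
    fix x
    have "ennreal ((norm (w x))\<^sup>2) \<le> ennreal (2 / m * (LINT y|lborel. exp (- m * \<bar>x - y\<bar>) * (norm (g y))\<^sup>2))"
      using exp_kernel_integrable_mult(2)[OF m g, of x] by (intro ennreal_leI) (simp add: w_def)
    also have "\<dots> = ennreal (2 / m) * (\<integral>\<^sup>+y. ennreal (exp (- m * \<bar>x - y\<bar>) * (norm (g y))\<^sup>2) \<partial>lborel)"
      using m by (subst nn_integral_eq_integral[OF exp_kernel_integrable_mult(3)[OF m g]])
        (simp, rule ennreal_mult, simp_all add: integral_nonneg_AE)
    finally show "ennreal ((norm (w x))\<^sup>2)
       \<le> ennreal (2 / m) * (\<integral>\<^sup>+y. ennreal (exp (- m * \<bar>x - y\<bar>) * (norm (g y))\<^sup>2) \<partial>lborel)" .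
  qed
  also have "\<dots> = ennreal (2 / m) * (\<integral>\<^sup>+x. (\<integral>\<^sup>+y. ennreal (exp (- m * \<bar>x - y\<bar>) * (norm (g y))\<^sup>2) \<partial>lborel) \<partial>lborel)"
    by (rule nn_integral_cmult) measurable
  also have "(\<integral>\<^sup>+x. (\<integral>\<^sup>+y. ennreal (exp (- m * \<bar>x - y\<bar>) * (norm (g y))\<^sup>2) \<partial>lborel) \<partial>lborel)
      = (\<integral>\<^sup>+y. (\<integral>\<^sup>+x. ennreal (exp (- m * \<bar>x - y\<bar>) * (norm (g y))\<^sup>2) \<partial>lborel) \<partial>lborel)"
    by (rule lborel_pair.Fubini') measurable
  also have "\<dots> \<le> (\<integral>\<^sup>+y. ennreal (2 / m) * ennreal ((norm (g y))\<^sup>2) \<partial>lborel)"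
  proof (rule nn_integral_mono)
    fix y
    have "(\<integral>\<^sup>+x. ennreal (exp (- m * \<bar>x - y\<bar>) * (norm (g y))\<^sup>2) \<partial>lborel)
        = (\<integral>\<^sup>+x. ennreal (exp (- m * \<bar>y - x\<bar>)) * ennreal ((norm (g y))\<^sup>2) \<partial>lborel)"
      by (intro nn_integral_cong) (simp add: ennreal_mult abs_minus_commute)
    also have "\<dots> = (\<integral>\<^sup>+x. ennreal (exp (- m * \<bar>y - x\<bar>)) \<partial>lborel) * ennreal ((norm (g y))\<^sup>2)"
      by (rule nn_integral_multc) measurable
    also have "\<dots> \<le> ennreal (2 / m) * ennreal ((norm (g y))\<^sup>2)"
      by (intro mult_right_mono nn_integral_exp_kernel_le m) auto
    finally show "(\<integral>\<^sup>+x. ennreal (exp (- m * \<bar>x - y\<bar>) * (norm (g y))\<^sup>2) \<partial>lborel) \<le> ennreal (2 / m) * ennreal ((norm (g y))\<^sup>2)" .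
  qed
  also have "\<dots> = ennreal (2 / m) * (\<integral>\<^sup>+y. ennreal ((norm (g y))\<^sup>2) \<partial>lborel)"
    by (rule nn_integral_cmult) measurable
  also have "(\<integral>\<^sup>+y. ennreal ((norm (g y))\<^sup>2) \<partial>lborel) = ennreal ((L2_norm g)\<^sup>2)"
    unfolding L2_norm_sq by (rule nn_integral_eq_integral[OF L2_integrable_norm_sq[OF g]]) auto
  also have "ennreal (2 / m) * (ennreal (2 / m) * ennreal ((L2_norm g)\<^sup>2)) = ennreal ((2 / m * L2_norm g)\<^sup>2)"
    using m by (simp add: power2_eq_square mult_ac flip: ennreal_mult)
  finally have le: "(\<integral>\<^sup>+x. ennreal ((norm (w x))\<^sup>2) \<partial>lborel) \<le> ennreal ((2 / m * L2_norm g)\<^sup>2)"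
    by (simp add: mult_left_mono)
  then have int: "integrable lborel (\<lambda>x. (norm (w x))\<^sup>2)"
    by (intro integrableI_nonneg) (auto simp: le_less_trans)
  then show "w \<in> L2" by (simp add: L2_def)
  have "ennreal ((L2_norm w)\<^sup>2) \<le> ennreal ((2 / m * L2_norm g)\<^sup>2)"
    unfolding L2_norm_sq[of w] using le nn_integral_eq_integral[OF int] by simp
  then have "(L2_norm w)\<^sup>2 \<le> (2 / m * L2_norm g)\<^sup>2"
    by (subst (asm) ennreal_le_iff) auto
  then show "L2_norm w \<le> 2 / m * L2_norm g"
    using m by (intro power2_le_imp_le[of "L2_norm w"]) auto
qed

section \<open>Contraction and symmetry of the convolution operator\<close>

lemma inv_helmholtz_integrable:
  assumes "u \<in> L2"
  shows "integrable lborel (\<lambda>y. (exp (- \<bar>x - y\<bar>) / 2) *\<^sub>R u y)"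
  by (rule Bochner_Integration.integrable_bound[OF exp_kernel_integrable_mult(1)[of 1 u x]])
    (use assms L2_measurable[OF assms] in auto)

lemma norm_inv_helmholtz_le:
  assumes "u \<in> L2"
  shows "norm (inv_helmholtz u x) \<le> 1 / 2 * (LINT y|lborel. exp (- 1 * \<bar>x - y\<bar>) * norm (u y))"
proof -
  have "norm (inv_helmholtz u x) \<le> (LINT y|lborel. norm ((exp (- \<bar>x - y\<bar>) / 2) *\<^sub>R u y))"
    unfolding inv_helmholtz_def by (rule integral_norm_bound)
  also have "\<dots> = (LINT y|lborel. (1 / 2) * (exp (- 1 * \<bar>x - y\<bar>) * norm (u y)))"
    by (rule Bochner_Integration.integral_cong) auto
  finally show ?thesis by simp
qed

lemma inv_helmholtz_L2:
  assumes "u \<in> L2"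
  shows "inv_helmholtz u \<in> L2" and "L2_norm (inv_helmholtz u) \<le> L2_norm u"
proof -
  let ?w = "\<lambda>x. complex_of_real (LINT y|lborel. exp (- 1 * \<bar>x - y\<bar>) * norm (u y))"
  have [measurable]: "u \<in> borel_measurable borel" using L2_measurable[OF assms] .
  have m: "inv_helmholtz u \<in> borel_measurable borel"
    unfolding inv_helmholtz_def[abs_def] by measurable
  have b: "AE x in lborel. norm (inv_helmholtz u x) \<le> 1 / 2 * norm (?w x)"
    using norm_inv_helmholtz_le[OF assms] by (auto simp: integral_nonneg_AE)
  have w: "?w \<in> L2" "L2_norm ?w \<le> 2 * L2_norm u"
    using exp_kernel_L2[OF _ assms, of 1] by auto
  show "inv_helmholtz u \<in> L2" by (rule L2_bound[OF m w(1) b])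
  show "L2_norm (inv_helmholtz u) \<le> L2_norm u"
    using L2_norm_mono[OF w(1) m b] w(2) by simp
qed

text \<open>The values agree at every point, because integration ignores the null set. This permits
  passing from an element of \<open>H2\<close> to its regular representative inside the nonlocal
  term.\<close>

lemma inv_helmholtz_cong_AE:
  assumes "u \<in> borel_measurable borel" "v \<in> borel_measurable borel" "AE x in lborel. u x = v x"
  shows "inv_helmholtz u = inv_helmholtz v"
proof
  fix x
  show "inv_helmholtz u x = inv_helmholtz v x"
    unfolding inv_helmholtz_def
  proof (rule integral_cong_AE)
    show "AE y in lborel. (exp (- \<bar>x - y\<bar>) / 2) *\<^sub>R u y = (exp (- \<bar>x - y\<bar>) / 2) *\<^sub>R v y"
      using assms(3) by eventually_elim simp
  qed (use assms in measurable)
qed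

lemma inv_helmholtz_add:
  assumes "u \<in> L2" "v \<in> L2"
  shows "inv_helmholtz (\<lambda>x. u x + v x) x = inv_helmholtz u x + inv_helmholtz v x"
  unfolding inv_helmholtz_def
  using Bochner_Integration.integral_add[OF inv_helmholtz_integrable[OF assms(1), of x] inv_helmholtz_integrable[OF assms(2), of x]]
  by (simp add: scaleR_add_right)

text \<open>The kernel is symmetric in its two arguments, so this is Fubini. The integrability on
  the plane comes from pairing the exponential convolution of \<open>norm (u y)\<close>, which is
  square-integrable, with \<open>v\<close>.\<close>

lemma inv_helmholtz_symmetric:
  assumes u: "u \<in> L2" and v: "v \<in> L2"
  shows "(LINT x|lborel. inv_helmholtz u x * cnj (v x)) = (LINT x|lborel. u x * cnj (inv_helmholtz v x))"
proof -
  have um [measurable]: "u \<in> borel_measurable borel" "v \<in> borel_measurable borel"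
    using L2_measurable u v by auto
  have cm [measurable]: "cnj \<in> borel_measurable borel"
    by (intro borel_measurable_continuous_onI continuous_intros)
  define f where "f x y = (exp (- \<bar>x - y\<bar>) / 2) *\<^sub>R (u y * cnj (v x))" for x y :: real
  have fm [measurable]: "case_prod f \<in> borel_measurable (lborel \<Otimes>\<^sub>M lborel)"
    unfolding f_def by measurable
  let ?w = "\<lambda>x. complex_of_real (LINT y|lborel. exp (- 1 * \<bar>x - y\<bar>) * norm (u y))"
  have fi: "integrable lborel (\<lambda>y. f x y)" for x
  proof -
    have "integrable lborel (\<lambda>y. (exp (- \<bar>x - y\<bar>) / 2) *\<^sub>R u y * cnj (v x))"
      by (rule integrable_mult_left) (rule inv_helmholtz_integrable[OF u])
    then show ?thesis by (simp add: f_def)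
  qed
  have nf: "(LINT y|lborel. norm (f x y)) = 1 / 2 * (norm (?w x) * norm (v x))" for x
  proof -
    have "(LINT y|lborel. norm (f x y)) = (LINT y|lborel. 1 / 2 * norm (v x) * (exp (- 1 * \<bar>x - y\<bar>) * norm (u y)))"
      by (rule Bochner_Integration.integral_cong) (auto simp: f_def norm_mult)
    also have "\<dots> = 1 / 2 * norm (v x) * (LINT y|lborel. (exp (- 1 * \<bar>x - y\<bar>) * norm (u y)))"
      by (rule integral_mult_right_zero)
    also have "(LINT y|lborel. (exp (- 1 * \<bar>x - y\<bar>) * norm (u y))) = norm (?w x)"
      by (simp add: integral_nonneg_AE)
    finally show ?thesis by simp
  qed
  have "integrable (lborel \<Otimes>\<^sub>M lborel) (case_prod f)"
  proof (rule lborel_pair.Fubini_integrable)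
    show "integrable lborel (\<lambda>x. LINT y|lborel. norm (case_prod f (x, y)))"
      using L2_integrable_norm_mult[OF exp_kernel_L2(1)[OF zero_less_one u] v]
      by (simp only: case_prod_conv nf) (intro integrable_mult_right, simp)
  qed (use fi in auto)
  then have "(LINT y|lborel. LINT x|lborel. f x y) = (LINT x|lborel. LINT y|lborel. f x y)"
    by (rule lborel_pair.Fubini_integral)
  moreover have "(LINT y|lborel. f x y) = inv_helmholtz u x * cnj (v x)" for x
    unfolding f_def inv_helmholtz_def by (simp flip: integral_mult_left_zero)
  moreover have "(LINT x|lborel. f x y) = u y * cnj (inv_helmholtz v y)" for y
  proof -
    have "(LINT x|lborel. f x y) = (LINT x|lborel. u y * cnj ((exp (- \<bar>y - x\<bar>) / 2) *\<^sub>R v x))"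
      by (rule Bochner_Integration.integral_cong) (auto simp: f_def abs_minus_commute)
    also have "\<dots> = u y * cnj (LINT x|lborel. (exp (- \<bar>y - x\<bar>) / 2) *\<^sub>R v x)"
      by (simp only: integral_mult_right_zero Bochner_Integration.integral_cnj)
    finally show ?thesis by (simp add: inv_helmholtz_def)
  qed
  ultimately show ?thesis by simp
qed

subsection \<open>Primitives of locally integrable functions\<close>

text \<open>In other words, \<open>F\<close> is locally absolutely continuous with almost-everywhere
  derivative \<open>f\<close>. The integral form needs no pointwise differentiation and, like a weak
  derivative, is insensitive to changes of \<open>f\<close> on null sets.\<close>

definition is_primitive :: "(real \<Rightarrow> complex) \<Rightarrow> (real \<Rightarrow> complex) \<Rightarrow> bool" where
  "is_primitive F f \<longleftrightarrow>
     locally_integrable f \<and> (\<forall>a b. a \<le> b \<longrightarrow> F b - F a = (LINT x:{a..b}|lborel. f x))"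

lemma locally_integrableD: "locally_integrable f \<Longrightarrow> set_integrable lborel {a..b} f"
  by (simp add: locally_integrable_def)

lemma continuous_locally_integrable:
  "continuous_on UNIV f \<Longrightarrow> locally_integrable f"
  unfolding locally_integrable_def
  by (auto intro!: borel_integrable_atLeastAtMost' intro: continuous_on_subset)

text \<open>A pointwise limit of truncations, each of which is measurable because it is
  integrable.\<close>

lemma locally_integrable_measurable:
  assumes "locally_integrable f"
  shows "f \<in> borel_measurable borel"
proof (rule borel_measurable_LIMSEQ_metric)
  show "(\<lambda>x. indicator {- real n..real n} x *\<^sub>R f x) \<in> borel_measurable borel" for n
    using locally_integrableD[OF assms, of "- real n" "real n"]
    by (simp add: set_integrable_def integrable_iff_bounded)
  fix x :: real
  show "(\<lambda>n. indicator {- real n..real n} x *\<^sub>R f x) \<longlonglongrightarrow> f x"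
  proof (rule tendsto_eventually)
    obtain N :: nat where "\<bar>x\<bar> \<le> N" using real_arch_simple by blast
    then show "\<forall>\<^sub>F n in sequentially. indicator {- real n..real n} x *\<^sub>R f x = f x"
      unfolding eventually_sequentially by (intro exI[of _ N]) (auto simp: indicator_def)
  qed
qed

lemma locally_integrable_mult_continuous:
  fixes f G :: "real \<Rightarrow> complex"
  assumes f: "locally_integrable f" and G: "continuous_on UNIV G"
  shows "locally_integrable (\<lambda>x. f x * G x)"
  unfolding locally_integrable_def
proof (intro allI)
  fix s t :: real
  have "compact (G ` {s..t})"
    by (intro compact_continuous_image continuous_on_subset[OF G]) auto
  then obtain B where B: "\<And>x. x \<in> {s..t} \<Longrightarrow> norm (G x) \<le> B"
    by (metis compact_imp_bounded bounded_iff image_eqI)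
  have [measurable]: "f \<in> borel_measurable borel" by (rule locally_integrable_measurable[OF f])
  have [measurable]: "G \<in> borel_measurable borel" by (rule borel_measurable_continuous_onI[OF G])
  have "set_integrable lborel {s..t} (\<lambda>x. of_real B * f x)"
    using locally_integrableD[OF f] by auto
  then show "set_integrable lborel {s..t} (\<lambda>x. f x * G x)"
  proof (rule set_integrable_bound)
    show "set_borel_measurable lborel {s..t} (\<lambda>x. f x * G x)"
      by (simp add: set_borel_measurable_def)
    show "AE x in lborel. x \<in> {s..t} \<longrightarrow> norm (f x * G x) \<le> norm (of_real B * f x)"
    proof (intro AE_I2 impI)
      fix x assume "x \<in> {s..t}"
      from B[OF this] have "norm (G x) \<le> \<bar>B\<bar>" by linarith
      then show "norm (f x * G x) \<le> norm (of_real B * f x)"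
        by (simp add: norm_mult mult.commute mult_right_mono)
    qed
  qed
qed

lemma locally_integrable_add:
  "locally_integrable f \<Longrightarrow> locally_integrable g \<Longrightarrow> locally_integrable (\<lambda>x. f x + g x)"
  by (simp add: locally_integrable_def set_integral_add)

lemma locally_integrable_diff:
  "locally_integrable f \<Longrightarrow> locally_integrable g \<Longrightarrow> locally_integrable (\<lambda>x. f x - g x)"
  by (simp add: locally_integrable_def set_integral_diff)

lemma locally_integrable_cong_AE:
  assumes "locally_integrable f" "g \<in> borel_measurable borel" "AE x in lborel. f x = g x"
  shows "locally_integrable g"
  unfolding locally_integrable_def
proof (intro allI)
  fix s t :: real
  have "set_integrable lborel {s..t} g = set_integrable lborel {s..t} f"
    using locally_integrable_measurable[OF assms(1)] assms(2,3)
    by (intro set_integrable_cong_AE) auto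
  then show "set_integrable lborel {s..t} g" using locally_integrableD[OF assms(1)] by simp
qed

lemma norm_sq_indicator: "(norm (complex_of_real (indicator A x)))\<^sup>2 = indicator A x"
  by (auto simp: indicator_def)

lemma L2_indicator: "(\<lambda>x. complex_of_real (indicator {s..t} x)) \<in> L2"
  unfolding L2_def mem_Collect_eq norm_sq_indicator by (simp add: emeasure_lborel_Icc_eq)

lemma L2_locally_integrable:
  assumes u: "u \<in> L2" shows "locally_integrable u"
  unfolding locally_integrable_def set_integrable_def
proof (intro allI)
  fix s t :: real
  from L2_integrable_mult[OF L2_indicator u] show "integrable lborel (\<lambda>x. indicator {s..t} x *\<^sub>R u x)"
    by (simp add: scaleR_conv_of_real)
qed

lemma set_integral_split:
  fixes f :: "real \<Rightarrow> 'a::{banach, second_countable_topology}"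
  assumes "set_integrable lborel {a..c} f" "a \<le> b" "b \<le> c"
  shows "(LINT x:{a..c}|lborel. f x) = (LINT x:{a..b}|lborel. f x) + (LINT x:{b..c}|lborel. f x)"
proof -
  have e: "{a..c} = {a..b} \<union> {b..c}" using assms by auto
  have "(LINT x:{a..b} \<union> {b..c}|lborel. f x) = (LINT x:{a..b}|lborel. f x) + (LINT x:{b..c}|lborel. f x)"
  proof (rule set_integral_Un_AE)
    show "AE x in lborel. \<not> (x \<in> {a..b} \<and> x \<in> {b..c})"
      using AE_lborel_singleton[of b] by eventually_elim auto
  qed (use assms in \<open>auto intro: set_integrable_subset\<close>)
  with e show ?thesis by simp
qed

text \<open>Set integrals carry no orientation, hence the explicit sign to the left of 0.\<close>

lemma is_primitiveI:
  assumes f: "locally_integrable f"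
  shows "is_primitive (\<lambda>x. if x \<ge> 0 then (LINT y:{0..x}|lborel. f y) else - (LINT y:{x..0}|lborel. f y)) f"
    (is "is_primitive ?F f")
  unfolding is_primitive_def
proof (intro conjI allI impI f)
  fix a b :: real assume ab: "a \<le> b"
  note i = locally_integrableD[OF f]
  consider "0 \<le> a" | "b < 0" | "a < 0" "0 \<le> b" by linarith
  then show "?F b - ?F a = (LINT x:{a..b}|lborel. f x)"
  proof cases
    case 1
    then show ?thesis using set_integral_split[OF i, of 0 a b] ab by simp
  next
    case 2
    then show ?thesis using set_integral_split[OF i, of a b 0] ab by simp
  next
    case 3
    then show ?thesis using set_integral_split[OF i, of a 0 b] by simp
  qed
qed

lemma is_primitive_locally_integrable: "is_primitive F f \<Longrightarrow> locally_integrable f"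
  by (simp add: is_primitive_def)

lemma is_primitive_integral:
  "is_primitive F f \<Longrightarrow> a \<le> b \<Longrightarrow> (LINT x:{a..b}|lborel. f x) = F b - F a"
  by (simp add: is_primitive_def)

text \<open>The indefinite integral of \<open>norm (f x)\<close> is continuous, hence uniformly
  continuous on a compact interval. Uniformity in the position of \<open>[s, t]\<close> is what the
  product rule below needs, where a fixed point may be either end of the interval.\<close>

lemma is_primitive_uniform_continuity:
  assumes f: "locally_integrable f" and e: "e > 0"
  obtains d where "d > 0" "\<And>s t. a \<le> s \<Longrightarrow> s \<le> t \<Longrightarrow> t \<le> b \<Longrightarrow> t - s < d \<Longrightarrow> (LINT x:{s..t}|lborel. norm (f x)) < e"
proof -
  have si: "set_integrable lborel {u..v} (\<lambda>x. norm (f x))" for u v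
    using set_integrable_norm[OF locally_integrableD[OF f]] .
  have "continuous_on {a..b} (\<lambda>x. integral {a..x} (\<lambda>x. norm (f x)))"
    by (rule indefinite_integral_continuous_1) (rule set_borel_integral_eq_integral(1)[OF si])
  then have "uniformly_continuous_on {a..b} (\<lambda>x. integral {a..x} (\<lambda>x. norm (f x)))"
    by (rule compact_uniformly_continuous) simp
  then obtain d where d: "d > 0" "\<And>x y. x \<in> {a..b} \<Longrightarrow> y \<in> {a..b} \<Longrightarrow> dist x y < d \<Longrightarrow>
       dist (integral {a..x} (\<lambda>x. norm (f x))) (integral {a..y} (\<lambda>x. norm (f x))) < e"
    unfolding uniformly_continuous_on_def using e by metis
  show thesis
  proof (rule that[OF d(1)])
    fix s t assume st: "a \<le> s" "s \<le> t" "t \<le> b" "t - s < d"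
    have "integral {a..t} (\<lambda>x. norm (f x)) = integral {a..s} (\<lambda>x. norm (f x)) + (LINT x:{s..t}|lborel. norm (f x))"
      using set_integral_split[OF si, of a s t] st by (simp add: set_borel_integral_eq_integral(2)[OF si])
    then show "(LINT x:{s..t}|lborel. norm (f x)) < e"
      using d(2)[of s t] st by (simp add: dist_real_def)
  qed
qed

lemma is_primitive_norm_diff_le:
  assumes "is_primitive F f" "s \<le> t"
  shows "norm (F t - F s) \<le> (LINT x:{s..t}|lborel. norm (f x))"
  using set_integral_norm_bound[OF locally_integrableD[OF is_primitive_locally_integrable[OF assms(1)]], of s t]
    is_primitive_integral[OF assms] by simp

lemma is_primitive_continuous:
  assumes F: "is_primitive F f"
  shows "continuous_on UNIV F"
proof -
  have "isCont F x" for x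
    unfolding isCont_def LIM_def dist_norm
  proof (intro allI impI)
    fix e :: real assume "e > 0"
    then obtain d where d: "d > 0" "\<And>s t. x - 1 \<le> s \<Longrightarrow> s \<le> t \<Longrightarrow> t \<le> x + 1 \<Longrightarrow> t - s < d \<Longrightarrow> (LINT x:{s..t}|lborel. norm (f x)) < e"
      using is_primitive_uniform_continuity[OF is_primitive_locally_integrable[OF F]] by metis
    have "norm (F y - F x) < e" if "norm (y - x) < min d 1" for y
    proof (cases "x \<le> y")
      case True
      then have "norm (F y - F x) \<le> (LINT x:{x..y}|lborel. norm (f x))" by (rule is_primitive_norm_diff_le[OF F])
      also have "\<dots> < e" using that True by (intro d(2)) auto
      finally show ?thesis .
    next
      case False
      then have "norm (F x - F y) \<le> (LINT x:{y..x}|lborel. norm (f x))" by (intro is_primitive_norm_diff_le[OF F]) simp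
      also have "\<dots> < e" using that False by (intro d(2)) auto
      finally show ?thesis by (simp add: norm_minus_commute)
    qed
    then show "\<exists>d>0. \<forall>x'. x' \<noteq> x \<and> norm (x' - x) < d \<longrightarrow> norm (F x' - F x) < e"
      using d(1) by (intro exI[of _ "min d 1"]) auto
  qed
  then show ?thesis by (simp add: continuous_on_eq_continuous_at)
qed

lemma C1_is_primitive:
  fixes F f :: "real \<Rightarrow> complex"
  assumes "\<And>x. (F has_vector_derivative f x) (at x)" "continuous_on UNIV f"
  shows "is_primitive F f"
  unfolding is_primitive_def
proof (intro conjI allI impI)
  show "locally_integrable f" by (rule continuous_locally_integrable[OF assms(2)])
  fix a b :: real assume "a \<le> b"
  then show "F b - F a = (LINT x:{a..b}|lborel. f x)"
    unfolding set_lebesgue_integral_def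
    by (intro integral_FTC_atLeastAtMost[symmetric])
      (auto intro: has_vector_derivative_at_within assms continuous_on_subset[OF assms(2)])
qed

lemma is_primitive_cong_AE:
  assumes F: "is_primitive F f" and g: "g \<in> borel_measurable borel" "AE x in lborel. f x = g x"
  shows "is_primitive F g"
  unfolding is_primitive_def
proof (intro conjI allI impI)
  note f = is_primitive_locally_integrable[OF F]
  show "locally_integrable g" by (rule locally_integrable_cong_AE[OF f g])
  fix a b :: real assume "a \<le> b"
  then show "F b - F a = (LINT x:{a..b}|lborel. g x)"
    by (subst is_primitive_integral[OF F, symmetric], simp, intro set_lebesgue_integral_cong_AE)
      (use g locally_integrable_measurable[OF f] in auto)
qed

lemma is_primitive_add:
  assumes "is_primitive F f" "is_primitive G g"
  shows "is_primitive (\<lambda>x. F x + G x) (\<lambda>x. f x + g x)"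
  using assms unfolding is_primitive_def locally_integrable_def
  by (auto simp: set_integral_add algebra_simps)

lemma is_primitive_cmult:
  assumes "is_primitive F f"
  shows "is_primitive (\<lambda>x. a * F x) (\<lambda>x. a * f x)"
  using assms unfolding is_primitive_def locally_integrable_def
  by (auto simp flip: right_diff_distrib)

lemma is_primitive_diff:
  assumes "is_primitive F f" "is_primitive G g"
  shows "is_primitive (\<lambda>x. F x - G x) (\<lambda>x. f x - g x)"
  using is_primitive_add[OF assms(1) is_primitive_cmult[OF assms(2), of "-1"]] by simp

lemma is_primitive_imp_has_vector_derivative:
  assumes F: "is_primitive F f" and f: "continuous_on UNIV f"
  shows "(F has_vector_derivative f x) (at x)"
proof -
  have d: "((\<lambda>t. integral {x-1..t} f) has_vector_derivative f x) (at x within {x-1..x+1})"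
    by (rule integral_has_vector_derivative) (auto intro: continuous_on_subset[OF f])
  have e: "F t = F (x-1) + integral {x-1..t} f" if "t \<in> {x-1..x+1}" for t
    using is_primitive_integral[OF F, of "x-1" t] that
      set_borel_integral_eq_integral(2)[OF locally_integrableD[OF is_primitive_locally_integrable[OF F]], of "x-1" t]
    by simp
  have "((\<lambda>t. F (x-1) + integral {x-1..t} f) has_vector_derivative 0 + f x) (at x within {x-1..x+1})"
    by (intro has_vector_derivative_add has_vector_derivative_const d)
  then have "(F has_vector_derivative f x) (at x within {x-1..x+1})"
    using has_vector_derivative_transform[of x "{x-1..x+1}" F, OF _ e] by simp
  then have "(F has_vector_derivative f x) (at x within {x-1<..<x+1})"
    by (rule has_vector_derivative_within_subset) auto
  then show ?thesis by (subst (asm) at_within_open) auto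
qed

text \<open>
  No Fubini argument is needed: the defect of the product rule on \<open>[s, t]\<close> is
  \<open>\<integral> f (G t - G) + \<integral> (F s - F) g\<close>, which is \<open>o(t - s)\<close> uniformly.
\<close>

lemma is_primitive_mult_C1:
  fixes F G :: "real \<Rightarrow> complex"
  assumes F: "is_primitive F f" and G: "\<And>x. (G has_vector_derivative g x) (at x)" "continuous_on UNIV g"
  shows "is_primitive (\<lambda>x. F x * G x) (\<lambda>x. f x * G x + F x * g x)"
proof -
  have Gp: "is_primitive G g" by (rule C1_is_primitive[OF G])
  have f: "locally_integrable f" by (rule is_primitive_locally_integrable[OF F])
  have Fc: "continuous_on UNIV F" and Gc: "continuous_on UNIV G"
    using F Gp is_primitive_continuous by blast+
  let ?h = "\<lambda>x. f x * G x + F x * g x"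
  have h: "locally_integrable ?h"
    by (intro locally_integrable_add locally_integrable_mult_continuous[OF f Gc] continuous_locally_integrable
        continuous_on_mult Fc G)
  have "F b * G b - F a * G a = (LINT x:{a..b}|lborel. ?h x)" if ab: "a \<le> b" for a b
  proof -
    have "compact (g ` {a..b})"
      by (intro compact_continuous_image continuous_on_subset[OF G(2)]) auto
    then obtain B where B: "\<And>x. x \<in> {a..b} \<Longrightarrow> norm (g x) \<le> B"
      by (metis compact_imp_bounded bounded_iff image_eqI)
    have B0: "0 \<le> B" using B[of a] ab by (meson atLeastAtMost_iff norm_ge_zero order.refl order.trans)
    \<comment> \<open>The product rule on \<open>[a, b]\<close> amounts to \<open>D b = D a\<close>,
      which will follow from a vanishing derivative.\<close>
    define D where "D t = F t * G t - (LINT x:{a..t}|lborel. ?h x)" for t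
    have defect: "norm (D t - D s) \<le> B * (t - s) * ((LINT x:{s..t}|lborel. norm (f x)) + M)"
      if st: "a \<le> s" "s \<le> t" "t \<le> b" and M: "\<And>x. x \<in> {s..t} \<Longrightarrow> norm (F s - F x) \<le> M" for s t M
    proof -
      have i1: "set_integrable lborel {s..t} (\<lambda>x. f x * (G t - G x))"
        by (intro locally_integrableD locally_integrable_mult_continuous f continuous_intros Gc)
      have i2: "set_integrable lborel {s..t} (\<lambda>x. (F s - F x) * g x)"
        by (intro locally_integrableD continuous_locally_integrable continuous_intros Fc G)
      have "(LINT x:{s..t}|lborel. ?h x) + ((LINT x:{s..t}|lborel. f x * (G t - G x)) + (LINT x:{s..t}|lborel. (F s - F x) * g x))
          = (LINT x:{s..t}|lborel. f x * G t + F s * g x)"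
        unfolding set_integral_add(2)[symmetric, OF i1 i2]
          set_integral_add(2)[symmetric, OF locally_integrableD[OF h] set_integral_add(1)[OF i1 i2]]
        by (simp add: algebra_simps)
      also have "\<dots> = (LINT x:{s..t}|lborel. f x) * G t + F s * (LINT x:{s..t}|lborel. g x)"
        by (subst set_integral_add(2))
          (auto intro: locally_integrableD[OF f] locally_integrableD[OF is_primitive_locally_integrable[OF Gp]])
      also have "\<dots> = F t * G t - F s * G s"
        unfolding is_primitive_integral[OF F st(2)] is_primitive_integral[OF Gp st(2)] by (simp add: algebra_simps)
      finally have eq: "(LINT x:{s..t}|lborel. ?h x) + ((LINT x:{s..t}|lborel. f x * (G t - G x)) + (LINT x:{s..t}|lborel. (F s - F x) * g x))
          = F t * G t - F s * G s" .
      \<comment> \<open>The bookkeeping is done with plain variables. \<open>Z\<close> stands for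
        the integral from \<open>a\<close> to \<open>s\<close>, which cancels.\<close>
      have gen: "X - (Z + A) - (Y - Z) = B + C" if "A + (B + C) = X - Y" for A B C X Y Z :: complex
        using that by (simp add: algebra_simps)
      have "D t - D s = (LINT x:{s..t}|lborel. f x * (G t - G x)) + (LINT x:{s..t}|lborel. (F s - F x) * g x)"
        unfolding D_def set_integral_split[OF locally_integrableD[OF h] st(1,2)]
        by (rule gen[OF eq])
      also have "norm \<dots> \<le> norm (LINT x:{s..t}|lborel. f x * (G t - G x)) + norm (LINT x:{s..t}|lborel. (F s - F x) * g x)"
        by (rule norm_triangle_ineq)
      also have "norm (LINT x:{s..t}|lborel. f x * (G t - G x)) \<le> (LINT x:{s..t}|lborel. norm (f x * (G t - G x)))"
        by (rule set_integral_norm_bound[OF i1])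
      also have "\<dots> \<le> (LINT x:{s..t}|lborel. norm (f x) * (B * (t - s)))"
      proof (rule set_integral_mono)
        show "set_integrable lborel {s..t} (\<lambda>x. norm (f x * (G t - G x)))" by (rule set_integrable_norm[OF i1])
        show "set_integrable lborel {s..t} (\<lambda>x. norm (f x) * (B * (t - s)))"
          using set_integrable_norm[OF locally_integrableD[OF f]] by auto
        fix x assume x: "x \<in> {s..t}"
        have "norm (G t - G x) \<le> (LINT y:{x..t}|lborel. norm (g y))"
          using x by (intro is_primitive_norm_diff_le[OF Gp]) simp
        also have "\<dots> \<le> (LINT y:{x..t}|lborel. B)"
        proof (rule set_integral_mono)
          show "set_integrable lborel {x..t} (\<lambda>y. norm (g y))"
            by (rule set_integrable_norm[OF locally_integrableD[OF is_primitive_locally_integrable[OF Gp]]])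
          show "set_integrable lborel {x..t} (\<lambda>y. B)" by (auto intro: borel_integrable_atLeastAtMost')
        qed (use x st B in auto)
        also have "\<dots> = B * (t - x)" using x by (simp add: set_lebesgue_integral_def)
        also have "\<dots> \<le> B * (t - s)" using x B0 by (intro mult_left_mono) auto
        finally show "norm (f x * (G t - G x)) \<le> norm (f x) * (B * (t - s))"
          by (simp add: norm_mult mult_left_mono)
      qed
      also have "(LINT x:{s..t}|lborel. norm (f x) * (B * (t - s))) = (LINT x:{s..t}|lborel. norm (f x)) * (B * (t - s))"
        by simp
      also have "norm (LINT x:{s..t}|lborel. (F s - F x) * g x) \<le> (LINT x:{s..t}|lborel. norm ((F s - F x) * g x))"
        by (rule set_integral_norm_bound[OF i2])
      also have "\<dots> \<le> (LINT x:{s..t}|lborel. M * B)"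
      proof (rule set_integral_mono)
        show "set_integrable lborel {s..t} (\<lambda>x. norm ((F s - F x) * g x))" by (rule set_integrable_norm[OF i2])
        show "set_integrable lborel {s..t} (\<lambda>x. M * B)"
          by (auto intro: borel_integrable_atLeastAtMost')
        fix x assume x: "x \<in> {s..t}"
        have "0 \<le> M" using order_trans[OF norm_ge_zero M[OF x]] .
        then show "norm ((F s - F x) * g x) \<le> M * B"
          using M[OF x] B[of x] x st by (auto simp: norm_mult intro!: mult_mono)
      qed
      also have "\<dots> = (t - s) * (M * B)" using st by (simp add: set_lebesgue_integral_def)
      finally show ?thesis by (simp add: algebra_simps)
    qed
    have "(D has_derivative (\<lambda>h. 0)) (at x within {a..b})" if "x \<in> {a..b}" for x
      unfolding has_derivative_within_alt
    proof (intro conjI allI impI)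
      fix e :: real assume e: "e > 0"
      \<comment> \<open>The defect is at most \<open>B (t - s)\<close> times \<open>2 e'\<close>, so
        this choice yields slope at most \<open>e\<close>; \<open>B + 1\<close> keeps the
        denominator positive.\<close>
      define e' where "e' = e / (2 * (B + 1))"
      have e': "e' > 0" using e B0 by (simp add: e'_def)
      obtain d1 where d1: "d1 > 0" "\<And>s t. a \<le> s \<Longrightarrow> s \<le> t \<Longrightarrow> t \<le> b \<Longrightarrow> t - s < d1 \<Longrightarrow> (LINT x:{s..t}|lborel. norm (f x)) < e'"
        using is_primitive_uniform_continuity[OF f e'] by metis
      have key: "norm (D t - D s) \<le> e * (t - s)" if st: "a \<le> s" "s \<le> t" "t \<le> b" "t - s < d1" for s t
      proof -
        have "norm (F s - F x) \<le> e'" if "x \<in> {s..t}" for x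
        proof -
          have "norm (F x - F s) \<le> (LINT x:{s..x}|lborel. norm (f x))"
            using that by (intro is_primitive_norm_diff_le[OF F]) simp
          also have "\<dots> < e'" using that st by (intro d1(2)) auto
          finally show ?thesis by (simp add: norm_minus_commute)
        qed
        from defect[OF st(1-3) this]
        have "norm (D t - D s) \<le> B * (t - s) * ((LINT x:{s..t}|lborel. norm (f x)) + e')" by simp
        also have "\<dots> \<le> B * (t - s) * (2 * e')"
          using d1(2)[OF st] B0 st by (intro mult_left_mono) auto
        also have "\<dots> \<le> (B + 1) * (t - s) * (2 * e')"
          using st e' by (intro mult_right_mono) auto
        also have "\<dots> = e * (t - s)" using B0 by (simp add: e'_def field_simps)
        finally show ?thesis .
      qed
      show "\<exists>d>0. \<forall>y\<in>{a..b}. norm (y - x) < d \<longrightarrow> norm (D y - D x - 0) \<le> e * norm (y - x)"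
      proof (intro exI[of _ d1] conjI ballI impI d1(1))
        fix y assume y: "y \<in> {a..b}" "norm (y - x) < d1"
        show "norm (D y - D x - 0) \<le> e * norm (y - x)"
        proof (cases "x \<le> y")
          case True
          then show ?thesis using key[of x y] y that by auto
        next
          case False
          then show ?thesis using key[of y x] y that by (auto simp: norm_minus_commute)
        qed
      qed
    qed simp
    then have "D b = D a"
      using has_derivative_zero_constant[of "{a..b}" D] ab by fastforce
    moreover have "(LINT x:{a..a}|lborel. ?h x) = 0"
      using set_integral_split[OF locally_integrableD[OF h], of a a a] by simp
    ultimately show ?thesis by (simp add: D_def algebra_simps)
  qed
  then show ?thesis using h by (simp add: is_primitive_def)
qed

lemma integral_Icc_tendsto:
  fixes f :: "real \<Rightarrow> 'a::{banach, second_countable_topology}"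
  assumes "integrable lborel f"
  shows "(\<lambda>n. LINT x:{- real n..real n}|lborel. f x) \<longlonglongrightarrow> (LINT x|lborel. f x)"
  unfolding set_lebesgue_integral_def
proof (rule integral_dominated_convergence[where w = "\<lambda>x. norm (f x)"])
  show "AE x in lborel. (\<lambda>n. indicator {- real n..real n} x *\<^sub>R f x) \<longlonglongrightarrow> f x"
  proof (rule AE_I2)
    fix x :: real
    obtain N :: nat where "\<bar>x\<bar> \<le> N" using real_arch_simple by blast
    then have "\<forall>\<^sub>F n in sequentially. indicator {- real n..real n} x *\<^sub>R f x = f x"
      unfolding eventually_sequentially by (intro exI[of _ N]) (auto simp: indicator_def)
    then show "(\<lambda>n. indicator {- real n..real n} x *\<^sub>R f x) \<longlonglongrightarrow> f x" by (rule tendsto_eventually)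
  qed
qed (use assms in \<open>auto simp: indicator_def\<close>)

lemma is_primitive_integral_UNIV_zero:
  assumes F: "is_primitive F f" and f: "integrable lborel f"
    and l: "(\<lambda>n. F (real n)) \<longlonglongrightarrow> 0" "(\<lambda>n. F (- real n)) \<longlonglongrightarrow> 0"
  shows "(LINT x|lborel. f x) = 0"
proof -
  have "(\<lambda>n. F (real n) - F (- real n)) \<longlonglongrightarrow> 0 - 0" by (intro tendsto_intros l)
  moreover have "F (real n) - F (- real n) = (LINT x:{- real n..real n}|lborel. f x)" for n
    by (rule is_primitive_integral[OF F, symmetric]) simp
  ultimately show ?thesis using LIMSEQ_unique[OF integral_Icc_tendsto[OF f]] by simp
qed

lemma integral_unit_interval_tendsto_0:
  fixes f :: "real \<Rightarrow> real" and X :: "nat \<Rightarrow> real"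
  assumes f: "integrable lborel f" and X: "filterlim (\<lambda>n. \<bar>X n\<bar>) at_top sequentially"
  shows "(\<lambda>n. LINT x:{X n..X n + 1}|lborel. f x) \<longlonglongrightarrow> 0"
proof -
  have "(\<lambda>n. LINT x|lborel. indicator {X n..X n + 1} x *\<^sub>R f x) \<longlonglongrightarrow> (LINT x::real|lborel. (0::real))"
  proof (rule integral_dominated_convergence[where w = "\<lambda>x. norm (f x)"])
    show "AE x in lborel. (\<lambda>n. indicator {X n..X n + 1} x *\<^sub>R f x) \<longlonglongrightarrow> 0"
    proof (rule AE_I2)
      fix x :: real
      have "eventually (\<lambda>n. \<bar>x\<bar> + 2 \<le> \<bar>X n\<bar>) sequentially"
        using X by (simp add: filterlim_at_top)
      then have "\<forall>\<^sub>F n in sequentially. indicator {X n..X n + 1} x *\<^sub>R f x = 0"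
        by eventually_elim (auto simp: indicator_def)
      then show "(\<lambda>n. indicator {X n..X n + 1} x *\<^sub>R f x) \<longlonglongrightarrow> 0" by (rule tendsto_eventually)
    qed
  qed (use f in \<open>auto simp: indicator_def\<close>)
  then show ?thesis by (simp add: set_lebesgue_integral_def)
qed

text \<open>Functions in the Sobolev space of order one vanish at infinity: \<open>F x\<close>
  differs from any \<open>F y\<close> with \<open>y\<close> in \<open>[x, x + 1]\<close> by at most
  the local L2 norm of \<open>f\<close>, and the local norms vanish as the interval moves out. This
  disposes of all boundary terms at infinity.\<close>

lemma L2_primitive_tendsto_0:
  assumes F: "is_primitive F f" "F \<in> L2" "f \<in> L2" and X: "filterlim (\<lambda>n. \<bar>X n\<bar>) at_top sequentially"
  shows "(\<lambda>n::nat. F (X n)) \<longlonglongrightarrow> 0"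
proof -
  have bd: "(norm (F x))\<^sup>2 \<le> 2 * (LINT y:{x..x+1}|lborel. (norm (F y))\<^sup>2) + 2 * (LINT y:{x..x+1}|lborel. (norm (f y))\<^sup>2)" for x
  proof -
    let ?I = "\<lambda>y. complex_of_real (indicator {x..x+1} y)"
    let ?A = "LINT y:{x..x+1}|lborel. (norm (f y))\<^sup>2"
    have iF: "set_integrable lborel {x..x+1} (\<lambda>y. (norm (F y))\<^sup>2)"
      unfolding set_integrable_def by (intro integrable_mult_indicator L2_integrable_norm_sq F) auto
    have I: "?I \<in> L2" by (rule L2_indicator)
    have If: "(\<lambda>y. ?I y * f y) \<in> L2"
      by (rule L2_mult_bounded[OF F(3), of _ 1]) (auto simp: indicator_def)
    have nI: "L2_norm ?I = 1" unfolding L2_norm_def norm_sq_indicator by simp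
    have nIf: "(L2_norm (\<lambda>y. ?I y * f y))\<^sup>2 = ?A"
      unfolding L2_norm_sq set_lebesgue_integral_def
      by (rule Bochner_Integration.integral_cong) (auto simp: indicator_def)
    have "(LINT y:{x..x+1}|lborel. norm (f y)) = (LINT y|lborel. norm (?I y) * norm (?I y * f y))"
      unfolding set_lebesgue_integral_def
      by (rule Bochner_Integration.integral_cong) (auto simp: indicator_def norm_mult)
    also have "\<dots> \<le> L2_norm (\<lambda>y. ?I y * f y)"
      using L2_Cauchy_Schwarz_norm[OF I If] nI by simp
    finally have n1: "(LINT y:{x..x+1}|lborel. norm (f y)) \<le> L2_norm (\<lambda>y. ?I y * f y)" .
    have "(norm (F x))\<^sup>2 \<le> 2 * (norm (F y))\<^sup>2 + 2 * ?A" if y: "y \<in> {x..x+1}" for y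
    proof -
      have si: "set_integrable lborel {x..x+1} (\<lambda>y. norm (f y))"
        by (rule set_integrable_norm[OF locally_integrableD[OF L2_locally_integrable[OF F(3)]]])
      have "norm (F y - F x) \<le> (LINT y:{x..y}|lborel. norm (f y))"
        using y by (intro is_primitive_norm_diff_le[OF F(1)]) auto
      also have "\<dots> \<le> (LINT y:{x..x+1}|lborel. norm (f y))"
        using set_integral_split[OF si, of y] y
        by (simp add: set_lebesgue_integral_def integral_nonneg_AE)
      also note n1
      finally have "norm (F x) \<le> norm (F y) + L2_norm (\<lambda>y. ?I y * f y)"
        using norm_triangle_ineq3[of "F x" "F y"] by (simp add: norm_minus_commute)
      then have "(norm (F x))\<^sup>2 \<le> (norm (F y) + L2_norm (\<lambda>y. ?I y * f y))\<^sup>2"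
        by (intro power_mono) auto
      also have "\<dots> \<le> 2 * (norm (F y))\<^sup>2 + 2 * (L2_norm (\<lambda>y. ?I y * f y))\<^sup>2"
        using zero_le_power2[of "norm (F y) - L2_norm (\<lambda>y. ?I y * f y)"]
        by (simp add: power2_eq_square algebra_simps)
      finally show ?thesis by (simp add: nIf)
    qed
    \<comment> \<open>Averaging in \<open>y\<close> over an interval of length 1; the left side does
      not depend on \<open>y\<close>.\<close>
    then have "(LINT y:{x..x+1}|lborel. (norm (F x))\<^sup>2) \<le> (LINT y:{x..x+1}|lborel. 2 * (norm (F y))\<^sup>2 + 2 * ?A)"
      by (intro set_integral_mono set_integral_add set_integrable_mult_right)
        (use iF in \<open>auto intro: borel_integrable_atLeastAtMost'\<close>)
    also have "\<dots> = 2 * (LINT y:{x..x+1}|lborel. (norm (F y))\<^sup>2) + (LINT y:{x..x+1}|lborel. 2 * ?A)"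
      by (subst set_integral_add(2)) (use iF in \<open>auto intro!: borel_integrable_atLeastAtMost'\<close>)
    finally show ?thesis by (simp add: set_lebesgue_integral_def)
  qed
  have "(\<lambda>n. 2 * (LINT y:{X n..X n+1}|lborel. (norm (F y))\<^sup>2) + 2 * (LINT y:{X n..X n+1}|lborel. (norm (f y))\<^sup>2)) \<longlonglongrightarrow> 2 * 0 + 2 * 0"
    by (intro tendsto_intros integral_unit_interval_tendsto_0[OF _ X] L2_integrable_norm_sq F)
  then have "(\<lambda>n. (norm (F (X n)))\<^sup>2) \<longlonglongrightarrow> 0"
    by (intro tendsto_sandwich[of "\<lambda>_. 0" "\<lambda>n. (norm (F (X n)))\<^sup>2", OF _ _ tendsto_const]) (use bd in auto)
  then have "(\<lambda>n. sqrt ((norm (F (X n)))\<^sup>2)) \<longlonglongrightarrow> sqrt 0" by (rule tendsto_real_sqrt)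
  then show ?thesis by (simp add: tendsto_norm_zero_iff)
qed

subsection \<open>Smooth functions\<close>

text \<open>\<open>smooth\<close> iterates \<open>deriv\<close> on the outside. Peeling off the
  first derivative instead makes closure under sums, products and affine substitutions an induction
  on \<open>n\<close> that ranges over all functions at once.\<close>

primrec diff_n :: "nat \<Rightarrow> (real \<Rightarrow> real) \<Rightarrow> bool" where
  "diff_n 0 g \<longleftrightarrow> (\<forall>x. g differentiable (at x))"
| "diff_n (Suc n) g \<longleftrightarrow> (\<forall>x. g differentiable (at x)) \<and> diff_n n (deriv g)"

lemma smooth_iff_diff_n: "smooth g \<longleftrightarrow> (\<forall>n. diff_n n g)"
proof
  have "\<forall>g. smooth g \<longrightarrow> diff_n n g" for n
  proof (induction n)
    case 0
    then show ?case by (auto simp: smooth_def dest: spec[of _ 0])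
  next
    case (Suc n)
    show ?case
    proof (intro allI impI)
      fix g assume g: "smooth g"
      have "smooth (deriv g)"
        unfolding smooth_def
      proof (intro allI)
        fix n x
        show "((deriv ^^ n) (deriv g)) differentiable (at x)"
          using g[unfolded smooth_def, rule_format, of "Suc n" x] by (simp only: funpow_Suc_right o_apply)
      qed
      moreover have "\<forall>x. g differentiable (at x)"
        using g[unfolded smooth_def] by (auto dest: spec[of _ 0])
      ultimately show "diff_n (Suc n) g" using Suc by simp
    qed
  qed
  then show "smooth g \<Longrightarrow> \<forall>n. diff_n n g" by blast
  have "\<forall>g. (\<forall>n. diff_n n g) \<longrightarrow> (\<forall>x. ((deriv ^^ n) g) differentiable (at x))" for n
  proof (induction n)
    case 0
    then show ?case by (auto dest: spec[of _ 0])
  next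
    case (Suc n)
    show ?case
    proof (intro allI impI)
      fix g :: "real \<Rightarrow> real" and x assume g: "\<forall>n. diff_n n g"
      have "\<forall>m. diff_n m (deriv g)" using g by (metis diff_n.simps(2))
      then show "((deriv ^^ Suc n) g) differentiable (at x)"
        using Suc by (simp only: funpow_Suc_right o_apply simp_thms)
    qed
  qed
  then show "\<forall>n. diff_n n g \<Longrightarrow> smooth g" unfolding smooth_def by blast
qed

lemma diff_n_differentiable: "diff_n n g \<Longrightarrow> g differentiable (at x)"
  by (cases n) auto

lemma diff_n_DERIV: "diff_n n g \<Longrightarrow> (g has_real_derivative deriv g x) (at x)"
  using diff_n_differentiable DERIV_deriv_iff_real_differentiable by blast

lemma diff_n_Suc: "diff_n (Suc n) g \<Longrightarrow> diff_n n g"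
  by (induction n arbitrary: g) auto

lemma diff_n_SucI:
  assumes "\<And>x. (g has_real_derivative g' x) (at x)" "diff_n n g'"
  shows "diff_n (Suc n) g"
proof -
  have "deriv g = g'" using assms(1) by (intro ext DERIV_imp_deriv)
  then show ?thesis using assms by (auto simp: real_differentiable_def)
qed

lemma diff_n_I:
  assumes "\<And>x. (g has_real_derivative g' x) (at x)" "\<And>m. n = Suc m \<Longrightarrow> diff_n m g'"
  shows "diff_n n g"
proof (cases n)
  case 0
  then show ?thesis using assms(1) by (auto simp: real_differentiable_def)
next
  case (Suc m)
  then show ?thesis using diff_n_SucI[OF assms(1)] assms(2) by blast
qed

lemma diff_n_add: "diff_n n f \<Longrightarrow> diff_n n g \<Longrightarrow> diff_n n (\<lambda>x. f x + g x)"
proof (induction n arbitrary: f g)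
  case 0
  then show ?case by auto
next
  case (Suc n)
  show ?case
    by (rule diff_n_SucI[where g' = "\<lambda>x. deriv f x + deriv g x"])
      (use Suc in \<open>auto intro!: derivative_intros intro: diff_n_DERIV[of "Suc n"]\<close>)
qed

lemma diff_n_mult: "diff_n n f \<Longrightarrow> diff_n n g \<Longrightarrow> diff_n n (\<lambda>x. f x * g x)"
proof (induction n arbitrary: f g)
  case 0
  then show ?case by auto
next
  case (Suc n)
  show ?case
  proof (rule diff_n_SucI[where g' = "\<lambda>x. deriv f x * g x + deriv g x * f x"])
    show "((\<lambda>x. f x * g x) has_real_derivative deriv f x * g x + deriv g x * f x) (at x)" for x
      by (rule DERIV_mult) (rule diff_n_DERIV[OF Suc.prems(1)] diff_n_DERIV[OF Suc.prems(2)])+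
    show "diff_n n (\<lambda>x. deriv f x * g x + deriv g x * f x)"
      using Suc.prems diff_n_Suc[OF Suc.prems(1)] diff_n_Suc[OF Suc.prems(2)]
      by (intro diff_n_add Suc.IH) auto
  qed
qed

lemma diff_n_const: "diff_n n (\<lambda>x. c)"
proof (induction n arbitrary: c)
  case (Suc n)
  show ?case by (rule diff_n_SucI[where g' = "\<lambda>x. 0"]) (use Suc in auto)
qed auto

lemma diff_n_affine: "diff_n n f \<Longrightarrow> diff_n n (\<lambda>x. f (a * x + b))"
proof (induction n arbitrary: f)
  case 0
  have "((\<lambda>x. f (a * x + b)) has_real_derivative deriv f (a * x + b) * a) (at x)" for x
    by (rule DERIV_chain2[OF diff_n_DERIV[OF 0]]) (auto intro!: derivative_eq_intros)
  then show ?case by (auto simp: real_differentiable_def)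
next
  case (Suc n)
  show ?case
  proof (rule diff_n_SucI[where g' = "\<lambda>x. deriv f (a * x + b) * a"])
    show "((\<lambda>x. f (a * x + b)) has_real_derivative deriv f (a * x + b) * a) (at x)" for x
      by (rule DERIV_chain2[OF diff_n_DERIV[OF Suc.prems]]) (auto intro!: derivative_eq_intros)
    show "diff_n n (\<lambda>x. deriv f (a * x + b) * a)"
      by (intro diff_n_mult diff_n_const Suc.IH) (use Suc.prems in auto)
  qed
qed

lemma smooth_add: "smooth f \<Longrightarrow> smooth g \<Longrightarrow> smooth (\<lambda>x. f x + g x)"
  and smooth_mult: "smooth f \<Longrightarrow> smooth g \<Longrightarrow> smooth (\<lambda>x. f x * g x)"
  and smooth_const: "smooth (\<lambda>x. c)"
  and smooth_affine: "smooth f \<Longrightarrow> smooth (\<lambda>x. f (a * x + b))"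
  by (auto simp: smooth_iff_diff_n diff_n_add diff_n_mult diff_n_const diff_n_affine)

lemma smooth_deriv: "smooth g \<Longrightarrow> smooth (deriv g)"
  unfolding smooth_iff_diff_n by (metis diff_n.simps(2))

lemma smooth_DERIV: "smooth g \<Longrightarrow> (g has_real_derivative deriv g x) (at x)"
  unfolding smooth_iff_diff_n using diff_n_DERIV by blast

lemma smooth_continuous: "smooth g \<Longrightarrow> continuous_on A g"
  by (meson DERIV_continuous continuous_at_imp_continuous_on smooth_DERIV)

lemma smooth_primitive:
  assumes "\<And>x. (g has_real_derivative g' x) (at x)" "smooth g'"
  shows "smooth g"
  using assms(2) unfolding smooth_iff_diff_n by (auto intro: diff_n_I[OF assms(1)])

subsection \<open>Test functions\<close>

text \<open>The factor \<open>y ^ k\<close> is there for the induction over the coefficients: each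
  coefficient peeled off raises the exponent by one.\<close>

lemma poly_exp_tendsto_0:
  fixes p :: "real poly"
  shows "((\<lambda>y. y ^ k * poly p y * exp (- y)) \<longlongrightarrow> 0) at_top"
proof (induction p arbitrary: k)
  case 0
  then show ?case by simp
next
  case (pCons a p)
  have "((\<lambda>y. a * (y ^ k / exp y) + y ^ Suc k * poly p y * exp (- y)) \<longlongrightarrow> a * 0 + 0) at_top"
    by (intro tendsto_add tendsto_mult tendsto_const tendsto_power_div_exp_0 pCons.IH)
  then show ?case by (simp add: exp_minus algebra_simps divide_inverse)
qed

text \<open>For \<open>p = 1\<close> this is the classical flat function. The polynomial in
  \<open>1 / x\<close> makes the family closed under differentiation, so that smoothness becomes an
  induction within the family.\<close>

definition flat_exp :: "real poly \<Rightarrow> real \<Rightarrow> real" where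
  "flat_exp p x = (if x > 0 then poly p (1 / x) * exp (- (1 / x)) else 0)"

text \<open>The factor \<open>[:0, 0, 1:]\<close> is the \<open>1 / x^2\<close> of the chain rule;
  it multiplies \<open>p\<close> from the exponential and \<open>- pderiv p\<close> from the
  polynomial. Only the origin needs a limit: there the difference quotient from the right is
  \<open>y p(y) exp (- y)\<close> with \<open>y = 1 / h\<close>.\<close>

lemma flat_exp_DERIV:
  "(flat_exp p has_real_derivative flat_exp ([:0, 0, 1:] * (p - pderiv p)) x) (at x)"
proof -
  consider "x > 0" | "x < 0" | "x = 0" by linarith
  then show ?thesis
  proof cases
    case 1
    have "((\<lambda>x. poly p (1 / x) * exp (- (1 / x))) has_real_derivative
        flat_exp ([:0, 0, 1:] * (p - pderiv p)) x) (at x)"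
      using 1 by (auto simp: flat_exp_def field_simps power2_eq_square intro!: derivative_eq_intros)
    then show ?thesis
      by (rule has_field_derivative_transform_within_open[of _ _ _ "{0<..}"])
        (use 1 in \<open>auto simp: flat_exp_def\<close>)
  next
    case 2
    have "((\<lambda>x. 0) has_real_derivative flat_exp ([:0, 0, 1:] * (p - pderiv p)) x) (at x)"
      using 2 by (auto simp: flat_exp_def)
    then show ?thesis
      by (rule has_field_derivative_transform_within_open[of _ _ _ "{..<0}"])
        (use 2 in \<open>auto simp: flat_exp_def\<close>)
  next
    case 3
    have lim: "((\<lambda>h. (1 / h) ^ 1 * poly p (1 / h) * exp (- (1 / h))) \<longlongrightarrow> 0) (at_right 0)"
      using filterlim_compose[OF poly_exp_tendsto_0[of 1 p] filterlim_inverse_at_top_right]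
      by (simp add: inverse_eq_divide)
    have "((\<lambda>h. (flat_exp p (0 + h) - flat_exp p 0) / h) \<longlongrightarrow> 0) (at 0)"
    proof (rule filterlim_split_at)
      have "eventually (\<lambda>h. 0 = (flat_exp p (0 + h) - flat_exp p 0) / h) (at_left (0::real))"
        unfolding eventually_at_filter by (rule always_eventually) (auto simp: flat_exp_def)
      then show "((\<lambda>h. (flat_exp p (0 + h) - flat_exp p 0) / h) \<longlongrightarrow> 0) (at_left 0)"
        by (rule Lim_transform_eventually[OF tendsto_const])
      have "eventually (\<lambda>h. (1 / h) ^ 1 * poly p (1 / h) * exp (- (1 / h)) = (flat_exp p (0 + h) - flat_exp p 0) / h) (at_right (0::real))"
        unfolding eventually_at_filter by (rule always_eventually) (auto simp: flat_exp_def)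
      then show "((\<lambda>h. (flat_exp p (0 + h) - flat_exp p 0) / h) \<longlongrightarrow> 0) (at_right 0)"
        by (rule Lim_transform_eventually[OF lim])
    qed
    then show ?thesis using 3 by (simp add: DERIV_def flat_exp_def)
  qed
qed

lemma smooth_flat_exp: "smooth (flat_exp p)"
proof -
  have "diff_n n (flat_exp p)" for n
  proof (induction n arbitrary: p)
    case 0
    show ?case by (rule diff_n_I[OF flat_exp_DERIV]) auto
  next
    case (Suc n)
    then show ?case by (intro diff_n_SucI[OF flat_exp_DERIV])
  qed
  then show ?thesis by (simp add: smooth_iff_diff_n)
qed

text \<open>A bump supported in \<open>[a, b]\<close>. As \<open>n\<close> grows it increases to the
  indicator of the open interval, and in this way test functions recover interval integrals.\<close>

definition bump :: "real \<Rightarrow> real \<Rightarrow> real \<Rightarrow> real \<Rightarrow> real" where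
  "bump n a b x = flat_exp 1 (n * x + (- n * a)) * flat_exp 1 (- n * x + n * b)"

lemma bump_eq:
  assumes "n > 0"
  shows "bump n a b x = (if a < x \<and> x < b then exp (- (1 / (n * (x - a)))) * exp (- (1 / (n * (b - x)))) else 0)"
proof -
  have "n * x + (- n * a) = n * (x - a)" "- n * x + n * b = n * (b - x)" by (simp_all add: algebra_simps)
  then show ?thesis unfolding bump_def flat_exp_def using assms by (auto simp: zero_less_mult_iff)
qed

lemma test_function_bump: "n > 0 \<Longrightarrow> test_function (bump n a b)"
  unfolding test_function_def
proof
  show "smooth (bump n a b)"
    unfolding bump_def[abs_def] by (intro smooth_mult smooth_affine smooth_flat_exp)
  assume "n > 0"
  then show "\<exists>R. \<forall>x. \<bar>x\<bar> > R \<longrightarrow> bump n a b x = 0"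
    by (intro exI[of _ "max \<bar>a\<bar> \<bar>b\<bar>"]) (auto simp: bump_eq)
qed

lemma test_function_add:
  assumes "test_function \<eta>" "test_function \<theta>"
  shows "test_function (\<lambda>x. \<eta> x + \<theta> x)"
proof -
  obtain R S where "\<And>x. \<bar>x\<bar> > R \<Longrightarrow> \<eta> x = 0" "\<And>x. \<bar>x\<bar> > S \<Longrightarrow> \<theta> x = 0"
    using assms by (auto simp: test_function_def)
  then have "\<forall>x. \<bar>x\<bar> > max R S \<longrightarrow> \<eta> x + \<theta> x = 0" by auto
  then show ?thesis using assms unfolding test_function_def by (intro conjI exI[of _ "max R S"]) (auto intro: smooth_add)
qed

lemma test_function_cmult:
  assumes "test_function \<eta>" shows "test_function (\<lambda>x. c * \<eta> x)"
  using assms by (fastforce simp: test_function_def intro!: smooth_mult smooth_const)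

lemma test_function_integrable_scaleR:
  assumes "test_function \<eta>" "locally_integrable G"
  shows "integrable lborel (\<lambda>x. \<eta> x *\<^sub>R G x)"
proof -
  obtain R where R: "\<And>x. \<bar>x\<bar> > R \<Longrightarrow> \<eta> x = 0" using assms by (auto simp: test_function_def)
  have "set_integrable lborel {-R..R} (\<lambda>x. G x * complex_of_real (\<eta> x))"
    using assms by (intro locally_integrableD locally_integrable_mult_continuous continuous_on_of_real smooth_continuous)
      (auto simp: test_function_def)
  then have "integrable lborel (\<lambda>x. indicator {-R..R} x *\<^sub>R (G x * complex_of_real (\<eta> x)))"
    by (simp add: set_integrable_def)
  moreover have "indicator {-R..R} x *\<^sub>R (G x * complex_of_real (\<eta> x)) = \<eta> x *\<^sub>R G x" for x
    using R[of x] by (cases "\<bar>x\<bar> \<le> R") (auto simp: indicator_def scaleR_conv_of_real)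
  ultimately show ?thesis by simp
qed

lemma test_function_deriv:
  assumes "test_function \<eta>" shows "test_function (deriv \<eta>)"
proof -
  obtain R where R: "\<And>x. \<bar>x\<bar> > R \<Longrightarrow> \<eta> x = 0" using assms by (auto simp: test_function_def)
  have "deriv \<eta> x = 0" if "\<bar>x\<bar> > R" for x
  proof (rule DERIV_imp_deriv)
    have "open {x::real. R < \<bar>x\<bar>}" by (intro open_Collect_less continuous_intros)
    then show "(\<eta> has_real_derivative 0) (at x)"
      using that R
      by (intro has_field_derivative_transform_within_open[of "\<lambda>x. 0" 0 x "{x. R < \<bar>x\<bar>}" \<eta>]) auto
  qed
  then show ?thesis using assms by (auto simp: test_function_def smooth_deriv)
qed

text \<open>Half-lines generate the Borel sets and are stable under intersection, so Dynkin's
  theorem carries the vanishing of the integrals over to all Borel sets. The truncation to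
  \<open>[- N, N]\<close> makes the integrand integrable and its total integral zero, as complements
  require.\<close>

lemma AE_zero_of_interval_integrals:
  fixes G :: "real \<Rightarrow> complex"
  assumes G: "locally_integrable G" and z: "\<And>a b. a < b \<Longrightarrow> (LINT x:{a<..<b}|lborel. G x) = 0"
  shows "AE x in lborel. G x = 0"
proof -
  have z': "(LINT x:{a..b}|lborel. G x) = 0" for a b
  proof (cases "a < b")
    case True
    have "(LINT x:{a..b}|lborel. G x) = (LINT x:{a<..<b}|lborel. G x)"
    proof (rule set_integral_cong_set)
      show "AE x in lborel. (x \<in> {a<..<b}) = (x \<in> {a..b})"
        using AE_lborel_singleton[of a] AE_lborel_singleton[of b] by eventually_elim auto
    qed (use locally_integrable_measurable[OF G] in \<open>auto simp: set_borel_measurable_def\<close>)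
    then show ?thesis using z[OF True] by simp
  next
    case False
    then show ?thesis
      using set_integral_split[OF locally_integrableD[OF G], of a a a]
      by (cases "a = b") (auto simp: set_lebesgue_integral_def)
  qed
  have "AE x in lborel. indicator {- real N..real N} x *\<^sub>R G x = 0" for N :: nat
  proof (rule sigma_finite_measure.density_zero[OF lborel.sigma_finite_measure_axioms])
    let ?f = "\<lambda>x. indicator {- real N..real N} x *\<^sub>R G x"
    show f: "integrable lborel ?f"
      using locally_integrableD[OF G] by (simp add: set_integrable_def)
    have tot: "(LINT x|lborel. ?f x) = 0" using z'[of "- real N" "real N"] by (simp add: set_lebesgue_integral_def)
    have fs: "set_integrable lborel A ?f" if "A \<in> sets borel" for A
      unfolding set_integrable_def by (rule integrable_mult_indicator) (use f that in auto)
    fix A :: "real set" assume "A \<in> sets lborel"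
    then have A: "A \<in> sigma_sets UNIV (range (\<lambda>a::real. {..a}))"
      by (simp add: borel_eq_atMost)
    have bs: "sets borel = sigma_sets UNIV (range (\<lambda>a::real. {..a}))"
      unfolding borel_eq_atMost by (rule sets_measure_of) auto
    have stable: "Int_stable (range (\<lambda>a::real. {..a}))" by (auto simp: Int_stable_def)
    have pow: "range (\<lambda>a::real. {..a}) \<subseteq> Pow UNIV" by simp
    show "(LINT x:A|lborel. ?f x) = 0"
      using stable pow A
    proof (induction rule: sigma_sets_induct_disjoint)
      case (basic A)
      then obtain a where "A = {..a}" by auto
      then have "(LINT x:A|lborel. ?f x) = (LINT x:{- real N..min a (real N)}|lborel. G x)"
        unfolding set_lebesgue_integral_def
        by (intro Bochner_Integration.integral_cong) (auto simp: indicator_def)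
      then show ?case using z' by simp
    next
      case empty
      then show ?case by (simp add: set_lebesgue_integral_def)
    next
      case (compl A)
      then have A: "A \<in> sets borel" by (simp add: bs)
      have "(LINT x:A \<union> (UNIV - A)|lborel. ?f x) = (LINT x:A|lborel. ?f x) + (LINT x:UNIV - A|lborel. ?f x)"
        by (rule set_integral_Un) (use A fs in auto)
      then show ?case using compl tot by (simp add: set_lebesgue_integral_def)
    next
      case (union A)
      then have A: "A i \<in> sets borel" for i by (auto simp: bs)
      have "(LINT x:(\<Union>i. A i)|lborel. ?f x) = (\<Sum>i. (LINT x:A i|lborel. ?f x))"
        by (rule lebesgue_integral_countable_add)
          (use A union(1) fs in \<open>auto simp: disjoint_family_on_def\<close>)
      then show ?case using union by simp
    qed
  qed
  then have "AE x in lborel. \<forall>N::nat. indicator {- real N..real N} x *\<^sub>R G x = 0"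
    unfolding AE_all_countable by blast
  then show ?thesis
  proof eventually_elim
    case (elim x)
    obtain N :: nat where "\<bar>x\<bar> \<le> N" using real_arch_simple by blast
    then show ?case using elim[rule_format, of N] by (auto simp: indicator_def split: if_splits)
  qed
qed

text \<open>The bumps converge to the indicator of the interval, dominated by
  \<open>norm (G x)\<close> on \<open>[a, b]\<close>; hence all interval integrals of
  \<open>G\<close> vanish.\<close>

lemma fundamental_lemma:
  fixes G :: "real \<Rightarrow> complex"
  assumes G: "locally_integrable G" and z: "\<And>\<eta>. test_function \<eta> \<Longrightarrow> (LINT x|lborel. \<eta> x *\<^sub>R G x) = 0"
  shows "AE x in lborel. G x = 0"
proof (rule AE_zero_of_interval_integrals[OF G])
  fix a b :: real assume ab: "a < b"
  have [measurable]: "G \<in> borel_measurable borel" by (rule locally_integrable_measurable[OF G])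
  have tf: "test_function (bump (Suc n) a b)" for n :: nat by (rule test_function_bump) simp
  then have [measurable]: "bump (Suc n) a b \<in> borel_measurable borel" for n :: nat
    by (intro borel_measurable_continuous_onI smooth_continuous) (simp add: test_function_def)
  have "(\<lambda>n::nat. LINT x|lborel. bump (Suc n) a b x *\<^sub>R G x) \<longlonglongrightarrow> (LINT x|lborel. indicator {a<..<b} x *\<^sub>R G x)"
  proof (rule integral_dominated_convergence[where w = "\<lambda>x. norm (indicator {a..b} x *\<^sub>R G x)"])
    show "integrable lborel (\<lambda>x. norm (indicator {a..b} x *\<^sub>R G x))"
      using locally_integrableD[OF G, of a b] unfolding set_integrable_def by (rule integrable_norm)
    show "AE x in lborel. (\<lambda>n::nat. bump (Suc n) a b x *\<^sub>R G x) \<longlonglongrightarrow> indicator {a<..<b} x *\<^sub>R G x"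
    proof (rule AE_I2)
      fix x
      have "(\<lambda>n::nat. bump (Suc n) a b x) \<longlonglongrightarrow> indicator {a<..<b} x"
      proof (cases "a < x \<and> x < b")
        case True
        have l: "(\<lambda>n::nat. 1 / (Suc n * y)) \<longlonglongrightarrow> 0" if "y > 0" for y :: real
          using tendsto_mult[OF LIMSEQ_inverse_real_of_nat tendsto_const, of "1 / y"] that by (simp add: field_simps)
        have "(\<lambda>n::nat. exp (- (1 / (Suc n * (x - a)))) * exp (- (1 / (Suc n * (b - x))))) \<longlonglongrightarrow> exp (- 0) * exp (- 0)"
          by (intro tendsto_mult tendsto_exp tendsto_minus l) (use True in auto)
        then show ?thesis using True by (simp add: bump_eq)
      next
        case False
        then show ?thesis by (auto simp: bump_eq)
      qed
      then show "(\<lambda>n::nat. bump (Suc n) a b x *\<^sub>R G x) \<longlonglongrightarrow> indicator {a<..<b} x *\<^sub>R G x"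
        by (intro tendsto_scaleR tendsto_const)
    qed
    show "AE x in lborel. norm (bump (Suc n) a b x *\<^sub>R G x) \<le> norm (indicator {a..b} x *\<^sub>R G x)" for n :: nat
    proof (rule AE_I2)
      fix x
      have "\<bar>bump (Suc n) a b x\<bar> \<le> indicator {a..b} x"
        by (auto simp: bump_eq indicator_def abs_mult intro!: mult_le_one)
      then have "\<bar>bump (Suc n) a b x\<bar> * norm (G x) \<le> indicator {a..b} x * norm (G x)"
        by (rule mult_right_mono) simp
      then show "norm (bump (Suc n) a b x *\<^sub>R G x) \<le> norm (indicator {a..b} x *\<^sub>R G x)" by simp
    qed
  qed measurable
  then show "(LINT x:{a<..<b}|lborel. G x) = 0"
    using z[OF tf] by (simp add: set_lebesgue_integral_def LIMSEQ_const_iff)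
qed

subsection \<open>Weak derivatives\<close>

text \<open>Integration by parts: the product of \<open>F\<close> with a test function is a
  primitive that vanishes far out, so the integral of its derivative is zero.\<close>

lemma is_primitive_has_weak_deriv:
  assumes F: "is_primitive F f"
  shows "has_weak_deriv F f"
  unfolding has_weak_deriv_def
proof (intro conjI allI impI)
  show Fl: "locally_integrable F"
    by (intro continuous_locally_integrable is_primitive_continuous[OF F])
  show fl: "locally_integrable f" by (rule is_primitive_locally_integrable[OF F])
  fix \<eta> assume t: "test_function \<eta>"
  then have s: "smooth \<eta>" by (simp add: test_function_def)
  obtain R where R: "\<And>x. \<bar>x\<bar> > R \<Longrightarrow> \<eta> x = 0" using t by (auto simp: test_function_def)
  have p: "is_primitive (\<lambda>x. F x * complex_of_real (\<eta> x)) (\<lambda>x. f x * of_real (\<eta> x) + F x * of_real (deriv \<eta> x))"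
  proof (rule is_primitive_mult_C1[OF F])
    show "((\<lambda>x. complex_of_real (\<eta> x)) has_vector_derivative complex_of_real (deriv \<eta> x)) (at x)" for x
      by (intro has_vector_derivative_of_real smooth_DERIV[OF s] )
    show "continuous_on UNIV (\<lambda>x. complex_of_real (deriv \<eta> x))"
      by (intro continuous_on_of_real smooth_continuous smooth_deriv s)
  qed
  have i1: "integrable lborel (\<lambda>x. \<eta> x *\<^sub>R f x)" by (rule test_function_integrable_scaleR[OF t fl])
  have i2: "integrable lborel (\<lambda>x. deriv \<eta> x *\<^sub>R F x)"
    by (rule test_function_integrable_scaleR[OF test_function_deriv[OF t] Fl])
  have e: "f x * of_real (\<eta> x) + F x * of_real (deriv \<eta> x) = \<eta> x *\<^sub>R f x + deriv \<eta> x *\<^sub>R F x" for x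
    by (simp add: scaleR_conv_of_real)
  obtain N :: nat where N: "\<bar>R\<bar> < real N" using reals_Archimedean2 by blast
  have ev: "\<forall>\<^sub>F n in sequentially. \<eta> (real n) = 0 \<and> \<eta> (- real n) = 0"
    unfolding eventually_sequentially by (intro exI[of _ N]) (use N in \<open>auto intro!: R\<close>)
  have "(LINT x|lborel. f x * of_real (\<eta> x) + F x * of_real (deriv \<eta> x)) = 0"
  proof (rule is_primitive_integral_UNIV_zero[OF p])
    show "integrable lborel (\<lambda>x. f x * of_real (\<eta> x) + F x * of_real (deriv \<eta> x))"
      unfolding e using i1 i2 by simp
    show "(\<lambda>n. F (real n) * of_real (\<eta> (real n))) \<longlonglongrightarrow> 0"
      by (rule tendsto_eventually) (use ev in \<open>auto elim: eventually_mono\<close>)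
    show "(\<lambda>n. F (- real n) * of_real (\<eta> (- real n))) \<longlonglongrightarrow> 0"
      by (rule tendsto_eventually) (use ev in \<open>auto elim: eventually_mono\<close>)
  qed
  then show "(LINT x|lborel. deriv \<eta> x *\<^sub>R F x) = - (LINT x|lborel. \<eta> x *\<^sub>R f x)"
    unfolding e using i1 i2 by (simp add: add_eq_0_iff)
qed

lemma has_weak_deriv_cong:
  assumes "has_weak_deriv u v" "u' \<in> borel_measurable borel" "AE x in lborel. u x = u' x"
  shows "has_weak_deriv u' v"
  unfolding has_weak_deriv_def
proof (intro conjI allI impI)
  have ul: "locally_integrable u" using assms(1) by (simp add: has_weak_deriv_def)
  show "locally_integrable u'" by (rule locally_integrable_cong_AE[OF ul assms(2,3)])
  show "locally_integrable v" using assms(1) by (simp add: has_weak_deriv_def)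
  fix \<eta> assume t: "test_function \<eta>"
  have "(LINT x|lborel. deriv \<eta> x *\<^sub>R u' x) = (LINT x|lborel. deriv \<eta> x *\<^sub>R u x)"
  proof (rule integral_cong_AE)
    have [measurable]: "deriv \<eta> \<in> borel_measurable borel"
      using t by (intro borel_measurable_continuous_onI smooth_continuous smooth_deriv) (simp add: test_function_def)
    have [measurable]: "u \<in> borel_measurable borel" "u' \<in> borel_measurable borel"
      using locally_integrable_measurable[OF ul] assms(2) by auto
    show "(\<lambda>x. deriv \<eta> x *\<^sub>R u' x) \<in> borel_measurable lborel" "(\<lambda>x. deriv \<eta> x *\<^sub>R u x) \<in> borel_measurable lborel"
      by measurable
    show "AE x in lborel. deriv \<eta> x *\<^sub>R u' x = deriv \<eta> x *\<^sub>R u x"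
      using assms(3) by eventually_elim simp
  qed
  then show "(LINT x|lborel. deriv \<eta> x *\<^sub>R u' x) = - (LINT x|lborel. \<eta> x *\<^sub>R v x)"
    using assms(1) t by (simp add: has_weak_deriv_def)
qed

lemma has_weak_deriv_unique:
  assumes "has_weak_deriv u v" "has_weak_deriv u w"
  shows "AE x in lborel. v x = w x"
proof -
  have vl: "locally_integrable v" and wl: "locally_integrable w"
    using assms by (simp_all add: has_weak_deriv_def)
  have "AE x in lborel. v x - w x = 0"
  proof (rule fundamental_lemma)
    show "locally_integrable (\<lambda>x. v x - w x)" by (rule locally_integrable_diff[OF vl wl])
    fix \<eta> assume t: "test_function \<eta>"
    show "(LINT x|lborel. \<eta> x *\<^sub>R (v x - w x)) = 0"
      using assms t test_function_integrable_scaleR[OF t vl] test_function_integrable_scaleR[OF t wl]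
      by (simp add: has_weak_deriv_def scaleR_diff_right)
  qed
  then show ?thesis by eventually_elim simp
qed

lemma has_weak_deriv_weak_deriv: "has_weak_deriv u v \<Longrightarrow> has_weak_deriv u (weak_deriv u)"
  unfolding weak_deriv_def by (rule someI[of "has_weak_deriv u"])

lemma weak_deriv_AE_eq: "has_weak_deriv u v \<Longrightarrow> AE x in lborel. weak_deriv u x = v x"
  using has_weak_deriv_unique[OF has_weak_deriv_weak_deriv] by blast

text \<open>The primitive that vanishes to the left of the support is constant to its right; zero
  mean makes this constant zero.\<close>

lemma test_function_antiderivative:
  assumes t: "test_function \<zeta>" and z: "(LINT x|lborel. \<zeta> x) = 0"
  obtains \<eta> where "test_function \<eta>" "deriv \<eta> = \<zeta>"
proof -
  have s: "smooth \<zeta>" using t by (simp add: test_function_def)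
  obtain R where R: "\<And>x. \<bar>x\<bar> > R \<Longrightarrow> \<zeta> x = 0" using t by (auto simp: test_function_def)
  have c: "continuous_on UNIV (\<lambda>x. complex_of_real (\<zeta> x))"
    by (intro continuous_on_of_real smooth_continuous s)
  obtain X where X: "is_primitive X (\<lambda>x. complex_of_real (\<zeta> x))"
    using is_primitiveI[OF continuous_locally_integrable[OF c]] by blast
  \<comment> \<open>\<open>R\<close> controls only points strictly beyond it; the margin makes
    \<open>\<zeta>\<close> vanish at \<open>r\<close> and \<open>- r\<close> as well.\<close>
  define r where "r = \<bar>R\<bar> + 1"
  define \<eta> where "\<eta> x = Re (X x - X (- r))" for x
  have "((\<lambda>x. X x - X (- r)) has_vector_derivative complex_of_real (\<zeta> x)) (at x)" for x
    using has_vector_derivative_diff[OF is_primitive_imp_has_vector_derivative[OF X c] has_vector_derivative_const] by simp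
  then have d: "(\<eta> has_real_derivative \<zeta> x) (at x)" for x
    unfolding \<eta>_def[abs_def] using bounded_linear.has_vector_derivative[OF bounded_linear_Re, of "\<lambda>x. X x - X (- r)" "complex_of_real (\<zeta> x)" "at x"]
    by (simp add: has_real_derivative_iff_has_vector_derivative)
  have I0: "(LINT x:{a..b}|lborel. complex_of_real (\<zeta> x)) = 0" if "b \<le> -r \<or> r \<le> a" for a b
  proof -
    have "(LINT x:{a..b}|lborel. complex_of_real (\<zeta> x)) = (LINT x:{a..b}|lborel. 0)"
      by (intro set_lebesgue_integral_cong) (use that in \<open>auto simp: r_def intro!: R\<close>)
    then show ?thesis by simp
  qed
  have Ir: "(LINT x:{-r..r}|lborel. complex_of_real (\<zeta> x)) = 0"
  proof -
    have "(LINT x:{-r..r}|lborel. complex_of_real (\<zeta> x)) = (LINT x|lborel. complex_of_real (\<zeta> x))"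
      unfolding set_lebesgue_integral_def
    proof (rule Bochner_Integration.integral_cong)
      fix x
      show "indicator {-r..r} x *\<^sub>R complex_of_real (\<zeta> x) = complex_of_real (\<zeta> x)"
        using R[of x] by (cases "\<bar>x\<bar> \<le> \<bar>R\<bar>") (auto simp: indicator_def r_def)
    qed simp
    then show ?thesis using z by simp
  qed
  have supp: "\<eta> x = 0" if "\<bar>x\<bar> > r" for x
  proof (cases "x < 0")
    case True
    then have "X (- r) - X x = 0" using that is_primitive_integral[OF X, of x "-r"] I0[of "-r" x] by simp
    then show ?thesis by (simp add: \<eta>_def)
  next
    case False
    have "X r - X (- r) = 0" using is_primitive_integral[OF X, of "-r" r] Ir by (simp add: r_def)
    moreover have "X x - X r = 0" using False that is_primitive_integral[OF X, of r x] I0[of x r] by simp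
    ultimately show ?thesis by (simp add: \<eta>_def)
  qed
  have "test_function \<eta>"
    unfolding test_function_def using smooth_primitive[OF d s] supp by blast
  moreover have "deriv \<eta> = \<zeta>" using d by (intro ext DERIV_imp_deriv)
  ultimately show thesis by (rule that)
qed

text \<open>The lemma of du Bois-Reymond. Derivatives of test functions are exactly the test
  functions of mean zero, and any test function acquires mean zero after subtraction of a multiple
  of one fixed bump \<open>\<rho>\<close>.\<close>

lemma weak_deriv_zero_const:
  assumes D: "locally_integrable D" and z: "\<And>\<eta>. test_function \<eta> \<Longrightarrow> (LINT x|lborel. deriv \<eta> x *\<^sub>R D x) = 0"
  shows "\<exists>C. AE x in lborel. D x = C"
proof -
  define \<rho> where "\<rho> = bump 1 0 1"
  have t\<rho>: "test_function \<rho>" unfolding \<rho>_def by (rule test_function_bump) simp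
  have int: "integrable lborel \<psi>" if "test_function \<psi>" for \<psi>
    using test_function_integrable_scaleR[OF that continuous_locally_integrable[of "\<lambda>x. 1"]]
    by (simp add: complex_of_real_integrable_eq scaleR_conv_of_real)
  define I where "I = (LINT x|lborel. \<rho> x)"
  have "I \<noteq> 0"
  proof
    assume "I = 0"
    have nonneg: "0 \<le> \<rho> x" for x by (simp add: \<rho>_def bump_eq)
    have "AE x in lborel. \<rho> x = 0"
      using integral_nonneg_eq_0_iff_AE[OF int[OF t\<rho>]] \<open>I = 0\<close> nonneg by (simp add: I_def)
    then have "AE x in lborel. x \<notin> {0<..<1::real}"
      by eventually_elim (auto simp: \<rho>_def bump_eq)
    then have "{0<..<1::real} \<in> null_sets lborel"
      using AE_iff_null_sets[of "{0<..<1::real}" lborel] by simp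
    then have "emeasure lborel {0<..<1::real} = 0" by (rule null_setsD1)
    then show False by (simp add: emeasure_lborel_Ioo)
  qed
  \<comment> \<open>Testing \<open>D = C\<close> against \<open>\<rho>\<close> leaves no other
    candidate than the weighted mean.\<close>
  define C where "C = (LINT x|lborel. \<rho> x *\<^sub>R D x) / of_real I"
  have "AE x in lborel. D x - C = 0"
  proof (rule fundamental_lemma)
    show "locally_integrable (\<lambda>x. D x - C)"
      by (intro locally_integrable_diff D continuous_locally_integrable continuous_on_const)
    fix \<psi> assume t: "test_function \<psi>"
    define J where "J = (LINT x|lborel. \<psi> x)"
    \<comment> \<open>The multiple of \<open>\<rho>\<close> cancels the mean \<open>J\<close> of
      \<open>\<psi>\<close>.\<close>
    define \<zeta> where "\<zeta> x = \<psi> x + (- (J / I)) * \<rho> x" for x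
    have "test_function \<zeta>" unfolding \<zeta>_def[abs_def] by (intro test_function_add test_function_cmult t t\<rho>)
    moreover have "(LINT x|lborel. \<zeta> x) = 0"
      unfolding \<zeta>_def using int[OF t] int[OF t\<rho>] \<open>I \<noteq> 0\<close> by (simp add: J_def[symmetric] I_def[symmetric])
    ultimately obtain \<eta> where "test_function \<eta>" "deriv \<eta> = \<zeta>" by (rule test_function_antiderivative)
    from z[OF this(1)] this(2) have "(LINT x|lborel. \<zeta> x *\<^sub>R D x) = 0" by simp
    moreover have "(LINT x|lborel. \<zeta> x *\<^sub>R D x) = (LINT x|lborel. \<psi> x *\<^sub>R D x) - (J / I) *\<^sub>R (LINT x|lborel. \<rho> x *\<^sub>R D x)"
    proof -
      have "(LINT x|lborel. \<zeta> x *\<^sub>R D x) = (LINT x|lborel. \<psi> x *\<^sub>R D x - (J / I) *\<^sub>R (\<rho> x *\<^sub>R D x))"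
        unfolding \<zeta>_def by (rule Bochner_Integration.integral_cong) (auto simp: algebra_simps)
      then show ?thesis
        using test_function_integrable_scaleR[OF t D] test_function_integrable_scaleR[OF t\<rho> D]
        by (simp del: scaleR_scaleR)
    qed
    ultimately have e: "(LINT x|lborel. \<psi> x *\<^sub>R D x) = (J / I) *\<^sub>R (LINT x|lborel. \<rho> x *\<^sub>R D x)" by simp
    have "(LINT x|lborel. \<psi> x *\<^sub>R (D x - C)) = (LINT x|lborel. \<psi> x *\<^sub>R D x) - J *\<^sub>R C"
      using test_function_integrable_scaleR[OF t D] int[OF t] by (simp add: scaleR_diff_right J_def)
    also have "\<dots> = 0" unfolding e C_def using \<open>I \<noteq> 0\<close> by (simp add: scaleR_conv_of_real)
    finally show "(LINT x|lborel. \<psi> x *\<^sub>R (D x - C)) = 0" .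
  qed
  then have "AE x in lborel. D x = C" by eventually_elim simp
  then show ?thesis by blast
qed

text \<open>The converse of \<open>is_primitive_has_weak_deriv\<close>: \<open>u\<close> and any
  primitive of \<open>v\<close> have the same weak derivative, so their difference is constant
  almost everywhere.\<close>

lemma has_weak_deriv_primitive:
  assumes w: "has_weak_deriv u v"
  obtains U where "is_primitive U v" "AE x in lborel. u x = U x"
proof -
  have ul: "locally_integrable u" and vl: "locally_integrable v"
    using w by (simp_all add: has_weak_deriv_def)
  obtain F where F: "is_primitive F v" using is_primitiveI[OF vl] by blast
  have Fl: "locally_integrable F" by (intro continuous_locally_integrable is_primitive_continuous[OF F])
  have "\<exists>C. AE x in lborel. u x - F x = C"
  proof (rule weak_deriv_zero_const)
    show "locally_integrable (\<lambda>x. u x - F x)" by (rule locally_integrable_diff[OF ul Fl])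
    fix \<eta> assume t: "test_function \<eta>"
    show "(LINT x|lborel. deriv \<eta> x *\<^sub>R (u x - F x)) = 0"
      using w is_primitive_has_weak_deriv[OF F] t
        test_function_integrable_scaleR[OF test_function_deriv[OF t] ul]
        test_function_integrable_scaleR[OF test_function_deriv[OF t] Fl]
      by (simp add: has_weak_deriv_def scaleR_diff_right)
  qed
  then obtain C where C: "AE x in lborel. u x - F x = C" by blast
  show thesis
  proof (rule that[of "\<lambda>x. F x + C"])
    show "is_primitive (\<lambda>x. F x + C) v" using F by (simp add: is_primitive_def)
    show "AE x in lborel. u x = F x + C" using C by eventually_elim (simp add: algebra_simps)
  qed
qed

subsection \<open>Regular representatives of Sobolev functions\<close>

text \<open>The continuously differentiable representative \<open>U\<close> of an element of
  \<open>H2\<close>, with its classical derivative \<open>V\<close> and its second derivative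
  \<open>W\<close>. The value at the origin, the boundary terms and the Riccati argument all refer
  to it.\<close>

definition H2_rep :: "(real \<Rightarrow> complex) \<Rightarrow> (real \<Rightarrow> complex) \<Rightarrow> (real \<Rightarrow> complex) \<Rightarrow> bool" where
  "H2_rep U V W \<longleftrightarrow> (\<forall>x. (U has_vector_derivative V x) (at x)) \<and> is_primitive V W
     \<and> U \<in> L2 \<and> V \<in> L2 \<and> W \<in> L2"

lemma H2_repD:
  assumes "H2_rep U V W"
  shows "(U has_vector_derivative V x) (at x)" "is_primitive V W" "U \<in> L2" "V \<in> L2" "W \<in> L2"
    "is_primitive U V" "continuous_on UNIV U" "continuous_on UNIV V"
proof -
  show 1: "(U has_vector_derivative V x) (at x)" "is_primitive V W" "U \<in> L2" "V \<in> L2" "W \<in> L2" for x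
    using assms by (auto simp: H2_rep_def)
  show 2: "continuous_on UNIV V" by (rule is_primitive_continuous[OF 1(2)])
  show "is_primitive U V" by (rule C1_is_primitive[OF 1(1) 2])
  then show "continuous_on UNIV U" by (rule is_primitive_continuous)
qed

lemma H2_L2: "u \<in> H2 \<Longrightarrow> u \<in> L2" by (simp add: H2_def)

lemma H2_rep_exists:
  assumes "u \<in> H2"
  obtains U V W where "H2_rep U V W" "AE x in lborel. u x = U x"
proof -
  obtain v w where v: "v \<in> L2" "w \<in> L2" "has_weak_deriv u v" "has_weak_deriv v w" and u: "u \<in> L2"
    using assms by (auto simp: H2_def)
  obtain V where V: "is_primitive V w" "AE x in lborel. v x = V x"
    using has_weak_deriv_primitive[OF v(4)] .
  obtain U where U: "is_primitive U v" "AE x in lborel. u x = U x"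
    using has_weak_deriv_primitive[OF v(3)] .
  have Vc: "continuous_on UNIV V" and Uc: "continuous_on UNIV U"
    using is_primitive_continuous V U by blast+
  have U': "is_primitive U V"
    by (rule is_primitive_cong_AE[OF U(1) borel_measurable_continuous_onI[OF Vc] V(2)])
  have "V \<in> L2" by (rule L2_cong_AE[OF v(1) borel_measurable_continuous_onI[OF Vc]])
      (use V(2) in eventually_elim, simp)
  moreover have "U \<in> L2" by (rule L2_cong_AE[OF u borel_measurable_continuous_onI[OF Uc]])
      (use U(2) in eventually_elim, simp)
  ultimately have "H2_rep U V w"
    unfolding H2_rep_def using is_primitive_imp_has_vector_derivative[OF U' Vc] V(1) v(2) by auto
  then show thesis using U(2) by (rule that)
qed

lemma H2_rep_in_H2:
  assumes "H2_rep U V W" shows "U \<in> H2"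
  using H2_repD(2-6)[OF assms] is_primitive_has_weak_deriv[of U V] is_primitive_has_weak_deriv[of V W]
  by (auto simp: H2_def)

lemma H2_rep_add:
  assumes "H2_rep U V W" "H2_rep U' V' W'"
  shows "H2_rep (\<lambda>x. U x + U' x) (\<lambda>x. V x + V' x) (\<lambda>x. W x + W' x)"
  using H2_repD[OF assms(1)] H2_repD[OF assms(2)]
  by (auto simp: H2_rep_def intro!: L2_add is_primitive_add has_vector_derivative_add)

lemma H2_rep_cmult:
  assumes "H2_rep U V W"
  shows "H2_rep (\<lambda>x. a * U x) (\<lambda>x. a * V x) (\<lambda>x. a * W x)"
  using H2_repD[OF assms]
  by (auto simp: H2_rep_def intro!: L2_cmult is_primitive_cmult has_vector_derivative_mult_right)

text \<open>\<open>weak_deriv\<close> is a choice, so the divergence term can only be identified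
  almost everywhere. Measurability of the chosen function is not automatic; it comes from the local
  integrability built into \<open>has_weak_deriv\<close>.\<close>

lemma weak_deriv_flux:
  assumes r: "H2_rep U V W" and u: "u \<in> borel_measurable borel" "AE x in lborel. u x = U x"
    and p: "\<And>x. (p has_real_derivative p' x) (at x)" "continuous_on UNIV p'"
  shows "AE x in lborel. weak_deriv (\<lambda>y. p y *\<^sub>R weak_deriv u y) x = p x *\<^sub>R W x + p' x *\<^sub>R V x"
    and "weak_deriv (\<lambda>y. p y *\<^sub>R weak_deriv u y) \<in> borel_measurable borel"
proof -
  note R = H2_repD[OF r]
  have pc: "continuous_on UNIV p" using p(1) by (meson DERIV_continuous continuous_at_imp_continuous_on)
  have [measurable]: "p \<in> borel_measurable borel" by (rule borel_measurable_continuous_onI[OF pc])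
  have "has_weak_deriv u V"
    by (rule has_weak_deriv_cong[OF is_primitive_has_weak_deriv[OF R(6)] u(1)])
      (use u(2) in eventually_elim, simp)
  then have wu: "has_weak_deriv u (weak_deriv u)" and eq: "AE x in lborel. weak_deriv u x = V x"
    by (auto intro: has_weak_deriv_weak_deriv weak_deriv_AE_eq)
  have [measurable]: "weak_deriv u \<in> borel_measurable borel"
    using wu by (intro locally_integrable_measurable) (simp add: has_weak_deriv_def)
  have "is_primitive (\<lambda>x. V x * complex_of_real (p x)) (\<lambda>x. W x * complex_of_real (p x) + V x * complex_of_real (p' x))"
    by (rule is_primitive_mult_C1[OF R(2)])
      (auto intro!: has_vector_derivative_of_real p continuous_on_of_real)
  then have "has_weak_deriv (\<lambda>x. p x *\<^sub>R V x) (\<lambda>x. p x *\<^sub>R W x + p' x *\<^sub>R V x)"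
    by (intro is_primitive_has_weak_deriv) (simp add: scaleR_conv_of_real mult.commute)
  then have fl: "has_weak_deriv (\<lambda>y. p y *\<^sub>R weak_deriv u y) (\<lambda>x. p x *\<^sub>R W x + p' x *\<^sub>R V x)"
  proof (rule has_weak_deriv_cong)
    show "AE x in lborel. p x *\<^sub>R V x = p x *\<^sub>R weak_deriv u x"
      using eq by eventually_elim simp
  qed measurable
  then show "AE x in lborel. weak_deriv (\<lambda>y. p y *\<^sub>R weak_deriv u y) x = p x *\<^sub>R W x + p' x *\<^sub>R V x"
    by (rule weak_deriv_AE_eq)
  show "weak_deriv (\<lambda>y. p y *\<^sub>R weak_deriv u y) \<in> borel_measurable borel"
    using has_weak_deriv_weak_deriv[OF fl] by (intro locally_integrable_measurable) (simp add: has_weak_deriv_def)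
qed

subsection \<open>The method of continuity\<close>

text \<open>\<open>Rel\<close> is the graph of an invertible operator; a relation suits solutions
  that are determined only up to null sets. Each right-hand side is \<open>- h Q\<close> applied to
  the solution for the preceding one, so \<open>h C K \<le> 1 / 2\<close> halves the norms. The
  right-hand sides are summed, not the solutions, and the equation is solved once for the sum
  \<open>G\<close>: in this way no closedness of the graph is needed.\<close>

lemma Neumann_step:
  fixes Rel :: "(real \<Rightarrow> complex) \<Rightarrow> (real \<Rightarrow> complex) \<Rightarrow> bool"
  assumes add: "\<And>u g v h. Rel u g \<Longrightarrow> Rel v h \<Longrightarrow> Rel (\<lambda>x. u x + v x) (\<lambda>x. g x + h x)"
    and neg: "\<And>u g. Rel u g \<Longrightarrow> Rel (\<lambda>x. - u x) (\<lambda>x. - g x)"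
    and zero: "Rel (\<lambda>x. 0) (\<lambda>x. 0)"
    and L2: "\<And>u g. Rel u g \<Longrightarrow> u \<in> L2 \<and> g \<in> L2"
    and AE: "\<And>u g h. Rel u g \<Longrightarrow> h \<in> L2 \<Longrightarrow> AE x in lborel. g x = h x \<Longrightarrow> Rel u h"
    and bound: "\<And>u g. Rel u g \<Longrightarrow> L2_norm u \<le> C * L2_norm g"
    and surj: "\<And>g. g \<in> L2 \<Longrightarrow> \<exists>u. Rel u g"
    and Q: "\<And>u. u \<in> L2 \<Longrightarrow> Q u \<in> L2" "\<And>u. u \<in> L2 \<Longrightarrow> L2_norm (Q u) \<le> K * L2_norm u"
    and Qadd: "\<And>u v x. u \<in> L2 \<Longrightarrow> v \<in> L2 \<Longrightarrow> Q (\<lambda>x. u x + v x) x = Q u x + Q v x"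
    and C: "0 \<le> C" and K: "0 \<le> K" and h: "0 \<le> h" "h * C * K \<le> 1 / 2"
    and g: "g \<in> L2"
  shows "\<exists>u. Rel u (\<lambda>x. g x - of_real h * Q u x)"
proof -
  obtain sol where sol: "\<And>g. g \<in> L2 \<Longrightarrow> Rel (sol g) g" using surj by metis
  define gs where "gs = rec_nat g (\<lambda>_ k x. - of_real h * Q (sol k) x)"
  have gs0: "gs 0 = g" and gsS: "gs (Suc n) = (\<lambda>x. - of_real h * Q (sol (gs n)) x)" for n
    by (simp_all add: gs_def)
  have gsL: "gs n \<in> L2" for n
  proof (induction n)
    case (Suc n)
    then show ?case unfolding gsS using sol L2 Q(1) by (intro L2_cmult) blast
  qed (simp add: gs0 g)
  define us where "us n = sol (gs n)" for n
  have us: "Rel (us n) (gs n)" "us n \<in> L2" for n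
    using sol[OF gsL[of n]] L2 by (auto simp: us_def)
  have half: "L2_norm (gs (Suc n)) \<le> 1 / 2 * L2_norm (gs n)" for n
  proof -
    have "L2_norm (gs (Suc n)) = h * L2_norm (Q (us n))"
      using h(1) by (simp only: gsS us_def[symmetric] L2_norm_cmult) simp
    also have "\<dots> \<le> h * (K * L2_norm (us n))" by (intro mult_left_mono Q us h)
    also have "\<dots> \<le> h * (K * (C * L2_norm (gs n)))" by (intro mult_left_mono bound us h K)
    also have "\<dots> = (h * C * K) * L2_norm (gs n)" by simp
    also have "\<dots> \<le> 1 / 2 * L2_norm (gs n)" by (intro mult_right_mono h) simp
    finally show ?thesis .
  qed
  have geo: "L2_norm (gs n) \<le> L2_norm g * (1 / 2) ^ n" for n
  proof (induction n)
    case (Suc n)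
    have "L2_norm (gs (Suc n)) \<le> 1 / 2 * L2_norm (gs n)" by (rule half)
    also have "\<dots> \<le> 1 / 2 * (L2_norm g * (1 / 2) ^ n)" by (intro mult_left_mono Suc) simp
    finally show ?case by simp
  qed (simp add: gs0)
  obtain G where G: "G \<in> L2" and lim: "(\<lambda>N. L2_norm (\<lambda>x. G x - (\<Sum>n<N. gs n x))) \<longlonglongrightarrow> 0"
    using L2_geometric_series_converges[OF gsL geo] .
  define u where "u = sol G"
  have u: "Rel u G" "u \<in> L2" using sol[OF G] L2 by (auto simp: u_def)
  have sums: "Rel (\<lambda>x. \<Sum>n<N. us n x) (\<lambda>x. \<Sum>n<N. gs n x)" for N
    by (induction N) (auto simp: zero intro: add us)
  have Q0: "Q (\<lambda>x. 0) x = 0" for x using Qadd[OF L2_zero L2_zero, of x] by simp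
  have Qneg: "Q (\<lambda>x. - v x) x = - Q v x" if "v \<in> L2" for v x
    using Qadd[OF that L2_uminus[OF that], of x] Q0[of x] by (simp add: add_eq_0_iff)
  have Qsum: "Q (\<lambda>x. \<Sum>n<N. us n x) x = (\<Sum>n<N. Q (us n) x)" for N x
    by (induction N) (auto simp: Q0 Qadd[OF L2_sum us(2)] us)
  \<comment> \<open>\<open>sol\<close> is a mere choice and need not be linear. The remainder is
    controlled through \<open>Rel\<close> and the a priori bound instead.\<close>
  have rest: "Rel (\<lambda>x. u x + - (\<Sum>n<N. us n x)) (\<lambda>x. G x + - (\<Sum>n<N. gs n x))" for N
    by (intro add neg u sums)
  let ?d = "\<lambda>N. L2_norm (\<lambda>x. G x - (\<Sum>n<N. gs n x))"
  have est: "L2_norm (\<lambda>x. G x - g x + of_real h * Q u x) \<le> ?d (Suc N) + h * (K * (C * ?d N))" for N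
  proof -
    let ?r = "\<lambda>x. u x + - (\<Sum>n<N. us n x)"
    have rL: "?r \<in> L2" using rest L2 by blast
    have q: "Q ?r x = Q u x - (\<Sum>n<N. Q (us n) x)" for x
      using Qadd[OF u(2) L2_uminus[OF L2_sum[of "{..<N}" us]]] Qneg[OF L2_sum[of "{..<N}" us]] us(2)
      by (simp add: Qsum)
    \<comment> \<open>The index is shifted by one: the correction by the first \<open>N\<close>
      solutions is the partial sum with \<open>Suc N\<close> terms.\<close>
    have g: "(\<Sum>n<Suc N. gs n x) = g x - of_real h * (\<Sum>n<N. Q (us n) x)" for x
      by (simp only: sum.lessThan_Suc_shift gs0 gsS us_def sum_distrib_left) (simp add: sum_negf)
    have e: "G x - g x + of_real h * Q u x = (G x - (\<Sum>n<Suc N. gs n x)) + of_real h * Q ?r x" for x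
      unfolding q g by (simp add: algebra_simps)
    have "L2_norm (\<lambda>x. (G x - (\<Sum>n<Suc N. gs n x)) + of_real h * Q ?r x)
        \<le> ?d (Suc N) + L2_norm (\<lambda>x. of_real h * Q ?r x)"
      by (intro L2_norm_triangle L2_diff G L2_sum gsL L2_cmult Q rL)
    also have "L2_norm (\<lambda>x. of_real h * Q ?r x) = h * L2_norm (Q ?r)"
      using h(1) by (simp only: L2_norm_cmult) simp
    also have "\<dots> \<le> h * (K * L2_norm ?r)" by (intro mult_left_mono Q rL h)
    also have "\<dots> \<le> h * (K * (C * ?d N))"
      using bound[OF rest[of N]] by (intro mult_left_mono h K) simp
    finally show ?thesis unfolding e by simp
  qed
  have "(\<lambda>N. ?d (Suc N) + h * (K * (C * ?d N))) \<longlonglongrightarrow> 0 + h * (K * (C * 0))"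
    by (intro tendsto_add tendsto_mult tendsto_const lim LIMSEQ_Suc[OF lim])
  then have "L2_norm (\<lambda>x. G x - g x + of_real h * Q u x) \<le> 0"
    by (intro LIMSEQ_le_const[of "\<lambda>N. ?d (Suc N) + h * (K * (C * ?d N))" 0]) (use est in auto)
  then have "L2_norm (\<lambda>x. G x - g x + of_real h * Q u x) = 0"
    using L2_norm_nonneg[of "\<lambda>x. G x - g x + of_real h * Q u x"] by linarith
  then have "AE x in lborel. G x - g x + of_real h * Q u x = 0"
    by (subst (asm) L2_norm_eq_0_iff) (intro L2_add L2_diff G g L2_cmult Q u)
  then have "AE x in lborel. G x = g x - of_real h * Q u x"
    by eventually_elim (simp add: algebra_simps eq_neg_iff_add_eq_0)
  then have "Rel u (\<lambda>x. g x - of_real h * Q u x)"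
    by (intro AE[OF u(1)] L2_diff g L2_cmult Q u)
  then show ?thesis by blast
qed

text \<open>The a priori bound \<open>C\<close> is uniform in \<open>t\<close>, so one step length
  \<open>h\<close> serves along the whole path, and finitely many Neumann steps lead from the base
  operator to the target.\<close>

lemma method_of_continuity:
  fixes Rel :: "(real \<Rightarrow> complex) \<Rightarrow> (real \<Rightarrow> complex) \<Rightarrow> bool"
  assumes add: "\<And>u g v h. Rel u g \<Longrightarrow> Rel v h \<Longrightarrow> Rel (\<lambda>x. u x + v x) (\<lambda>x. g x + h x)"
    and neg: "\<And>u g. Rel u g \<Longrightarrow> Rel (\<lambda>x. - u x) (\<lambda>x. - g x)"
    and zero: "Rel (\<lambda>x. 0) (\<lambda>x. 0)"
    and L2: "\<And>u g. Rel u g \<Longrightarrow> u \<in> L2 \<and> g \<in> L2"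
    and AE: "\<And>u g h. Rel u g \<Longrightarrow> h \<in> L2 \<Longrightarrow> AE x in lborel. g x = h x \<Longrightarrow> Rel u h"
    and bound: "\<And>t u g. 0 \<le> t \<Longrightarrow> t \<le> 1 \<Longrightarrow> g \<in> L2 \<Longrightarrow> Rel u (\<lambda>x. g x - of_real t * Q u x) \<Longrightarrow> L2_norm u \<le> C * L2_norm g"
    and surj: "\<And>g. g \<in> L2 \<Longrightarrow> \<exists>u. Rel u g"
    and Q: "\<And>u. u \<in> L2 \<Longrightarrow> Q u \<in> L2" "\<And>u. u \<in> L2 \<Longrightarrow> L2_norm (Q u) \<le> K * L2_norm u"
    and Qadd: "\<And>u v x. u \<in> L2 \<Longrightarrow> v \<in> L2 \<Longrightarrow> Q (\<lambda>x. u x + v x) x = Q u x + Q v x"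
    and C: "0 \<le> C" and K: "0 \<le> K" and g: "g \<in> L2"
  shows "\<exists>u. Rel u (\<lambda>x. g x - Q u x)"
proof -
  \<comment> \<open>This yields \<open>h C K \<le> 1 / 2\<close>; the summand 1 keeps
    \<open>N\<close> positive even when \<open>C K = 0\<close>.\<close>
  obtain N :: nat where N: "2 * C * K + 1 \<le> real N" using real_arch_simple by blast
  have N0: "real N > 0" using N C K by (smt (verit) mult_nonneg_nonneg)
  define h where "h = 1 / real N"
  have h: "0 \<le> h" "h * C * K \<le> 1 / 2" using N0 N by (auto simp: h_def field_simps)
  have Q0: "Q (\<lambda>x. 0) x = 0" for x using Qadd[OF L2_zero L2_zero, of x] by simp
  have Qneg: "Q (\<lambda>x. - v x) x = - Q v x" if "v \<in> L2" for v x
    using Qadd[OF that L2_uminus[OF that], of x] Q0[of x] by (simp add: add_eq_0_iff)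
  have "n \<le> N \<Longrightarrow> g \<in> L2 \<Longrightarrow> \<exists>u. Rel u (\<lambda>x. g x - of_real (n * h) * Q u x)" for n g
  proof (induction n arbitrary: g)
    case 0
    then show ?case using surj by simp
  next
    case (Suc n)
    define t where "t = real n * h"
    have t: "0 \<le> t" "t \<le> 1" using Suc.prems N0 by (auto simp: t_def h_def field_simps)
    \<comment> \<open>The graph of the base operator plus \<open>t Q\<close>. Its surjectivity is
      the induction hypothesis, and its bound is the a priori estimate at \<open>t\<close>.\<close>
    define Rel' where "Rel' u g \<longleftrightarrow> g \<in> L2 \<and> Rel u (\<lambda>x. g x - of_real t * Q u x)" for u g
    have "\<exists>u. Rel' u (\<lambda>x. g x - of_real h * Q u x)"
    proof (rule Neumann_step[where C = C and K = K])
      fix u v g h assume uv: "Rel' u g" "Rel' v h"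
      then have "Rel (\<lambda>x. u x + v x) (\<lambda>x. (g x - of_real t * Q u x) + (h x - of_real t * Q v x))"
        unfolding Rel'_def by (intro add) auto
      moreover have "u \<in> L2" "v \<in> L2" using uv L2 by (auto simp: Rel'_def)
      ultimately show "Rel' (\<lambda>x. u x + v x) (\<lambda>x. g x + h x)"
        using uv by (simp add: Rel'_def L2_add Qadd algebra_simps)
    next
      fix u g assume u: "Rel' u g"
      then have "Rel (\<lambda>x. - u x) (\<lambda>x. - (g x - of_real t * Q u x))"
        unfolding Rel'_def by (intro neg) auto
      moreover have "u \<in> L2" using u L2 by (auto simp: Rel'_def)
      ultimately show "Rel' (\<lambda>x. - u x) (\<lambda>x. - g x)"
        using u by (simp add: Rel'_def L2_uminus Qneg)
    next
      show "Rel' (\<lambda>x. 0) (\<lambda>x. 0)" using zero by (simp add: Rel'_def Q0 L2_zero)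
      show "u \<in> L2 \<and> g \<in> L2" if "Rel' u g" for u g using that L2 by (auto simp: Rel'_def)
      show "Rel' u h" if u: "Rel' u g" and h: "h \<in> L2" "AE x in lborel. g x = h x" for u g h
      proof -
        have "u \<in> L2" using u L2 by (auto simp: Rel'_def)
        then have "(\<lambda>x. h x - of_real t * Q u x) \<in> L2" by (intro L2_diff L2_cmult Q h)
        moreover have "AE x in lborel. g x - of_real t * Q u x = h x - of_real t * Q u x"
          using h(2) by eventually_elim simp
        ultimately show ?thesis using u h(1) AE by (auto simp: Rel'_def)
      qed
      show "L2_norm u \<le> C * L2_norm g" if "Rel' u g" for u g
        using that bound[OF t] by (auto simp: Rel'_def)
      show "\<exists>u. Rel' u g" if "g \<in> L2" for g
        using Suc.IH[of g] Suc.prems that by (auto simp: Rel'_def t_def)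
    qed (use Q Qadd C K h Suc.prems in auto)
    then obtain u where u: "Rel' u (\<lambda>x. g x - of_real h * Q u x)" by blast
    have "(\<lambda>x. g x - of_real h * Q u x - of_real t * Q u x) = (\<lambda>x. g x - of_real (real (Suc n) * h) * Q u x)"
      by (rule ext) (simp add: t_def algebra_simps)
    then show ?case using u by (auto simp: Rel'_def)
  qed
  from this[OF order_refl g] show ?thesis using N0 by (simp add: h_def)
qed

subsection \<open>First-order equations\<close>

lemma L2_reflect:
  assumes "u \<in> L2" shows "(\<lambda>x. u (- x)) \<in> L2"
  using assms lborel_integrable_real_affine[of "\<lambda>x. (norm (u x))\<^sup>2" "-1" 0]
  by (auto simp: L2_def)

lemma is_primitive_reflect:
  assumes F: "is_primitive F f"
  shows "is_primitive (\<lambda>x. F (- x)) (\<lambda>x. - f (- x))"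
proof -
  have r: "set_integrable lborel {a..b} (\<lambda>x. f (- x))" 
    and e: "(LINT x:{a..b}|lborel. f (- x)) = (LINT x:{-b..-a}|lborel. f x)" for a b
  proof -
    have i: "indicator {-b..-a} (- x) = (indicator {a..b} x :: real)" for x by (auto simp: indicator_def)
    have "integrable lborel (\<lambda>x. indicator {-b..-a} x *\<^sub>R f x)"
      using locally_integrableD[OF is_primitive_locally_integrable[OF F]] by (simp add: set_integrable_def)
    from lborel_integrable_real_affine[OF this, of "-1" 0]
    show "set_integrable lborel {a..b} (\<lambda>x. f (- x))" by (simp add: set_integrable_def i)
    show "(LINT x:{a..b}|lborel. f (- x)) = (LINT x:{-b..-a}|lborel. f x)"
      using lborel_integral_real_affine[of "-1" "\<lambda>x. indicator {-b..-a} x *\<^sub>R f x" 0]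
      by (simp add: set_lebesgue_integral_def i)
  qed
  show ?thesis
    unfolding is_primitive_def locally_integrable_def
  proof (intro conjI allI impI)
    show s: "set_integrable lborel {a..b} (\<lambda>x. - f (- x))" for a b
      using set_integrable_mult_right[of "-1" lborel, OF r[of a b]] by simp
    fix a b :: real assume "a \<le> b"
    then show "F (- b) - F (- a) = (LINT x:{a..b}|lborel. - f (- x))"
      using is_primitive_integral[OF F, of "-b" "-a"] r[of a b] by (simp add: set_integral_uminus e)
  qed
qed

text \<open>The equation \<open>y' + a y = h\<close>, solved by variation of constants from minus
  infinity. With \<open>\<theta>' = a \<ge> m\<close> the kernel
  \<open>exp (\<theta> t - \<theta> x)\<close> lies below \<open>exp (- m (x - t))\<close> for
  \<open>t \<le> x\<close>, so the solution inherits square-integrability from the exponential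
  convolution.\<close>

lemma first_order_solution:
  fixes a :: "real \<Rightarrow> real"
  assumes ac: "continuous_on UNIV a" and am: "\<And>x. m \<le> a x" and m: "m > 0" and h: "h \<in> L2"
  obtains y where "y \<in> L2" "is_primitive y (\<lambda>x. h x - of_real (a x) * y x)"
proof -
  obtain A where A: "is_primitive A (\<lambda>x. complex_of_real (a x))"
    using is_primitiveI[OF continuous_locally_integrable[OF continuous_on_of_real[OF ac]]] by blast
  define \<theta> where "\<theta> x = Re (A x)" for x
  have d: "(\<theta> has_real_derivative a x) (at x)" for x
    unfolding \<theta>_def[abs_def]
    using bounded_linear.has_vector_derivative[OF bounded_linear_Re
        is_primitive_imp_has_vector_derivative[OF A continuous_on_of_real[OF ac], of x]]
    by (simp add: has_real_derivative_iff_has_vector_derivative)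
  have \<theta>c: "continuous_on UNIV \<theta>" using d by (meson DERIV_continuous continuous_at_imp_continuous_on)
  have mono: "m * (x - t) \<le> \<theta> x - \<theta> t" if "t \<le> x" for x t
  proof -
    have "\<theta> t - m * t \<le> \<theta> x - m * x"
      by (rule DERIV_nonneg_imp_nondecreasing[OF that])
        (use am in \<open>auto intro!: derivative_eq_intros d exI[of _ "a z - m" for z]\<close>)
    then show ?thesis by (simp add: algebra_simps)
  qed
  have [measurable]: "h \<in> borel_measurable borel" "\<theta> \<in> borel_measurable borel"
    using L2_measurable[OF h] borel_measurable_continuous_onI[OF \<theta>c] by auto
  define k where "k t = complex_of_real (exp (\<theta> t)) * h t" for t
  have km [measurable]: "k \<in> borel_measurable borel" unfolding k_def by measurable
  have nk: "norm (k t) \<le> exp (\<theta> x) * (exp (- m * \<bar>x - t\<bar>) * norm (h t))" if "t \<le> x" for t x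
  proof -
    have "exp (\<theta> t) \<le> exp (\<theta> x + - m * \<bar>x - t\<bar>)" using mono[OF that] that by simp
    then have "exp (\<theta> t) * norm (h t) \<le> exp (\<theta> x + - m * \<bar>x - t\<bar>) * norm (h t)" by (rule mult_right_mono) simp
    then show ?thesis by (simp only: k_def norm_mult exp_add mult.assoc norm_of_real abs_exp_cancel)
  qed
  have ki: "set_integrable lborel {..x} k" for x
    unfolding set_integrable_def
  proof (rule Bochner_Integration.integrable_bound)
    show "integrable lborel (\<lambda>t. exp (\<theta> x) * (exp (- m * \<bar>x - t\<bar>) * norm (h t)))"
      by (intro integrable_mult_right exp_kernel_integrable_mult m h)
    show "AE t in lborel. norm (indicator {..x} t *\<^sub>R k t) \<le> norm (exp (\<theta> x) * (exp (- m * \<bar>x - t\<bar>) * norm (h t)))"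
      using nk[of _ x] by (auto simp: indicator_def)
  qed simp
  define \<Phi> where "\<Phi> x = (LINT t:{..x}|lborel. k t)" for x
  have \<Phi>: "is_primitive \<Phi> k"
    unfolding is_primitive_def locally_integrable_def
  proof (intro conjI allI impI)
    show kk: "set_integrable lborel {s..t} k" for s t
      by (rule set_integrable_subset[OF ki[of t]]) auto
    fix s t :: real assume st: "s \<le> t"
    have "(LINT x:{..s} \<union> {s..t}|lborel. k x) = (LINT x:{..s}|lborel. k x) + (LINT x:{s..t}|lborel. k x)"
    proof (rule set_integral_Un_AE)
      show "AE x in lborel. \<not> (x \<in> {..s} \<and> x \<in> {s..t})"
        using AE_lborel_singleton[of s] by eventually_elim auto
    qed (use ki kk in auto)
    moreover have "{..s} \<union> {s..t} = {..t}" using st by auto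
    ultimately show "\<Phi> t - \<Phi> s = (LINT x:{s..t}|lborel. k x)" by (simp add: \<Phi>_def)
  qed
  define y where "y x = \<Phi> x * complex_of_real (exp (- \<theta> x))" for x
  have "is_primitive y (\<lambda>x. k x * complex_of_real (exp (- \<theta> x)) + \<Phi> x * complex_of_real (- (exp (- \<theta> x) * a x)))"
    unfolding y_def[abs_def]
  proof (rule is_primitive_mult_C1[OF \<Phi>])
    show "((\<lambda>x. complex_of_real (exp (- \<theta> x))) has_vector_derivative complex_of_real (- (exp (- \<theta> x) * a x))) (at x)" for x
      by (intro has_vector_derivative_of_real) (auto intro!: derivative_eq_intros d)
    show "continuous_on UNIV (\<lambda>x. complex_of_real (- (exp (- \<theta> x) * a x)))"
      by (intro continuous_intros \<theta>c ac)
  qed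
  moreover have "k x * complex_of_real (exp (- \<theta> x)) + \<Phi> x * complex_of_real (- (exp (- \<theta> x) * a x))
      = h x - of_real (a x) * y x" for x
    by (simp add: k_def y_def exp_minus)
  ultimately have y: "is_primitive y (\<lambda>x. h x - of_real (a x) * y x)" by simp
  have "norm (y x) \<le> (LINT t|lborel. exp (- m * \<bar>x - t\<bar>) * norm (h t))" for x
  proof -
    have "norm (\<Phi> x) \<le> (LINT t:{..x}|lborel. norm (k t))"
      unfolding \<Phi>_def by (rule set_integral_norm_bound[OF ki])
    also have "\<dots> \<le> (LINT t|lborel. exp (\<theta> x) * (exp (- m * \<bar>x - t\<bar>) * norm (h t)))"
      unfolding set_lebesgue_integral_def
    proof (rule integral_mono)
      show "integrable lborel (\<lambda>t. indicator {..x} t *\<^sub>R norm (k t))"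
        using set_integrable_norm[OF ki] by (simp add: set_integrable_def)
      show "integrable lborel (\<lambda>t. exp (\<theta> x) * (exp (- m * \<bar>x - t\<bar>) * norm (h t)))"
        by (intro integrable_mult_right exp_kernel_integrable_mult m h)
    qed (use nk[of _ x] in \<open>auto simp: indicator_def\<close>)
    also have "\<dots> = exp (\<theta> x) * (LINT t|lborel. exp (- m * \<bar>x - t\<bar>) * norm (h t))"
      by (rule integral_mult_right_zero)
    finally have *: "norm (\<Phi> x) \<le> exp (\<theta> x) * (LINT t|lborel. exp (- m * \<bar>x - t\<bar>) * norm (h t))" .
    have "norm (y x) = norm (\<Phi> x) * exp (- \<theta> x)" by (simp add: y_def norm_mult)
    also have "\<dots> \<le> exp (\<theta> x) * (LINT t|lborel. exp (- m * \<bar>x - t\<bar>) * norm (h t)) * exp (- \<theta> x)"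
      using * by (rule mult_right_mono) simp
    also have "\<dots> = (LINT t|lborel. exp (- m * \<bar>x - t\<bar>) * norm (h t))"
      by (simp add: exp_minus)
    finally show ?thesis .
  qed
  then have "y \<in> L2"
    by (intro L2_bound[OF borel_measurable_continuous_onI[OF is_primitive_continuous[OF y]] exp_kernel_L2(1)[OF m h], of 1])
      (auto simp: integral_nonneg_AE)
  then show thesis using y by (rule that)
qed

text \<open>Here homogeneous solutions grow to the right, so the integration would start at plus
  infinity; the reflection of the line reduces this to the preceding case.\<close>

lemma first_order_adjoint_solution:
  fixes a :: "real \<Rightarrow> real"
  assumes ac: "continuous_on UNIV a" and am: "\<And>x. m \<le> a x" and m: "m > 0" and h: "h \<in> L2"
  obtains y where "y \<in> L2" "is_primitive y (\<lambda>x. of_real (a x) * y x - h x)"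
proof -
  have ac': "continuous_on UNIV (\<lambda>x. a (- x))"
    by (rule continuous_on_compose2[OF ac]) (auto intro: continuous_intros)
  obtain y where y: "y \<in> L2" "is_primitive y (\<lambda>x. h (- x) - of_real (a (- x)) * y x)"
    using first_order_solution[OF ac' _ m L2_reflect[OF h]] am by blast
  show thesis
    by (rule that[OF L2_reflect[OF y(1)]]) (use is_primitive_reflect[OF y(2)] in simp)
qed

subsection \<open>Resolvents of perturbed Sturm--Liouville operators\<close>

text \<open>A uniformly elliptic principal part \<open>- \<partial> P \<partial>\<close> on the
  line. The bound on \<open>P'\<close> ensures that the divergence term of an \<open>H2\<close>
  function is square-integrable.\<close>

locale leading_coefficient =
  fixes P P' :: "real \<Rightarrow> real" and pl pu b :: real
  assumes P_deriv: "\<And>x. (P has_real_derivative P' x) (at x)"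
    and P'_cont: "continuous_on UNIV P'"
    and pl_pos: "0 < pl" and P_lower: "\<And>x. pl \<le> P x" and P_upper: "\<And>x. P x \<le> pu"
    and P'_bound: "\<And>x. \<bar>P' x\<bar> \<le> b"
begin

lemma P_pos: "0 < P x"
  using pl_pos P_lower[of x] by linarith

lemma P_nz: "P x \<noteq> 0"
  using P_pos[of x] by simp

lemma P_cont: "continuous_on UNIV P"
  using P_deriv by (meson DERIV_continuous continuous_at_imp_continuous_on)

lemma P_measurable [measurable]: "P \<in> borel_measurable borel" "P' \<in> borel_measurable borel"
  using P_cont P'_cont by (auto intro: borel_measurable_continuous_onI)

lemma P_abs_bound: "\<bar>P x\<bar> \<le> pu"
  using P_pos[of x] P_upper[of x] by simp

text \<open>The almost-everywhere derivative of the flux \<open>P V\<close> when \<open>W\<close> is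
  that of \<open>V\<close>.\<close>

definition flux_deriv :: "(real \<Rightarrow> complex) \<Rightarrow> (real \<Rightarrow> complex) \<Rightarrow> real \<Rightarrow> complex" where
  "flux_deriv V W x = P x *\<^sub>R W x + P' x *\<^sub>R V x"

lemma flux_primitive:
  assumes "is_primitive V W"
  shows "is_primitive (\<lambda>x. P x *\<^sub>R V x) (flux_deriv V W)"
proof -
  have "is_primitive (\<lambda>x. V x * complex_of_real (P x)) (\<lambda>x. W x * complex_of_real (P x) + V x * complex_of_real (P' x))"
    by (rule is_primitive_mult_C1[OF assms])
      (auto intro!: has_vector_derivative_of_real P_deriv continuous_on_of_real P'_cont)
  then show ?thesis by (simp add: flux_deriv_def[abs_def] scaleR_conv_of_real mult.commute)
qed

lemma flux_deriv_L2: "V \<in> L2 \<Longrightarrow> W \<in> L2 \<Longrightarrow> flux_deriv V W \<in> L2"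
  unfolding flux_deriv_def[abs_def]
  by (intro L2_add L2_scaleR_bounded[where C = pu] L2_scaleR_bounded[where C = b] P_abs_bound P'_bound P_measurable)

text \<open>Integration by parts over the line; the flux and \<open>U'\<close> both vanish at
  infinity, being primitives that are square-integrable together with their derivatives.\<close>

lemma form_identity:
  assumes r: "H2_rep U V W" and r': "H2_rep U' V' W'"
  shows "(LINT x|lborel. flux_deriv V W x * cnj (U' x)) = - (LINT x|lborel. P x *\<^sub>R (V x * cnj (V' x)))"
proof -
  note R = H2_repD[OF r] and R' = H2_repD[OF r']
  have p: "is_primitive (\<lambda>x. P x *\<^sub>R V x * cnj (U' x))
      (\<lambda>x. flux_deriv V W x * cnj (U' x) + P x *\<^sub>R V x * cnj (V' x))"
  proof (rule is_primitive_mult_C1[OF flux_primitive[OF R(2)]])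
    show "((\<lambda>x. cnj (U' x)) has_vector_derivative cnj (V' x)) (at x)" for x
      using bounded_linear.has_vector_derivative[OF bounded_linear_cnj R'(1)] .
    show "continuous_on UNIV (\<lambda>x. cnj (V' x))" by (intro continuous_intros R')
  qed
  have PV: "(\<lambda>x. P x *\<^sub>R V x) \<in> L2" by (rule L2_scaleR_bounded[OF R(4) _ P_abs_bound]) simp
  have i1: "integrable lborel (\<lambda>x. flux_deriv V W x * cnj (U' x))"
    by (intro L2_integrable_mult_cnj flux_deriv_L2 R R')
  have i2: "integrable lborel (\<lambda>x. P x *\<^sub>R V x * cnj (V' x))"
    by (intro L2_integrable_mult_cnj PV R')
  have lim: "(\<lambda>n. P (X n) *\<^sub>R V (X n) * cnj (U' (X n))) \<longlonglongrightarrow> 0"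
    if X: "filterlim (\<lambda>n::nat. \<bar>X n\<bar>) at_top sequentially" for X
  proof -
    have "(\<lambda>n. P (X n) *\<^sub>R V (X n)) \<longlonglongrightarrow> 0"
      by (rule L2_primitive_tendsto_0[OF flux_primitive[OF R(2)] PV flux_deriv_L2[OF R(4,5)] X])
    moreover have "(\<lambda>n. U' (X n)) \<longlonglongrightarrow> 0"
      by (rule L2_primitive_tendsto_0[OF R'(6) R'(3,4) X])
    ultimately have "(\<lambda>n. P (X n) *\<^sub>R V (X n) * cnj (U' (X n))) \<longlonglongrightarrow> 0 * cnj 0"
      by (intro tendsto_mult tendsto_cnj)
    then show ?thesis by simp
  qed
  have "filterlim (\<lambda>n. \<bar>real n\<bar>) at_top sequentially" "filterlim (\<lambda>n. \<bar>- real n\<bar>) at_top sequentially"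
    using filterlim_real_sequentially by simp_all
  note l = lim[OF this(1)] lim[OF this(2)]
  have "(LINT x|lborel. flux_deriv V W x * cnj (U' x) + P x *\<^sub>R V x * cnj (V' x)) = 0"
    by (rule is_primitive_integral_UNIV_zero[OF p _ l]) (intro Bochner_Integration.integrable_add i1 i2)
  then have "(LINT x|lborel. flux_deriv V W x * cnj (U' x)) = - (LINT x|lborel. P x *\<^sub>R V x * cnj (V' x))"
    using i1 i2 by (simp add: eq_neg_iff_add_eq_0)
  then show ?thesis by simp
qed

lemma form_integrable:
  assumes r: "H2_rep u V W" and q: "continuous_on UNIV q" "\<And>x. \<bar>q x\<bar> \<le> M"
  shows "integrable lborel (\<lambda>x. P x * (norm (V x))\<^sup>2 + q x * (norm (u x))\<^sup>2)"
    "continuous_on UNIV (\<lambda>x. P x * (norm (V x))\<^sup>2 + q x * (norm (u x))\<^sup>2)"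
    "integrable lborel (\<lambda>x. P x * (norm (V x))\<^sup>2)" "integrable lborel (\<lambda>x. q x * (norm (u x))\<^sup>2)"
proof -
  note R = H2_repD[OF r]
  have [measurable]: "q \<in> borel_measurable borel" by (rule borel_measurable_continuous_onI[OF q(1)])
  show 1: "integrable lborel (\<lambda>x. P x * (norm (V x))\<^sup>2)"
    by (rule Bochner_Integration.integrable_bound[OF integrable_mult_right[OF L2_integrable_norm_sq[OF R(4)], of pu]])
      (use P_abs_bound L2_measurable[OF R(4)] in \<open>auto simp: abs_mult intro!: mult_right_mono order_trans[OF P_abs_bound]\<close>)
  show 2: "integrable lborel (\<lambda>x. q x * (norm (u x))\<^sup>2)"
    by (rule Bochner_Integration.integrable_bound[OF integrable_mult_right[OF L2_integrable_norm_sq[OF R(3)], of M]])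
      (use q(2) L2_measurable[OF R(3)] in \<open>auto simp: abs_mult intro!: mult_right_mono order_trans[OF q(2)]\<close>)
  show "integrable lborel (\<lambda>x. P x * (norm (V x))\<^sup>2 + q x * (norm (u x))\<^sup>2)"
    using 1 2 by simp
  show "continuous_on UNIV (\<lambda>x. P x * (norm (V x))\<^sup>2 + q x * (norm (u x))\<^sup>2)"
    by (intro continuous_intros P_cont q R)
qed

lemma form_eq:
  assumes r: "H2_rep u V W" and q: "continuous_on UNIV q" "\<And>x. \<bar>q x\<bar> \<le> M"
  shows "(LINT x|lborel. (- flux_deriv V W x + q x *\<^sub>R u x) * cnj (u x))
    = complex_of_real (LINT x|lborel. P x * (norm (V x))\<^sup>2 + q x * (norm (u x))\<^sup>2)"
proof -
  note R = H2_repD[OF r]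
  have [measurable]: "q \<in> borel_measurable borel" by (rule borel_measurable_continuous_onI[OF q(1)])
  have i0: "integrable lborel (\<lambda>x. (- flux_deriv V W x) * cnj (u x))"
    by (intro L2_integrable_mult_cnj L2_uminus flux_deriv_L2 R)
  have i1: "integrable lborel (\<lambda>x. (q x *\<^sub>R u x) * cnj (u x))"
    by (intro L2_integrable_mult_cnj R L2_scaleR_bounded[OF R(3) _ q(2)]) simp
  have "(LINT x|lborel. (- flux_deriv V W x + q x *\<^sub>R u x) * cnj (u x))
      = (LINT x|lborel. (- flux_deriv V W x) * cnj (u x)) + (LINT x|lborel. (q x *\<^sub>R u x) * cnj (u x))"
    unfolding distrib_right by (rule Bochner_Integration.integral_add[OF i0 i1])
  also have "(LINT x|lborel. (- flux_deriv V W x) * cnj (u x)) = (LINT x|lborel. P x *\<^sub>R (V x * cnj (V x)))"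
    using form_identity[OF r r] by simp
  also have "\<dots> = (LINT x|lborel. complex_of_real (P x * (norm (V x))\<^sup>2))"
    by (rule Bochner_Integration.integral_cong) (auto simp: scaleR_conv_of_real complex_norm_square simp del: of_real_power)
  also have "(LINT x|lborel. (q x *\<^sub>R u x) * cnj (u x)) = (LINT x|lborel. complex_of_real (q x * (norm (u x))\<^sup>2))"
    by (rule Bochner_Integration.integral_cong) (auto simp: scaleR_conv_of_real complex_norm_square simp del: of_real_power)
  finally show ?thesis
    using form_integrable(3,4)[OF r q] by (simp only: integral_complex_of_real Bochner_Integration.integral_add of_real_add)
qed

text \<open>
  With \<open>s = sqrt P\<close> and a constant \<open>\<kappa>\<close>, the operator \<open>-\<partial> P \<partial> + \<kappa>\<^sup>2 - \<kappa> s'\<close> factorises as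
  \<open>(\<kappa> - \<partial> s) (\<kappa> + s \<partial>)\<close>, and both first-order factors can be inverted explicitly.
\<close>

lemma base_operator:
  obtains q0 :: "real \<Rightarrow> real" and m0 M0 :: real where "continuous_on UNIV q0" "m0 > 0" "\<And>x. m0 \<le> q0 x" "\<And>x. \<bar>q0 x\<bar> \<le> M0"
    "\<And>g. g \<in> L2 \<Longrightarrow> \<exists>U V W. H2_rep U V W \<and> (AE x in lborel. - flux_deriv V W x + q0 x *\<^sub>R U x = g x)"
proof -
  define s s' where "s x = sqrt (P x)" and "s' x = P' x / (2 * sqrt (P x))" for x
  have sd: "(s has_real_derivative s' x) (at x)" for x
    unfolding s_def[abs_def] s'_def
    by (rule DERIV_cong[OF DERIV_chain2[OF DERIV_real_sqrt[OF P_pos] P_deriv]]) (simp add: divide_simps)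
  have sc: "continuous_on UNIV s" using sd by (meson DERIV_continuous continuous_at_imp_continuous_on)
  have s'c: "continuous_on UNIV s'"
    unfolding s'_def[abs_def]
    by (intro continuous_on_divide continuous_on_mult continuous_on_real_sqrt continuous_on_const P_cont P'_cont)
      (simp add: P_nz)
  have sl: "sqrt pl \<le> s x" and su: "s x \<le> sqrt pu" and s2: "s x * s x = P x" and s0: "0 < s x" for x
    unfolding s_def using P_lower[of x] P_upper[of x] P_pos[of x] by auto
  have snz: "s x \<noteq> 0" for x using s0[of x] by simp
  have pl0: "0 < sqrt pl" using pl_pos by simp
  have pu0: "0 < sqrt pu" using s0[of 0] su[of 0] by linarith
  define B where "B = \<bar>b\<bar> / (2 * sqrt pl)"
  have B0: "0 \<le> B" using pl0 by (simp add: B_def)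
  have s'b: "\<bar>s' x\<bar> \<le> B" for x
  proof -
    have "\<bar>P' x\<bar> / (2 * s x) \<le> \<bar>b\<bar> / (2 * sqrt pl)"
      using P'_bound[of x] sl[of x] pl0 by (intro frac_le) auto
    then show ?thesis using P_pos[of x] by (simp add: s'_def B_def s_def abs_mult)
  qed
  \<comment> \<open>Since \<open>\<bar>s'\<bar> \<le> B\<close>, this choice gives
    \<open>q0 = \<kappa>^2 - \<kappa> s' \<ge> \<kappa> > 0\<close>.\<close>
  define \<kappa> where "\<kappa> = B + 1"
  have \<kappa>: "0 < \<kappa>" using B0 by (simp add: \<kappa>_def)
  define a where "a x = \<kappa> / s x" for x
  have ac: "continuous_on UNIV a" unfolding a_def[abs_def] 
    by (intro continuous_intros sc) (simp_all add: snz)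
  have am: "\<kappa> / sqrt pu \<le> a x" for x
    unfolding a_def using su s0 \<kappa> by (intro divide_left_mono) (auto intro: mult_pos_pos pu0)
  have m: "0 < \<kappa> / sqrt pu" using \<kappa> pu0 by simp
  define q0 where "q0 x = \<kappa>\<^sup>2 - \<kappa> * s' x" for x
  have q0c: "continuous_on UNIV q0" unfolding q0_def[abs_def] by (intro continuous_intros s'c)
  have q0l: "\<kappa> \<le> q0 x" for x
  proof -
    have "\<kappa> * s' x \<le> \<kappa> * B" using s'b[of x] \<kappa> by (intro mult_left_mono) auto
    then show ?thesis by (simp add: q0_def \<kappa>_def power2_eq_square algebra_simps)
  qed
  have q0u: "\<bar>q0 x\<bar> \<le> \<kappa>\<^sup>2 + \<kappa> * B" for x
  proof -
    have "\<bar>\<kappa> * s' x\<bar> \<le> \<kappa> * B" using s'b[of x] \<kappa> by (simp add: abs_mult)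
    then show ?thesis unfolding q0_def by (smt (verit) zero_le_power2)
  qed
  have inv_sb: "\<bar>1 / s x\<bar> \<le> 1 / sqrt pl" for x
    using sl[of x] s0[of x] pl0 by (simp add: frac_le)
  have inv_Pb: "\<bar>1 / P x\<bar> \<le> 1 / pl" for x
    using P_lower[of x] P_pos[of x] pl_pos by (simp add: frac_le)
  have [measurable]: "s \<in> borel_measurable borel" "s' \<in> borel_measurable borel" "q0 \<in> borel_measurable borel"
    using sc s'c q0c by (auto intro: borel_measurable_continuous_onI)
  have "\<exists>U V W. H2_rep U V W \<and> (AE x in lborel. - flux_deriv V W x + q0 x *\<^sub>R U x = g x)" if g: "g \<in> L2" for g
  proof -
    \<comment> \<open>\<open>y\<close> is \<open>s z\<close> for the intermediate function
      \<open>z = \<kappa> u + s u'\<close>. The outer factor reads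
      \<open>\<kappa> z - (s z)' = g\<close>, that is \<open>y' = a y - g\<close> with
      \<open>a = \<kappa> / s\<close>; the inner one then becomes
      \<open>u' = y / P - a u\<close>.\<close>
    obtain y where y: "y \<in> L2" "is_primitive y (\<lambda>x. of_real (a x) * y x - g x)"
      using first_order_adjoint_solution[OF ac am m g] .
    have yc: "continuous_on UNIV y" by (rule is_primitive_continuous[OF y(2)])
    have w: "(\<lambda>x. (1 / P x) *\<^sub>R y x) \<in> L2"
      by (rule L2_scaleR_bounded[OF y(1) _ inv_Pb]) simp
    obtain u where u: "u \<in> L2" "is_primitive u (\<lambda>x. (1 / P x) *\<^sub>R y x - of_real (a x) * u x)"
      using first_order_solution[OF ac am m w] .
    have uc: "continuous_on UNIV u" by (rule is_primitive_continuous[OF u(2)])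
    define V where "V x = (1 / P x) *\<^sub>R y x - of_real (a x) * u x" for x
    have Vc: "continuous_on UNIV V"
      unfolding V_def[abs_def]
      by (intro continuous_intros ac yc uc P_cont) (simp_all add: P_nz)
    have uV: "(u has_vector_derivative V x) (at x)" for x
      using is_primitive_imp_has_vector_derivative[OF u(2)] Vc unfolding V_def by blast
    have ab: "\<bar>a x\<bar> \<le> \<kappa> / sqrt pl" for x
      unfolding a_def using sl[of x] s0[of x] \<kappa> pl0 by (simp add: frac_le)
    have am': "a \<in> borel_measurable borel" by (rule borel_measurable_continuous_onI[OF ac])
    have VL: "V \<in> L2"
      unfolding V_def[abs_def] using L2_diff[OF w L2_scaleR_bounded[OF u(1) am' ab]] by (simp add: scaleR_conv_of_real)
    \<comment> \<open>The flux \<open>P V\<close>, written so that its derivative follows from those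
      of \<open>y\<close> and \<open>u\<close>; \<open>\<phi>\<close> below is the derivative that
      the equation prescribes for it.\<close>
    define \<Phi> where "\<Phi> x = y x - of_real (\<kappa> * s x) * u x" for x
    have \<Phi>V: "\<Phi> x = P x *\<^sub>R V x" for x
    proof -
      have "P x * a x = \<kappa> * s x" using s0[of x] by (simp add: a_def field_simps flip: s2)
      then have "complex_of_real (P x) * complex_of_real (a x) = complex_of_real (\<kappa> * s x)" by (metis of_real_mult)
      then show ?thesis using P_pos[of x]
        by (simp add: \<Phi>_def V_def scaleR_diff_right) (simp add: scaleR_conv_of_real flip: mult.assoc)
    qed
    define \<phi> where "\<phi> x = q0 x *\<^sub>R u x - g x" for x
    have \<phi>L: "\<phi> \<in> L2"
      unfolding \<phi>_def[abs_def] by (intro L2_diff g L2_scaleR_bounded[OF u(1) _ q0u]) simp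
    have "is_primitive (\<lambda>x. u x * complex_of_real (\<kappa> * s x))
        (\<lambda>x. V x * complex_of_real (\<kappa> * s x) + u x * complex_of_real (\<kappa> * s' x))"
      by (rule is_primitive_mult_C1[OF C1_is_primitive[OF uV Vc]])
        (rule has_vector_derivative_of_real DERIV_cmult sd continuous_on_of_real continuous_on_mult continuous_on_const s'c)+
    from is_primitive_diff[OF y(2) this]
    have "is_primitive \<Phi> (\<lambda>x. of_real (a x) * y x - g x -
        (V x * complex_of_real (\<kappa> * s x) + u x * complex_of_real (\<kappa> * s' x)))"
      by (simp add: \<Phi>_def[abs_def] mult.commute)
    moreover have "of_real (a x) * y x - g x - (V x * complex_of_real (\<kappa> * s x) + u x * complex_of_real (\<kappa> * s' x)) = \<phi> x" for x
    proof -
      have "\<kappa> * s x / P x = a x" using s0[of x] by (simp add: a_def field_simps flip: s2)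
      then have e1: "complex_of_real (1 / P x) * complex_of_real (\<kappa> * s x) = complex_of_real (a x)"
        by (metis of_real_mult mult.commute times_divide_eq_right mult.right_neutral)
      have "a x * (\<kappa> * s x) = \<kappa>\<^sup>2" using s0[of x] by (simp add: a_def power2_eq_square)
      then have e2: "complex_of_real (a x) * complex_of_real (\<kappa> * s x) = complex_of_real (\<kappa>\<^sup>2)"
        by (metis of_real_mult)
      have "V x * complex_of_real (\<kappa> * s x) = of_real (a x) * y x - of_real (\<kappa>\<^sup>2) * u x"
        unfolding V_def scaleR_conv_of_real left_diff_distrib
        using e1 e2 by (simp only: mult.commute[of _ "complex_of_real (\<kappa> * s x)"] mult.assoc[symmetric])
      then show ?thesis by (simp add: \<phi>_def q0_def scaleR_conv_of_real algebra_simps)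
    qed
    ultimately have \<Phi>p: "is_primitive \<Phi> \<phi>" by simp
    define W where "W x = (1 / P x) *\<^sub>R \<phi> x - (P' x / (P x)\<^sup>2) *\<^sub>R \<Phi> x" for x
    have "is_primitive (\<lambda>x. \<Phi> x * complex_of_real (1 / P x))
       (\<lambda>x. \<phi> x * complex_of_real (1 / P x) + \<Phi> x * complex_of_real (- (P' x / (P x)\<^sup>2)))"
    proof (rule is_primitive_mult_C1[OF \<Phi>p])
      show "((\<lambda>x. complex_of_real (1 / P x)) has_vector_derivative complex_of_real (- (P' x / (P x)\<^sup>2))) (at x)" for x
        using P_pos[of x]
        by (intro has_vector_derivative_of_real) (auto intro!: derivative_eq_intros P_deriv simp: power2_eq_square)
      show "continuous_on UNIV (\<lambda>x. complex_of_real (- (P' x / (P x)\<^sup>2)))"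
        by (intro continuous_intros P_cont P'_cont) (simp_all add: P_nz)
    qed
    moreover have "\<Phi> x * complex_of_real (1 / P x) = V x" for x
      using P_pos[of x] by (simp add: \<Phi>V scaleR_conv_of_real)
    ultimately have VW: "is_primitive V W"
      unfolding W_def[abs_def] by (simp add: scaleR_conv_of_real mult.commute)
    have Weq: "W x = (1 / P x) *\<^sub>R (\<phi> x - P' x *\<^sub>R V x)" for x
      using P_pos[of x] by (simp add: W_def \<Phi>V scaleR_diff_right power2_eq_square field_simps)
    have "(\<lambda>x. (1 / P x) *\<^sub>R (\<phi> x - P' x *\<^sub>R V x)) \<in> L2"
      by (rule L2_scaleR_bounded[OF _ _ inv_Pb]) (auto intro!: L2_diff \<phi>L L2_scaleR_bounded[OF VL _ P'_bound])
    then have WL: "W \<in> L2" by (simp add: Weq[abs_def])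
    have "H2_rep u V W" unfolding H2_rep_def using uV VW u(1) VL WL by blast
    moreover have "- flux_deriv V W x + q0 x *\<^sub>R u x = g x" for x
      using P_pos[of x] by (simp add: flux_deriv_def Weq \<phi>_def)
    ultimately show ?thesis by blast
  qed
  then show thesis using that[OF q0c \<kappa> q0l q0u] by blast
qed

end

text \<open>Here \<open>a0\<close> and \<open>a1\<close> are form values of the base and the target
  operator at a function with squared norm \<open>n\<close>. For real \<open>z < \<sigma>\<close>
  both ends of the path are bounded below. For nonreal \<open>z\<close> the real part, dominated by
  \<open>a0\<close>, serves for small \<open>t\<close>, and the imaginary part
  \<open>t n Im z\<close> for the other \<open>t\<close>.\<close>

lemma numerical_range_bound:
  fixes z :: complex and m \<sigma> :: real
  assumes m: "m > 0" and z: "z \<notin> complex_of_real ` {\<sigma>..}"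
  obtains c0 where "c0 > 0" "\<And>t n a0 a1. 0 \<le> t \<Longrightarrow> t \<le> 1 \<Longrightarrow> 0 \<le> n \<Longrightarrow> m * n \<le> a0 \<Longrightarrow> \<sigma> * n \<le> a1 \<Longrightarrow>
    c0 * n \<le> norm (complex_of_real ((1 - t) * a0 + t * a1) - of_real t * z * of_real n)"
proof (cases "Im z = 0")
  case True
  have lt: "Re z < \<sigma>"
  proof (rule ccontr)
    assume "\<not> Re z < \<sigma>"
    then have "z \<in> complex_of_real ` {\<sigma>..}"
      using True by (intro image_eqI[of _ _ "Re z"]) (auto simp: complex_eq_iff)
    with z show False by simp
  qed
  show thesis
  proof (rule that[of "min m (\<sigma> - Re z)"])
    fix t n a0 a1 :: real
    assume *: "0 \<le> t" "t \<le> 1" "0 \<le> n" "m * n \<le> a0" "\<sigma> * n \<le> a1"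
    let ?c = "min m (\<sigma> - Re z)"
    have "?c * n \<le> m * n" "?c * n \<le> (\<sigma> - Re z) * n" using * by (auto intro: mult_right_mono)
    then have "?c * n \<le> a0" "?c * n \<le> a1 - Re z * n" using * by (auto simp: left_diff_distrib)
    then have "(1 - t) * (?c * n) \<le> (1 - t) * a0" "t * (?c * n) \<le> t * (a1 - Re z * n)"
      using * by (auto intro: mult_left_mono)
    then have "?c * n \<le> Re (complex_of_real ((1 - t) * a0 + t * a1) - of_real t * z * of_real n)"
      by (simp add: algebra_simps)
    also have "\<dots> \<le> norm (complex_of_real ((1 - t) * a0 + t * a1) - of_real t * z * of_real n)"
      by (rule complex_Re_le_cmod)
    finally show "?c * n \<le> norm (complex_of_real ((1 - t) * a0 + t * a1) - of_real t * z * of_real n)" .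
  qed (use m lt in auto)
next
  case False
  define K where "K = m + \<bar>\<sigma> - Re z\<bar>"
  have K: "0 < K" using m by (simp add: K_def)
  \<comment> \<open>In units of \<open>n\<close> the real part is at least \<open>m - t K\<close>;
    up to \<open>t0\<close> at least half of \<open>m\<close> remains.\<close>
  define t0 where "t0 = m / (2 * K)"
  have t0: "0 < t0" using m K by (simp add: t0_def)
  show thesis
  proof (rule that[of "min (m / 2) (t0 * \<bar>Im z\<bar>)"])
    show "0 < min (m / 2) (t0 * \<bar>Im z\<bar>)" using m t0 False by simp
    fix t n a0 a1 :: real
    assume *: "0 \<le> t" "t \<le> 1" "0 \<le> n" "m * n \<le> a0" "\<sigma> * n \<le> a1"
    let ?c = "min (m / 2) (t0 * \<bar>Im z\<bar>)"
    let ?\<zeta> = "complex_of_real ((1 - t) * a0 + t * a1) - of_real t * z * of_real n"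
    show "?c * n \<le> norm ?\<zeta>"
    proof (cases "t \<le> t0")
      case True
      have "t * K \<le> t0 * K" using True K by (intro mult_right_mono) auto
      also have "t0 * K = m / 2" using K by (simp add: t0_def)
      finally have "m / 2 \<le> m - t * K" by simp
      then have "m / 2 * n \<le> (m - t * K) * n" using * by (intro mult_right_mono) auto
      also have "\<dots> \<le> (1 - t) * (m * n) + t * ((\<sigma> - Re z) * n)"
      proof -
        have "t * (- \<bar>\<sigma> - Re z\<bar> * n) \<le> t * ((\<sigma> - Re z) * n)" using * by (intro mult_left_mono mult_right_mono) auto
        then show ?thesis by (simp add: K_def algebra_simps)
      qed
      also have "\<dots> \<le> (1 - t) * a0 + t * (a1 - Re z * n)"
        using * by (intro add_mono mult_left_mono) (auto simp: algebra_simps)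
      also have "\<dots> = Re ?\<zeta>" by (simp add: algebra_simps)
      also have "\<dots> \<le> norm ?\<zeta>" by (rule complex_Re_le_cmod)
      finally have "m / 2 * n \<le> norm ?\<zeta>" .
      moreover have "?c * n \<le> m / 2 * n" using * by (intro mult_right_mono) auto
      ultimately show ?thesis by linarith
    next
      case f: False
      have "?c * n \<le> t0 * \<bar>Im z\<bar> * n" using * by (intro mult_right_mono) auto
      also have "\<dots> \<le> t * \<bar>Im z\<bar> * n" using * f by (intro mult_right_mono) auto
      also have "\<dots> = \<bar>Im ?\<zeta>\<bar>" using * by (simp add: abs_mult)
      also have "\<dots> \<le> norm ?\<zeta>" by (rule abs_Im_le_cmod)
      finally show ?thesis .
    qed
  qed
qed

context leading_coefficient
begin

text \<open>\<open>S\<close> collects all bounded terms, the nonlocal one included, which is why it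
  is an operator and not a multiplier. Of symmetry only the consequence that the form values are
  real and at least \<open>\<sigma>\<close> times the squared norm is used; the path joins the base
  operator to \<open>T - z\<close>.\<close>

theorem spectrum_bounded_below:
  fixes T S :: "(real \<Rightarrow> complex) \<Rightarrow> (real \<Rightarrow> complex)"
  assumes T: "\<And>u U V W. u \<in> H2 \<Longrightarrow> H2_rep U V W \<Longrightarrow> AE x in lborel. u x = U x \<Longrightarrow>
      AE x in lborel. T u x = - flux_deriv V W x + S U x"
    and Tm: "\<And>u. u \<in> H2 \<Longrightarrow> T u \<in> borel_measurable borel"
    and S: "\<And>u. u \<in> L2 \<Longrightarrow> S u \<in> L2" "\<And>u. u \<in> L2 \<Longrightarrow> L2_norm (S u) \<le> K * L2_norm u" and K: "0 \<le> K"
    and Sadd: "\<And>u v x. u \<in> L2 \<Longrightarrow> v \<in> L2 \<Longrightarrow> S (\<lambda>x. u x + v x) x = S u x + S v x"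
    and Sform: "\<And>U V W. H2_rep U V W \<Longrightarrow> \<exists>a \<ge> \<sigma> * (L2_norm U)\<^sup>2.
       (LINT x|lborel. (- flux_deriv V W x + S U x) * cnj (U x)) = complex_of_real a"
  shows "spectrum H2 T \<subseteq> complex_of_real ` {\<sigma>..}"
proof -
  have "z \<in> resolvent_set H2 T" if z: "z \<notin> complex_of_real ` {\<sigma>..}" for z
  proof -
    obtain q0 m0 M0 where q0: "continuous_on UNIV q0" "m0 > 0" "\<And>x. m0 \<le> q0 x" "\<And>x. \<bar>q0 x\<bar> \<le> M0"
      and base: "\<And>g. g \<in> L2 \<Longrightarrow> \<exists>U V W. H2_rep U V W \<and> (AE x in lborel. - flux_deriv V W x + q0 x *\<^sub>R U x = g x)"
      using base_operator by blast
    have [measurable]: "q0 \<in> borel_measurable borel" by (rule borel_measurable_continuous_onI[OF q0(1)])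
    obtain c0 where c0: "c0 > 0" "\<And>t n a0 a1. 0 \<le> t \<Longrightarrow> t \<le> 1 \<Longrightarrow> 0 \<le> n \<Longrightarrow> m0 * n \<le> a0 \<Longrightarrow> \<sigma> * n \<le> a1 \<Longrightarrow>
      c0 * n \<le> norm (complex_of_real ((1 - t) * a0 + t * a1) - of_real t * z * of_real n)"
      using numerical_range_bound[OF q0(2) z] by blast
    have M0: "0 \<le> M0" using q0(4)[of 0] by simp
    define Rel where "Rel u g \<longleftrightarrow> g \<in> L2 \<and> (\<exists>V W. H2_rep u V W \<and> (AE x in lborel. - flux_deriv V W x + q0 x *\<^sub>R u x = g x))" for u g
    \<comment> \<open>The difference between \<open>T - z\<close> and the base operator. It is
      bounded because the second-order parts cancel.\<close>
    define Q where "Q u x = S u x + - (q0 x *\<^sub>R u x) + - (z * u x)" for u x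
    have q0L: "(\<lambda>x. q0 x *\<^sub>R u x) \<in> L2" "L2_norm (\<lambda>x. - (q0 x *\<^sub>R u x)) \<le> M0 * L2_norm u" if "u \<in> L2" for u
    proof -
      show L: "(\<lambda>x. q0 x *\<^sub>R u x) \<in> L2" by (rule L2_scaleR_bounded[OF that _ q0(4)]) simp
      show "L2_norm (\<lambda>x. - (q0 x *\<^sub>R u x)) \<le> M0 * L2_norm u"
        by (rule L2_norm_mono[OF that L2_measurable[OF L2_uminus[OF L]]])
          (use q0(4) M0 in \<open>auto intro!: mult_right_mono\<close>)
    qed
    have QL: "Q u \<in> L2" if "u \<in> L2" for u
      unfolding Q_def[abs_def] by (intro L2_add L2_uminus S L2_cmult q0L that)
    have Qn: "L2_norm (Q u) \<le> (K + M0 + norm z) * L2_norm u" if u: "u \<in> L2" for u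
    proof -
      have "L2_norm (Q u) \<le> L2_norm (\<lambda>x. S u x + - (q0 x *\<^sub>R u x)) + L2_norm (\<lambda>x. - (z * u x))"
        unfolding Q_def[abs_def] by (intro L2_norm_triangle L2_add L2_uminus S L2_cmult q0L u)
      also have "L2_norm (\<lambda>x. S u x + - (q0 x *\<^sub>R u x)) \<le> L2_norm (S u) + L2_norm (\<lambda>x. - (q0 x *\<^sub>R u x))"
        by (intro L2_norm_triangle L2_uminus S q0L u)
      also have "L2_norm (\<lambda>x. - (z * u x)) = norm z * L2_norm u"
        using L2_norm_cmult[of "- z" u] by simp
      finally show ?thesis using S(2)[OF u] q0L(2)[OF u] by (simp add: algebra_simps)
    qed
    have Qadd: "Q (\<lambda>x. u x + v x) x = Q u x + Q v x" if "u \<in> L2" "v \<in> L2" for u v x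
      by (simp add: Q_def Sadd[OF that] algebra_simps)
    have coercive: "L2_norm u \<le> (1 / c0) * L2_norm g"
      if t: "0 \<le> t" "t \<le> 1" and g: "g \<in> L2" and r: "Rel u (\<lambda>x. g x - of_real t * Q u x)" for t u g
    proof -
      obtain V W where vw: "H2_rep u V W" "AE x in lborel. - flux_deriv V W x + q0 x *\<^sub>R u x = g x - of_real t * Q u x"
        using r by (auto simp: Rel_def)
      note R = H2_repD[OF vw(1)]
      obtain a1 where a1: "\<sigma> * (L2_norm u)\<^sup>2 \<le> a1"
        "(LINT x|lborel. (- flux_deriv V W x + S u x) * cnj (u x)) = complex_of_real a1"
        using Sform[OF vw(1)] by blast
      have i1: "integrable lborel (\<lambda>x. (- flux_deriv V W x + q0 x *\<^sub>R u x) * cnj (u x))"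
        by (intro L2_integrable_mult_cnj L2_add L2_uminus flux_deriv_L2 q0L R)
      have i2: "integrable lborel (\<lambda>x. (- flux_deriv V W x + S u x) * cnj (u x))"
        by (intro L2_integrable_mult_cnj L2_add L2_uminus flux_deriv_L2 S R)
      have i3: "integrable lborel (\<lambda>x. u x * cnj (u x))" by (intro L2_integrable_mult_cnj R)
      have nsq: "(LINT x|lborel. u x * cnj (u x)) = of_real ((L2_norm u)\<^sup>2)"
        unfolding L2_norm_sq integral_complex_of_real[symmetric] complex_norm_square ..
      define a0 where "a0 = (LINT x|lborel. P x * (norm (V x))\<^sup>2 + q0 x * (norm (u x))\<^sup>2)"
      have e0: "(LINT x|lborel. (- flux_deriv V W x + q0 x *\<^sub>R u x) * cnj (u x)) = of_real a0"
        unfolding a0_def by (rule form_eq[OF vw(1) q0(1) q0(4)])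
      have a0: "m0 * (L2_norm u)\<^sup>2 \<le> a0"
      proof -
        have "m0 * (L2_norm u)\<^sup>2 = (LINT x|lborel. m0 * (norm (u x))\<^sup>2)" by (simp add: L2_norm_sq)
        also have "\<dots> \<le> a0" unfolding a0_def
        proof (rule integral_mono)
          show "m0 * (norm (u x))\<^sup>2 \<le> P x * (norm (V x))\<^sup>2 + q0 x * (norm (u x))\<^sup>2" for x
            using P_pos[of x] q0(3)[of x] by (intro add_increasing mult_right_mono) auto
        qed (intro integrable_mult_right L2_integrable_norm_sq R form_integrable(1)[OF vw(1) q0(1) q0(4)])+
        finally show ?thesis .
      qed
      have [measurable]: "g \<in> borel_measurable borel" "u \<in> borel_measurable borel" "S u \<in> borel_measurable borel"
          "flux_deriv V W \<in> borel_measurable borel" "cnj \<in> borel_measurable borel"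
          using L2_measurable g R(3) S(1)[OF R(3)] flux_deriv_L2[OF R(4,5)]
          by (auto intro: borel_measurable_continuous_onI continuous_intros)
      \<comment> \<open>Pairing the equation at \<open>t\<close> with \<open>u\<close> produces the
        convex combination of the two forms minus \<open>t z\<close> times the squared norm, which
        is the quantity estimated in \<open>numerical_range_bound\<close>.\<close>
      have "(LINT x|lborel. g x * cnj (u x)) =
          (LINT x|lborel. (1 - of_real t) * ((- flux_deriv V W x + q0 x *\<^sub>R u x) * cnj (u x))
            + of_real t * ((- flux_deriv V W x + S u x) * cnj (u x)) - of_real t * z * (u x * cnj (u x)))"
      proof (rule integral_cong_AE)
        show "AE x in lborel. g x * cnj (u x) = (1 - of_real t) * ((- flux_deriv V W x + q0 x *\<^sub>R u x) * cnj (u x))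
            + of_real t * ((- flux_deriv V W x + S u x) * cnj (u x)) - of_real t * z * (u x * cnj (u x))"
          using vw(2)
        proof eventually_elim
          case (elim x)
          then have g: "g x = - flux_deriv V W x + q0 x *\<^sub>R u x + of_real t * Q u x" by simp
          show ?case unfolding g Q_def by (simp add: algebra_simps)
        qed
      qed measurable
      also have "\<dots> = complex_of_real ((1 - t) * a0 + t * a1) - of_real t * z * of_real ((L2_norm u)\<^sup>2)"
        by (subst Bochner_Integration.integral_diff, (intro Bochner_Integration.integrable_add integrable_mult_right i1 i2 i3)+,
            subst Bochner_Integration.integral_add, (intro integrable_mult_right i1 i2 i3)+,
            simp only: integral_mult_right_zero a1(2) nsq e0, simp)
      finally have "norm (LINT x|lborel. g x * cnj (u x)) = norm (complex_of_real ((1 - t) * a0 + t * a1) - of_real t * z * of_real ((L2_norm u)\<^sup>2))"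
        by simp
      then have "c0 * (L2_norm u)\<^sup>2 \<le> norm (LINT x|lborel. g x * cnj (u x))"
        using c0(2)[OF t _ a0 a1(1)] by simp
      also have "\<dots> \<le> L2_norm g * L2_norm u" by (rule L2_Cauchy_Schwarz[OF g R(3)])
      finally have le: "c0 * (L2_norm u)\<^sup>2 \<le> L2_norm g * L2_norm u" .
      show ?thesis
      proof (cases "L2_norm u = 0")
        case True
        then show ?thesis using c0(1) by simp
      next
        case False
        then have "0 < L2_norm u" using L2_norm_nonneg[of u] by linarith
        with le have "c0 * L2_norm u \<le> L2_norm g" by (simp add: power2_eq_square)
        then show ?thesis using c0(1) by (simp add: field_simps)
      qed
    qed
    have exist: "\<exists>u. Rel u (\<lambda>x. g x - Q u x)" if g: "g \<in> L2" for g
    proof (rule method_of_continuity[where C = "1 / c0" and K = "K + M0 + norm z"])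
      fix u v g h assume "Rel u g" "Rel v h"
      then obtain V W V' W' where vw: "g \<in> L2" "H2_rep u V W" "AE x in lborel. - flux_deriv V W x + q0 x *\<^sub>R u x = g x"
        "h \<in> L2" "H2_rep v V' W'" "AE x in lborel. - flux_deriv V' W' x + q0 x *\<^sub>R v x = h x"
        by (auto simp: Rel_def)
      have "AE x in lborel. - flux_deriv (\<lambda>x. V x + V' x) (\<lambda>x. W x + W' x) x + q0 x *\<^sub>R (u x + v x) = g x + h x"
        using vw(3,6) by eventually_elim (simp add: flux_deriv_def algebra_simps)
      then show "Rel (\<lambda>x. u x + v x) (\<lambda>x. g x + h x)"
        using H2_rep_add[OF vw(2,5)] L2_add[OF vw(1,4)] by (auto simp: Rel_def)
    next
      fix u g assume "Rel u g"
      then obtain V W where vw: "g \<in> L2" "H2_rep u V W" "AE x in lborel. - flux_deriv V W x + q0 x *\<^sub>R u x = g x"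
        by (auto simp: Rel_def)
      have "AE x in lborel. - flux_deriv (\<lambda>x. - V x) (\<lambda>x. - W x) x + q0 x *\<^sub>R (- u x) = - g x"
        using vw(3) by eventually_elim (auto simp: flux_deriv_def algebra_simps)
      then show "Rel (\<lambda>x. - u x) (\<lambda>x. - g x)"
        using H2_rep_cmult[OF vw(2), of "-1"] L2_uminus[OF vw(1)] by (auto simp: Rel_def)
    next
      have "H2_rep (\<lambda>x. 0) (\<lambda>x. 0) (\<lambda>x. 0)"
        by (auto simp: H2_rep_def L2_zero is_primitive_def intro: continuous_locally_integrable)
      then show "Rel (\<lambda>x. 0) (\<lambda>x. 0)"
        unfolding Rel_def by (intro conjI L2_zero exI[of _ "\<lambda>x. 0"]) (auto simp: flux_deriv_def)
      show "u \<in> L2 \<and> g \<in> L2" if "Rel u g" for u g using that H2_repD(3) by (auto simp: Rel_def)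
      show "Rel u h" if u: "Rel u g" and h: "h \<in> L2" "AE x in lborel. g x = h x" for u g h
      proof -
        obtain V W where vw: "H2_rep u V W" "AE x in lborel. - flux_deriv V W x + q0 x *\<^sub>R u x = g x"
          using u by (auto simp: Rel_def)
        have "AE x in lborel. - flux_deriv V W x + q0 x *\<^sub>R u x = h x"
          using vw(2) h(2) by eventually_elim simp
        then show ?thesis using h(1) vw(1) by (auto simp: Rel_def)
      qed
      show "\<exists>u. Rel u g" if "g \<in> L2" for g using base[OF that] that by (auto simp: Rel_def)
    qed (use coercive QL Qn Qadd c0(1) K M0 g in auto)
    have rel_T: "Rel U (\<lambda>x. (T u x - z * u x) - Q U x)" and T_L2: "(\<lambda>x. T u x - z * u x) \<in> L2"
      if u: "u \<in> H2" and r: "H2_rep U V W" and ae: "AE x in lborel. u x = U x" for u U V W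
    proof -
      note R = H2_repD[OF r]
      have TL: "T u \<in> L2"
      proof (rule L2_cong_AE)
        show "(\<lambda>x. - flux_deriv V W x + S U x) \<in> L2"
          by (intro L2_add L2_uminus flux_deriv_L2 S R)
      qed (use Tm[OF u] T[OF u r ae] in auto)
      then show L: "(\<lambda>x. T u x - z * u x) \<in> L2" by (intro L2_diff L2_cmult H2_L2[OF u])
      have "AE x in lborel. - flux_deriv V W x + q0 x *\<^sub>R U x = (T u x - z * u x) - Q U x"
        using T[OF u r ae] ae by eventually_elim (simp add: Q_def)
      then show "Rel U (\<lambda>x. (T u x - z * u x) - Q U x)"
        using r L2_diff[OF L QL[OF R(3)]] by (auto simp: Rel_def)
    qed
    have bnd: "L2_norm u \<le> (1 / c0) * L2_norm (\<lambda>x. T u x - z * u x)" if u: "u \<in> H2" for u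
    proof -
      obtain U V W where r: "H2_rep U V W" "AE x in lborel. u x = U x" using H2_rep_exists[OF u] .
      have "L2_norm U \<le> (1 / c0) * L2_norm (\<lambda>x. T u x - z * u x)"
        by (rule coercive[of 1, OF _ _ T_L2[OF u r]]) (use rel_T[OF u r] in simp_all)
      moreover have "L2_norm u = L2_norm U"
        by (rule L2_norm_cong_AE) (use r L2_measurable H2_L2[OF u] H2_repD(3)[OF r(1)] in auto)
      ultimately show ?thesis by simp
    qed
    show ?thesis
      unfolding resolvent_set_def mem_Collect_eq
    proof (intro conjI ballI)
      show "\<exists>C. \<forall>u\<in>H2. L2_norm u \<le> C * L2_norm (\<lambda>x. T u x - z * u x)" using bnd by blast
      fix g assume g: "g \<in> L2"
      obtain U V W where vw: "H2_rep U V W" "AE x in lborel. - flux_deriv V W x + q0 x *\<^sub>R U x = g x - Q U x"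
        using exist[OF g] by (auto simp: Rel_def)
      have U: "U \<in> H2" by (rule H2_rep_in_H2[OF vw(1)])
      have TU1: "AE x in lborel. T U x = - flux_deriv V W x + S U x" by (rule T[OF U vw(1)]) simp
      have TU: "AE x in lborel. T U x - z * U x = g x"
        using TU1 vw(2) by eventually_elim (simp add: Q_def algebra_simps)
      show "\<exists>u\<in>H2. (AE x in lborel. T u x - z * u x = g x) \<and>
        (\<forall>v\<in>H2. (AE x in lborel. T v x - z * v x = g x) \<longrightarrow> (AE x in lborel. v x = u x))"
      proof (intro bexI[OF _ U] conjI TU ballI impI)
        fix v assume v: "v \<in> H2" and Tv: "AE x in lborel. T v x - z * v x = g x"
        obtain U' V' W' where r: "H2_rep U' V' W'" "AE x in lborel. v x = U' x" using H2_rep_exists[OF v] .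
        \<comment> \<open>\<open>T\<close> is not assumed linear; the difference is formed on
          regular representatives, on which \<open>T\<close> is explicit.\<close>
        let ?d = "\<lambda>x. U' x + (-1) * U x"
        have rd: "H2_rep ?d (\<lambda>x. V' x + (-1) * V x) (\<lambda>x. W' x + (-1) * W x)"
          by (intro H2_rep_add H2_rep_cmult r vw)
        have d: "?d \<in> H2" by (rule H2_rep_in_H2[OF rd])
        have Sd: "S ?d x = S U' x - S U x" for x
        proof -
          note UL = H2_repD(3)[OF vw(1)]
          have S0: "S (\<lambda>x. 0) x = 0" using Sadd[OF L2_zero L2_zero, of x] by simp
          have "S (\<lambda>x. (-1) * U x) x = - S U x"
            using Sadd[OF UL L2_cmult[OF UL, of "-1"], of x] S0 by (simp add: add_eq_0_iff)
          then show ?thesis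
            using Sadd[OF H2_repD(3)[OF r(1)] L2_cmult[OF UL, of "-1"], of x] by simp
        qed
        have Td: "AE x in lborel. T ?d x = - flux_deriv (\<lambda>x. V' x + (-1) * V x) (\<lambda>x. W' x + (-1) * W x) x + S ?d x"
          by (rule T[OF d rd]) simp
        have "AE x in lborel. T ?d x - z * ?d x = 0"
          using Td TU1 T[OF v r] TU Tv r(2)
        proof eventually_elim
          case (elim x)
          have e: "T ?d x - z * ?d x = (T v x - z * v x) - (T U x - z * U x)"
            unfolding elim(1) elim(2) elim(3) elim(6) Sd flux_deriv_def by (simp add: algebra_simps)
          show ?case unfolding e elim(4) elim(5) by simp
        qed
        then have "L2_norm (\<lambda>x. T ?d x - z * ?d x) = 0"
          using L2_norm_eq_0_iff[OF T_L2[OF d rd]] by (metis (no_types, lifting) AE_I2)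
        then have "L2_norm ?d = 0" by (intro antisym L2_norm_nonneg) (use bnd[OF d] in simp)
        then have "AE x in lborel. ?d x = 0" using L2_norm_eq_0_iff[OF H2_L2[OF d]] by simp
        then show "AE x in lborel. v x = U x" using r(2) by eventually_elim simp
      qed
    qed
  qed
  then show ?thesis unfolding spectrum_def by blast
qed

end

subsection \<open>Linear initial value problems\<close>

lemma real_antiderivative:
  fixes g :: "real \<Rightarrow> real"
  assumes "continuous_on UNIV g"
  shows "\<exists>G. G 0 = 0 \<and> (\<forall>x. (G has_real_derivative g x) (at x))"
proof -
  have c: "continuous_on UNIV (\<lambda>x. complex_of_real (g x))" by (rule continuous_on_of_real[OF assms])
  obtain A where A: "is_primitive A (\<lambda>x. complex_of_real (g x))"
    using is_primitiveI[OF continuous_locally_integrable[OF c]] by blast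
  have "((\<lambda>x. Re (A x)) has_real_derivative g x) (at x)" for x
    using bounded_linear.has_vector_derivative[OF bounded_linear_Re is_primitive_imp_has_vector_derivative[OF A c, of x]]
    by (simp add: has_real_derivative_iff_has_vector_derivative)
  then have "((\<lambda>x. Re (A x) - Re (A 0)) has_real_derivative g x) (at x)" for x
    using DERIV_diff[OF _ DERIV_const[of "Re (A 0)"], of "\<lambda>x. Re (A x)" "g x" x UNIV] by simp
  then show ?thesis by (intro exI[of _ "\<lambda>x. Re (A x) - Re (A 0)"]) simp
qed

definition antideriv :: "(real \<Rightarrow> real) \<Rightarrow> real \<Rightarrow> real" where
  "antideriv g = (SOME G. G 0 = 0 \<and> (\<forall>x. (G has_real_derivative g x) (at x)))"

lemma antideriv:
  assumes "continuous_on UNIV g"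
  shows "antideriv g 0 = 0" "(antideriv g has_real_derivative g x) (at x)" "continuous_on UNIV (antideriv g)"
proof -
  have *: "antideriv g 0 = 0 \<and> (\<forall>x. (antideriv g has_real_derivative g x) (at x))"
    unfolding antideriv_def by (rule someI_ex[OF real_antiderivative[OF assms]])
  then show "antideriv g 0 = 0" "(antideriv g has_real_derivative g x) (at x)" by auto
  show "continuous_on UNIV (antideriv g)"
    using * by (meson DERIV_continuous continuous_at_imp_continuous_on)
qed

lemma DERIV_exp_bound_right:
  fixes G g :: "real \<Rightarrow> real"
  assumes d: "\<And>x. (G has_real_derivative g x) (at x)" and "G 0 = 0" "N > 0" "B \<ge> 0"
    and b: "\<And>x. 0 \<le> x \<Longrightarrow> g x \<le> B * exp (N * x)" and x: "0 \<le> x"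
  shows "G x \<le> B / N * exp (N * x)"
proof -
  have "B / N * exp (N * 0) - G 0 \<le> B / N * exp (N * x) - G x"
  proof (rule DERIV_nonneg_imp_nondecreasing[OF x])
    fix y :: real assume "0 \<le> y"
    have "((\<lambda>x. B / N * exp (N * x) - G x) has_real_derivative B * exp (N * y) - g y) (at y)"
      using \<open>N > 0\<close> by (auto intro!: derivative_eq_intros d)
    then show "\<exists>z. ((\<lambda>x. B / N * exp (N * x) - G x) has_real_derivative z) (at y) \<and> 0 \<le> z"
      using b[OF \<open>0 \<le> y\<close>] by (intro exI conjI) auto
  qed
  moreover have "0 \<le> B / N * exp (N * 0)" using assms by simp
  ultimately show ?thesis using \<open>G 0 = 0\<close> by linarith
qed

text \<open>Integration from 0 gains a factor \<open>1 / N\<close> in the sup norm with weight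
  \<open>exp (N \<bar>x\<bar>)\<close>. Two integrations make the Picard map of a linear system a
  contraction on the whole line.\<close>

lemma DERIV_exp_bound:
  fixes G g :: "real \<Rightarrow> real"
  assumes d: "\<And>x. (G has_real_derivative g x) (at x)" and G0: "G 0 = 0" and N: "N > 0" and B: "B \<ge> 0"
    and b: "\<And>x. \<bar>g x\<bar> \<le> B * exp (N * \<bar>x\<bar>)"
  shows "\<bar>G x\<bar> \<le> B / N * exp (N * \<bar>x\<bar>)"
proof (cases "0 \<le> x")
  case True
  have "G x \<le> B / N * exp (N * x)"
    by (rule DERIV_exp_bound_right[OF d G0 N B _ True]) (use b in \<open>auto simp: abs_le_iff\<close>, metis abs_of_nonneg b abs_le_iff)
  moreover have "- G x \<le> B / N * exp (N * x)"
    by (rule DERIV_exp_bound_right[OF DERIV_minus[OF d] _ N B _ True])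
      (use G0 in \<open>auto\<close>, metis abs_of_nonneg b abs_le_iff)
  ultimately show ?thesis using True by (simp add: abs_le_iff)
next
  case False
  have d': "((\<lambda>x. G (- x)) has_real_derivative - g (- x)) (at x)" for x
    using d[of "- x"] by (simp add: DERIV_mirror)
  have "G (- (- x)) \<le> B / N * exp (N * (- x))"
    by (rule DERIV_exp_bound_right[OF d' _ N B])
      (use G0 False in \<open>auto\<close>, metis abs_of_nonneg abs_minus_cancel b abs_le_iff)
  moreover have "- G (- (- x)) \<le> B / N * exp (N * (- x))"
    by (rule DERIV_exp_bound_right[OF DERIV_minus[OF d'] _ N B])
      (use G0 False in \<open>auto\<close>, metis abs_of_nonneg abs_minus_cancel b abs_le_iff)
  ultimately show ?thesis using False by (simp add: abs_le_iff)
qed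

text \<open>Picard iteration in an exponentially weighted sup norm (Bielecki's trick): one
  application of the contraction principle gives a global solution, with no continuation of local
  ones.\<close>

lemma linear_ivp:
  fixes c1 c2 :: "real \<Rightarrow> real"
  assumes c1: "continuous_on UNIV c1" "\<And>x. \<bar>c1 x\<bar> \<le> M" and c2: "continuous_on UNIV c2" "\<And>x. \<bar>c2 x\<bar> \<le> M"
  shows "\<exists>U W. U 0 = 1 \<and> W 0 = 0 \<and> (\<forall>x. (U has_real_derivative c1 x * W x) (at x)) \<and>
     (\<forall>x. (W has_real_derivative c2 x * U x) (at x))"
proof -
  have M: "0 \<le> M" using c1(2)[of 0] by linarith
  \<comment> \<open>Then \<open>M / N \<le> 1 / 2\<close>, so the two integrations contract by 1/4;
    the summand 1 keeps \<open>N\<close> positive.\<close>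
  define N where "N = 2 * M + 1"
  have N: "N > 0" using M by (simp add: N_def)
  define wt where "wt x = exp (N * \<bar>x\<bar>)" for x :: real
  have wt: "0 < wt x" "1 \<le> wt x" "continuous_on UNIV wt" for x
    using N by (auto simp: wt_def[abs_def] intro!: continuous_intros)
  define I2 where "I2 f = antideriv (\<lambda>t. c2 t * (wt t * f t))" for f
  define I1 where "I1 f = antideriv (\<lambda>t. c1 t * I2 f t)" for f
  have i2: "I2 f 0 = 0" "(I2 f has_real_derivative c2 x * (wt x * f x)) (at x)" "continuous_on UNIV (I2 f)"
    if "continuous_on UNIV f" for f x
    unfolding I2_def using that by (auto intro!: antideriv continuous_intros c2 wt)
  have i1: "I1 f 0 = 0" "(I1 f has_real_derivative c1 x * I2 f x) (at x)" "continuous_on UNIV (I1 f)"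
    if "continuous_on UNIV f" for f x
    unfolding I1_def using that by (auto intro!: antideriv continuous_intros c1 i2)
  have diff: "\<bar>I1 f x - I1 g x\<bar> \<le> (M / N)\<^sup>2 * d * wt x"
    if fg: "continuous_on UNIV f" "continuous_on UNIV g" and d: "0 \<le> d" "\<And>x. \<bar>f x - g x\<bar> \<le> d" for f g d x
  proof -
    have "\<bar>I2 f x - I2 g x\<bar> \<le> (M * d) / N * exp (N * \<bar>x\<bar>)" for x
    proof (rule DERIV_exp_bound[where G = "\<lambda>x. I2 f x - I2 g x" and g = "\<lambda>x. c2 x * (wt x * f x) - c2 x * (wt x * g x)"])
      fix x
      have "\<bar>c2 x * (wt x * f x) - c2 x * (wt x * g x)\<bar> = \<bar>c2 x\<bar> * \<bar>f x - g x\<bar> * wt x"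
        using wt(1)[of x] by (simp add: abs_mult right_diff_distrib[symmetric])
      also have "\<dots> \<le> M * d * wt x" using c2(2) d M wt(1)[of x] by (intro mult_right_mono mult_mono) auto
      finally show "\<bar>c2 x * (wt x * f x) - c2 x * (wt x * g x)\<bar> \<le> (M * d) * exp (N * \<bar>x\<bar>)" by (simp add: wt_def)
    qed (use i2 fg N M d in \<open>auto intro!: DERIV_diff\<close>)
    then have I2d: "\<bar>I2 f x - I2 g x\<bar> \<le> (M * d) / N * wt x" for x by (simp add: wt_def)
    have "\<bar>I1 f x - I1 g x\<bar> \<le> (M * (M * d / N)) / N * exp (N * \<bar>x\<bar>)"
    proof (rule DERIV_exp_bound[where G = "\<lambda>x. I1 f x - I1 g x" and g = "\<lambda>x. c1 x * I2 f x - c1 x * I2 g x"])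
      fix x
      have "\<bar>c1 x * I2 f x - c1 x * I2 g x\<bar> = \<bar>c1 x\<bar> * \<bar>I2 f x - I2 g x\<bar>"
        by (simp add: abs_mult right_diff_distrib[symmetric])
      also have "\<dots> \<le> M * ((M * d) / N * wt x)" using c1(2) I2d M by (intro mult_mono) auto
      finally show "\<bar>c1 x * I2 f x - c1 x * I2 g x\<bar> \<le> (M * (M * d / N)) * exp (N * \<bar>x\<bar>)" by (simp add: wt_def)
    qed (use i1 fg N M d in \<open>auto intro!: DERIV_diff\<close>)
    then show ?thesis by (simp add: wt_def power2_eq_square)
  qed
  \<comment> \<open>With this, \<open>diff\<close> against the zero function bounds
    \<open>I1\<close> itself.\<close>
  have I10: "I1 (\<lambda>x. 0) x = 0" for x
  proof -
    have e: "(\<lambda>t. c2 t * (wt t * 0)) = (\<lambda>t. 0)" by simp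
    have "\<bar>I2 (\<lambda>x. 0) x\<bar> \<le> 0 / N * exp (N * \<bar>x\<bar>)" for x
      by (rule DERIV_exp_bound[OF i2(2)]) (use N i2(1)[of "\<lambda>x. 0"] in auto)
    then have "\<bar>I1 (\<lambda>x. 0) x\<bar> \<le> 0 / N * exp (N * \<bar>x\<bar>)"
      by (intro DERIV_exp_bound[OF i1(2)]) (use N i1(1)[of "\<lambda>x. 0"] in auto)
    then show ?thesis by simp
  qed
  \<comment> \<open>The unknown is \<open>U / wt\<close>, which stays bounded although
    \<open>U\<close> may grow.\<close>
  define Psi where "Psi f x = (1 + I1 (apply_bcontfun f) x) / wt x" for f :: "real \<Rightarrow>\<^sub>C real" and x
  have fc: "continuous_on UNIV (apply_bcontfun f)" for f :: "real \<Rightarrow>\<^sub>C real" by simp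
  have Pb: "Psi f \<in> bcontfun" for f
  proof (rule bcontfun_normI)
    show "continuous_on UNIV (Psi f)"
      unfolding Psi_def[abs_def] using wt(1) by (intro continuous_intros i1 fc wt) (metis less_irrefl)
    fix x
    have "\<bar>I1 (apply_bcontfun f) x - I1 (\<lambda>x. 0) x\<bar> \<le> (M / N)\<^sup>2 * norm f * wt x"
      by (rule diff) (auto intro: norm_bounded[of f, simplified])
    then have "\<bar>1 + I1 (apply_bcontfun f) x\<bar> \<le> (1 + (M / N)\<^sup>2 * norm f) * wt x"
      using wt(2)[of x] by (simp add: I10 algebra_simps)
    then show "norm (Psi f x) \<le> 1 + (M / N)\<^sup>2 * norm f"
      using wt(1)[of x] by (simp add: Psi_def field_simps)
  qed
  have MN: "(M / N)\<^sup>2 \<le> 1 / 4"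
  proof -
    have "M / N \<le> 1 / 2" using N by (simp add: N_def field_simps)
    then have "(M / N)\<^sup>2 \<le> (1 / 2)\<^sup>2" using M N by (intro power_mono) auto
    then show ?thesis by (simp add: power2_eq_square)
  qed
  have "\<exists>!f. Bcontfun (Psi f) = f"
  proof (rule banach_fix_type)
    show "\<forall>f g. dist (Bcontfun (Psi f)) (Bcontfun (Psi g)) \<le> 1 / 4 * dist f g"
    proof (intro allI dist_bound)
      fix f g :: "real \<Rightarrow>\<^sub>C real" and x
      have "\<bar>I1 (apply_bcontfun f) x - I1 (apply_bcontfun g) x\<bar> \<le> (M / N)\<^sup>2 * dist f g * wt x"
        by (rule diff) (use dist_bounded[of f _ g] in \<open>auto simp: dist_real_def\<close>)
      also have "\<dots> \<le> 1 / 4 * dist f g * wt x" using MN wt(1)[of x] by (intro mult_right_mono) auto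
      finally have "\<bar>I1 (apply_bcontfun f) x - I1 (apply_bcontfun g) x\<bar> / wt x \<le> 1 / 4 * dist f g"
        using wt(1)[of x] by (simp add: field_simps)
      moreover have "Psi f x - Psi g x = (I1 (apply_bcontfun f) x - I1 (apply_bcontfun g) x) / wt x"
        by (simp add: Psi_def diff_divide_distrib add_divide_distrib)
      ultimately show "dist (apply_bcontfun (Bcontfun (Psi f)) x) (apply_bcontfun (Bcontfun (Psi g)) x) \<le> 1 / 4 * dist f g"
        using wt(1)[of x] by (simp add: Bcontfun_inverse Pb dist_real_def)
    qed
  qed auto
  then obtain f where "Bcontfun (Psi f) = f" by blast
  then have fx: "apply_bcontfun f x = Psi f x" for x by (metis Bcontfun_inverse Pb)
  define U where "U x = 1 + I1 (apply_bcontfun f) x" for x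
  have Uf: "wt x * apply_bcontfun f x = U x" for x using wt(1)[of x] by (simp add: fx[of x] Psi_def U_def)
  have "(U has_real_derivative c1 x * I2 (apply_bcontfun f) x) (at x)" for x
    unfolding U_def[abs_def] using DERIV_add[OF DERIV_const i1(2)[OF fc]] by simp
  moreover have "(I2 (apply_bcontfun f) has_real_derivative c2 x * U x) (at x)" for x
    using i2(2)[OF fc, of f x] by (simp add: Uf)
  ultimately show ?thesis
    using i1(1)[OF fc, of f] i2(1)[OF fc, of f] by (intro exI[of _ U] exI[of _ "I2 (apply_bcontfun f)"]) (auto simp: U_def)
qed

text \<open>Gronwall's argument for the squared distance of two solutions whose potentials differ by
  a constant. It yields continuity in the spectral parameter and, for \<open>e = 0\<close>,
  uniqueness.\<close>

lemma ivp_stability: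
  fixes U1 U2 W1 W2 c1 q1 q2 :: "real \<Rightarrow> real"
  assumes U1: "\<And>x. (U1 has_real_derivative c1 x * W1 x) (at x)" and W1: "\<And>x. (W1 has_real_derivative q1 x * U1 x) (at x)"
    and U2: "\<And>x. (U2 has_real_derivative c1 x * W2 x) (at x)" and W2: "\<And>x. (W2 has_real_derivative q2 x * U2 x) (at x)"
    and i: "U1 0 = U2 0" "W1 0 = W2 0"
    and M: "\<And>x. \<bar>c1 x\<bar> \<le> M" "\<And>x. \<bar>q1 x\<bar> \<le> M" and e: "\<And>x. q1 x - q2 x = e"
    and K: "\<And>x. 0 \<le> x \<Longrightarrow> x \<le> X \<Longrightarrow> \<bar>U2 x\<bar> \<le> K" and x: "0 \<le> x" "x \<le> X"
  shows "(U1 x - U2 x)\<^sup>2 + (W1 x - W2 x)\<^sup>2 \<le> (e * K)\<^sup>2 * X * exp ((2 * M + 1) * X)"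
proof -
  \<comment> \<open>\<open>2 * M\<close> absorbs the two cross terms in \<open>u w\<close>, and the
    1 absorbs the \<open>w^2\<close> split off from the forcing term
    \<open>2 w e U2\<close>.\<close>
  define C where "C = 2 * M + 1"
  have C: "0 \<le> C" using M(1)[of 0] by (simp add: C_def)
  define u w where "u x = U1 x - U2 x" and "w x = W1 x - W2 x" for x
  have ud: "(u has_real_derivative c1 x * w x) (at x)" for x
    unfolding u_def[abs_def] w_def right_diff_distrib by (intro DERIV_diff U1 U2)
  have wd: "(w has_real_derivative q1 x * u x + e * U2 x) (at x)" for x
    unfolding w_def[abs_def]
    by (rule DERIV_cong[OF DERIV_diff[OF W1 W2]]) (simp add: u_def e[of x, symmetric] algebra_simps)
  define D where "D x = (u x)\<^sup>2 + (w x)\<^sup>2" for x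
  define D' where "D' x = 2 * u x * (c1 x * w x) + 2 * w x * (q1 x * u x + e * U2 x)" for x
  have Dd: "(D has_real_derivative D' x) (at x)" for x
    unfolding D_def[abs_def] D'_def by (auto intro!: derivative_eq_intros ud wd)
  have D'b: "D' y \<le> C * D y + (e * K)\<^sup>2" if y: "0 \<le> y" "y \<le> X" for y
  proof -
    have uw: "2 * \<bar>u y * w y\<bar> \<le> D y"
      using zero_le_power2[of "\<bar>u y\<bar> - \<bar>w y\<bar>"] by (simp add: D_def power2_eq_square algebra_simps abs_mult)
    have m: "2 * (a * (u y * w y)) \<le> M * D y" if "\<bar>a\<bar> \<le> M" for a
    proof -
      have "2 * (a * (u y * w y)) \<le> \<bar>a\<bar> * (2 * \<bar>u y * w y\<bar>)" by (metis abs_ge_self abs_mult mult.left_commute mult_left_mono zero_le_numeral)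
      also have "\<dots> \<le> M * D y" using that uw by (intro mult_mono) auto
      finally show ?thesis .
    qed
    have "(e * U2 y)\<^sup>2 \<le> (e * K)\<^sup>2"
      using K[OF y] by (simp add: abs_le_square_iff[symmetric] abs_mult mult_left_mono)
    moreover have "2 * (w y * (e * U2 y)) \<le> (w y)\<^sup>2 + (e * U2 y)\<^sup>2"
      using zero_le_power2[of "w y - e * U2 y"] by (simp add: power2_eq_square algebra_simps)
    moreover have "(w y)\<^sup>2 \<le> D y" by (simp add: D_def)
    ultimately have "2 * (w y * (e * U2 y)) \<le> D y + (e * K)\<^sup>2" by linarith
    moreover have "D' y = 2 * (c1 y * (u y * w y)) + 2 * (q1 y * (u y * w y)) + 2 * (w y * (e * U2 y))"
      by (simp add: D'_def algebra_simps)
    ultimately show ?thesis using m[OF M(1)[of y]] m[OF M(2)[of y]] by (simp add: C_def algebra_simps)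
  qed
  have "exp (- C * x) * D x - (e * K)\<^sup>2 * x \<le> exp (- C * 0) * D 0 - (e * K)\<^sup>2 * 0"
  proof (rule DERIV_nonpos_imp_nonincreasing[OF x(1)])
    fix y assume y: "0 \<le> y" "y \<le> x"
    have "((\<lambda>x. exp (- C * x) * D x - (e * K)\<^sup>2 * x) has_real_derivative
        exp (- C * y) * (D' y - C * D y) - (e * K)\<^sup>2) (at y)"
      by (auto intro!: derivative_eq_intros Dd simp: algebra_simps)
    moreover have "exp (- C * y) * (D' y - C * D y) \<le> exp (- C * y) * (e * K)\<^sup>2"
      using D'b[of y] y x by (intro mult_left_mono) auto
    moreover have "exp (- C * y) * (e * K)\<^sup>2 \<le> 1 * (e * K)\<^sup>2" using C y by (intro mult_right_mono) auto
    ultimately show "\<exists>z. ((\<lambda>x. exp (- C * x) * D x - (e * K)\<^sup>2 * x) has_real_derivative z) (at y) \<and> z \<le> 0"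
      by (intro exI conjI) (assumption, linarith)
  qed
  then have "exp (- C * x) * D x \<le> (e * K)\<^sup>2 * x" using i by (simp add: D_def u_def w_def)
  then have "D x \<le> (e * K)\<^sup>2 * x * exp (C * x)" by (simp add: exp_minus field_simps)
  also have "\<dots> \<le> (e * K)\<^sup>2 * X * exp (C * X)"
    using x C by (intro mult_mono) (auto intro: mult_left_mono)
  finally show ?thesis by (simp add: D_def u_def w_def C_def)
qed

subsection \<open>The ground state, by shooting\<close>

text \<open>\<open>v\<close> is a known solution at energy zero and \<open>vf = P v'\<close> is its
  flux: it is odd, decays, and has its only zero at the origin. Beyond \<open>X\<close> the
  potential is at least \<open>\<delta>\<close>, so that solutions do not oscillate there for
  parameters below \<open>\<delta>\<close>.\<close>

locale even_sturm_liouville = leading_coefficient +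
  fixes Q v vf :: "real \<Rightarrow> real" and qb \<delta> X :: real
  assumes Q_cont: "continuous_on UNIV Q" and Q_bound: "\<And>x. \<bar>Q x\<bar> \<le> qb"
    and P_even: "\<And>x. P (- x) = P x" and Q_even: "\<And>x. Q (- x) = Q x"
    and \<delta>_pos: "0 < \<delta>" and X_pos: "0 < X" and Q_far: "\<And>x. X \<le> x \<Longrightarrow> \<delta> \<le> Q x"
    and v_deriv: "\<And>x. (v has_real_derivative vf x / P x) (at x)"
    and vf_deriv: "\<And>x. (vf has_real_derivative Q x * v x) (at x)"
    and v_0: "v 0 = 0" and vf_0: "0 < vf 0" and v_pos: "\<And>x. 0 < x \<Longrightarrow> 0 < v x"
    and v_lim: "(v \<longlongrightarrow> 0) at_top"
    and v_odd: "\<And>x. v (- x) = - v x" and vf_even: "\<And>x. vf (- x) = vf x"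
begin

lemma pu_pos: "0 < pu"
  using P_pos[of 0] P_upper[of 0] by linarith

text \<open>The energy \<open>W^2 - s U^2\<close> has derivative \<open>2 U W (q - s / P)\<close>
  with \<open>U W \<le> 0\<close>. It does not increase for \<open>s = d pl\<close> and does not
  decrease for \<open>s = M pu\<close>. A violation of either inequality at one point therefore
  persists, and then drives \<open>W\<close> above 0 or \<open>U\<close> down to 0, against the sign
  hypotheses.\<close>

lemma decaying_solution_bounds:
  fixes U W q :: "real \<Rightarrow> real"
  assumes Ud: "\<And>x. x0 \<le> x \<Longrightarrow> (U has_real_derivative W x / P x) (at x)"
    and Wd: "\<And>x. x0 \<le> x \<Longrightarrow> (W has_real_derivative q x * U x) (at x)"
    and U: "\<And>x. x0 \<le> x \<Longrightarrow> 0 < U x" and W: "\<And>x. x0 \<le> x \<Longrightarrow> W x \<le> 0"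
    and q: "0 < d" "\<And>x. x0 \<le> x \<Longrightarrow> d \<le> q x" "\<And>x. x0 \<le> x \<Longrightarrow> q x \<le> M"
  shows "\<exists>\<kappa> K. 0 < \<kappa> \<and> (\<forall>x\<ge>x0. \<kappa> * U x \<le> - W x \<and> - W x \<le> K * U x)"
proof -
  have M: "0 \<le> M" using q(1) q(2)[of x0] q(3)[of x0] by simp
  define \<kappa> K where "\<kappa> = sqrt (d * pl)" and "K = sqrt (M * pu)"
  have \<kappa>: "0 < \<kappa>" "\<kappa>\<^sup>2 = d * pl" using q(1) pl_pos by (simp_all add: \<kappa>_def)
  have K: "0 \<le> K" "K\<^sup>2 = M * pu" using M pu_pos by (simp_all add: K_def)
  have Hd: "((\<lambda>x. (W x)\<^sup>2 - s * (U x)\<^sup>2) has_real_derivative 2 * (U x * W x) * (q x - s / P x)) (at x)" if "x0 \<le> x" for x s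
    using P_pos[of x] by (auto intro!: derivative_eq_intros Ud Wd that simp: field_simps)
  have UW: "U x * W x \<le> 0" if "x0 \<le> x" for x
    using U[OF that] W[OF that] by (simp add: mult_nonneg_nonpos)
  have 1: "\<kappa> * U y \<le> - W y" if y: "x0 \<le> y" for y
  proof (rule ccontr)
    assume "\<not> ?thesis"
    then have "(- W y)\<^sup>2 < (\<kappa> * U y)\<^sup>2" using W[OF y] by (intro power_strict_mono) auto
    then have "0 < \<kappa>\<^sup>2 * (U y)\<^sup>2 - (W y)\<^sup>2" by (simp add: power_mult_distrib)
    define e where "e = \<kappa>\<^sup>2 * (U y)\<^sup>2 - (W y)\<^sup>2"
    have e: "0 < e" using \<open>0 < \<kappa>\<^sup>2 * (U y)\<^sup>2 - (W y)\<^sup>2\<close> by (simp add: e_def)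
    define u0 where "u0 = sqrt e / \<kappa>"
    have u0: "0 < u0" using e \<kappa> by (simp add: u0_def)
    have Ul: "u0 \<le> U x" if x: "y \<le> x" for x
    proof -
      have "(W x)\<^sup>2 - \<kappa>\<^sup>2 * (U x)\<^sup>2 \<le> (W y)\<^sup>2 - \<kappa>\<^sup>2 * (U y)\<^sup>2"
      proof (rule DERIV_nonpos_imp_nonincreasing[OF x])
        fix z assume z: "y \<le> z" "z \<le> x"
        have "d * pl \<le> d * P z" using P_lower[of z] q(1) by simp
        then have "\<kappa>\<^sup>2 / P z \<le> d" using P_pos[of z] by (simp add: \<kappa> divide_le_eq)
        then have "0 \<le> q z - \<kappa>\<^sup>2 / P z" using q(2)[of z] y z by linarith
        then have "2 * (U z * W z) * (q z - \<kappa>\<^sup>2 / P z) \<le> 0"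
          using UW[of z] y z by (simp add: mult_nonpos_nonneg)
        then show "\<exists>t. ((\<lambda>x. (W x)\<^sup>2 - \<kappa>\<^sup>2 * (U x)\<^sup>2) has_real_derivative t) (at z) \<and> t \<le> 0"
          using Hd[OF order_trans[OF y z(1)], of "\<kappa>\<^sup>2"] by blast
      qed
      then have "e \<le> \<kappa>\<^sup>2 * (U x)\<^sup>2" using zero_le_power2[of "W x"] unfolding e_def by linarith
      then have "sqrt e \<le> \<kappa> * U x"
        using \<kappa> U[of x] x y by (intro real_le_lsqrt) (auto simp: power_mult_distrib)
      then show ?thesis using \<kappa> by (simp add: u0_def field_simps)
    qed
    \<comment> \<open>By this point growth of \<open>W\<close> at rate at least
      \<open>d * u0\<close> has lifted it to 1 or more.\<close>
    define x where "x = y + (1 - W y) / (d * u0)"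
    have x: "y \<le> x" using W[OF y] q(1) u0 by (simp add: x_def)
    have "W y - d * u0 * y \<le> W x - d * u0 * x"
    proof (rule DERIV_nonneg_imp_nondecreasing[OF x])
      fix z assume z: "y \<le> z" "z \<le> x"
      have "((\<lambda>x. W x - d * u0 * x) has_real_derivative q z * U z - d * u0) (at z)"
        by (auto intro!: derivative_eq_intros Wd) (use y z in auto)
      moreover have "d * u0 \<le> q z * U z" using q(1) q(2)[of z] Ul[of z] u0 y z by (intro mult_mono) auto
      ultimately show "\<exists>t. ((\<lambda>x. W x - d * u0 * x) has_real_derivative t) (at z) \<and> 0 \<le> t"
        by (intro exI conjI) auto
    qed
    moreover have "d * u0 * x - d * u0 * y = 1 - W y" using q(1) u0 by (simp add: x_def field_simps)
    ultimately have "1 \<le> W x" by linarith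
    then show False using W[of x] x y by linarith
  qed
  have 2: "- W y \<le> K * U y" if y: "x0 \<le> y" for y
  proof (rule ccontr)
    assume "\<not> ?thesis"
    then have "(K * U y)\<^sup>2 < (- W y)\<^sup>2" using K U[OF y] by (intro power_strict_mono) auto
    then have "0 < (W y)\<^sup>2 - K\<^sup>2 * (U y)\<^sup>2" by (simp add: power_mult_distrib)
    define e where "e = (W y)\<^sup>2 - K\<^sup>2 * (U y)\<^sup>2"
    have e: "0 < e" using \<open>0 < (W y)\<^sup>2 - K\<^sup>2 * (U y)\<^sup>2\<close> by (simp add: e_def)
    have Wl: "W x \<le> - sqrt e" if x: "y \<le> x" for x
    proof -
      have "(W y)\<^sup>2 - K\<^sup>2 * (U y)\<^sup>2 \<le> (W x)\<^sup>2 - K\<^sup>2 * (U x)\<^sup>2"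
      proof (rule DERIV_nonneg_imp_nondecreasing[OF x])
        fix z assume z: "y \<le> z" "z \<le> x"
        have "M * P z \<le> M * pu" using P_upper[of z] M by (intro mult_left_mono) auto
        then have "M \<le> K\<^sup>2 / P z" using P_pos[of z] by (simp add: K le_divide_eq)
        then have "q z - K\<^sup>2 / P z \<le> 0" using q(3)[of z] y z by linarith
        then have "0 \<le> 2 * (U z * W z) * (q z - K\<^sup>2 / P z)"
          using UW[of z] y z by (simp add: mult_nonpos_nonpos)
        then show "\<exists>t. ((\<lambda>x. (W x)\<^sup>2 - K\<^sup>2 * (U x)\<^sup>2) has_real_derivative t) (at z) \<and> 0 \<le> t"
          using Hd[OF order_trans[OF y z(1)], of "K\<^sup>2"] by blast
      qed
      then have "e \<le> (- W x)\<^sup>2" using mult_nonneg_nonneg[of "K\<^sup>2" "(U x)\<^sup>2"] unfolding e_def power2_minus by (smt (verit) zero_le_power2)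
      then have "sqrt e \<le> - W x" using W[of x] x y by (intro real_le_lsqrt) auto
      then show ?thesis by linarith
    qed
    define s where "s = sqrt e / pu"
    have s: "0 < s" using e pu_pos by (simp add: s_def)
    \<comment> \<open>\<open>U\<close> falls at rate at least \<open>s\<close>, so it has reached 0
      by this point.\<close>
    define x where "x = y + U y / s"
    have x: "y \<le> x" using U[OF y] s by (simp add: x_def)
    have "U x + s * x \<le> U y + s * y"
    proof (rule DERIV_nonpos_imp_nonincreasing[OF x])
      fix z assume z: "y \<le> z" "z \<le> x"
      have "((\<lambda>x. U x + s * x) has_real_derivative W z / P z + s) (at z)"
        by (auto intro!: derivative_eq_intros Ud) (use y z in auto)
      moreover have "W z / P z + s \<le> 0"
      proof -
        have "s \<le> sqrt e / P z" unfolding s_def using P_pos[of z] P_upper[of z] e by (intro divide_left_mono) auto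
        also have "\<dots> \<le> - W z / P z" using Wl[of z] z P_pos[of z] by (intro divide_right_mono) auto
        finally show ?thesis by simp
      qed
      ultimately show "\<exists>t. ((\<lambda>x. U x + s * x) has_real_derivative t) (at z) \<and> t \<le> 0"
        by (intro exI conjI) auto
    qed
    moreover have "s * x - s * y = U y" using s by (simp add: x_def field_simps)
    ultimately have "U x \<le> 0" by linarith
    then show False using U[of x] x y by linarith
  qed
  show ?thesis using 1 2 \<kappa>(1) by blast
qed

text \<open>The shooting problem for \<open>- (P U')' + Q U = l U\<close> with even initial data, as
  a first-order system in \<open>U\<close> and the flux \<open>W = P U'\<close>, so that no
  derivative of \<open>P\<close> enters.\<close>

definition is_sol :: "real \<Rightarrow> (real \<Rightarrow> real) \<Rightarrow> (real \<Rightarrow> real) \<Rightarrow> bool" where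
  "is_sol l U W \<longleftrightarrow> U 0 = 1 \<and> W 0 = 0 \<and> (\<forall>x. (U has_real_derivative W x / P x) (at x)) \<and>
     (\<forall>x. (W has_real_derivative (Q x - l) * U x) (at x))"

lemma is_solD:
  assumes "is_sol l U W"
  shows "U 0 = 1" "W 0 = 0" "(U has_real_derivative W x / P x) (at x)"
    "(W has_real_derivative (Q x - l) * U x) (at x)" "continuous_on A U" "continuous_on A W"
  using assms unfolding is_sol_def by (auto, (meson DERIV_continuous continuous_at_imp_continuous_on)+)

lemma inverse_P_bound: "\<bar>1 / P x\<bar> \<le> 1 / pl"
  using P_lower[of x] P_pos[of x] pl_pos by (simp add: frac_le)

lemma sol_exists: "\<exists>U W. is_sol l U W"
proof -
  let ?M = "max (1 / pl) (qb + \<bar>l\<bar>)"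
  have "\<exists>U W. U 0 = 1 \<and> W 0 = 0 \<and> (\<forall>x. (U has_real_derivative (1 / P x) * W x) (at x)) \<and>
     (\<forall>x. (W has_real_derivative (Q x - l) * U x) (at x))"
  proof (rule linear_ivp[where M = ?M])
    show "continuous_on UNIV (\<lambda>x. 1 / P x)" by (intro continuous_intros P_cont) (simp add: P_nz)
    show "continuous_on UNIV (\<lambda>x. Q x - l)" by (intro continuous_intros Q_cont)
    show "\<bar>1 / P x\<bar> \<le> ?M" for x using inverse_P_bound[of x] by simp
    show "\<bar>Q x - l\<bar> \<le> ?M" for x using Q_bound[of x] by linarith
  qed
  then show ?thesis by (auto simp: is_sol_def)
qed

lemma sol_stability:
  assumes s: "is_sol l U W" and t: "is_sol l' U' W'" and m: "\<bar>l\<bar> \<le> m"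
    and K: "\<And>x. 0 \<le> x \<Longrightarrow> x \<le> x1 \<Longrightarrow> \<bar>U' x\<bar> \<le> K" and x: "0 \<le> x" "x \<le> x1"
  shows "(U x - U' x)\<^sup>2 + (W x - W' x)\<^sup>2 \<le> ((l' - l) * K)\<^sup>2 * x1 * exp ((2 * max (1 / pl) (qb + m) + 1) * x1)"
proof (rule ivp_stability[where ?U1.0 = U and ?U2.0 = U' and ?W1.0 = W and ?W2.0 = W' and x = x and ?c1.0 = "\<lambda>x. 1 / P x" and ?q1.0 = "\<lambda>x. Q x - l" and ?q2.0 = "\<lambda>x. Q x - l'"])
  show "\<bar>1 / P x\<bar> \<le> max (1 / pl) (qb + m)" for x using inverse_P_bound[of x] by simp
  show "\<bar>Q x - l\<bar> \<le> max (1 / pl) (qb + m)" for x using Q_bound[of x] m by linarith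
qed (use is_solD[OF s] is_solD[OF t] K x in auto)

text \<open>The reflected pair solves the same problem, and the stability estimate with equal
  parameters is uniqueness.\<close>

lemma sol_even:
  assumes s: "is_sol l U W"
  shows "U (- x) = U x" "W (- x) = - W x"
proof -
  have r: "is_sol l (\<lambda>x. U (- x)) (\<lambda>x. - W (- x))"
    unfolding is_sol_def
  proof (intro conjI allI)
    fix x
    show "((\<lambda>x. U (- x)) has_real_derivative - W (- x) / P x) (at x)"
      using is_solD(3)[OF s, of "- x"] by (simp add: DERIV_mirror P_even)
    have "((\<lambda>x. W (- x)) has_real_derivative - ((Q x - l) * U (- x))) (at x)"
      using is_solD(4)[OF s, of "- x"] by (simp add: DERIV_mirror Q_even)
    from DERIV_minus[OF this]
    show "((\<lambda>x. - W (- x)) has_real_derivative (Q x - l) * U (- x)) (at x)" by simp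
  qed (use is_solD[OF s] in auto)
  have "U (- x) = U x \<and> W (- x) = - W x" if "0 \<le> x" for x
  proof -
    have "compact ((\<lambda>x. U (- x)) ` {0..x})"
      by (intro compact_continuous_image is_solD(5)[OF r]) auto
    then obtain K where K: "\<And>y. y \<in> {0..x} \<Longrightarrow> norm (U (- y)) \<le> K"
      by (metis (no_types, lifting) compact_imp_bounded bounded_iff image_eqI)
    have "(U x - U (- x))\<^sup>2 + (W x - - W (- x))\<^sup>2 \<le> ((l - l) * K)\<^sup>2 * x * exp ((2 * max (1 / pl) (qb + \<bar>l\<bar>) + 1) * x)"
      by (rule sol_stability[OF s r]) (use K that in auto)
    then show ?thesis by (simp add: sum_power2_le_zero_iff add_eq_0_iff)
  qed
  from this[of x] this[of "- x"] show "U (- x) = U x" "W (- x) = - W x"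
    by (cases "0 \<le> x"; auto)+
qed

lemma sol_close:
  assumes s: "is_sol l U W" and e: "0 < e" and x1: "0 \<le> x1"
  shows "\<exists>h>0. \<forall>l' U' W'. \<bar>l' - l\<bar> < h \<longrightarrow> is_sol l' U' W' \<longrightarrow>
    (\<forall>x. 0 \<le> x \<longrightarrow> x \<le> x1 \<longrightarrow> \<bar>U' x - U x\<bar> < e \<and> \<bar>W' x - W x\<bar> < e)"
proof -
  have "compact (U ` {0..x1})"
    by (intro compact_continuous_image is_solD(5)[OF s]) auto
  then obtain K where K: "\<And>y. y \<in> {0..x1} \<Longrightarrow> norm (U y) \<le> K"
    by (metis (no_types, lifting) compact_imp_bounded bounded_iff image_eqI)
  define B where "B = K\<^sup>2 * x1 * exp ((2 * max (1 / pl) (qb + (\<bar>l\<bar> + 1)) + 1) * x1)"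
  have B: "0 \<le> B" using x1 by (simp add: B_def)
  \<comment> \<open>The cap 1 keeps \<open>\<bar>l'\<bar> \<le> \<bar>l\<bar> + 1\<close>, the range
    for which \<open>B\<close> is valid; the other term makes the squared distance less than
    \<open>e^2\<close>.\<close>
  define h where "h = min 1 (e / sqrt (B + 1))"
  have h: "0 < h" using e B by (simp add: h_def)
  have "\<bar>U' x - U x\<bar> < e \<and> \<bar>W' x - W x\<bar> < e"
    if l': "\<bar>l' - l\<bar> < h" and t: "is_sol l' U' W'" and x: "0 \<le> x" "x \<le> x1" for l' U' W' x
  proof -
    have "(U' x - U x)\<^sup>2 + (W' x - W x)\<^sup>2 \<le> ((l - l') * K)\<^sup>2 * x1 * exp ((2 * max (1 / pl) (qb + (\<bar>l\<bar> + 1)) + 1) * x1)"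
      by (rule sol_stability[OF t s]) (use K x l' in \<open>auto simp: h_def\<close>)
    also have "\<dots> = \<bar>l' - l\<bar>\<^sup>2 * B" by (simp add: B_def power_mult_distrib power2_commute)
    also have "\<dots> \<le> \<bar>l' - l\<bar>\<^sup>2 * (B + 1)" by (intro mult_left_mono) auto
    also have "\<dots> < (e / sqrt (B + 1))\<^sup>2 * (B + 1)"
      using l' B e by (intro mult_strict_right_mono power_strict_mono) (auto simp: h_def)
    also have "\<dots> = e\<^sup>2" using B by (simp add: power_divide)
    finally have "(U' x - U x)\<^sup>2 + (W' x - W x)\<^sup>2 < e\<^sup>2" .
    then have "(U' x - U x)\<^sup>2 < e\<^sup>2" "(W' x - W x)\<^sup>2 < e\<^sup>2"
      using zero_le_power2[of "U' x - U x"] zero_le_power2[of "W' x - W x"] by linarith+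
    then show ?thesis using e by (metis abs_le_square_iff abs_of_pos linorder_not_less)
  qed
  then show ?thesis using h by blast
qed

text \<open>A nontrivial solution has no double zero: with a large enough exponential weight
  \<open>U^2 + W^2\<close> is nondecreasing, and it starts at 1.\<close>

lemma sol_nondegenerate:
  assumes s: "is_sol l U W" and x: "0 \<le> x"
  shows "\<not> (U x = 0 \<and> W x = 0)"
proof
  assume z: "U x = 0 \<and> W x = 0"
  define C where "C = 1 / pl + (qb + \<bar>l\<bar>)"
  have "exp (C * 0) * ((U 0)\<^sup>2 + (W 0)\<^sup>2) \<le> exp (C * x) * ((U x)\<^sup>2 + (W x)\<^sup>2)"
  proof (rule DERIV_nonneg_imp_nondecreasing[OF x])
    fix y
    let ?D' = "2 * U y * (W y / P y) + 2 * W y * ((Q y - l) * U y)"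
    have d: "((\<lambda>x. exp (C * x) * ((U x)\<^sup>2 + (W x)\<^sup>2)) has_real_derivative
        exp (C * y) * (C * ((U y)\<^sup>2 + (W y)\<^sup>2) + ?D')) (at y)"
      by (auto intro!: derivative_eq_intros is_solD[OF s] simp: algebra_simps)
    have uw: "2 * \<bar>U y * W y\<bar> \<le> (U y)\<^sup>2 + (W y)\<^sup>2"
      using zero_le_power2[of "\<bar>U y\<bar> - \<bar>W y\<bar>"] by (simp add: power2_eq_square algebra_simps abs_mult)
    have m: "\<bar>1 / P y + (Q y - l)\<bar> \<le> C"
      using inverse_P_bound[of y] Q_bound[of y] unfolding C_def by linarith
    have e: "?D' = (1 / P y + (Q y - l)) * (2 * (U y * W y))" by (simp add: algebra_simps)
    have "\<bar>?D'\<bar> = \<bar>1 / P y + (Q y - l)\<bar> * (2 * \<bar>U y * W y\<bar>)"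
      unfolding e by (simp add: abs_mult)
    also have "\<dots> \<le> C * ((U y)\<^sup>2 + (W y)\<^sup>2)" using m uw by (intro mult_mono) auto
    finally have "0 \<le> C * ((U y)\<^sup>2 + (W y)\<^sup>2) + ?D'" by linarith
    then show "\<exists>t. ((\<lambda>x. exp (C * x) * ((U x)\<^sup>2 + (W x)\<^sup>2)) has_real_derivative t) (at y) \<and> 0 \<le> t"
      using d by (intro exI conjI) (assumption, simp only: mult_nonneg_nonneg exp_ge_zero)
  qed
  then show False using z is_solD(1,2)[OF s] by simp
qed

text \<open>Where \<open>Q \<ge> l\<close> there is no turning back: the derivative of
  \<open>U W\<close> is a sum of squares with nonnegative weights, whatever the sign of
  \<open>U\<close>. So \<open>U W\<close> stays nonnegative and \<open>U^2\<close> does not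
  decrease, which keeps \<open>U\<close> away from 0.\<close>

lemma sol_positive_after:
  assumes s: "is_sol l U W" and U1: "0 < U x1" and W1: "0 \<le> W x1" and q: "\<And>x. x1 \<le> x \<Longrightarrow> l \<le> Q x"
    and x: "x1 \<le> x"
  shows "0 < U x"
proof -
  have UW: "0 \<le> U y * W y" if y: "x1 \<le> y" for y
  proof -
    have "U x1 * W x1 \<le> U y * W y"
    proof (rule DERIV_nonneg_imp_nondecreasing[OF y])
      fix z assume z: "x1 \<le> z" "z \<le> y"
      have "((\<lambda>x. U x * W x) has_real_derivative (W z)\<^sup>2 / P z + (Q z - l) * (U z)\<^sup>2) (at z)"
        by (auto intro!: derivative_eq_intros is_solD[OF s] simp: power2_eq_square algebra_simps)
      moreover have "0 \<le> (W z)\<^sup>2 / P z + (Q z - l) * (U z)\<^sup>2"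
        using P_pos[of z] q[OF z(1)] by simp
      ultimately show "\<exists>t. ((\<lambda>x. U x * W x) has_real_derivative t) (at z) \<and> 0 \<le> t" by blast
    qed
    then show ?thesis using U1 W1 mult_nonneg_nonneg[of "U x1" "W x1"] by linarith
  qed
  have nz: "U y \<noteq> 0" if y: "x1 \<le> y" for y
  proof -
    have "(U x1)\<^sup>2 \<le> (U y)\<^sup>2"
    proof (rule DERIV_nonneg_imp_nondecreasing[OF y])
      fix z assume z: "x1 \<le> z" "z \<le> y"
      have "((\<lambda>x. (U x)\<^sup>2) has_real_derivative 2 * (U z * W z) / P z) (at z)"
        by (auto intro!: derivative_eq_intros is_solD[OF s])
      moreover have "0 \<le> 2 * (U z * W z) / P z"
        using UW[OF z(1)] P_pos[of z] by simp
      ultimately show "\<exists>t. ((\<lambda>x. (U x)\<^sup>2) has_real_derivative t) (at z) \<and> 0 \<le> t" by blast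
    qed
    then show ?thesis using U1 by auto
  qed
  show ?thesis
  proof (rule ccontr)
    assume "\<not> 0 < U x"
    then have "\<exists>y. x1 \<le> y \<and> y \<le> x \<and> U y = 0"
      using U1 x by (intro IVT2' is_solD(5)[OF s]) auto
    then show False using nz by blast
  qed
qed

text \<open>This makes the eigenvalue strictly negative. The Wronskian of \<open>U\<close> with
  \<open>v\<close> is the positive constant \<open>vf 0\<close>, so \<open>U / v\<close> has
  derivative \<open>- vf 0 / (P v^2)\<close>. Once \<open>v < 1\<close> it falls at a rate bounded
  away from zero and must become negative.\<close>

lemma sol_zero_sign_change:
  assumes s: "is_sol 0 U W"
  shows "\<exists>x\<ge>0. U x < 0"
proof (rule ccontr)
  assume "\<not> ?thesis"
  then have U: "0 \<le> U x" if "0 \<le> x" for x using that by (meson linorder_not_le)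
  have wr: "U x * vf x - v x * W x = vf 0" for x
  proof -
    have "((\<lambda>x. U x * vf x - v x * W x) has_real_derivative 0) (at x)" for x
      by (auto intro!: derivative_eq_intros is_solD[OF s] v_deriv vf_deriv simp: algebra_simps)
    then have "U x * vf x - v x * W x = U 0 * vf 0 - v 0 * W 0"
      using DERIV_isconst_all by blast
    then show ?thesis using is_solD[OF s] v_0 by simp
  qed
  have "eventually (\<lambda>x. v x < 1) at_top" using v_lim by (rule order_tendstoD) simp
  then obtain y0 where y0: "\<And>x. y0 \<le> x \<Longrightarrow> v x < 1" by (auto simp: eventually_at_top_linorder)
  define y where "y = max y0 1"
  have y: "0 < y" "\<And>x. y \<le> x \<Longrightarrow> v x < 1" using y0 by (auto simp: y_def)
  define s where "s = vf 0 / pu"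
  have s0: "0 < s" using vf_0 pu_pos by (simp add: s_def)
  \<comment> \<open>At rate at least \<open>s\<close>, the quotient \<open>U / v\<close> has fallen
    from its value at \<open>y\<close> to -1 or below by this point.\<close>
  define x where "x = y + (U y / v y + 1) / s"
  have x: "y \<le> x" using U[of y] v_pos[OF y(1)] y(1) s0 by (simp add: x_def)
  have "U x / v x + s * x \<le> U y / v y + s * y"
  proof (rule DERIV_nonpos_imp_nonincreasing[OF x])
    fix z assume z: "y \<le> z" "z \<le> x"
    have vz: "0 < v z" using v_pos y z by auto
    have "((\<lambda>x. U x / v x + s * x) has_real_derivative
        (W z / P z * v z - U z * (vf z / P z)) / (v z * v z) + s) (at z)"
      using vz by (auto intro!: derivative_eq_intros is_solD[OF assms] v_deriv)
    moreover have "W z / P z * v z - U z * (vf z / P z) = - (vf 0 / P z)"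
      using wr[of z] P_pos[of z] by (simp add: field_simps)
    moreover have "- (vf 0 / P z) / (v z * v z) + s \<le> 0"
    proof -
      have "v z * v z \<le> 1 * 1" using vz y(2)[OF z(1)] by (intro mult_mono) auto
      then have "P z * (v z * v z) \<le> pu * 1" using P_upper[of z] pu_pos vz by (intro mult_mono) auto
      then have "vf 0 / pu \<le> vf 0 / (P z * (v z * v z))"
        using vf_0 vz P_pos[of z] pu_pos by (intro divide_left_mono) auto
      then show ?thesis by (simp add: s_def)
    qed
    ultimately show "\<exists>t. ((\<lambda>x. U x / v x + s * x) has_real_derivative t) (at z) \<and> t \<le> 0" by auto
  qed
  moreover have "s * x - s * y = U y / v y + 1" using s0 by (simp add: x_def field_simps)
  ultimately have "U x / v x \<le> - 1" by linarith
  moreover have "0 \<le> U x / v x" using U[of x] v_pos[of x] x y(1) by simp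
  ultimately show False by linarith
qed

text \<open>The eigenvalue is the infimum of the nonpositive parameters whose even solution becomes
  negative to the right of 0. At the infimum the solution is nonnegative by continuity in the
  parameter; a zero would be a minimum and hence a double zero. Nonpositive flux beyond
  \<open>X\<close> excludes exponential growth, and \<open>decaying_solution_bounds\<close> turns it
  into decay.\<close>

theorem ground_state:
  obtains l U W K C m where "l < 0" "is_sol l U W" "\<And>x. 0 < U x" "\<And>x. \<bar>W x\<bar> \<le> K * U x"
    "0 < m" "\<And>x. U x \<le> C * exp (- m * \<bar>x\<bar>)"
proof -
  define Neg where "Neg = {l. l \<le> 0 \<and> (\<exists>U W. is_sol l U W \<and> (\<exists>x\<ge>0. U x < 0))}"
  have N0: "0 \<in> Neg" using sol_exists[of 0] sol_zero_sign_change by (auto simp: Neg_def)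
  \<comment> \<open>For \<open>l < - qb\<close> the coefficient \<open>Q - l\<close> is nonnegative
    everywhere, and the solution stays positive from 0 on.\<close>
  have lb: "- qb \<le> l" if lN: "l \<in> Neg" for l
  proof (rule ccontr)
    assume l: "\<not> - qb \<le> l"
    obtain U W x where s: "is_sol l U W" "0 \<le> x" "U x < 0" using lN by (auto simp: Neg_def)
    have "l \<le> Q y" for y using Q_bound[of y] l by (simp add: abs_le_iff)
    then have "0 < U x" using is_solD(1,2)[OF s(1)] s(2) by (intro sol_positive_after[OF s(1), of 0 x]) simp_all
    then show False using s(3) by simp
  qed
  define l where "l = Inf Neg"
  have bdd: "bdd_below Neg" using lb by (auto simp: bdd_below_def)
  obtain U W where s: "is_sol l U W" using sol_exists by blast
  \<comment> \<open>The sign change at parameter 0 survives a small decrease of the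
    parameter.\<close>
  have l_neg: "l < 0"
  proof -
    obtain U0 W0 x where s0: "is_sol 0 U0 W0" "0 \<le> x" "U0 x < 0"
      using sol_exists[of 0] sol_zero_sign_change by blast
    obtain h where h: "0 < h" "\<And>l' U' W'. \<bar>l' - 0\<bar> < h \<Longrightarrow> is_sol l' U' W' \<Longrightarrow> \<bar>U' x - U0 x\<bar> < - U0 x"
      using sol_close[OF s0(1) _ s0(2), of "- U0 x"] s0(2,3) by (metis neg_0_less_iff_less order_refl)
    obtain U' W' where s': "is_sol (- h / 2) U' W'" using sol_exists by blast
    have "U' x < 0" using h(2)[OF _ s'] h(1) by simp
    then have "- h / 2 \<in> Neg" using s' s0(2) h(1) by (auto simp: Neg_def)
    then have "l \<le> - h / 2" unfolding l_def by (rule cInf_lower[OF _ bdd])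
    then show ?thesis using h(1) by simp
  qed
  \<comment> \<open>A negative value at the infimum would survive for slightly smaller
    parameters.\<close>
  have nonneg: "0 \<le> U x" if x0: "0 \<le> x" for x
  proof (rule ccontr)
    assume neg: "\<not> 0 \<le> U x"
    obtain h where h: "0 < h" "\<And>l' U' W'. \<bar>l' - l\<bar> < h \<Longrightarrow> is_sol l' U' W' \<Longrightarrow> \<bar>U' x - U x\<bar> < - U x"
      using sol_close[OF s _ x0, of "- U x"] x0 neg by (metis linorder_not_le neg_0_less_iff_less order_refl)
    obtain U' W' where s': "is_sol (l - h / 2) U' W'" using sol_exists by blast
    have "U' x < 0" using h(2)[OF _ s'] h(1) by simp
    then have "l - h / 2 \<in> Neg" using s' x0 h(1) l_neg by (auto simp: Neg_def)
    then have "l \<le> l - h / 2" unfolding l_def by (rule cInf_lower[OF _ bdd])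
    then show False using h(1) by simp
  qed
  have pos': "0 < U x" if x: "0 \<le> x" for x
  proof (rule ccontr)
    assume "\<not> 0 < U x"
    then have z: "U x = 0" using nonneg[OF x] by simp
    then have "0 < x" using x is_solD(1)[OF s] by (cases "x = 0") auto
    have "W x / P x = 0"
    proof (rule DERIV_local_min[OF is_solD(3)[OF s] \<open>0 < x\<close>])
      show "\<forall>y. \<bar>x - y\<bar> < x \<longrightarrow> U x \<le> U y" using nonneg z by auto
    qed
    then have "W x = 0" using P_nz[of x] by simp
    then show False using sol_nondegenerate[OF s x] z by simp
  qed
  have pos: "0 < U x" for x
    using pos'[of x] pos'[of "- x"] sol_even(1)[OF s, of x] by (cases "0 \<le> x") auto
  \<comment> \<open>If the flux were positive at such an \<open>x\<close>, then for all parameters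
    slightly above \<open>l\<close> the solution would be positive up to \<open>x\<close> by
    closeness and beyond it by \<open>sol_positive_after\<close>. They would be missing from
    \<open>Neg\<close>, against the choice of \<open>l\<close> as its infimum.\<close>
  have W_neg: "W x \<le> 0" if x: "X \<le> x" for x
  proof (rule ccontr)
    assume Wx: "\<not> W x \<le> 0"
    have x0: "0 \<le> x" using x X_pos by linarith
    obtain y where y: "y \<in> {0..x}" "\<And>z. z \<in> {0..x} \<Longrightarrow> U y \<le> U z"
      using continuous_attains_inf[of "{0..x}" U] is_solD(5)[OF s] x0 by auto
    define e where "e = min (U y) (W x)"
    have e: "0 < e" using pos[of y] Wx by (simp add: e_def)
    obtain h where h: "0 < h" and h': "\<And>l' U' W' z. \<bar>l' - l\<bar> < h \<Longrightarrow> is_sol l' U' W' \<Longrightarrow> 0 \<le> z \<Longrightarrow> z \<le> x \<Longrightarrow>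
       \<bar>U' z - U z\<bar> < e \<and> \<bar>W' z - W z\<bar> < e"
      using sol_close[OF s e x0] by metis
    \<comment> \<open>The 0 ensures \<open>l' < 0 < \<delta> \<le> Q\<close> beyond
      \<open>x\<close>, the nonoscillation condition.\<close>
    have "min (l + h) 0 \<le> l'" if l': "l' \<in> Neg" for l'
    proof (rule ccontr)
      assume lt: "\<not> min (l + h) 0 \<le> l'"
      have ge: "l \<le> l'" unfolding l_def by (rule cInf_lower[OF l' bdd])
      obtain U' W' z where s': "is_sol l' U' W'" "0 \<le> z" "U' z < 0" using l' by (auto simp: Neg_def)
      have c: "\<bar>U' t - U t\<bar> < e \<and> \<bar>W' t - W t\<bar> < e" if "0 \<le> t" "t \<le> x" for t
        using h'[OF _ s'(1) that] lt ge by auto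
      have pU: "0 < U' t" if "0 \<le> t" "t \<le> x" for t
        using c[OF that] y(2)[of t] that by (auto simp: e_def)
      have pW: "0 < W' x" using c[OF x0] by (auto simp: e_def)
      have "0 < U' z"
      proof (cases "z \<le> x")
        case False
        have "l' \<le> Q t" if "x \<le> t" for t using Q_far[of t] that x \<delta>_pos lt by auto
        then show ?thesis using False pU[OF x0 order_refl] pW by (intro sol_positive_after[OF s'(1), of x z]) simp_all
      qed (use pU s'(2) in auto)
      then show False using s'(3) by simp
    qed
    then have "min (l + h) 0 \<le> l" unfolding l_def using N0 by (intro cInf_greatest) auto
    then show False using h l_neg by auto
  qed
  obtain \<kappa> K1 where \<kappa>: "0 < \<kappa>" and \<kappa>K: "\<And>x. X \<le> x \<Longrightarrow> \<kappa> * U x \<le> - W x \<and> - W x \<le> K1 * U x"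
  proof -
    have "\<exists>\<kappa> K. 0 < \<kappa> \<and> (\<forall>x\<ge>X. \<kappa> * U x \<le> - W x \<and> - W x \<le> K * U x)"
    proof (rule decaying_solution_bounds[where q = "\<lambda>x. Q x - l" and d = "\<delta> - l" and M = "qb - l"])
      show "Q x - l \<le> qb - l" for x using Q_bound[of x] by linarith
    qed (use is_solD[OF s] pos W_neg \<delta>_pos l_neg Q_far in auto)
    then show thesis using that by blast
  qed
  have "compact ((\<lambda>x. \<bar>W x\<bar> / U x) ` {0..X})"
    by (intro compact_continuous_image continuous_on_divide continuous_on_rabs is_solD(5,6)[OF s])
      (use pos in \<open>simp_all add: order_less_imp_not_eq2\<close>)
  then obtain K2 where K2: "\<And>x. x \<in> {0..X} \<Longrightarrow> norm (\<bar>W x\<bar> / U x) \<le> K2"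
    by (metis (no_types, lifting) compact_imp_bounded bounded_iff image_eqI)
  define K where "K = max K1 K2"
  have Wb': "\<bar>W x\<bar> \<le> K * U x" if x: "0 \<le> x" for x
  proof (cases "X \<le> x")
    case True
    then have "\<bar>W x\<bar> \<le> K1 * U x" using \<kappa>K[OF True] W_neg[OF True] by simp
    also have "\<dots> \<le> K * U x" using pos[of x] by (intro mult_right_mono) (auto simp: K_def)
    finally show ?thesis .
  next
    case False
    then have "\<bar>W x\<bar> / U x \<le> K2" using K2[of x] x pos[of x] by simp
    then have "\<bar>W x\<bar> \<le> K2 * U x" using pos[of x] by (simp add: pos_divide_le_eq)
    also have "\<dots> \<le> K * U x" using pos[of x] by (intro mult_right_mono) (auto simp: K_def)
    finally show ?thesis .
  qed
  have Wb: "\<bar>W x\<bar> \<le> K * U x" for x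
    using Wb'[of x] Wb'[of "- x"] sol_even[OF s, of x] by (cases "0 \<le> x") auto
  \<comment> \<open>Far out \<open>U' / U = W / (P U) \<le> - \<kappa> / P \<le> - \<kappa> /
    pu\<close>.\<close>
  define m where "m = \<kappa> / pu"
  have m: "0 < m" using \<kappa> pu_pos by (simp add: m_def)
  have "compact ((\<lambda>x. U x * exp (m * x)) ` {0..X})"
    by (intro compact_continuous_image continuous_intros is_solD(5)[OF s]) auto
  then obtain C where C: "\<And>x. x \<in> {0..X} \<Longrightarrow> norm (U x * exp (m * x)) \<le> C"
    by (metis (no_types, lifting) compact_imp_bounded bounded_iff image_eqI)
  have dec': "U x * exp (m * x) \<le> C" if x: "0 \<le> x" for x
  proof (cases "x \<le> X")
    case True
    then show ?thesis using C[of x] x by (auto simp: abs_le_iff)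
  next
    case False
    then have Xx: "X \<le> x" by simp
    have "U x * exp (m * x) \<le> U X * exp (m * X)"
    proof (rule DERIV_nonpos_imp_nonincreasing[OF Xx])
      fix z assume z: "X \<le> z" "z \<le> x"
      have "((\<lambda>x. U x * exp (m * x)) has_real_derivative (W z / P z + m * U z) * exp (m * z)) (at z)"
        by (auto intro!: derivative_eq_intros is_solD[OF s] simp: algebra_simps)
      moreover have "W z / P z + m * U z \<le> 0"
      proof -
        have "m * U z \<le> \<kappa> * U z / P z"
          unfolding m_def using P_upper[of z] P_pos[of z] pos[of z] \<kappa> by (simp add: frac_le)
        also have "\<dots> \<le> - W z / P z" using \<kappa>K[OF z(1)] P_pos[of z] by (intro divide_right_mono) auto
        finally show ?thesis by simp
      qed
      ultimately show "\<exists>t. ((\<lambda>x. U x * exp (m * x)) has_real_derivative t) (at z) \<and> t \<le> 0"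
        by (intro exI conjI) (assumption, simp only: mult_nonpos_nonneg exp_ge_zero)
    qed
    also have "\<dots> \<le> C" using C[of X] X_pos by (auto simp: abs_le_iff)
    finally show ?thesis .
  qed
  have "U x \<le> C * exp (- m * \<bar>x\<bar>)" for x
  proof -
    have "U \<bar>x\<bar> * exp (m * \<bar>x\<bar>) \<le> C" by (rule dec') simp
    moreover have "U \<bar>x\<bar> = U x" using sol_even(1)[OF s, of x] by (auto simp: abs_if)
    ultimately show ?thesis by (simp add: exp_minus field_simps)
  qed
  then show thesis using that[OF l_neg s pos Wb m] by blast
qed

end

subsection \<open>The quadratic form and the negative eigenvalue\<close>

lemma has_real_derivative_norm_sq:
  fixes u :: "real \<Rightarrow> complex"
  assumes "(u has_vector_derivative v) (at x)"
  shows "((\<lambda>x. (norm (u x))\<^sup>2) has_real_derivative 2 * (u x \<bullet> v)) (at x)"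
proof -
  have "((\<lambda>x. u x \<bullet> u x) has_derivative (\<lambda>h. u x \<bullet> (h *\<^sub>R v) + (h *\<^sub>R v) \<bullet> u x)) (at x)"
    using assms unfolding has_vector_derivative_def by (intro has_derivative_inner)
  then show ?thesis
    unfolding has_field_derivative_def power2_norm_eq_inner
    by (rule has_derivative_eq_rhs) (auto simp: inner_commute fun_eq_iff)
qed

context leading_coefficient
begin

text \<open>
  Completing the square with a solution \<open>h\<close> of the Riccati equation: the integrand minus
  \<open>(h |u|\<^sup>2)'\<close> equals \<open>P |V - (h/P) u|\<^sup>2\<close>.
\<close>

lemma Riccati_interval:
  assumes r: "H2_rep u V W" and q: "continuous_on UNIV q" "\<And>x. \<bar>q x\<bar> \<le> M" and st: "s \<le> t"
    and h: "\<And>x. s \<le> x \<Longrightarrow> x \<le> t \<Longrightarrow> (h has_real_derivative q x - (h x)\<^sup>2 / P x) (at x)"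
  shows "h t * (norm (u t))\<^sup>2 - h s * (norm (u s))\<^sup>2
    \<le> (LINT x:{s..t}|lborel. P x * (norm (V x))\<^sup>2 + q x * (norm (u x))\<^sup>2)"
proof -
  let ?g = "\<lambda>x. P x * (norm (V x))\<^sup>2 + q x * (norm (u x))\<^sup>2"
  note R = H2_repD[OF r]
  have gc: "continuous_on UNIV ?g" by (rule form_integrable(2)[OF r q])
  define G where "G = antideriv ?g"
  have G: "(G has_real_derivative ?g x) (at x)" for x unfolding G_def by (rule antideriv(2)[OF gc])
  have "G s - h s * (norm (u s))\<^sup>2 \<le> G t - h t * (norm (u t))\<^sup>2"
  proof (rule DERIV_nonneg_imp_nondecreasing[OF st])
    fix x assume x: "s \<le> x" "x \<le> t"
    have "((\<lambda>x. G x - h x * (norm (u x))\<^sup>2) has_real_derivative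
        ?g x - ((q x - (h x)\<^sup>2 / P x) * (norm (u x))\<^sup>2 + 2 * (u x \<bullet> V x) * h x)) (at x)"
      by (intro DERIV_diff DERIV_mult G h x has_real_derivative_norm_sq R)
    moreover have "?g x - ((q x - (h x)\<^sup>2 / P x) * (norm (u x))\<^sup>2 + 2 * (u x \<bullet> V x) * h x)
        = P x * (norm (V x - (h x / P x) *\<^sub>R u x))\<^sup>2"
      unfolding power2_norm_eq_inner using P_nz[of x]
      by (simp add: inner_diff_left inner_diff_right inner_commute field_simps power2_eq_square)
    moreover have "0 \<le> P x * (norm (V x - (h x / P x) *\<^sub>R u x))\<^sup>2" using P_pos[of x] by simp
    ultimately show "\<exists>y. ((\<lambda>x. G x - h x * (norm (u x))\<^sup>2) has_real_derivative y) (at x) \<and> 0 \<le> y"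
      by metis
  qed
  moreover have "(LINT x:{s..t}|lborel. ?g x) = G t - G s"
    unfolding set_lebesgue_integral_def
  proof (rule integral_FTC_atLeastAtMost[OF st])
    show "(G has_vector_derivative ?g x) (at x within {s..t})" for x
      using G[of x] has_vector_derivative_at_within by (auto simp: has_real_derivative_iff_has_vector_derivative)
  qed (rule continuous_on_subset[OF gc], simp)
  ultimately show ?thesis by linarith
qed

end

context even_sturm_liouville
begin

lemma sol_Riccati:
  assumes "(U has_real_derivative w / P x) (at x)" "(W has_real_derivative q * U x) (at x)" "U x \<noteq> 0" "w = W x"
  shows "((\<lambda>x. W x / U x) has_real_derivative q - (W x / U x)\<^sup>2 / P x) (at x)"
proof -
  have "((\<lambda>x. W x / U x) has_real_derivative (q * U x * U x - W x * (w / P x)) / (U x * U x)) (at x)"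
    by (rule DERIV_divide[OF assms(2,1,3)])
  moreover have "(q * U x * U x - W x * (w / P x)) / (U x * U x) = q - (W x / U x)\<^sup>2 / P x"
    using assms(3,4) P_nz[of x] by (simp add: field_simps power2_eq_square)
  ultimately show ?thesis by simp
qed

lemma filterlim_abs_real_sequentially:
  "filterlim (\<lambda>n. \<bar>real n\<bar>) at_top sequentially" "filterlim (\<lambda>n. \<bar>- real n\<bar>) at_top sequentially"
  using filterlim_real_sequentially by simp_all

text \<open>Since \<open>U\<close> has no zero, the Riccati inequality holds on every interval. The
  quotient \<open>W / U\<close> is bounded and \<open>u\<close> vanishes at infinity, so the
  boundary terms disappear as the interval exhausts the line.\<close>

lemma form_lower_bound:
  assumes s: "is_sol l U W" and U: "\<And>x. 0 < U x" and K: "\<And>x. \<bar>W x\<bar> \<le> K * U x"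
    and r: "H2_rep u V W'"
  shows "l * (L2_norm u)\<^sup>2 \<le> (LINT x|lborel. P x * (norm (V x))\<^sup>2 + Q x * (norm (u x))\<^sup>2)"
proof -
  note R = H2_repD[OF r]
  define q where "q x = Q x - l" for x
  have qc: "continuous_on UNIV q" unfolding q_def[abs_def] by (intro continuous_intros Q_cont)
  have qm: "\<bar>q x\<bar> \<le> qb + \<bar>l\<bar>" for x using Q_bound[of x] by (simp add: q_def)
  define h where "h x = W x / U x" for x
  have hb: "\<bar>h x\<bar> \<le> K" for x using K[of x] U[of x] by (simp add: h_def pos_divide_le_eq)
  have hd: "(h has_real_derivative q x - (h x)\<^sup>2 / P x) (at x)" for x
    unfolding h_def[abs_def] q_def
    by (rule sol_Riccati[OF is_solD(3)[OF s] is_solD(4)[OF s]]) (use U[of x] in auto)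
  let ?g = "\<lambda>x. P x * (norm (V x))\<^sup>2 + q x * (norm (u x))\<^sup>2"
  have lim0: "(\<lambda>n. h (Y n) * (norm (u (Y n)))\<^sup>2) \<longlonglongrightarrow> 0"
    if Y: "filterlim (\<lambda>n::nat. \<bar>Y n\<bar>) at_top sequentially" for Y
  proof -
    have "(\<lambda>n. u (Y n)) \<longlonglongrightarrow> 0" by (rule L2_primitive_tendsto_0[OF R(6) R(3,4) Y])
    then have "(\<lambda>n. K * (norm (u (Y n)))\<^sup>2) \<longlonglongrightarrow> K * (norm (0::complex))\<^sup>2"
      by (intro tendsto_mult tendsto_const tendsto_power tendsto_norm)
    then have "(\<lambda>n. K * (norm (u (Y n)))\<^sup>2) \<longlonglongrightarrow> 0" by simp
    then show ?thesis
      by (rule Lim_null_comparison[rotated])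
        (use hb in \<open>auto simp: abs_mult intro!: always_eventually mult_right_mono\<close>)
  qed
  have "(\<lambda>n. h (real n) * (norm (u (real n)))\<^sup>2 - h (- real n) * (norm (u (- real n)))\<^sup>2) \<longlonglongrightarrow> 0 - 0"
    by (intro tendsto_diff lim0 filterlim_abs_real_sequentially)
  then have "0 - 0 \<le> (LINT x|lborel. ?g x)"
  proof (rule LIMSEQ_le[OF _ integral_Icc_tendsto[OF form_integrable(1)[OF r qc qm]]], intro exI[of _ 0] allI impI)
    show "h (real n) * (norm (u (real n)))\<^sup>2 - h (- real n) * (norm (u (- real n)))\<^sup>2
        \<le> (LINT x:{- real n..real n}|lborel. ?g x)" for n :: nat
    proof -
      have n: "- real n \<le> real n" by simp
      show ?thesis using Riccati_interval[OF r qc qm n hd] .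
    qed
  qed
  also have "(LINT x|lborel. ?g x) = (LINT x|lborel. (P x * (norm (V x))\<^sup>2 + Q x * (norm (u x))\<^sup>2) - l * (norm (u x))\<^sup>2)"
    by (rule Bochner_Integration.integral_cong) (auto simp: q_def algebra_simps)
  also have "\<dots> = (LINT x|lborel. P x * (norm (V x))\<^sup>2 + Q x * (norm (u x))\<^sup>2) - l * (L2_norm u)\<^sup>2"
    unfolding L2_norm_sq
    by (subst Bochner_Integration.integral_diff)
      (auto intro!: form_integrable(1)[OF r Q_cont Q_bound] L2_integrable_norm_sq R)
  finally show ?thesis by simp
qed

text \<open>The flux of \<open>v\<close> is nonpositive beyond \<open>X\<close>: a positive value
  would stay positive because \<open>Q v \<ge> 0\<close>, making \<open>v\<close> nondecreasing from
  there on, against its decay. Hence \<open>decaying_solution_bounds\<close> applies.\<close>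

lemma v_log_derivative_bounded:
  obtains K where "\<And>x. X \<le> x \<Longrightarrow> \<bar>vf x / v x\<bar> \<le> K"
proof -
  have vp: "0 < v x" if "X \<le> x" for x using v_pos[of x] X_pos that by linarith
  have neg: "vf x \<le> 0" if x: "X \<le> x" for x
  proof (rule ccontr)
    assume pos: "\<not> vf x \<le> 0"
    have vf_pos: "0 \<le> vf y" if y: "x \<le> y" for y
    proof -
      have "vf x \<le> vf y"
      proof (rule DERIV_nonneg_imp_nondecreasing[OF y])
        fix z assume z: "x \<le> z" "z \<le> y"
        have "0 \<le> Q z * v z" using Q_far[of z] \<delta>_pos vp[of z] x z by simp
        then show "\<exists>t. (vf has_real_derivative t) (at z) \<and> 0 \<le> t" using vf_deriv by blast
      qed
      then show ?thesis using pos by linarith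
    qed
    have ge: "v x \<le> v y" if y: "x \<le> y" for y
    proof (rule DERIV_nonneg_imp_nondecreasing[OF y])
      fix z assume z: "x \<le> z" "z \<le> y"
      have "0 \<le> vf z / P z" using vf_pos[OF z(1)] P_pos[of z] by simp
      then show "\<exists>t. (v has_real_derivative t) (at z) \<and> 0 \<le> t" using v_deriv by blast
    qed
    have "v x \<le> 0"
      by (rule tendsto_lowerbound[OF v_lim]) (use ge in \<open>auto simp: eventually_at_top_linorder\<close>)
    then show False using vp[OF x] by simp
  qed
  have "\<exists>\<kappa> K. 0 < \<kappa> \<and> (\<forall>x\<ge>X. \<kappa> * v x \<le> - vf x \<and> - vf x \<le> K * v x)"
  proof (rule decaying_solution_bounds[where q = Q and d = \<delta> and M = qb])
    show "Q x \<le> qb" for x using Q_bound[of x] by linarith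
  qed (use v_deriv vf_deriv vp neg \<delta>_pos Q_far in auto)
  then obtain K where K: "\<And>x. X \<le> x \<Longrightarrow> - vf x \<le> K * v x" by blast
  have "\<bar>vf x / v x\<bar> \<le> K" if "X \<le> x" for x
  proof -
    have "\<bar>vf x / v x\<bar> = (- vf x) / v x" using neg[OF that] vp[OF that] by (simp add: abs_divide)
    also have "\<dots> \<le> K" using K[OF that] vp[OF that] by (simp only: pos_divide_le_eq)
    finally show ?thesis .
  qed
  then show thesis by (rule that)
qed

text \<open>The quotient \<open>h = vf / v\<close> has its only pole at the origin, where it behaves
  like \<open>P 0 / x\<close>. For \<open>u 0 = 0\<close> the squared norm of \<open>u\<close> is of
  order \<open>x^2\<close>, so the boundary terms at \<open>a n\<close> and \<open>- a n\<close>
  vanish as the gap closes.\<close>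

lemma form_nonneg_if_vanishing:
  assumes r: "H2_rep u V W" and u0: "u 0 = 0"
  shows "0 \<le> (LINT x|lborel. P x * (norm (V x))\<^sup>2 + Q x * (norm (u x))\<^sup>2)"
proof -
  note R = H2_repD[OF r]
  let ?g = "\<lambda>x. P x * (norm (V x))\<^sup>2 + Q x * (norm (u x))\<^sup>2"
  note gi = form_integrable[OF r Q_cont Q_bound]
  define h where "h x = vf x / v x" for x
  have vnz: "v x \<noteq> 0" if "x \<noteq> 0" for x
    using v_pos[of x] v_pos[of "- x"] v_odd[of x] that by (cases "0 < x") auto
  have hd: "(h has_real_derivative Q x - (h x)\<^sup>2 / P x) (at x)" if "x \<noteq> 0" for x
    unfolding h_def[abs_def] by (rule sol_Riccati[OF v_deriv vf_deriv vnz[OF that]]) simp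
  have hodd: "h (- x) = - h x" for x by (simp add: h_def v_odd vf_even)
  obtain K where K: "\<And>x. X \<le> x \<Longrightarrow> \<bar>h x\<bar> \<le> K" using v_log_derivative_bounded unfolding h_def by blast
  define a b where "a n = 1 / real (Suc n)" and "b n = real (Suc n)" for n
  have a: "0 < a n" "a n \<le> b n" for n by (auto simp: a_def b_def field_simps)
  have anz: "a n \<noteq> 0" for n using a(1)[of n] by simp
  have blim: "filterlim b at_top sequentially"
    unfolding b_def[abs_def] by (rule filterlim_compose[OF filterlim_real_sequentially filterlim_Suc])
  have alim: "a \<longlonglongrightarrow> 0" unfolding a_def[abs_def] using LIMSEQ_inverse_real_of_nat by (simp add: inverse_eq_divide)
  have b_abs: "\<bar>b n\<bar> = b n" for n by (simp add: b_def)
  have far: "(\<lambda>n. h (s * b n) * (norm (u (s * b n)))\<^sup>2) \<longlonglongrightarrow> 0" if s: "s = 1 \<or> s = -1" for s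
  proof -
    have "filterlim (\<lambda>n. \<bar>s * b n\<bar>) at_top sequentially"
      using blim s b_abs by (auto simp: abs_mult)
    then have "(\<lambda>n. u (s * b n)) \<longlonglongrightarrow> 0" by (rule L2_primitive_tendsto_0[OF R(6) R(3,4)])
    then have "(\<lambda>n. K * (norm (u (s * b n)))\<^sup>2) \<longlonglongrightarrow> K * (norm (0::complex))\<^sup>2"
      by (intro tendsto_mult tendsto_const tendsto_power tendsto_norm)
    then have lim: "(\<lambda>n. K * (norm (u (s * b n)))\<^sup>2) \<longlonglongrightarrow> 0" by simp
    have "eventually (\<lambda>n. X \<le> b n) sequentially" using blim by (simp add: filterlim_at_top)
    then have "eventually (\<lambda>n. norm (h (s * b n) * (norm (u (s * b n)))\<^sup>2) \<le> K * (norm (u (s * b n)))\<^sup>2) sequentially"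
    proof eventually_elim
      case (elim n)
      have "\<bar>h (s * b n)\<bar> \<le> K" using K[OF elim] s hodd[of "b n"] by auto
      then show ?case by (simp add: abs_mult mult_right_mono)
    qed
    then show ?thesis by (rule Lim_null_comparison[OF _ lim])
  qed
  have near: "(\<lambda>n. h (s * a n) * (norm (u (s * a n)))\<^sup>2) \<longlonglongrightarrow> 0" if s: "s = 1 \<or> s = -1" for s
  proof -
    have s0: "s \<noteq> 0" "\<bar>s\<bar> = 1" using s by auto
    have "((\<lambda>x. norm ((u x - u 0) - (x - 0) *\<^sub>R V 0) / norm (x - 0)) \<longlongrightarrow> 0) (at 0)"
      using R(1)[of 0] unfolding has_vector_derivative_def has_derivative_iff_norm by blast
    then have z: "((\<lambda>x. norm (u x - x *\<^sub>R V 0) / \<bar>x\<bar>) \<longlongrightarrow> 0) (at 0)" by (simp add: u0)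
    have l1: "((\<lambda>x. norm (u x) / \<bar>x\<bar>) \<longlongrightarrow> norm (V 0)) (at 0)"
    proof (rule LIM_zero_cancel, rule Lim_null_comparison[OF _ z])
      show "\<forall>\<^sub>F x in at 0. norm (norm (u x) / \<bar>x\<bar> - norm (V 0)) \<le> norm (u x - x *\<^sub>R V 0) / \<bar>x\<bar>"
        unfolding eventually_at_filter
      proof (rule always_eventually, intro allI impI)
        fix x :: real assume x: "x \<noteq> 0"
        have "norm (u x) / \<bar>x\<bar> - norm (V 0) = (norm (u x) - norm (x *\<^sub>R V 0)) / \<bar>x\<bar>"
          using x by (simp add: diff_divide_distrib)
        then show "norm (norm (u x) / \<bar>x\<bar> - norm (V 0)) \<le> norm (u x - x *\<^sub>R V 0) / \<bar>x\<bar>"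
          using norm_triangle_ineq3[of "u x" "x *\<^sub>R V 0"] by (simp add: abs_divide divide_right_mono)
      qed
    qed
    have l2: "((\<lambda>x. v x / x) \<longlongrightarrow> vf 0 / P 0) (at 0)"
      using v_deriv[of 0] by (simp add: DERIV_def v_0)
    have l3: "(vf \<longlongrightarrow> vf 0) (at 0)" using DERIV_isCont[OF vf_deriv] by (simp add: isCont_def)
    \<comment> \<open>The boundary term is written as convergent quotients times \<open>x\<close>:
      \<open>u / x\<close> tends to \<open>V 0\<close> in norm, and \<open>v / x\<close> tends to
      \<open>v'(0) = vf 0 / P 0\<close>, which is not zero.\<close>
    have "((\<lambda>x. vf x * (norm (u x) / \<bar>x\<bar>)\<^sup>2 / (v x / x) * x) \<longlongrightarrow> vf 0 * (norm (V 0))\<^sup>2 / (vf 0 / P 0) * 0) (at 0)"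
      by (intro tendsto_mult tendsto_divide tendsto_power l1 l2 l3 tendsto_ident_at) (use vf_0 P_nz in auto)
    moreover have "eventually (\<lambda>x. vf x * (norm (u x) / \<bar>x\<bar>)\<^sup>2 / (v x / x) * x = h x * (norm (u x))\<^sup>2) (at 0)"
      unfolding eventually_at_filter
      by (rule always_eventually) (auto simp: h_def power_divide vnz field_simps power2_eq_square)
    ultimately have l: "((\<lambda>x. h x * (norm (u x))\<^sup>2) \<longlongrightarrow> 0) (at 0)"
      by (simp add: tendsto_cong)
    have "filterlim (\<lambda>n. s * a n) (at 0) sequentially"
      unfolding filterlim_at using tendsto_mult[OF tendsto_const alim, of s] anz s0 by auto
    from filterlim_compose[OF l this] show ?thesis .
  qed
  have "(\<lambda>n. (h (1 * b n) * (norm (u (1 * b n)))\<^sup>2 - h (1 * a n) * (norm (u (1 * a n)))\<^sup>2) +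
        (h (-1 * a n) * (norm (u (-1 * a n)))\<^sup>2 - h (-1 * b n) * (norm (u (-1 * b n)))\<^sup>2)) \<longlonglongrightarrow> (0 - 0) + (0 - 0)"
    by (intro tendsto_add tendsto_diff near far) auto
  then have L: "(\<lambda>n. (h (b n) * (norm (u (b n)))\<^sup>2 - h (a n) * (norm (u (a n)))\<^sup>2) +
        (h (- a n) * (norm (u (- a n)))\<^sup>2 - h (- b n) * (norm (u (- b n)))\<^sup>2)) \<longlonglongrightarrow> 0" by simp
  have Rl: "(\<lambda>n. (LINT x:{a n..b n}|lborel. ?g x) + (LINT x:{- b n..- a n}|lborel. ?g x)) \<longlonglongrightarrow> (LINT x|lborel. ?g x)"
  proof -
    have gs: "set_integrable lborel A ?g" if "A \<in> sets borel" for A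
      unfolding set_integrable_def by (rule integrable_mult_indicator) (use gi(1) that in auto)
    have eq: "(LINT x:{a n..b n}|lborel. ?g x) + (LINT x:{- b n..- a n}|lborel. ?g x)
       = (LINT x|lborel. indicator ({a n..b n} \<union> {- b n..- a n}) x *\<^sub>R ?g x)" for n
      unfolding set_lebesgue_integral_def[symmetric]
      by (rule set_integral_Un[symmetric])
        (use a(1)[of n] gs in auto)
    have "(\<lambda>n. LINT x|lborel. indicator ({a n..b n} \<union> {- b n..- a n}) x *\<^sub>R ?g x) \<longlonglongrightarrow> (LINT x|lborel. ?g x)"
    proof (rule integral_dominated_convergence[where w = "\<lambda>x. norm (?g x)"])
      show "AE x in lborel. (\<lambda>n. indicator ({a n..b n} \<union> {- b n..- a n}) x *\<^sub>R ?g x) \<longlonglongrightarrow> ?g x"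
        using AE_lborel_singleton[of 0]
      proof eventually_elim
        case (elim x)
        have "eventually (\<lambda>n. a n < \<bar>x\<bar>) sequentially" using alim elim by (intro order_tendstoD) auto
        moreover have "eventually (\<lambda>n. \<bar>x\<bar> \<le> b n) sequentially" using blim by (simp add: filterlim_at_top)
        ultimately have "eventually (\<lambda>n. indicator ({a n..b n} \<union> {- b n..- a n}) x *\<^sub>R ?g x = ?g x) sequentially"
          by eventually_elim (auto simp: indicator_def)
        then show ?case by (rule tendsto_eventually)
      qed
    qed (use gi(1) in \<open>auto simp: indicator_def\<close>)
    then show ?thesis by (simp only: eq)
  qed
  show ?thesis
  proof (rule LIMSEQ_le[OF L Rl], intro exI[of _ 0] allI impI add_mono)
    fix n
    show "h (b n) * (norm (u (b n)))\<^sup>2 - h (a n) * (norm (u (a n)))\<^sup>2 \<le> (LINT x:{a n..b n}|lborel. ?g x)"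
      by (rule Riccati_interval[OF r Q_cont Q_bound a(2)]) (use a(1)[of n] in \<open>auto intro!: hd\<close>)
    show "h (- a n) * (norm (u (- a n)))\<^sup>2 - h (- b n) * (norm (u (- b n)))\<^sup>2 \<le> (LINT x:{- b n..- a n}|lborel. ?g x)"
      by (rule Riccati_interval[OF r Q_cont Q_bound]) (use a[of n] in \<open>auto intro!: hd\<close>)
  qed
qed

section \<open>Eigenfunctions and uniqueness of the negative eigenvalue\<close>

definition eigenpair :: "real \<Rightarrow> (real \<Rightarrow> complex) \<Rightarrow> (real \<Rightarrow> complex) \<Rightarrow> (real \<Rightarrow> complex) \<Rightarrow> bool" where
  "eigenpair l u V W \<longleftrightarrow> H2_rep u V W \<and> \<not> (AE x in lborel. u x = 0) \<and>
     (AE x in lborel. - flux_deriv V W x + Q x *\<^sub>R u x = of_real l * u x)"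

text \<open>Decay of \<open>U\<close> passes to its derivative through the bound on
  \<open>W\<close>, and to its second derivative through the equation; all three are therefore
  square-integrable.\<close>

lemma sol_eigenpair:
  assumes s: "is_sol l U W" and U: "\<And>x. 0 < U x" and K: "\<And>x. \<bar>W x\<bar> \<le> K * U x"
    and m: "0 < m" and dec: "\<And>x. U x \<le> C * exp (- m * \<bar>x\<bar>)"
  shows "\<exists>V W. eigenpair l (\<lambda>x. complex_of_real (U x)) V W"
proof -
  have Uc: "continuous_on UNIV U" and Wc: "continuous_on UNIV W" using is_solD(5,6)[OF s] by blast+
  define V where "V x = W x / P x" for x
  define W2 where "W2 x = ((Q x - l) * U x - P' x * V x) / P x" for x
  have Vd: "(V has_real_derivative W2 x) (at x)" for x
    unfolding V_def[abs_def]
    by (rule DERIV_cong[OF DERIV_divide[OF is_solD(4)[OF s] P_deriv P_nz]])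
      (use P_nz[of x] in \<open>simp add: W2_def V_def field_simps\<close>)
  have Vc: "continuous_on UNIV V" unfolding V_def[abs_def] by (intro continuous_intros Wc P_cont) (simp add: P_nz)
  have W2c: "continuous_on UNIV W2"
    unfolding W2_def[abs_def] by (intro continuous_intros Uc Vc P_cont P'_cont Q_cont) (simp add: P_nz)
  \<comment> \<open>Half the rate, so that the square is the integrable exponential kernel
    itself.\<close>
  have e: "(\<lambda>x. complex_of_real (exp (- m / 2 * \<bar>x\<bar>))) \<in> L2"
  proof -
    have "(norm (complex_of_real (exp (- m / 2 * \<bar>x\<bar>))))\<^sup>2 = exp (- m * \<bar>0 - x\<bar>)" for x
      by (simp add: power2_eq_square flip: exp_add)
    then show ?thesis unfolding L2_def using integrable_exp_kernel(1)[OF m, of 0] by simp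
  qed
  have C: "0 \<le> C"
  proof -
    have "0 < C * exp (- m * \<bar>0\<bar>)" using U[of 0] dec[of 0] by linarith
    then show ?thesis by simp
  qed
  have UL: "(\<lambda>x. complex_of_real (U x)) \<in> L2"
  proof (rule L2_bound[OF _ e, of _ C])
    have "U x \<le> C * exp (- m / 2 * \<bar>x\<bar>)" for x
    proof -
      have "exp (- m * \<bar>x\<bar>) \<le> exp (- m / 2 * \<bar>x\<bar>)" using m by simp
      then show ?thesis using dec[of x] C mult_left_mono[of "exp (- m * \<bar>x\<bar>)" "exp (- m / 2 * \<bar>x\<bar>)" C] by linarith
    qed
    then show "AE x in lborel. norm (complex_of_real (U x)) \<le> C * norm (complex_of_real (exp (- m / 2 * \<bar>x\<bar>)))"
      using U by (auto simp: less_imp_le)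
  qed (use borel_measurable_continuous_onI[OF Uc] in simp)
  have Vb: "\<bar>V x\<bar> \<le> K / pl * U x" for x
  proof -
    have "\<bar>V x\<bar> = \<bar>W x\<bar> * (1 / P x)" using P_pos[of x] by (simp add: V_def abs_divide)
    also have "\<dots> \<le> (K * U x) * (1 / pl)"
      using K[of x] P_lower[of x] P_pos[of x] pl_pos by (intro mult_mono frac_le) (auto intro: order_trans[OF abs_ge_zero K])
    finally show ?thesis by simp
  qed
  have VL: "(\<lambda>x. complex_of_real (V x)) \<in> L2"
    by (rule L2_bound[OF _ UL, of _ "K / pl"])
      (use borel_measurable_continuous_onI[OF Vc] Vb U in \<open>auto simp: less_imp_le\<close>)
  have inv: "\<bar>1 / P x\<bar> \<le> 1 / pl" for x by (rule inverse_P_bound)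
  have qm: "\<bar>Q x - l\<bar> \<le> qb + \<bar>l\<bar>" for x using Q_bound[of x] by linarith
  have [measurable]: "Q \<in> borel_measurable borel" by (rule borel_measurable_continuous_onI[OF Q_cont])
  have "(\<lambda>x. (1 / P x) *\<^sub>R ((Q x - l) *\<^sub>R complex_of_real (U x) - P' x *\<^sub>R complex_of_real (V x))) \<in> L2"
    by (rule L2_scaleR_bounded[OF _ _ inv])
      (auto intro!: L2_diff L2_scaleR_bounded[OF UL _ qm] L2_scaleR_bounded[OF VL _ P'_bound])
  then have WL: "(\<lambda>x. complex_of_real (W2 x)) \<in> L2"
    by (simp add: W2_def scaleR_conv_of_real)
  have rep: "H2_rep (\<lambda>x. complex_of_real (U x)) (\<lambda>x. complex_of_real (V x)) (\<lambda>x. complex_of_real (W2 x))"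
    unfolding H2_rep_def
  proof (intro conjI allI UL VL WL)
    show "((\<lambda>x. complex_of_real (U x)) has_vector_derivative complex_of_real (V x)) (at x)" for x
      unfolding V_def by (intro has_vector_derivative_of_real is_solD(3)[OF s])
    show "is_primitive (\<lambda>x. complex_of_real (V x)) (\<lambda>x. complex_of_real (W2 x))"
      by (intro C1_is_primitive has_vector_derivative_of_real Vd continuous_on_of_real W2c)
  qed
  have "- flux_deriv (\<lambda>x. complex_of_real (V x)) (\<lambda>x. complex_of_real (W2 x)) x + Q x *\<^sub>R complex_of_real (U x)
      = of_real l * of_real (U x)" for x
  proof -
    have "P x * W2 x + P' x * V x = (Q x - l) * U x" using P_nz[of x] by (simp add: W2_def)
    then have "complex_of_real (P x * W2 x + P' x * V x) = complex_of_real ((Q x - l) * U x)" by simp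
    then show ?thesis by (simp add: flux_deriv_def scaleR_conv_of_real algebra_simps)
  qed
  moreover have "\<not> (AE x in lborel. complex_of_real (U x) = 0)"
  proof -
    have "U x \<noteq> 0" for x using U[of x] by simp
    then show ?thesis by (simp add: eventually_False ae_filter_eq_bot_iff emeasure_lborel_UNIV)
  qed
  ultimately show ?thesis using rep by (auto simp: eigenpair_def)
qed

text \<open>Here \<open>u'\<close> is a second eigenfunction, not a derivative. Eigenfunctions for
  different real eigenvalues are orthogonal, so the form at a combination that vanishes at 0 is a
  combination of the two eigenvalues with nonnegative weights. It is negative, against
  \<open>form_nonneg_if_vanishing\<close>.\<close>

lemma negative_eigenvalue_unique:
  assumes e: "eigenpair l u V W" and e': "eigenpair l' u' V' W'" and l: "l < 0" "l' < 0"
    and u0: "u 0 \<noteq> 0"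
  shows "l' = l"
proof (rule ccontr)
  assume ne: "l' \<noteq> l"
  have r: "H2_rep u V W" "H2_rep u' V' W'" using e e' by (auto simp: eigenpair_def)
  note R = H2_repD[OF r(1)] and R' = H2_repD[OF r(2)]
  have ae: "AE x in lborel. - flux_deriv V W x + Q x *\<^sub>R u x = of_real l * u x"
    "AE x in lborel. - flux_deriv V' W' x + Q x *\<^sub>R u' x = of_real l' * u' x"
    using e e' by (auto simp: eigenpair_def)
  have [measurable]: "Q \<in> borel_measurable borel" "cnj \<in> borel_measurable borel"
    "u \<in> borel_measurable borel" "u' \<in> borel_measurable borel"
    "flux_deriv V W \<in> borel_measurable borel" "flux_deriv V' W' \<in> borel_measurable borel"
    using L2_measurable R(3) R'(3) flux_deriv_L2[OF R(4,5)] flux_deriv_L2[OF R'(4,5)]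
    by (auto intro: borel_measurable_continuous_onI continuous_intros Q_cont)
  define b where "b = (LINT x|lborel. u' x * cnj (u x))"
  have b': "(LINT x|lborel. u x * cnj (u' x)) = cnj b"
    unfolding b_def Bochner_Integration.integral_cnj[symmetric] by (simp add: mult.commute)
  have Qu: "(\<lambda>x. Q x *\<^sub>R u x) \<in> L2" "(\<lambda>x. Q x *\<^sub>R u' x) \<in> L2"
    by (intro L2_scaleR_bounded[OF R(3) _ Q_bound] L2_scaleR_bounded[OF R'(3) _ Q_bound], simp)+
  define B where "B = (LINT x|lborel. P x *\<^sub>R (V' x * cnj (V x)))"
  define D where "D = (LINT x|lborel. (Q x *\<^sub>R u' x) * cnj (u x))"
  have 1: "of_real l' * b = B + D"
  proof -
    have "of_real l' * b = (LINT x|lborel. of_real l' * u' x * cnj (u x))" by (simp add: b_def mult.assoc)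
    also have "\<dots> = (LINT x|lborel. (- flux_deriv V' W' x) * cnj (u x) + (Q x *\<^sub>R u' x) * cnj (u x))"
    proof (rule integral_cong_AE)
      show "AE x in lborel. of_real l' * u' x * cnj (u x) = (- flux_deriv V' W' x) * cnj (u x) + (Q x *\<^sub>R u' x) * cnj (u x)"
        using ae(2) by eventually_elim (simp only: distrib_right[symmetric])
    qed measurable
    also have "\<dots> = (LINT x|lborel. (- flux_deriv V' W' x) * cnj (u x)) + D"
      unfolding D_def by (intro Bochner_Integration.integral_add L2_integrable_mult_cnj L2_uminus flux_deriv_L2 R R' Qu)
    also have "(LINT x|lborel. (- flux_deriv V' W' x) * cnj (u x)) = B"
      using form_identity[OF r(2,1)] by (simp add: B_def)
    finally show ?thesis .
  qed
  have 2: "of_real l * cnj b = cnj B + cnj D"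
  proof -
    have "of_real l * cnj b = (LINT x|lborel. of_real l * u x * cnj (u' x))" by (simp add: b'[symmetric] mult.assoc)
    also have "\<dots> = (LINT x|lborel. (- flux_deriv V W x) * cnj (u' x) + (Q x *\<^sub>R u x) * cnj (u' x))"
    proof (rule integral_cong_AE)
      show "AE x in lborel. of_real l * u x * cnj (u' x) = (- flux_deriv V W x) * cnj (u' x) + (Q x *\<^sub>R u x) * cnj (u' x)"
        using ae(1) by eventually_elim (simp only: distrib_right[symmetric])
    qed measurable
    also have "\<dots> = (LINT x|lborel. (- flux_deriv V W x) * cnj (u' x)) + (LINT x|lborel. (Q x *\<^sub>R u x) * cnj (u' x))"
      by (intro Bochner_Integration.integral_add L2_integrable_mult_cnj L2_uminus flux_deriv_L2 R R' Qu)
    also have "(LINT x|lborel. (- flux_deriv V W x) * cnj (u' x)) = (LINT x|lborel. P x *\<^sub>R (V x * cnj (V' x)))"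
      using form_identity[OF r] by simp
    also have "\<dots> = cnj B" unfolding B_def Bochner_Integration.integral_cnj[symmetric] by (simp add: mult.commute)
    also have "(LINT x|lborel. (Q x *\<^sub>R u x) * cnj (u' x)) = cnj D"
      unfolding D_def Bochner_Integration.integral_cnj[symmetric] by (simp add: mult.commute)
    finally show ?thesis .
  qed
  \<comment> \<open>Conjugating the second identity gives \<open>l b = B + D = l' b\<close>, as
    \<open>l\<close> is real.\<close>
  have b0: "b = 0"
  proof -
    have "cnj (of_real l * cnj b) = B + D" using 2 by simp
    then have "of_real l' * b = of_real l * b" using 1 by simp
    then show ?thesis using ne by simp
  qed
  \<comment> \<open>The combination vanishes at 0, and \<open>u 0 \<noteq> 0\<close> guarantees that
    \<open>u'\<close> really occurs in it.\<close>
  define w where "w x = u 0 * u' x + (- u' 0) * u x" for x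
  have rw: "H2_rep w (\<lambda>x. u 0 * V' x + (- u' 0) * V x) (\<lambda>x. u 0 * W' x + (- u' 0) * W x)"
    unfolding w_def[abs_def] by (intro H2_rep_add H2_rep_cmult r)
  have "w 0 = 0" by (simp add: w_def)
  from form_nonneg_if_vanishing[OF rw this] form_eq[OF rw Q_cont Q_bound]
  obtain t where t: "0 \<le> t" "(LINT x|lborel. (- flux_deriv (\<lambda>x. u 0 * V' x + (- u' 0) * V x) (\<lambda>x. u 0 * W' x + (- u' 0) * W x) x
      + Q x *\<^sub>R w x) * cnj (w x)) = complex_of_real t" by blast
  have nn: "(LINT x|lborel. u x * cnj (u x)) = of_real ((L2_norm u)\<^sup>2)"
    "(LINT x|lborel. u' x * cnj (u' x)) = of_real ((L2_norm u')\<^sup>2)"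
    unfolding L2_norm_sq integral_complex_of_real[symmetric] complex_norm_square by auto
  note ii = L2_integrable_mult_cnj[OF R(3) R(3)] L2_integrable_mult_cnj[OF R'(3) R'(3)]
    L2_integrable_mult_cnj[OF R(3) R'(3)] L2_integrable_mult_cnj[OF R'(3) R(3)]
  have wm: "w \<in> borel_measurable borel" "flux_deriv (\<lambda>x. u 0 * V' x + (- u' 0) * V x) (\<lambda>x. u 0 * W' x + (- u' 0) * W x) \<in> borel_measurable borel"
    using H2_repD(3)[OF rw] flux_deriv_L2[OF H2_repD(4,5)[OF rw]] L2_measurable by auto
  have "complex_of_real t = (LINT x|lborel. (u 0 * cnj (u 0) * of_real l') * (u' x * cnj (u' x))
      + (u' 0 * cnj (u' 0) * of_real l) * (u x * cnj (u x))
      + (- (u 0 * cnj (u' 0) * of_real l')) * (u' x * cnj (u x)) + (- (u' 0 * cnj (u 0) * of_real l)) * (u x * cnj (u' x)))"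
    unfolding t(2)[symmetric]
  proof (rule integral_cong_AE)
    show "AE x in lborel. (- flux_deriv (\<lambda>x. u 0 * V' x + (- u' 0) * V x) (\<lambda>x. u 0 * W' x + (- u' 0) * W x) x
      + Q x *\<^sub>R w x) * cnj (w x) = (u 0 * cnj (u 0) * of_real l') * (u' x * cnj (u' x))
      + (u' 0 * cnj (u' 0) * of_real l) * (u x * cnj (u x))
      + (- (u 0 * cnj (u' 0) * of_real l')) * (u' x * cnj (u x)) + (- (u' 0 * cnj (u 0) * of_real l)) * (u x * cnj (u' x))"
      using ae
    proof eventually_elim
      case (elim x)
      have q: "- flux_deriv (\<lambda>x. u 0 * V' x + (- u' 0) * V x) (\<lambda>x. u 0 * W' x + (- u' 0) * W x) x + Q x *\<^sub>R w x
        = u 0 * (- flux_deriv V' W' x + Q x *\<^sub>R u' x) + (- u' 0) * (- flux_deriv V W x + Q x *\<^sub>R u x)"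
        by (simp add: flux_deriv_def w_def scaleR_conv_of_real algebra_simps)
      show ?case unfolding q elim by (simp add: w_def algebra_simps)
    qed
  qed (use wm in measurable)
  also have "\<dots> = (u 0 * cnj (u 0) * of_real l') * of_real ((L2_norm u')\<^sup>2) + (u' 0 * cnj (u' 0) * of_real l) * of_real ((L2_norm u)\<^sup>2)"
    using ii by (simp add: nn b_def[symmetric] b' b0 del: of_real_power)
  also have "\<dots> = complex_of_real ((norm (u 0))\<^sup>2 * l' * (L2_norm u')\<^sup>2 + (norm (u' 0))\<^sup>2 * l * (L2_norm u)\<^sup>2)"
    by (simp only: of_real_add of_real_mult complex_norm_square)
  finally have "t = (norm (u 0))\<^sup>2 * l' * (L2_norm u')\<^sup>2 + (norm (u' 0))\<^sup>2 * l * (L2_norm u)\<^sup>2"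
    by (simp only: of_real_eq_iff)
  moreover have "(norm (u 0))\<^sup>2 * l' * (L2_norm u')\<^sup>2 < 0"
  proof -
    have "L2_norm u' \<noteq> 0" using L2_norm_eq_0_iff[OF R'(3)] e' by (auto simp: eigenpair_def)
    then show ?thesis using u0 l by (intro mult_neg_pos mult_pos_neg) auto
  qed
  moreover have "(norm (u' 0))\<^sup>2 * l * (L2_norm u)\<^sup>2 \<le> 0"
    using l by (intro mult_nonpos_nonneg mult_nonneg_nonpos) auto
  ultimately show False using t(1) by linarith
qed

theorem negative_eigenvalue:
  obtains l where "l < 0" "\<exists>u V W. eigenpair l u V W"
    "\<And>l'. l' < 0 \<Longrightarrow> \<exists>u V W. eigenpair l' u V W \<Longrightarrow> l' = l"
    "\<And>u V W. H2_rep u V W \<Longrightarrow> l * (L2_norm u)\<^sup>2 \<le> (LINT x|lborel. P x * (norm (V x))\<^sup>2 + Q x * (norm (u x))\<^sup>2)"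
proof (rule ground_state)
  fix l U W K C m
  assume g: "l < 0" "is_sol l U W" "\<And>x. 0 < U x" "\<And>x. \<bar>W x\<bar> \<le> K * U x"
    "0 < m" "\<And>x. U x \<le> C * exp (- m * \<bar>x\<bar>)"
  obtain V W2 where e: "eigenpair l (\<lambda>x. complex_of_real (U x)) V W2"
    using sol_eigenpair[OF g(2-6)] by blast
  show thesis
  proof (rule that[OF g(1)])
    show "\<exists>u V W. eigenpair l u V W" using e by blast
    show "l' = l" if l': "l' < 0" and ex: "\<exists>u V W. eigenpair l' u V W" for l'
    proof -
      obtain u' V' W' where e': "eigenpair l' u' V' W'" using ex by blast
      show ?thesis by (rule negative_eigenvalue_unique[OF e e' g(1) l']) (use g(3)[of 0] in simp)
    qed
  qed (rule form_lower_bound[OF g(2-4)])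
qed

end

subsection \<open>The solitary wave profile\<close>

text \<open>Exponential weights make \<open>u^2\<close> nonincreasing as one moves away from
  \<open>x0\<close>, on either side.\<close>

lemma Gronwall_zero:
  fixes u u' :: "real \<Rightarrow> real"
  assumes d: "\<And>x. (u has_real_derivative u' x) (at x)" and b: "\<And>x. \<bar>u' x\<bar> \<le> C * \<bar>u x\<bar>" and z: "u x0 = 0"
  shows "u x = 0"
proof -
  have uu: "\<bar>2 * u y * u' y\<bar> \<le> 2 * C * (u y)\<^sup>2" for y
    using mult_left_mono[OF b[of y], of "2 * \<bar>u y\<bar>"] by (simp add: abs_mult power2_eq_square mult_ac)
  show ?thesis
  proof (cases "x0 \<le> x")
    case True
    have "exp (- 2 * C * x) * (u x)\<^sup>2 \<le> exp (- 2 * C * x0) * (u x0)\<^sup>2"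
    proof (rule DERIV_nonpos_imp_nonincreasing[OF True])
      fix y
      have "((\<lambda>x. exp (- 2 * C * x) * (u x)\<^sup>2) has_real_derivative exp (- 2 * C * y) * (2 * u y * u' y - 2 * C * (u y)\<^sup>2)) (at y)"
        by (auto intro!: derivative_eq_intros d simp: algebra_simps)
      moreover have "exp (- 2 * C * y) * (2 * u y * u' y - 2 * C * (u y)\<^sup>2) \<le> 0"
        using uu[of y] by (intro mult_nonneg_nonpos) (auto simp: abs_le_iff)
      ultimately show "\<exists>t. ((\<lambda>x. exp (- 2 * C * x) * (u x)\<^sup>2) has_real_derivative t) (at y) \<and> t \<le> 0" by blast
    qed
    then show ?thesis using z by (simp add: mult_le_0_iff)
  next
    case False
    then have le: "x \<le> x0" by simp
    have "exp (2 * C * x) * (u x)\<^sup>2 \<le> exp (2 * C * x0) * (u x0)\<^sup>2"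
    proof (rule DERIV_nonneg_imp_nondecreasing[OF le])
      fix y
      have "((\<lambda>x. exp (2 * C * x) * (u x)\<^sup>2) has_real_derivative exp (2 * C * y) * (2 * u y * u' y + 2 * C * (u y)\<^sup>2)) (at y)"
        by (auto intro!: derivative_eq_intros d simp: algebra_simps)
      moreover have "0 \<le> exp (2 * C * y) * (2 * u y * u' y + 2 * C * (u y)\<^sup>2)"
        using uu[of y] by (intro mult_nonneg_nonneg) (auto simp: abs_le_iff)
      ultimately show "\<exists>t. ((\<lambda>x. exp (2 * C * x) * (u x)\<^sup>2) has_real_derivative t) (at y) \<and> 0 \<le> t" by blast
    qed
    then show ?thesis using z by (simp add: mult_le_0_iff)
  qed
qed

locale novikov_profile =
  fixes c k :: real and \<phi> :: "real \<Rightarrow> real"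
  assumes c_pos: "c > 0" and k_pos: "0 < k" and k_lt: "k < sqrt c / 2"
    and profile: "solitary_profile c k \<phi>"
begin

definition a :: real where "a = nov_a c k"
definition E :: real where "E = nov_E c k"
text \<open>The limit of \<open>r\<close> at infinity.\<close>

definition \<rho> :: real where "\<rho> = sqrt (c - k\<^sup>2)"
definition \<phi>1 :: "real \<Rightarrow> real" where "\<phi>1 = deriv \<phi>"
definition \<phi>2 :: "real \<Rightarrow> real" where "\<phi>2 = deriv \<phi>1"
text \<open>The momentum density is \<open>a / r ^ 3\<close>, so in terms of \<open>r\<close> the
  fractional powers in the coefficients become integral.\<close>

definition r :: "real \<Rightarrow> real" where "r x = sqrt (c - (\<phi> x)\<^sup>2)"
text \<open>The height of the crest: besides \<open>k\<close>, the positive root of the first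
  integral after the square root has been removed.\<close>

definition p0 :: real where "p0 = (c - 2 * k\<^sup>2) / sqrt c"

lemma smooth_\<phi>: "smooth \<phi>" and \<phi>_even: "\<phi> (- x) = \<phi> x" and \<phi>1_0: "\<phi>1 0 = 0"
  and \<phi>_lim: "(\<phi> \<longlongrightarrow> k) at_top" and \<phi>_sq: "(\<phi> x)\<^sup>2 < c" and \<phi>_nonconst: "\<not> (\<exists>C. \<forall>x. \<phi> x = C)"
  and \<phi>_ode: "\<phi> x - \<phi>2 x = a * (c - (\<phi> x)\<^sup>2) powr (-3/2)"
  using profile by (auto simp: solitary_profile_def \<phi>1_def \<phi>2_def a_def)

lemma four_k: "4 * k\<^sup>2 < c"
proof -
  have "(2 * k)\<^sup>2 < (sqrt c)\<^sup>2" using k_lt k_pos by (intro power_strict_mono) auto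
  then show ?thesis using c_pos by (simp add: power_mult_distrib)
qed

lemma \<rho>_pos: "0 < \<rho>" and \<rho>_sq: "\<rho>\<^sup>2 = c - k\<^sup>2"
proof -
  have "k\<^sup>2 < c" using four_k zero_le_power2[of k] by linarith
  then show "0 < \<rho>" "\<rho>\<^sup>2 = c - k\<^sup>2" by (simp_all add: \<rho>_def)
qed

lemma a_eq: "a = k * \<rho> ^ 3"
proof -
  have "(c - k\<^sup>2) powr (3/2) = (\<rho> powr 2) powr (3/2)" using \<rho>_pos by (simp add: \<rho>_sq)
  also have "\<dots> = \<rho> powr (2 * (3/2))" by (rule powr_powr)
  also have "\<dots> = \<rho> ^ 3" using \<rho>_pos by simp
  finally show ?thesis by (simp add: a_def nov_a_def)
qed

lemma a_pos: "0 < a" using k_pos \<rho>_pos by (simp add: a_eq)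

lemma twoE: "2 * E = k\<^sup>2 * (c - 2 * k\<^sup>2) / c"
  using c_pos by (simp add: E_def nov_E_def)

lemma E_pos: "0 < E"
  using twoE four_k k_pos c_pos by (smt (verit) divide_pos_pos mult_pos_pos zero_less_power)

lemma r_pos: "0 < r x" and r_sq: "(r x)\<^sup>2 = c - (\<phi> x)\<^sup>2"
  using \<phi>_sq[of x] by (simp_all add: r_def)

lemma \<phi>_deriv: "(\<phi> has_real_derivative \<phi>1 x) (at x)"
  and \<phi>1_deriv: "(\<phi>1 has_real_derivative \<phi>2 x) (at x)"
  unfolding \<phi>1_def \<phi>2_def using smooth_\<phi> by (auto intro!: smooth_DERIV smooth_deriv)

lemma powr_r: "(c - (\<phi> x)\<^sup>2) powr (-3/2) = 1 / r x ^ 3"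
proof -
  have "(c - (\<phi> x)\<^sup>2) powr (-3/2) = (r x powr 2) powr (-3/2)" using r_pos[of x] by (simp add: r_sq)
  also have "\<dots> = r x powr (2 * (-3/2))" by (rule powr_powr)
  also have "2 * (-3/2) = - (3::real)" by simp
  also have "r x powr (- 3) = 1 / r x powr 3" by (rule powr_minus_divide)
  also have "r x powr 3 = r x ^ 3" by (rule powr_numeral) (use r_pos[of x] in simp)
  finally show ?thesis .
qed

lemma \<phi>2_eq: "\<phi>2 x = \<phi> x - a / r x ^ 3"
  using \<phi>_ode[of x] unfolding powr_r by simp

lemma r_deriv: "(r has_real_derivative - (\<phi> x * \<phi>1 x / r x)) (at x)"
proof -
  have "((\<lambda>x. c - (\<phi> x)\<^sup>2) has_real_derivative - (2 * \<phi> x * \<phi>1 x)) (at x)"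
    by (auto intro!: derivative_eq_intros \<phi>_deriv)
  then have "(r has_real_derivative inverse (sqrt (c - (\<phi> x)\<^sup>2)) / 2 * - (2 * \<phi> x * \<phi>1 x)) (at x)"
    unfolding r_def[abs_def] using \<phi>_sq[of x] by (intro DERIV_chain2[OF DERIV_real_sqrt]) auto
  then show ?thesis by (rule DERIV_cong) (simp add: r_def inverse_eq_divide)
qed

lemma r_lim: "(r \<longlongrightarrow> \<rho>) at_top"
  unfolding r_def[abs_def] \<rho>_def by (intro tendsto_intros \<phi>_lim)

section \<open>The first integral of the profile equation\<close>

lemma first_integral_const:
  "(\<phi>1 x)\<^sup>2 / 2 - (\<phi> x)\<^sup>2 / 2 + a * \<phi> x / (c * r x) = (\<phi>1 0)\<^sup>2 / 2 - (\<phi> 0)\<^sup>2 / 2 + a * \<phi> 0 / (c * r 0)"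
proof -
  have "((\<lambda>x. (\<phi>1 x)\<^sup>2 / 2 - (\<phi> x)\<^sup>2 / 2 + a * \<phi> x / (c * r x)) has_real_derivative 0) (at x)" for x
  proof -
    have rn: "r x \<noteq> 0" using r_pos[of x] by simp
    have "((\<lambda>x. (\<phi>1 x)\<^sup>2 / 2 - (\<phi> x)\<^sup>2 / 2 + a * \<phi> x / (c * r x)) has_real_derivative
      \<phi>1 x * \<phi>2 x - \<phi> x * \<phi>1 x + (a * \<phi>1 x * (c * r x) - a * \<phi> x * (c * - (\<phi> x * \<phi>1 x / r x))) / (c * r x * (c * r x))) (at x)"
      using rn c_pos by (auto intro!: derivative_eq_intros \<phi>_deriv \<phi>1_deriv r_deriv)
    moreover have "\<phi>1 x * \<phi>2 x - \<phi> x * \<phi>1 x + (a * \<phi>1 x * (c * r x) - a * \<phi> x * (c * - (\<phi> x * \<phi>1 x / r x))) / (c * r x * (c * r x)) = 0"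
    proof -
      have "(a * \<phi>1 x * (c * r x) - a * \<phi> x * (c * - (\<phi> x * \<phi>1 x / r x))) / (c * r x * (c * r x))
          = a * \<phi>1 x * ((r x)\<^sup>2 + (\<phi> x)\<^sup>2) / (c * r x ^ 3)"
        using rn c_pos by (simp add: field_simps power2_eq_square power3_eq_cube)
      also have "\<dots> = a * \<phi>1 x / r x ^ 3" using c_pos by (simp add: r_sq)
      finally show ?thesis by (simp add: \<phi>2_eq algebra_simps)
    qed
    ultimately show ?thesis by simp
  qed
  then show ?thesis using DERIV_isconst_all by blast
qed

text \<open>The conserved quantity gives \<open>\<phi>1^2\<close> some limit. Since
  \<open>\<phi>\<close> converges, mean values over \<open>[n, n + 1]\<close> provide points along
  which \<open>\<phi>1\<close> tends to 0, so that limit is 0. Evaluation at infinity then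
  identifies the constant as \<open>E\<close>.\<close>

lemma \<phi>1_sq_lim_aux: "((\<lambda>x. (\<phi>1 x)\<^sup>2) \<longlongrightarrow> 0) at_top"
  and first_integral: "(\<phi>1 x)\<^sup>2 = 2 * E + (\<phi> x)\<^sup>2 - 2 * a * \<phi> x / (c * r x)"
proof -
  define I where "I = (\<phi>1 0)\<^sup>2 / 2 - (\<phi> 0)\<^sup>2 / 2 + a * \<phi> 0 / (c * r 0)"
  have sq: "(\<phi>1 x)\<^sup>2 = 2 * I + (\<phi> x)\<^sup>2 - 2 * (a * \<phi> x / (c * r x))" for x
    using first_integral_const[of x] by (simp add: I_def)
  define L where "L = 2 * I + k\<^sup>2 - 2 * (a * k / (c * \<rho>))"
  have lim: "((\<lambda>x. (\<phi>1 x)\<^sup>2) \<longlongrightarrow> L) at_top"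
    unfolding sq L_def by (intro tendsto_intros \<phi>_lim r_lim) (use c_pos \<rho>_pos in auto)
  have "\<exists>\<xi>. real n < \<xi> \<and> \<phi> (real n + 1) - \<phi> (real n) = \<phi>1 \<xi>" for n
  proof -
    obtain z where "real n < z" "\<phi> (real n + 1) - \<phi> (real n) = (real n + 1 - real n) * \<phi>1 z"
      using MVT2[of "real n" "real n + 1" \<phi> \<phi>1] \<phi>_deriv by auto
    then show ?thesis by auto
  qed
  then obtain \<xi> where \<xi>: "\<And>n. real n < \<xi> n" "\<And>n. \<phi> (real n + 1) - \<phi> (real n) = \<phi>1 (\<xi> n)" by metis
  have x\<xi>: "filterlim \<xi> at_top sequentially"
    by (rule filterlim_at_top_mono[OF filterlim_real_sequentially]) (use \<xi>(1) in \<open>auto intro!: always_eventually less_imp_le\<close>)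
  have s1: "filterlim (\<lambda>n. real n + 1) at_top sequentially"
    by (rule filterlim_at_top_mono[OF filterlim_real_sequentially]) auto
  have "(\<lambda>n. (\<phi> (real n + 1) - \<phi> (real n))\<^sup>2) \<longlonglongrightarrow> (k - k)\<^sup>2"
    by (intro tendsto_power tendsto_diff filterlim_compose[OF \<phi>_lim s1] filterlim_compose[OF \<phi>_lim filterlim_real_sequentially])
  then have "(\<lambda>n. (\<phi>1 (\<xi> n))\<^sup>2) \<longlonglongrightarrow> 0" by (simp add: \<xi>(2))
  moreover have "(\<lambda>n. (\<phi>1 (\<xi> n))\<^sup>2) \<longlonglongrightarrow> L" by (rule filterlim_compose[OF lim x\<xi>])
  ultimately have L0: "L = 0" using LIMSEQ_unique by blast
  with lim show "((\<lambda>x. (\<phi>1 x)\<^sup>2) \<longlongrightarrow> 0) at_top" by simp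
  have "a * k / (c * \<rho>) = k\<^sup>2 * \<rho>\<^sup>2 / c"
    using \<rho>_pos c_pos by (simp add: a_eq field_simps power2_eq_square power3_eq_cube)
  also have "\<dots> = k\<^sup>2 * (c - k\<^sup>2) / c" by (simp add: \<rho>_sq)
  finally have "2 * I = 2 * (k\<^sup>2 * (c - k\<^sup>2) / c) - k\<^sup>2" using L0 by (simp add: L_def)
  also have "\<dots> = 2 * E" unfolding twoE using c_pos by (simp add: field_simps)
  finally show "(\<phi>1 x)\<^sup>2 = 2 * E + (\<phi> x)\<^sup>2 - 2 * a * \<phi> x / (c * r x)" by (simp add: sq[of x])
qed

lemma \<phi>1_lim: "(\<phi>1 \<longlongrightarrow> 0) at_top"
proof -
  have "((\<lambda>x. sqrt ((\<phi>1 x)\<^sup>2)) \<longlongrightarrow> sqrt 0) at_top" by (intro tendsto_real_sqrt \<phi>1_sq_lim_aux)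
  then show ?thesis by (simp add: tendsto_rabs_zero_iff)
qed

text \<open>Multiplication by the conjugate expression removes the square root \<open>r\<close> and
  leaves a cubic in \<open>\<phi>^2\<close>. Its double root \<open>k^2\<close> reflects the
  homoclinic orbit, its simple root \<open>p0^2\<close> the crest.\<close>

lemma factorised_first_integral:
  "(\<phi>1 x)\<^sup>2 * (r x * (r x * (2 * E + (\<phi> x)\<^sup>2) + 2 * a * \<phi> x / c)) = ((\<phi> x)\<^sup>2 - k\<^sup>2)\<^sup>2 * (p0\<^sup>2 - (\<phi> x)\<^sup>2)"
proof -
  define Y where "Y = (\<phi> x)\<^sup>2"
  define y where "y = \<phi> x"
  define R where "R = r x"
  have R: "R \<noteq> 0" "R\<^sup>2 = c - Y" using r_pos[of x] r_sq[of x] by (auto simp: R_def Y_def)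
  have p0: "p0\<^sup>2 = (c - 2 * k\<^sup>2)\<^sup>2 / c" using c_pos by (simp add: p0_def power_divide)
  have asq: "a\<^sup>2 = k\<^sup>2 * (c - k\<^sup>2) ^ 3"
  proof -
    have "a\<^sup>2 = k\<^sup>2 * (\<rho>\<^sup>2) ^ 3" by (simp add: a_eq power_mult_distrib flip: power_mult)
    then show ?thesis by (simp add: \<rho>_sq)
  qed
  have F: "(\<phi>1 x)\<^sup>2 * R = R * (2 * E + Y) - 2 * a * y / c"
    unfolding first_integral Y_def y_def R_def using r_pos[of x] c_pos by (simp add: field_simps)
  have "(\<phi>1 x)\<^sup>2 * (R * (R * (2 * E + Y) + 2 * a * y / c)) = (R * (2 * E + Y) - 2 * a * y / c) * (R * (2 * E + Y) + 2 * a * y / c)"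
    unfolding F[symmetric] by (simp only: mult.assoc)
  also have "\<dots> = R\<^sup>2 * (2 * E + Y)\<^sup>2 - 4 * a\<^sup>2 * y\<^sup>2 / c\<^sup>2"
    by (simp add: power2_eq_square algebra_simps)
  also have "\<dots> = (c - Y) * (k\<^sup>2 * (c - 2 * k\<^sup>2) / c + Y)\<^sup>2 - 4 * (k\<^sup>2 * (c - k\<^sup>2) ^ 3) * Y / c\<^sup>2"
    by (simp add: R(2) twoE asq Y_def y_def)
  also have "\<dots> = (Y - k\<^sup>2)\<^sup>2 * ((c - 2 * k\<^sup>2)\<^sup>2 / c - Y)"
    using c_pos by (simp add: divide_simps) algebra
  finally show ?thesis by (simp add: p0 R_def Y_def y_def)
qed

lemma p0_pos: "0 < p0" and p0_sq: "p0\<^sup>2 = (c - 2 * k\<^sup>2)\<^sup>2 / c" and c_p0: "c - p0\<^sup>2 = 4 * k\<^sup>2 * \<rho>\<^sup>2 / c"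
proof -
  have "0 < c - 2 * k\<^sup>2" using four_k zero_le_power2[of k] by linarith
  then show "0 < p0" using c_pos by (simp add: p0_def)
  show s: "p0\<^sup>2 = (c - 2 * k\<^sup>2)\<^sup>2 / c" using c_pos by (simp add: p0_def power_divide)
  show "c - p0\<^sup>2 = 4 * k\<^sup>2 * \<rho>\<^sup>2 / c" unfolding s \<rho>_sq using c_pos by (simp add: field_simps power2_eq_square)
qed

lemma k_less_p0: "k < p0"
proof -
  have "sqrt c * k < c - 2 * k\<^sup>2"
  proof -
    have "sqrt c * k \<le> sqrt c * (sqrt c / 2)" using k_lt c_pos by (intro mult_left_mono) auto
    also have "\<dots> = c / 2" using c_pos by simp
    also have "\<dots> < c - 2 * k\<^sup>2" using four_k by linarith
    finally show ?thesis .
  qed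
  then show ?thesis using c_pos by (simp add: p0_def field_simps)
qed

section \<open>Positivity, crest and monotonicity of the profile\<close>

lemma critical_pos:
  assumes "\<phi>1 x = 0" shows "0 < \<phi> x"
proof -
  have "2 * a * \<phi> x / (c * r x) = 2 * E + (\<phi> x)\<^sup>2" using first_integral[of x] assms by simp
  also have "\<dots> > 0" using E_pos by (simp add: add_pos_nonneg)
  finally have pos: "0 < 2 * a * \<phi> x / (c * r x)" .
  show ?thesis
  proof (rule ccontr)
    assume "\<not> 0 < \<phi> x"
    then have "2 * a * \<phi> x / (c * r x) \<le> 0"
      using a_pos c_pos r_pos[of x] by (intro divide_nonpos_pos mult_nonneg_nonpos mult_pos_pos) auto
    then show False using pos by simp
  qed
qed

lemma \<phi>_cont: "continuous_on S \<phi>"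
  and \<phi>1_cont: "continuous_on S \<phi>1" and \<phi>2_cont: "continuous_on S \<phi>2" and r_cont: "continuous_on S r"
proof -
  show "continuous_on S \<phi>" "continuous_on S \<phi>1" "continuous_on S \<phi>2"
    unfolding \<phi>1_def \<phi>2_def by (intro smooth_continuous smooth_deriv smooth_\<phi>)+
  then show "continuous_on S r" unfolding r_def[abs_def] by (intro continuous_intros)
qed

text \<open>On a long interval a nonpositive minimum would be attained at a critical point, the
  origin counting as one, and the first integral forces positive values there.\<close>

lemma \<phi>_pos: "0 < \<phi> x"
proof -
  have "0 < \<phi> x" if x: "0 \<le> x" for x
  proof (rule ccontr)
    assume neg: "\<not> 0 < \<phi> x"
    have "eventually (\<lambda>y. 0 < \<phi> y) at_top" using \<phi>_lim k_pos by (rule order_tendstoD)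
    then obtain T where T: "\<And>y. T \<le> y \<Longrightarrow> 0 < \<phi> y" by (auto simp: eventually_at_top_linorder)
    define T' where "T' = max T x + 1"
    obtain y where y: "y \<in> {0..T'}" "\<And>z. z \<in> {0..T'} \<Longrightarrow> \<phi> y \<le> \<phi> z"
      using continuous_attains_inf[of "{0..T'}" \<phi>] \<phi>_cont x by (auto simp: T'_def)
    have "x \<in> {0..T'}" using x by (simp add: T'_def)
    then have yn: "\<phi> y \<le> 0" using y(2)[of x] neg by linarith
    have "0 < \<phi> T'" by (rule T) (simp add: T'_def)
    with yn have "y \<noteq> 0" "y \<noteq> T'" using critical_pos[OF \<phi>1_0] by auto
    then have yi: "0 < y" "y < T'" using y(1) by auto
    have "\<phi>1 y = 0"
    proof (rule DERIV_local_min[OF \<phi>_deriv, of "min y (T' - y)"])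
      show "\<forall>z. \<bar>y - z\<bar> < min y (T' - y) \<longrightarrow> \<phi> y \<le> \<phi> z" using y(2) by (auto simp: abs_if split: if_splits)
    qed (use yi in auto)
    then show False using critical_pos yn by fastforce
  qed
  from this[of x] this[of "- x"] show ?thesis by (cases "0 \<le> x") (auto simp: \<phi>_even)
qed

lemma denom_pos: "0 < r x * (r x * (2 * E + (\<phi> x)\<^sup>2) + 2 * a * \<phi> x / c)"
proof -
  have "0 < 2 * E + (\<phi> x)\<^sup>2" using E_pos by (simp add: add_pos_nonneg)
  moreover have "0 < 2 * a * \<phi> x / c" using a_pos c_pos \<phi>_pos[of x] by simp
  ultimately show ?thesis using r_pos[of x] by (simp add: add_pos_pos)
qed

lemma \<phi>_le_p0: "\<phi> x \<le> p0"
proof (rule ccontr)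
  assume "\<not> \<phi> x \<le> p0"
  then have gt: "p0 < \<phi> x" by simp
  have "p0\<^sup>2 < (\<phi> x)\<^sup>2" using gt p0_pos by (intro power_strict_mono) auto
  moreover have "k\<^sup>2 < (\<phi> x)\<^sup>2" using gt k_less_p0 k_pos by (intro power_strict_mono) auto
  ultimately have "((\<phi> x)\<^sup>2 - k\<^sup>2)\<^sup>2 * (p0\<^sup>2 - (\<phi> x)\<^sup>2) < 0"
    by (intro mult_pos_neg) auto
  moreover have "0 \<le> (\<phi>1 x)\<^sup>2 * (r x * (r x * (2 * E + (\<phi> x)\<^sup>2) + 2 * a * \<phi> x / c))"
    using denom_pos[of x] by simp
  ultimately show False using factorised_first_integral[of x] by linarith
qed

definition r0 :: real where "r0 = 2 * k * \<rho> / sqrt c"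

lemma r0_pos: "0 < r0" using k_pos \<rho>_pos c_pos by (simp add: r0_def)

lemma r0_sq: "r0\<^sup>2 = c - p0\<^sup>2"
  using c_pos by (simp add: r0_def c_p0 power_divide power_mult_distrib)

lemma r0_le_r: "r0 \<le> r x"
proof -
  have "r0\<^sup>2 \<le> (r x)\<^sup>2"
    unfolding r0_sq r_sq using power_mono[OF \<phi>_le_p0[of x], of 2] \<phi>_pos[of x] by simp
  then show ?thesis using less_imp_le[OF r_pos[of x]] by (rule power2_le_imp_le)
qed

lemma r_le: "r x \<le> sqrt c"
  unfolding r_def by simp

text \<open>Because \<open>k^2\<close> is a double root, \<open>\<phi>1\<close> is bounded by a
  multiple of \<open>\<phi> - k\<close>. Gronwall's argument would spread a single value
  \<open>k\<close> over the whole line and make the profile constant.\<close>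

lemma \<phi>_neq_k: "\<phi> x \<noteq> k"
proof
  assume z: "\<phi> x = k"
  \<comment> \<open>From the factorised first integral:
    \<open>(\<phi> + k)^2 \<le> (2 p0)^2\<close>, \<open>p0^2 - \<phi>^2 \<le> p0^2\<close>, and the
    cofactor of \<open>\<phi>1^2\<close> is at least \<open>2 E r0^2\<close>.\<close>
  define C where "C = 2 * p0 * p0 / sqrt (r0 * (r0 * (2 * E)))"
  have den: "r0 * (r0 * (2 * E)) \<le> r y * (r y * (2 * E + (\<phi> y)\<^sup>2) + 2 * a * \<phi> y / c)" for y
  proof -
    have "r0 * (2 * E) \<le> r y * (2 * E + (\<phi> y)\<^sup>2)"
      using r0_le_r[of y] r0_pos E_pos by (intro mult_mono) auto
    also have "\<dots> \<le> r y * (2 * E + (\<phi> y)\<^sup>2) + 2 * a * \<phi> y / c" using a_pos c_pos \<phi>_pos[of y] by simp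
    finally show ?thesis using r0_le_r[of y] r0_pos E_pos by (intro mult_mono) auto
  qed
  have d0: "0 < r0 * (r0 * (2 * E))" using r0_pos E_pos by simp
  have b: "\<bar>\<phi>1 y\<bar> \<le> C * \<bar>\<phi> y - k\<bar>" for y
  proof -
    have "(\<phi>1 y)\<^sup>2 * (r0 * (r0 * (2 * E))) \<le> (\<phi>1 y)\<^sup>2 * (r y * (r y * (2 * E + (\<phi> y)\<^sup>2) + 2 * a * \<phi> y / c))"
      by (intro mult_left_mono den) simp
    also have "\<dots> = ((\<phi> y)\<^sup>2 - k\<^sup>2)\<^sup>2 * (p0\<^sup>2 - (\<phi> y)\<^sup>2)" by (rule factorised_first_integral)
    also have "\<dots> = (\<phi> y - k)\<^sup>2 * ((\<phi> y + k)\<^sup>2 * (p0\<^sup>2 - (\<phi> y)\<^sup>2))" by (simp add: power2_eq_square algebra_simps)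
    also have "\<dots> \<le> (\<phi> y - k)\<^sup>2 * ((2 * p0)\<^sup>2 * p0\<^sup>2)"
    proof (intro mult_left_mono mult_mono)
      show "(\<phi> y + k)\<^sup>2 \<le> (2 * p0)\<^sup>2" using \<phi>_le_p0[of y] k_less_p0 \<phi>_pos[of y] k_pos by (intro power_mono) auto
      show "0 \<le> p0\<^sup>2 - (\<phi> y)\<^sup>2" using power_mono[OF \<phi>_le_p0[of y], of 2] \<phi>_pos[of y] by simp
    qed auto
    also have "(2 * p0)\<^sup>2 * p0\<^sup>2 = (2 * p0 * p0)\<^sup>2" by (simp only: power_mult_distrib)
    finally have "(\<phi>1 y)\<^sup>2 \<le> (\<phi> y - k)\<^sup>2 * (2 * p0 * p0)\<^sup>2 / (r0 * (r0 * (2 * E)))"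
      unfolding pos_le_divide_eq[OF d0] .
    also have "\<dots> = (C * \<bar>\<phi> y - k\<bar>)\<^sup>2" using d0 by (simp add: C_def power_divide power_mult_distrib)
    finally have "\<bar>\<phi>1 y\<bar>\<^sup>2 \<le> (C * \<bar>\<phi> y - k\<bar>)\<^sup>2" by simp
    moreover have "0 \<le> C" using d0 by (simp add: C_def)
    ultimately show ?thesis by (intro power2_le_imp_le[of "\<bar>\<phi>1 y\<bar>"]) auto
  qed
  have "\<phi> y - k = 0" for y
  proof (rule Gronwall_zero[where u = "\<lambda>y. \<phi> y - k" and u' = \<phi>1 and C = C and ?x0.0 = x and x = y])
    show "((\<lambda>y. \<phi> y - k) has_real_derivative \<phi>1 y) (at y)" for y
      using DERIV_diff[OF \<phi>_deriv[of y] DERIV_const[of k]] by simp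
  qed (use b z in auto)
  then show False using \<phi>_nonconst by (metis eq_iff_diff_eq_0)
qed

lemma critical_value:
  assumes "\<phi>1 x = 0" shows "\<phi> x = p0"
proof -
  have "((\<phi> x)\<^sup>2 - k\<^sup>2)\<^sup>2 * (p0\<^sup>2 - (\<phi> x)\<^sup>2) = 0"
    using factorised_first_integral[of x] assms by simp
  moreover have "(\<phi> x)\<^sup>2 \<noteq> k\<^sup>2" using \<phi>_neq_k[of x] \<phi>_pos[of x] k_pos by (simp add: power2_eq_iff)
  ultimately show ?thesis using \<phi>_pos[of x] p0_pos by (simp add: power2_eq_iff)
qed

lemma \<phi>_0: "\<phi> 0 = p0"
  by (rule critical_value[OF \<phi>1_0])

lemma r_0: "r 0 = r0"
  using r0_sq r0_pos by (metis \<phi>_0 r_def real_sqrt_unique less_imp_le)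

text \<open>The left side is the second derivative at the crest. It equals
  \<open>- (c - 4 k^2)^2 / (8 k^2 sqrt c)\<close>, so the crest is a strict maximum.\<close>

lemma \<phi>2_crest: "p0 - a / r0 ^ 3 < 0"
proof -
  have sc: "sqrt c * sqrt c = c" "0 < sqrt c" using c_pos by auto
  have "a / r0 ^ 3 = c * sqrt c / (8 * k\<^sup>2)"
    unfolding a_eq r0_def using \<rho>_pos k_pos sc
    by (simp add: power_divide power_mult_distrib field_simps power3_eq_cube power2_eq_square)
  also have "\<dots> = c\<^sup>2 / (8 * k\<^sup>2 * sqrt c)" using sc k_pos by (simp add: field_simps power2_eq_square)
  finally have e: "a / r0 ^ 3 = c\<^sup>2 / (8 * k\<^sup>2 * sqrt c)" .
  have "p0 - a / r0 ^ 3 = - ((c - 4 * k\<^sup>2)\<^sup>2 / (8 * k\<^sup>2 * sqrt c))"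
    unfolding p0_def e using sc(2) k_pos by (simp add: divide_simps) (simp add: power2_eq_square algebra_simps)
  also have "\<dots> < 0" using four_k k_pos sc by simp
  finally show ?thesis .
qed

text \<open>All critical values equal the maximum \<open>p0\<close>. A second critical point would
  force the minimum in between to be \<open>p0\<close> as well, so the profile would be constant on
  an interval, against its negative second derivative at that height.\<close>

lemma \<phi>1_nonzero:
  assumes x: "0 < x" shows "\<phi>1 x \<noteq> 0"
proof
  assume z: "\<phi>1 x = 0"
  then have px: "\<phi> x = p0" by (rule critical_value)
  obtain y where y: "y \<in> {0..x}" "\<And>z. z \<in> {0..x} \<Longrightarrow> \<phi> y \<le> \<phi> z"
    using continuous_attains_inf[of "{0..x}" \<phi>] \<phi>_cont x by auto
  have "\<phi> y = p0"
  proof (cases "y = 0 \<or> y = x")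
    case True
    then show ?thesis using px \<phi>_0 by auto
  next
    case False
    then have yi: "0 < y" "y < x" using y(1) by auto
    have "\<phi>1 y = 0"
    proof (rule DERIV_local_min[OF \<phi>_deriv, of "min y (x - y)"])
      show "\<forall>z. \<bar>y - z\<bar> < min y (x - y) \<longrightarrow> \<phi> y \<le> \<phi> z" using y(2) by (auto simp: abs_if split: if_splits)
    qed (use yi in auto)
    then show ?thesis by (rule critical_value)
  qed
  then have const: "\<phi> t = p0" if "t \<in> {0<..<x}" for t using y(2)[of t] \<phi>_le_p0[of t] that by force
  have d0: "\<phi>1 t = 0" if "t \<in> {0<..<x}" for t
  proof -
    have "(\<phi> has_real_derivative 0) (at t)"
      using that const by (intro has_field_derivative_transform_within_open[of "\<lambda>x. p0" 0 t "{0<..<x}" \<phi>]) auto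
    then show ?thesis using DERIV_unique[OF \<phi>_deriv] by blast
  qed
  have t: "x / 2 \<in> {0<..<x}" using x by simp
  have "(\<phi>1 has_real_derivative 0) (at (x / 2))"
    using t d0 by (intro has_field_derivative_transform_within_open[of "\<lambda>x. 0" 0 "x / 2" "{0<..<x}" \<phi>1]) auto
  then have "\<phi>2 (x / 2) = 0" using DERIV_unique[OF \<phi>1_deriv] by blast
  moreover have "r (x / 2) = r0" using const[OF t] \<phi>_0 r_0 by (simp add: r_def)
  ultimately show False using \<phi>2_eq[of "x / 2"] const[OF t] \<phi>2_crest by simp
qed

lemma \<phi>1_neg:
  assumes x: "0 < x" shows "\<phi>1 x < 0"
proof (rule ccontr)
  assume "\<not> \<phi>1 x < 0"
  then have pos: "0 < \<phi>1 x" using \<phi>1_nonzero[OF x] by simp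
  obtain z where z: "0 < z" "z < x" "\<phi> x - \<phi> 0 = (x - 0) * \<phi>1 z" using MVT2[OF x, of \<phi> \<phi>1] \<phi>_deriv by auto
  have "(x - 0) * \<phi>1 z \<le> 0" using z(3) \<phi>_0 \<phi>_le_p0[of x] by linarith
  then have "\<phi>1 z \<le> 0" using x by (simp add: mult_le_0_iff)
  then have "\<exists>y. z \<le> y \<and> y \<le> x \<and> \<phi>1 y = 0" using pos z by (intro IVT' \<phi>1_cont) auto
  then show False using \<phi>1_nonzero z(1) by force
qed

lemma \<phi>1_odd: "\<phi>1 (- x) = - \<phi>1 x"
proof -
  have "((\<lambda>x. \<phi> (- x)) has_real_derivative - \<phi>1 (- x)) (at x)"
    using \<phi>_deriv[of "- x"] by (simp add: DERIV_mirror)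
  then have "(\<phi> has_real_derivative - \<phi>1 (- x)) (at x)" by (simp add: \<phi>_even)
  then have "- \<phi>1 (- x) = \<phi>1 x" using DERIV_unique[OF _ \<phi>_deriv] by blast
  then show ?thesis by linarith
qed

lemma r_even: "r (- x) = r x" by (simp add: r_def \<phi>_even)

lemma \<phi>2_even: "\<phi>2 (- x) = \<phi>2 x" by (simp add: \<phi>2_eq r_even \<phi>_even)

lemma \<phi>2_lim: "(\<phi>2 \<longlongrightarrow> 0) at_top"
proof -
  have "((\<lambda>x. \<phi> x - a / r x ^ 3) \<longlongrightarrow> k - a / \<rho> ^ 3) at_top"
    by (intro tendsto_intros \<phi>_lim r_lim) (use \<rho>_pos in auto)
  then show ?thesis using \<rho>_pos by (simp add: \<phi>2_eq[abs_def] a_eq)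
qed

end

subsection \<open>Coefficients of the operators\<close>

lemma bounded_of_symmetric_limit:
  fixes f :: "real \<Rightarrow> real"
  assumes "continuous_on UNIV f" "(f \<longlongrightarrow> L) at_top" "\<And>x. \<bar>f (- x)\<bar> = \<bar>f x\<bar>"
  obtains B where "\<And>x. \<bar>f x\<bar> \<le> B"
proof -
  have "eventually (\<lambda>x. dist (f x) L < 1) at_top" by (rule tendstoD[OF assms(2)]) simp
  then obtain T where T: "\<And>x. T \<le> x \<Longrightarrow> \<bar>f x - L\<bar> < 1"
    by (auto simp: eventually_at_top_linorder dist_real_def)
  have "compact (f ` {0..T})" by (intro compact_continuous_image continuous_on_subset[OF assms(1)]) auto
  then obtain B where B: "\<And>x. x \<in> {0..T} \<Longrightarrow> norm (f x) \<le> B"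
    by (metis compact_imp_bounded bounded_iff image_eqI)
  have *: "\<bar>f x\<bar> \<le> max B (\<bar>L\<bar> + 1)" if "0 \<le> x" for x
    using B[of x] T[of x] that by (cases "x \<le> T") (auto simp: le_max_iff_disj)
  have "\<bar>f x\<bar> \<le> max B (\<bar>L\<bar> + 1)" for x
    using *[of x] *[of "- x"] assms(3)[of x] by (cases "0 \<le> x") auto
  then show thesis by (rule that)
qed

lemma powr_third:
  fixes a r :: real
  assumes "0 < a" "0 < r"
  shows "(a / r ^ 3) powr (- (real j / 3)) = a powr (- (real j / 3)) * r ^ j"
proof -
  have "(r ^ 3) powr (- (real j / 3)) = (r powr 3) powr (- (real j / 3))"
    using assms by simp
  also have "\<dots> = r powr (3 * - (real j / 3))" by (rule powr_powr)
  also have "3 * - (real j / 3) = - real j" by simp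
  also have "r powr (- real j) = 1 / r powr (real j)" by (rule powr_minus_divide)
  also have "r powr (real j) = r ^ j" using assms by (rule_tac powr_realpow)
  finally show ?thesis using assms by (simp add: powr_divide)
qed

context novikov_profile
begin

text \<open>The common scale of all coefficients once \<open>\<mu>\<close> is expressed through
  \<open>r\<close>.\<close>

definition A :: real where "A = a powr (-8/3)"

lemma A_pos: "0 < A" using a_pos by (simp add: A_def)

lemma A_powers:
  "a powr (-11/3) * a = A" "a powr (-14/3) * a\<^sup>2 = A" "a powr (-4/3) * a powr (-4/3) = A"
  "a powr (-2/3) / a = A * a"
proof -
  have p: "a powr s * a powr t = a powr (s + t)" for s t by (rule powr_add[symmetric])
  have a1: "a powr 1 = a" and a2: "a powr 2 = a\<^sup>2" using a_pos by simp_all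
  show "a powr (-11/3) * a = A" using p[of "-11/3" 1] unfolding a1 A_def by simp
  show "a powr (-14/3) * a\<^sup>2 = A" using p[of "-14/3" 2] unfolding a2 A_def by simp
  show "a powr (-4/3) * a powr (-4/3) = A" using p[of "-4/3" "-4/3"] unfolding A_def by simp
  have "A * a * a = a powr (-2/3)" using p[of "-8/3" 2] unfolding a2 A_def by (simp add: power2_eq_square)
  then show "a powr (-2/3) / a = A * a" using a_pos by (simp add: field_simps)
qed

lemma r_nz: "r x \<noteq> 0" using r_pos[of x] by simp

lemma \<phi>_nz: "\<phi> x \<noteq> 0" using \<phi>_pos[of x] by simp

abbreviation \<mu> :: "real \<Rightarrow> real" where "\<mu> \<equiv> nov_mu \<phi>"

lemma \<mu>_eq: "\<mu> x = a / r x ^ 3"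
  using \<phi>2_eq[of x] by (simp add: nov_mu_def \<phi>2_def \<phi>1_def)

lemma \<mu>_powr:
  "\<mu> x powr (-8/3) = A * r x ^ 8" "\<mu> x powr (-11/3) = a powr (-11/3) * r x ^ 11"
  "\<mu> x powr (-14/3) = a powr (-14/3) * r x ^ 14" "\<mu> x powr (-4/3) = a powr (-4/3) * r x ^ 4"
  using powr_third[OF a_pos r_pos[of x], of 8] powr_third[OF a_pos r_pos[of x], of 11]
    powr_third[OF a_pos r_pos[of x], of 14] powr_third[OF a_pos r_pos[of x], of 4]
  by (simp_all add: \<mu>_eq A_def)

definition \<mu>1 :: "real \<Rightarrow> real" where "\<mu>1 x = 3 * a * \<phi> x * \<phi>1 x / r x ^ 5"
definition \<mu>2 :: "real \<Rightarrow> real" where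
  "\<mu>2 x = 3 * a * (((\<phi>1 x)\<^sup>2 + \<phi> x * \<phi>2 x) / r x ^ 5 + 5 * (\<phi> x)\<^sup>2 * (\<phi>1 x)\<^sup>2 / r x ^ 7)"

lemma r_power_deriv: "((\<lambda>x. r x ^ n) has_real_derivative - (real n * r x ^ (n - 1) * (\<phi> x * \<phi>1 x / r x))) (at x)"
  by (rule DERIV_cong[OF DERIV_power[OF r_deriv]]) simp

lemma inverse_r_power_deriv:
  "((\<lambda>x. 1 / r x ^ n) has_real_derivative real n * \<phi> x * \<phi>1 x / r x ^ (n + 2)) (at x)"
proof -
  have "((\<lambda>x. 1 / r x ^ n) has_real_derivative
     (0 * r x ^ n - 1 * - (real n * r x ^ (n - 1) * (\<phi> x * \<phi>1 x / r x))) / (r x ^ n * r x ^ n)) (at x)"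
    by (rule DERIV_divide[OF DERIV_const r_power_deriv]) (simp add: r_nz)
  moreover have "(0 * r x ^ n - 1 * - (real n * r x ^ (n - 1) * (\<phi> x * \<phi>1 x / r x))) / (r x ^ n * r x ^ n)
      = real n * \<phi> x * \<phi>1 x / r x ^ (n + 2)"
    using r_nz[of x] by (cases n) (simp_all add: field_simps power_add power2_eq_square)
  ultimately show ?thesis by simp
qed

lemma \<mu>_deriv: "(\<mu> has_real_derivative \<mu>1 x) (at x)"
proof -
  have "((\<lambda>x. a * (1 / r x ^ 3)) has_real_derivative a * (real 3 * \<phi> x * \<phi>1 x / r x ^ (3 + 2))) (at x)"
    by (rule DERIV_cmult[OF inverse_r_power_deriv])
  moreover have "\<mu> = (\<lambda>x. a * (1 / r x ^ 3))" by (rule ext) (simp add: \<mu>_eq)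
  ultimately show ?thesis by (simp add: \<mu>1_def mult_ac)
qed

lemma \<phi>\<phi>1_deriv: "((\<lambda>x. \<phi> x * \<phi>1 x) has_real_derivative (\<phi>1 x)\<^sup>2 + \<phi> x * \<phi>2 x) (at x)"
  by (auto intro!: derivative_eq_intros \<phi>_deriv \<phi>1_deriv simp: power2_eq_square)

lemma \<phi>\<phi>1_r5_deriv:
  "((\<lambda>x. \<phi> x * \<phi>1 x / r x ^ 5) has_real_derivative
     ((\<phi>1 x)\<^sup>2 + \<phi> x * \<phi>2 x) / r x ^ 5 + 5 * (\<phi> x)\<^sup>2 * (\<phi>1 x)\<^sup>2 / r x ^ 7) (at x)"
  using DERIV_mult[OF \<phi>\<phi>1_deriv[of x] inverse_r_power_deriv[of 5 x]]
  by (simp add: power2_eq_square mult_ac)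

lemma \<mu>1_deriv: "(\<mu>1 has_real_derivative \<mu>2 x) (at x)"
proof -
  have "\<mu>1 = (\<lambda>x. 3 * a * (\<phi> x * \<phi>1 x / r x ^ 5))" by (rule ext) (simp add: \<mu>1_def)
  then show ?thesis using DERIV_cmult[OF \<phi>\<phi>1_r5_deriv[of x], of "3 * a"] by (simp add: \<mu>2_def)
qed

lemma deriv_\<mu>: "deriv \<mu> = \<mu>1" "deriv \<mu>1 = \<mu>2"
  using \<mu>_deriv \<mu>1_deriv by (auto intro!: ext DERIV_imp_deriv)

definition P :: "real \<Rightarrow> real" where "P x = 2 * A * r x ^ 8"
definition P' :: "real \<Rightarrow> real" where "P' x = - (16 * A * r x ^ 6 * (\<phi> x * \<phi>1 x))"

lemma P_deriv: "(P has_real_derivative P' x) (at x)"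
  unfolding P_def[abs_def]
  by (rule DERIV_cong[OF DERIV_cmult[OF r_power_deriv]]) (use r_nz[of x] in \<open>simp add: P'_def field_simps eval_nat_numeral\<close>)

text \<open>The zeroth-order coefficient of \<open>op_L0\<close>. The numbers arise as
  \<open>16 = 2/3 * 8 * 3\<close>, \<open>- 8 = 2/3 * (8 * 15 - 44/3 * 9)\<close> and
  \<open>10 = 2/3 * 15\<close>, where 3, 15 and 9 come from the derivatives of
  \<open>\<mu>\<close>.\<close>

definition q :: "real \<Rightarrow> real" where
  "q x = A * (16 * ((\<phi>1 x)\<^sup>2 + \<phi> x * \<phi>2 x) * r x ^ 6 - 8 * (\<phi> x)\<^sup>2 * (\<phi>1 x)\<^sup>2 * r x ^ 4
     + 10 * r x ^ 8 - 2 * (c * (2 * E + c)) * r x ^ 4)"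

lemma q_eq: "q x = 2/3 * (8 * deriv (deriv \<mu>) x * \<mu> x powr (-11/3)
           - (44/3) * (deriv \<mu> x)\<^sup>2 * \<mu> x powr (-14/3)
           + 15 * \<mu> x powr (-8/3)) - 2 * omega1 c k / 9 * \<mu> x powr (-4/3)"
proof -
  have 1: "\<mu>2 x * \<mu> x powr (-11/3) = 3 * A * (((\<phi>1 x)\<^sup>2 + \<phi> x * \<phi>2 x) * r x ^ 6 + 5 * (\<phi> x)\<^sup>2 * (\<phi>1 x)\<^sup>2 * r x ^ 4)"
  proof -
    have "\<mu>2 x * \<mu> x powr (-11/3) = 3 * (a powr (-11/3) * a) *
        (((\<phi>1 x)\<^sup>2 + \<phi> x * \<phi>2 x) * (r x ^ 11 / r x ^ 5) + 5 * (\<phi> x)\<^sup>2 * (\<phi>1 x)\<^sup>2 * (r x ^ 11 / r x ^ 7))"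
      unfolding \<mu>2_def \<mu>_powr by (simp add: algebra_simps)
    moreover have "r x ^ 11 / r x ^ 5 = r x ^ 6" "r x ^ 11 / r x ^ 7 = r x ^ 4"
      using r_nz[of x] by (simp_all add: power_diff[symmetric])
    ultimately show ?thesis by (simp only: A_powers)
  qed
  have 2: "(\<mu>1 x)\<^sup>2 * \<mu> x powr (-14/3) = 9 * A * ((\<phi> x)\<^sup>2 * (\<phi>1 x)\<^sup>2 * r x ^ 4)"
  proof -
    have "(\<mu>1 x)\<^sup>2 * \<mu> x powr (-14/3) = 9 * (a powr (-14/3) * a\<^sup>2) * ((\<phi> x)\<^sup>2 * (\<phi>1 x)\<^sup>2 * (r x ^ 14 / r x ^ 10))"
      unfolding \<mu>1_def \<mu>_powr by (simp add: power_divide power_mult_distrib flip: power_mult)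
    moreover have "r x ^ 14 / r x ^ 10 = r x ^ 4" using r_nz[of x] by (simp add: power_diff[symmetric])
    ultimately show ?thesis by (simp only: A_powers)
  qed
  have 3: "2 * omega1 c k / 9 * \<mu> x powr (-4/3) = A * (2 * (c * (2 * E + c)) * r x ^ 4)"
  proof -
    have "2 * omega1 c k / 9 * \<mu> x powr (-4/3) = (a powr (-4/3) * a powr (-4/3)) * (2 * (c * (2 * E + c)) * r x ^ 4)"
      unfolding \<mu>_powr omega1_def E_def a_def by simp
    then show ?thesis by (simp only: A_powers)
  qed
  have "2/3 * (8 * deriv (deriv \<mu>) x * \<mu> x powr (-11/3) - (44/3) * (deriv \<mu> x)\<^sup>2 * \<mu> x powr (-14/3) + 15 * \<mu> x powr (-8/3))
      = 2/3 * (8 * (\<mu>2 x * \<mu> x powr (-11/3)) - (44/3) * ((\<mu>1 x)\<^sup>2 * \<mu> x powr (-14/3)) + 15 * (A * r x ^ 8))"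
    unfolding deriv_\<mu> \<mu>_powr(1) by simp
  then show ?thesis unfolding 1 2 3 by (simp add: q_def algebra_simps)
qed

section \<open>The modified potential and its kernel solution\<close>

definition f :: "real \<Rightarrow> real" where "f x = r x ^ 5 / (3 * a * \<phi> x)"
definition \<omega> :: real where "\<omega> = omega0 c k"

lemma f_eq: "nov_f c k \<phi> x = f x"
proof -
  have "(a / r x ^ 3) powr (- (5/3)) = a powr (- (5/3)) * r x ^ 5"
    using powr_third[OF a_pos r_pos[of x], of 5] by simp
  then have m: "1 / \<mu> x powr (5/3) = a powr (- (5/3)) * r x ^ 5"
    by (simp add: \<mu>_eq powr_minus_divide)
  have "a powr (2/3) * a powr (- (5/3)) = a powr (- 1)" by (simp flip: powr_add)
  also have "\<dots> = 1 / a" using a_pos by (simp add: powr_minus_divide)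
  finally have aa: "a powr (2/3) * a powr (- (5/3)) = 1 / a" .
  have "nov_f c k \<phi> x = a powr (2/3) * (1 / \<mu> x powr (5/3)) / (3 * \<phi> x)"
    by (simp add: nov_f_def a_def)
  also have "\<dots> = (a powr (2/3) * a powr (- (5/3))) * r x ^ 5 / (3 * \<phi> x)" unfolding m by simp
  finally show ?thesis unfolding aa by (simp add: f_def)
qed

lemma \<omega>_neg: "\<omega> < 0"
  unfolding \<omega>_def omega0_def a_def[symmetric] using a_pos by simp

lemma \<omega>f: "2 * \<omega> * f x = - (6 * A * a * r x ^ 5 / \<phi> x)"
proof -
  have "2 * \<omega> * f x = - 6 * (a powr (-2/3) / a) * r x ^ 5 / \<phi> x"
    unfolding \<omega>_def omega0_def a_def[symmetric] f_def using \<phi>_nz[of x] a_pos by (simp add: field_simps)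
  then show ?thesis unfolding A_powers by simp
qed

definition Q :: "real \<Rightarrow> real" where "Q x = q x + 2 * \<omega> * f x"

text \<open>The derivative of the momentum density divided by \<open>- 3 a\<close>; the sign makes
  it positive to the right of the crest. \<open>vf\<close> is its flux \<open>P v'\<close>.\<close>

definition v :: "real \<Rightarrow> real" where "v x = - (\<phi> x * \<phi>1 x / r x ^ 5)"
definition vf :: "real \<Rightarrow> real" where
  "vf x = - (2 * A * (((\<phi>1 x)\<^sup>2 + \<phi> x * \<phi>2 x) * r x ^ 3 + 5 * ((\<phi> x)\<^sup>2 * (\<phi>1 x)\<^sup>2 * r x)))"

lemma v_deriv: "(v has_real_derivative vf x / P x) (at x)"
proof -
  have "vf x / P x = - (((\<phi>1 x)\<^sup>2 + \<phi> x * \<phi>2 x) / r x ^ 5 + 5 * (\<phi> x)\<^sup>2 * (\<phi>1 x)\<^sup>2 / r x ^ 7)"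
    unfolding vf_def P_def using r_nz[of x] A_pos by (simp add: field_simps eval_nat_numeral)
  then show ?thesis unfolding v_def[abs_def] using DERIV_minus[OF \<phi>\<phi>1_r5_deriv[of x]] by simp
qed

lemma \<phi>2_deriv: "(\<phi>2 has_real_derivative \<phi>1 x - 3 * a * \<phi> x * \<phi>1 x / r x ^ 5) (at x)"
proof -
  have "\<phi>2 = (\<lambda>x. \<phi> x - a * (1 / r x ^ 3))" by (rule ext) (simp add: \<phi>2_eq)
  then show ?thesis
    using DERIV_diff[OF \<phi>_deriv[of x] DERIV_cmult[OF inverse_r_power_deriv[of 3 x], of a]] by (simp add: mult_ac)
qed

text \<open>
  This is the identity stating that the derivative of the momentum density is in the kernel of the
  modified operator; the constant \<open>c (2 E + c)\<close> is eliminated by means of the first integral.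
\<close>

lemma vf_deriv: "(vf has_real_derivative Q x * v x) (at x)"
proof -
  define y D R where "y = \<phi> x" and "D = \<phi>1 x" and "R = r x"
  have R: "R \<noteq> 0" and y: "y \<noteq> 0" by (simp_all add: R_def y_def r_nz \<phi>_nz)
  have c: "c = R\<^sup>2 + y\<^sup>2" using r_sq[of x] by (simp add: R_def y_def)
  have K: "c * (2 * E + c) = (R\<^sup>2 + y\<^sup>2) * (D\<^sup>2 + R\<^sup>2) + 2 * a * y / R"
  proof -
    have "2 * E = D\<^sup>2 - y\<^sup>2 + 2 * a * y / (c * R)" using first_integral[of x] by (simp add: D_def y_def R_def)
    then have "c * (2 * E + c) = c * (D\<^sup>2 + (c - y\<^sup>2)) + 2 * a * y / R"
      using c_pos R by (simp add: field_simps)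
    then show ?thesis by (simp add: c)
  qed
  have d2: "\<phi>2 x = y - a / R ^ 3" by (simp add: \<phi>2_eq y_def R_def)
  have "((\<lambda>x. ((\<phi>1 x)\<^sup>2 + \<phi> x * \<phi>2 x) * r x ^ 3 + 5 * ((\<phi> x)\<^sup>2 * (\<phi>1 x)\<^sup>2 * r x)) has_real_derivative
    (2 * D * \<phi>2 x + (D * \<phi>2 x + (D - 3 * a * y * D / R ^ 5) * y)) * R ^ 3
      + - (real 3 * R ^ (3 - 1) * (y * D / R)) * (D\<^sup>2 + y * \<phi>2 x)
    + 5 * ((2 * y * D * D\<^sup>2 + 2 * D * \<phi>2 x * y\<^sup>2) * R + - (y * D / R) * (y\<^sup>2 * D\<^sup>2))) (at x)"
    unfolding y_def D_def R_def
    by (intro DERIV_add DERIV_mult DERIV_cmult r_power_deriv r_deriv)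
      (auto intro!: derivative_eq_intros \<phi>_deriv \<phi>1_deriv \<phi>2_deriv)
  note vfd = DERIV_minus[OF DERIV_cmult[OF this, of "2 * A"]]
  have Q: "Q x = A * (16 * (D\<^sup>2 + y * \<phi>2 x) * R ^ 6 - 8 * y\<^sup>2 * D\<^sup>2 * R ^ 4 + 10 * R ^ 8
      - 2 * (c * (2 * E + c)) * R ^ 4 - 6 * a * R ^ 5 / y)"
    unfolding Q_def q_def \<omega>f y_def D_def R_def by (simp add: algebra_simps)
  have "- (2 * A * ((2 * D * \<phi>2 x + (D * \<phi>2 x + (D - 3 * a * y * D / R ^ 5) * y)) * R ^ 3
      + - (real 3 * R ^ (3 - 1) * (y * D / R)) * (D\<^sup>2 + y * \<phi>2 x)
    + 5 * ((2 * y * D * D\<^sup>2 + 2 * D * \<phi>2 x * y\<^sup>2) * R + - (y * D / R) * (y\<^sup>2 * D\<^sup>2)))) = Q x * - (y * D / R ^ 5)"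
    unfolding Q K d2 using R y by (simp add: field_simps) (simp add: algebra_simps eval_nat_numeral)
  then show ?thesis unfolding vf_def[abs_def] v_def y_def[symmetric] D_def[symmetric] R_def[symmetric]
    using vfd by (simp only:)
qed

end

subsection \<open>The spectral bound\<close>

context novikov_profile
begin

lemma q_cont: "continuous_on UNIV q" and f_cont: "continuous_on UNIV f" and Q_cont: "continuous_on UNIV Q"
  and P'_cont: "continuous_on UNIV P'"
proof -
  show qc: "continuous_on UNIV q"
    unfolding q_def[abs_def] by (intro continuous_intros \<phi>_cont \<phi>1_cont \<phi>2_cont r_cont)
  show fc: "continuous_on UNIV f"
    unfolding f_def[abs_def] by (intro continuous_intros \<phi>_cont r_cont) (use \<phi>_nz a_pos in auto)
  show "continuous_on UNIV Q" unfolding Q_def[abs_def] by (intro continuous_intros qc fc)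
  show "continuous_on UNIV P'"
    unfolding P'_def[abs_def] by (intro continuous_intros \<phi>_cont \<phi>1_cont r_cont)
qed

text \<open>At the crest \<open>\<phi>\<close> is largest and \<open>r\<close> is smallest, so the
  numerator is least and the denominator greatest.\<close>

lemma f_ge: "f 0 \<le> f x"
  unfolding f_def r_0 \<phi>_0
proof (rule frac_le)
  show "r0 ^ 5 \<le> r x ^ 5" using r0_le_r[of x] r0_pos by (intro power_mono) auto
  show "3 * a * \<phi> x \<le> 3 * a * p0" using \<phi>_le_p0[of x] a_pos by simp
  show "0 < 3 * a * \<phi> x" using \<phi>_pos[of x] a_pos by simp
  show "0 \<le> r x ^ 5" using r_pos[of x] by simp
qed

text \<open>After insertion of \<open>r0\<close>, \<open>p0\<close> and \<open>a\<close> the claim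
  is \<open>32 k^4 (c - k^2) < 3 c^2 (c - 2 k^2)\<close>. With \<open>4 k^2 < c\<close> the left
  side is at most \<open>8 c k^2 (c - k^2)\<close>, and the gap to the right side factorises as
  \<open>c (c - 4 k^2) (3 c - 2 k^2)\<close>.\<close>

lemma f_0_less_1: "f 0 < 1"
proof -
  define s where "s = sqrt c"
  have s: "0 < s" "c = s\<^sup>2" using c_pos by (simp_all add: s_def)
  have "32 * (k\<^sup>2)\<^sup>2 * (c - k\<^sup>2) < 3 * c\<^sup>2 * (c - 2 * k\<^sup>2)"
  proof -
    have k2: "0 < k\<^sup>2" using k_pos by simp
    have "32 * (k\<^sup>2)\<^sup>2 * (c - k\<^sup>2) \<le> 8 * c * k\<^sup>2 * (c - k\<^sup>2)"
    proof (rule mult_right_mono)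
      have "8 * k\<^sup>2 * (4 * k\<^sup>2) \<le> 8 * k\<^sup>2 * c" using four_k k2 by (intro mult_left_mono) auto
      then show "32 * (k\<^sup>2)\<^sup>2 \<le> 8 * c * k\<^sup>2" by (simp add: power2_eq_square algebra_simps)
    qed (use four_k k2 in linarith)
    moreover have "0 < c * ((c - 4 * k\<^sup>2) * (3 * c - 2 * k\<^sup>2))"
      using four_k k2 c_pos by (intro mult_pos_pos) linarith+
    moreover have "3 * c\<^sup>2 * (c - 2 * k\<^sup>2) - 8 * c * k\<^sup>2 * (c - k\<^sup>2) = c * ((c - 4 * k\<^sup>2) * (3 * c - 2 * k\<^sup>2))"
      by (simp add: power2_eq_square algebra_simps)
    ultimately show ?thesis by linarith
  qed
  then have "32 * k ^ 4 * \<rho>\<^sup>2 < 3 * c\<^sup>2 * (c - 2 * k\<^sup>2)" by (simp add: \<rho>_sq flip: power_mult)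
  then have "(32 * k ^ 4 * \<rho>\<^sup>2) * (k * \<rho> ^ 3) < (3 * c\<^sup>2 * (c - 2 * k\<^sup>2)) * (k * \<rho> ^ 3)"
    using k_pos \<rho>_pos by (intro mult_strict_right_mono) auto
  then have "32 * k ^ 5 * \<rho> ^ 5 / s ^ 5 < 3 * (k * \<rho> ^ 3) * ((c - 2 * k\<^sup>2) / s)"
    using s(1) unfolding s(2) by (simp add: field_simps eval_nat_numeral)
  then have "r0 ^ 5 < 3 * a * p0"
    by (simp add: r0_def p0_def a_eq s_def power_divide power_mult_distrib)
  then show ?thesis using a_pos p0_pos by (simp add: f_def r_0 \<phi>_0)
qed

text \<open>The limit of \<open>Q\<close> is \<open>2 A \<rho>^6 (c - 4 k^2)\<close>: the bound
  \<open>k < sqrt c / 2\<close> is precisely what makes the potential positive far out.\<close>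

lemma Q_lim: obtains Qi where "0 < Qi" "(Q \<longlongrightarrow> Qi) at_top" "(q \<longlongrightarrow> Qi - 2 * \<omega> * (\<rho> ^ 5 / (3 * a * k))) at_top"
  "(f \<longlongrightarrow> \<rho> ^ 5 / (3 * a * k)) at_top"
proof -
  define qi where "qi = A * (16 * (0\<^sup>2 + k * 0) * \<rho> ^ 6 - 8 * k\<^sup>2 * 0\<^sup>2 * \<rho> ^ 4 + 10 * \<rho> ^ 8 - 2 * (c * (2 * E + c)) * \<rho> ^ 4)"
  define fi where "fi = \<rho> ^ 5 / (3 * a * k)"
  have ql: "(q \<longlongrightarrow> qi) at_top"
    unfolding q_def[abs_def] qi_def by (intro tendsto_intros \<phi>_lim \<phi>1_lim \<phi>2_lim r_lim)
  have fl: "(f \<longlongrightarrow> fi) at_top"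
    unfolding f_def[abs_def] fi_def by (intro tendsto_intros \<phi>_lim r_lim) (use a_pos k_pos in auto)
  have Ql: "(Q \<longlongrightarrow> qi + 2 * \<omega> * fi) at_top"
    unfolding Q_def[abs_def] by (intro tendsto_intros ql fl)
  have cE: "c * (2 * E + c) = \<rho>\<^sup>2 * (c + 2 * k\<^sup>2)"
    unfolding twoE \<rho>_sq using c_pos by (simp add: field_simps power2_eq_square)
  have "2 * \<omega> * fi = - 6 * (a powr (-2/3) / a) * \<rho> ^ 5 / k"
    unfolding \<omega>_def omega0_def a_def[symmetric] fi_def using k_pos a_pos by (simp add: field_simps)
  also have "\<dots> = - 6 * (A * a) * \<rho> ^ 5 / k" by (simp only: A_powers)
  also have "\<dots> = - (A * (6 * \<rho> ^ 8))"
    unfolding a_eq using k_pos by (simp add: field_simps eval_nat_numeral)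
  finally have wf: "2 * \<omega> * fi = - (A * (6 * \<rho> ^ 8))" .
  have "qi + 2 * \<omega> * fi = A * (4 * \<rho> ^ 8 - 2 * (\<rho>\<^sup>2 * (c + 2 * k\<^sup>2)) * \<rho> ^ 4)"
    unfolding wf qi_def cE by (simp add: algebra_simps)
  also have "\<dots> = A * (\<rho> ^ 6 * (2 * (2 * \<rho>\<^sup>2 - (c + 2 * k\<^sup>2))))"
  proof -
    have "\<rho> ^ 8 = \<rho> ^ 6 * \<rho>\<^sup>2" "\<rho>\<^sup>2 * z * \<rho> ^ 4 = \<rho> ^ 6 * z" for z by (simp_all add: eval_nat_numeral)
    then show ?thesis by (simp add: right_diff_distrib mult_ac)
  qed
  also have "\<dots> = A * (\<rho> ^ 6 * (2 * (c - 4 * k\<^sup>2)))" by (simp add: \<rho>_sq)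
  also have "\<dots> > 0" using A_pos \<rho>_pos four_k by simp
  finally have pos: "0 < qi + 2 * \<omega> * fi" .
  show thesis using that[OF pos Ql] ql fl by (simp add: fi_def)
qed

lemma q_even: "q (- x) = q x" and f_even: "f (- x) = f x" and P'_odd: "P' (- x) = - P' x"
  by (simp_all add: q_def f_def P'_def \<phi>_even \<phi>1_odd \<phi>2_even r_even)

lemma leading: obtains b where "leading_coefficient P P' (2 * A * r0 ^ 8) (2 * A * sqrt c ^ 8) b"
proof -
  have "((\<lambda>x. - (16 * A * r x ^ 6 * (\<phi> x * \<phi>1 x))) \<longlongrightarrow> - (16 * A * \<rho> ^ 6 * (k * 0))) at_top"
    by (intro tendsto_intros r_lim \<phi>_lim \<phi>1_lim)
  then have "(P' \<longlongrightarrow> - (16 * A * \<rho> ^ 6 * (k * 0))) at_top" by (simp add: P'_def[abs_def])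
  then obtain b where b: "\<And>x. \<bar>P' x\<bar> \<le> b"
    using bounded_of_symmetric_limit[OF P'_cont] P'_odd by (metis abs_minus_cancel)
  show thesis
  proof (rule that, unfold_locales)
    fix x
    show "2 * A * r0 ^ 8 \<le> P x" unfolding P_def
      using r0_le_r[of x] r0_pos A_pos by (intro mult_left_mono power_mono) auto
    show "P x \<le> 2 * A * sqrt c ^ 8" unfolding P_def
      using r_le[of x] r_pos[of x] A_pos by (intro mult_left_mono power_mono) auto
  qed (use P_deriv P'_cont b A_pos r0_pos in auto)
qed

lemma sturm_liouville:
  obtains pl pu b qb \<delta> X where "even_sturm_liouville P P' pl pu b Q v vf qb \<delta> X"
proof -
  obtain b where lc: "leading_coefficient P P' (2 * A * r0 ^ 8) (2 * A * sqrt c ^ 8) b" using leading .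
  obtain Qi where Qi: "0 < Qi" "(Q \<longlongrightarrow> Qi) at_top" using Q_lim by metis
  have Q_even: "Q (- x) = Q x" for x by (simp add: Q_def q_even f_even)
  obtain qb where qb: "\<And>x. \<bar>Q x\<bar> \<le> qb"
    using bounded_of_symmetric_limit[OF Q_cont Qi(2)] Q_even by metis
  have "eventually (\<lambda>x. Qi / 2 < Q x) at_top" using Qi by (intro order_tendstoD) auto
  then obtain T where T: "\<And>x. T \<le> x \<Longrightarrow> Qi / 2 < Q x" by (auto simp: eventually_at_top_linorder)
  have vl: "(v \<longlongrightarrow> - (k * 0 / \<rho> ^ 5)) at_top"
    unfolding v_def[abs_def] by (intro tendsto_intros \<phi>_lim \<phi>1_lim r_lim) (use \<rho>_pos in simp)
  \<comment> \<open>Half the limit is a lower bound far out; \<open>max T 1\<close> keeps the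
    threshold positive.\<close>
  have "even_sturm_liouville P P' (2 * A * r0 ^ 8) (2 * A * sqrt c ^ 8) b Q v vf qb (Qi / 2) (max T 1)"
  proof (rule even_sturm_liouville.intro[OF lc], unfold_locales)
    show "P (- x) = P x" "v (- x) = - v x" "vf (- x) = vf x" for x
      by (simp_all add: P_def v_def vf_def r_even \<phi>_even \<phi>1_odd \<phi>2_even)
    \<comment> \<open>At the crest \<open>\<phi>1\<close> vanishes, so \<open>vf 0\<close> is
      \<open>- 2 A \<phi> \<phi>2 r^3\<close>, positive by \<open>\<phi>2_crest\<close>.\<close>
    show "0 < vf 0"
    proof -
      have "\<phi> 0 * \<phi>2 0 < 0" using \<phi>2_eq[of 0] \<phi>2_crest p0_pos by (simp add: \<phi>_0 r_0 mult_pos_neg)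
      then have "\<phi> 0 * \<phi>2 0 * r 0 ^ 3 < 0" using r_pos[of 0] by (simp add: mult_neg_pos)
      then show ?thesis using A_pos by (simp add: vf_def \<phi>1_0 mult_pos_neg)
    qed
    show "0 < v x" if "0 < x" for x
      unfolding v_def using \<phi>1_neg[OF that] \<phi>_pos[of x] r_pos[of x] by (simp add: divide_neg_pos mult_pos_neg)
    show "Qi / 2 \<le> Q x" if "max T 1 \<le> x" for x using T[of x] that by simp
  qed (use Q_cont qb Q_even Qi v_deriv vf_deriv vl \<phi>1_0 in \<open>auto simp: v_def\<close>)
  then show thesis by (rule that)
qed

section \<open>Reduction of the operators to regular representatives, and the spectral bound\<close>

lemma op_L0_eq:
  "op_L0 c k \<phi> u x = (-2) *\<^sub>R weak_deriv (\<lambda>y. (\<mu> y powr (-8/3)) *\<^sub>R weak_deriv u y) x + q x *\<^sub>R u x"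
  unfolding op_L0_def Let_def q_eq by (simp add: scaleR_diff_left scaleR_add_left algebra_simps)

lemma op_L0_AE:
  assumes u: "u \<in> H2" and rep: "H2_rep U V W" "AE x in lborel. u x = U x"
  shows "AE x in lborel. op_L0 c k \<phi> u x = - leading_coefficient.flux_deriv P P' V W x + q x *\<^sub>R U x"
    and "op_L0 c k \<phi> u \<in> borel_measurable borel"
proof -
  obtain b where lc: "leading_coefficient P P' (2 * A * r0 ^ 8) (2 * A * sqrt c ^ 8) b" using leading .
  interpret lc: leading_coefficient P P' "2 * A * r0 ^ 8" "2 * A * sqrt c ^ 8" b by (rule lc)
  have um: "u \<in> borel_measurable borel" by (rule L2_measurable[OF H2_L2[OF u]])
  \<comment> \<open>\<open>P\<close> includes the factor 2, which is 2/3 times 3, in front of the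
    divergence term.\<close>
  have p: "\<mu> y powr (-8/3) = P y / 2" for y unfolding \<mu>_powr(1) P_def by simp
  have pd: "((\<lambda>y. P y / 2) has_real_derivative P' x / 2) (at x)" for x
    using DERIV_cdivide[OF P_deriv] .
  have pc: "continuous_on UNIV (\<lambda>y. P' y / 2)" by (intro continuous_intros P'_cont) simp
  note fl = weak_deriv_flux[OF rep(1) um rep(2) pd pc]
  show "AE x in lborel. op_L0 c k \<phi> u x = - lc.flux_deriv V W x + q x *\<^sub>R U x"
    using fl(1) rep(2)
  proof eventually_elim
    case (elim x)
    show ?case unfolding op_L0_eq p elim lc.flux_deriv_def by (simp add: scaleR_add_right)
  qed
  have [measurable]: "q \<in> borel_measurable borel" by (rule borel_measurable_continuous_onI[OF q_cont])
  have [measurable]: "u \<in> borel_measurable borel" "weak_deriv (\<lambda>y. (P y / 2) *\<^sub>R weak_deriv u y) \<in> borel_measurable borel"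
    using um fl(2) by auto
  show "op_L0 c k \<phi> u \<in> borel_measurable borel"
    unfolding op_L0_eq[abs_def] p by measurable
qed

theorem spectral_bound:
  "spectrum H2 (op_L c k \<phi>) \<subseteq> complex_of_real ` {sigma1 c k \<phi>..} \<and> sigma1 c k \<phi> < 0"
proof (rule sturm_liouville)
  fix pl pu b qb \<delta> X
  assume sl: "even_sturm_liouville P P' pl pu b Q v vf qb \<delta> X"
  interpret SL: even_sturm_liouville P P' pl pu b Q v vf qb \<delta> X by (rule sl)
  obtain Qi where "(q \<longlongrightarrow> Qi) at_top" using Q_lim by metis
  then obtain M where M: "\<And>x. \<bar>q x\<bar> \<le> M"
    using bounded_of_symmetric_limit[OF q_cont] q_even by metis
  have M0: "0 \<le> M" using M[of 0] by linarith
  have [measurable]: "q \<in> borel_measurable borel" "f \<in> borel_measurable borel"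
    using q_cont f_cont by (auto intro: borel_measurable_continuous_onI)
  have Lt: "AE x in lborel. op_Ltilde c k \<phi> u x = - SL.flux_deriv V W x + Q x *\<^sub>R U x"
    if "u \<in> H2" "H2_rep U V W" "AE x in lborel. u x = U x" for u U V W
    using op_L0_AE(1)[OF that] that(3)
    by eventually_elim (simp add: op_Ltilde_def f_eq \<omega>_def[symmetric] Q_def scaleR_add_left)
  \<comment> \<open>Eigenvalues on \<open>H2\<close> are those of regular representatives; this
    allows the definite description in \<open>lambda_minus\<close> to be evaluated by the uniqueness
    result for eigenpairs.\<close>
  have eig: "is_eigenvalue H2 (op_Ltilde c k \<phi>) (complex_of_real l) \<longleftrightarrow> (\<exists>u V W. SL.eigenpair l u V W)" for l
  proof
    assume "is_eigenvalue H2 (op_Ltilde c k \<phi>) (complex_of_real l)"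
    then obtain u where u: "u \<in> H2" "\<not> (AE x in lborel. u x = 0)"
      "AE x in lborel. op_Ltilde c k \<phi> u x = complex_of_real l * u x" by (auto simp: is_eigenvalue_def)
    obtain U V W where rep: "H2_rep U V W" "AE x in lborel. u x = U x" using H2_rep_exists[OF u(1)] .
    have "AE x in lborel. - SL.flux_deriv V W x + Q x *\<^sub>R U x = of_real l * U x"
      using Lt[OF u(1) rep] u(3) rep(2) by eventually_elim simp
    moreover have "\<not> (AE x in lborel. U x = 0)"
    proof
      assume "AE x in lborel. U x = 0"
      then have "AE x in lborel. u x = 0" using rep(2) by eventually_elim simp
      then show False using u(2) by simp
    qed
    ultimately show "\<exists>u V W. SL.eigenpair l u V W" using rep(1) by (auto simp: SL.eigenpair_def)
  next
    assume "\<exists>u V W. SL.eigenpair l u V W"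
    then obtain u V W where u: "H2_rep u V W" "\<not> (AE x in lborel. u x = 0)"
      "AE x in lborel. - SL.flux_deriv V W x + Q x *\<^sub>R u x = of_real l * u x" by (auto simp: SL.eigenpair_def)
    have uH: "u \<in> H2" by (rule H2_rep_in_H2[OF u(1)])
    have "AE x in lborel. op_Ltilde c k \<phi> u x = - SL.flux_deriv V W x + Q x *\<^sub>R u x"
      by (rule Lt[OF uH u(1)]) simp
    then have "AE x in lborel. op_Ltilde c k \<phi> u x = of_real l * u x" using u(3) by eventually_elim simp
    then show "is_eigenvalue H2 (op_Ltilde c k \<phi>) (complex_of_real l)"
      using uH u(2) by (auto simp: is_eigenvalue_def)
  qed
  show ?thesis
  proof (rule SL.negative_eigenvalue)
    fix l
    assume l: "l < 0" "\<exists>u V W. SL.eigenpair l u V W"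
      and uniq: "\<And>l'. l' < 0 \<Longrightarrow> \<exists>u V W. SL.eigenpair l' u V W \<Longrightarrow> l' = l"
      and low: "\<And>u V W. H2_rep u V W \<Longrightarrow> l * (L2_norm u)\<^sup>2 \<le> (LINT x|lborel. P x * (norm (V x))\<^sup>2 + Q x * (norm (u x))\<^sup>2)"
    have lm: "lambda_minus c k \<phi> = l"
      unfolding lambda_minus_def eig
    proof (rule the_equality)
      show "l < 0 \<and> (\<exists>u V W. SL.eigenpair l u V W)" using l by (rule conjI)
      show "l' = l" if "l' < 0 \<and> (\<exists>u V W. SL.eigenpair l' u V W)" for l'
        by (rule uniq[OF conjunct1[OF that] conjunct2[OF that]])
    qed
    have s1: "sigma1 c k \<phi> = l + 2 * \<omega> * (1 - f 0)" by (simp add: sigma1_def lm f_eq \<omega>_def)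
    have "2 * \<omega> * (1 - f 0) < 0" using \<omega>_neg f_0_less_1 by (simp add: mult_neg_pos)
    then have neg: "sigma1 c k \<phi> < 0" using l(1) s1 by linarith
    define S where "S u x = q x *\<^sub>R u x + (2 * \<omega>) *\<^sub>R inv_helmholtz u x" for u x
    have qL: "(\<lambda>x. q x *\<^sub>R u x) \<in> L2" "L2_norm (\<lambda>x. q x *\<^sub>R u x) \<le> M * L2_norm u" if u: "u \<in> L2" for u
    proof -
      show L: "(\<lambda>x. q x *\<^sub>R u x) \<in> L2" by (rule L2_scaleR_bounded[OF u _ M]) simp
      show "L2_norm (\<lambda>x. q x *\<^sub>R u x) \<le> M * L2_norm u"
        by (rule L2_norm_mono[OF u L2_measurable[OF L]]) (use M M0 in \<open>auto intro!: mult_right_mono\<close>)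
    qed
    have GL: "(\<lambda>x. (2 * \<omega>) *\<^sub>R inv_helmholtz u x) \<in> L2"
      "L2_norm (\<lambda>x. (2 * \<omega>) *\<^sub>R inv_helmholtz u x) \<le> \<bar>2 * \<omega>\<bar> * L2_norm u" if u: "u \<in> L2" for u
    proof -
      have e: "(\<lambda>x. (2 * \<omega>) *\<^sub>R inv_helmholtz u x) = (\<lambda>x. complex_of_real (2 * \<omega>) * inv_helmholtz u x)"
        by (simp add: scaleR_conv_of_real)
      show "(\<lambda>x. (2 * \<omega>) *\<^sub>R inv_helmholtz u x) \<in> L2"
        unfolding e by (intro L2_cmult inv_helmholtz_L2 u)
      show "L2_norm (\<lambda>x. (2 * \<omega>) *\<^sub>R inv_helmholtz u x) \<le> \<bar>2 * \<omega>\<bar> * L2_norm u"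
        unfolding e L2_norm_cmult norm_of_real by (intro mult_left_mono inv_helmholtz_L2 u) simp
    qed
    have "spectrum H2 (op_L c k \<phi>) \<subseteq> complex_of_real ` {sigma1 c k \<phi>..}"
    proof (rule SL.spectrum_bounded_below[where S = S and K = "M + \<bar>2 * \<omega>\<bar>"])
      fix u U V W assume u: "u \<in> H2" "H2_rep U V W" "AE x in lborel. u x = U x"
      have i: "inv_helmholtz u = inv_helmholtz U"
        by (rule inv_helmholtz_cong_AE) (use u L2_measurable H2_L2 H2_repD(3) in auto)
      show "AE x in lborel. op_L c k \<phi> u x = - SL.flux_deriv V W x + S U x"
        using op_L0_AE(1)[OF u] by eventually_elim (simp add: op_L_def S_def i \<omega>_def)
    next
      fix u assume u: "u \<in> H2"
      obtain U V W where rep: "H2_rep U V W" "AE x in lborel. u x = U x" using H2_rep_exists[OF u] .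
      have [measurable]: "op_L0 c k \<phi> u \<in> borel_measurable borel" "inv_helmholtz u \<in> borel_measurable borel"
        using op_L0_AE(2)[OF u rep] L2_measurable[OF inv_helmholtz_L2(1)[OF H2_L2[OF u]]] by auto
      show "op_L c k \<phi> u \<in> borel_measurable borel" unfolding op_L_def[abs_def] by measurable
    next
      fix u assume u: "u \<in> L2"
      show "S u \<in> L2" unfolding S_def[abs_def] by (intro L2_add qL GL u)
      have "L2_norm (S u) \<le> L2_norm (\<lambda>x. q x *\<^sub>R u x) + L2_norm (\<lambda>x. (2 * \<omega>) *\<^sub>R inv_helmholtz u x)"
        unfolding S_def[abs_def] by (intro L2_norm_triangle qL GL u)
      then show "L2_norm (S u) \<le> (M + \<bar>2 * \<omega>\<bar>) * L2_norm u"
        using qL(2)[OF u] GL(2)[OF u] by (simp add: algebra_simps)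
    next
      show "0 \<le> M + \<bar>2 * \<omega>\<bar>" using M0 by simp
      show "S (\<lambda>x. u x + w x) x = S u x + S w x" if "u \<in> L2" "w \<in> L2" for u w x
        by (simp add: S_def inv_helmholtz_add[OF that] scaleR_add_right)
    next
      fix U V W assume rep: "H2_rep U V W"
      note R = H2_repD[OF rep]
      let ?G = "LINT x|lborel. inv_helmholtz U x * cnj (U x)"
      have "cnj ?G = (LINT x|lborel. U x * cnj (inv_helmholtz U x))"
        unfolding Bochner_Integration.integral_cnj[symmetric] by (simp add: mult.commute)
      \<comment> \<open>Symmetry makes the nonlocal part of the form real, as the abstract spectral
        bound demands.\<close>
      then have "cnj ?G = ?G" using inv_helmholtz_symmetric[OF R(3) R(3)] by simp
      then have Gr: "?G = complex_of_real (Re ?G)" by (simp add: complex_eq_iff)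
      have "Re ?G \<le> norm ?G" by (rule complex_Re_le_cmod)
      also have "\<dots> \<le> L2_norm (inv_helmholtz U) * L2_norm U"
        by (rule L2_Cauchy_Schwarz[OF inv_helmholtz_L2(1)[OF R(3)] R(3)])
      also have "\<dots> \<le> L2_norm U * L2_norm U" by (intro mult_right_mono inv_helmholtz_L2 R) simp
      finally have Gle: "Re ?G \<le> (L2_norm U)\<^sup>2" by (simp add: power2_eq_square)
      define t where "t = (LINT x|lborel. P x * (norm (V x))\<^sup>2 + q x * (norm (U x))\<^sup>2)"
      have i1: "integrable lborel (\<lambda>x. (- SL.flux_deriv V W x + q x *\<^sub>R U x) * cnj (U x))"
        by (intro L2_integrable_mult_cnj L2_add L2_uminus SL.flux_deriv_L2 qL R)
      have i2: "integrable lborel (\<lambda>x. ((2 * \<omega>) *\<^sub>R inv_helmholtz U x) * cnj (U x))"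
        by (intro L2_integrable_mult_cnj GL R)
      have "(LINT x|lborel. (- SL.flux_deriv V W x + S U x) * cnj (U x))
          = (LINT x|lborel. (- SL.flux_deriv V W x + q x *\<^sub>R U x) * cnj (U x) + ((2 * \<omega>) *\<^sub>R inv_helmholtz U x) * cnj (U x))"
        by (rule Bochner_Integration.integral_cong) (simp, simp only: S_def distrib_right add.assoc)
      also have "\<dots> = complex_of_real t + (LINT x|lborel. ((2 * \<omega>) *\<^sub>R inv_helmholtz U x) * cnj (U x))"
        unfolding t_def SL.form_eq[OF rep q_cont M, symmetric] by (rule Bochner_Integration.integral_add[OF i1 i2])
      also have "(LINT x|lborel. ((2 * \<omega>) *\<^sub>R inv_helmholtz U x) * cnj (U x)) = of_real (2 * \<omega>) * ?G"
        by (simp add: scaleR_conv_of_real mult.assoc)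
      also have "?G = complex_of_real (Re ?G)" by (rule Gr)
      finally have form: "(LINT x|lborel. (- SL.flux_deriv V W x + S U x) * cnj (U x)) = complex_of_real (t + 2 * \<omega> * Re ?G)"
        by simp
      have Qi: "integrable lborel (\<lambda>x. P x * (norm (V x))\<^sup>2 + Q x * (norm (U x))\<^sup>2)"
        by (rule SL.form_integrable(1)[OF rep SL.Q_cont SL.Q_bound])
      have Ui: "integrable lborel (\<lambda>x. (norm (U x))\<^sup>2)" by (rule L2_integrable_norm_sq[OF R(3)])
      \<comment> \<open>The potential is \<open>q = Q - 2 \<omega> f\<close> with
        \<open>- 2 \<omega> > 0\<close>, so replacing \<open>f\<close> by its minimum can only lower
        the form.\<close>
      have "(LINT x|lborel. (P x * (norm (V x))\<^sup>2 + Q x * (norm (U x))\<^sup>2) + (- 2 * \<omega> * f 0) * (norm (U x))\<^sup>2) \<le> t"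
        unfolding t_def
      proof (rule integral_mono)
        show "integrable lborel (\<lambda>x. P x * (norm (V x))\<^sup>2 + q x * (norm (U x))\<^sup>2)"
          by (rule SL.form_integrable(1)[OF rep q_cont M])
        show "integrable lborel (\<lambda>x. (P x * (norm (V x))\<^sup>2 + Q x * (norm (U x))\<^sup>2) + (- 2 * \<omega> * f 0) * (norm (U x))\<^sup>2)"
          using Qi Ui by simp
        fix x
        have "(- 2 * \<omega> * f 0) * (norm (U x))\<^sup>2 \<le> (- 2 * \<omega> * f x) * (norm (U x))\<^sup>2"
          using f_ge[of x] \<omega>_neg by (intro mult_right_mono mult_left_mono) auto
        then show "(P x * (norm (V x))\<^sup>2 + Q x * (norm (U x))\<^sup>2) + (- 2 * \<omega> * f 0) * (norm (U x))\<^sup>2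
            \<le> P x * (norm (V x))\<^sup>2 + q x * (norm (U x))\<^sup>2"
          by (simp add: Q_def algebra_simps)
      qed
      moreover have "(LINT x|lborel. (P x * (norm (V x))\<^sup>2 + Q x * (norm (U x))\<^sup>2) + (- 2 * \<omega> * f 0) * (norm (U x))\<^sup>2)
          = (LINT x|lborel. P x * (norm (V x))\<^sup>2 + Q x * (norm (U x))\<^sup>2) + (- 2 * \<omega> * f 0) * (L2_norm U)\<^sup>2"
        unfolding L2_norm_sq
        by (subst Bochner_Integration.integral_add[OF Qi integrable_mult_right[OF Ui]]) simp
      ultimately have t: "l * (L2_norm U)\<^sup>2 + (- 2 * \<omega> * f 0) * (L2_norm U)\<^sup>2 \<le> t"
        using low[OF rep] by linarith
      \<comment> \<open>The negative factor turns the contraction bound into a lower bound. In total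
        the form is at least \<open>l - 2 \<omega> f 0 + 2 \<omega>\<close> times the squared norm,
        which is \<open>sigma1\<close>.\<close>
      have "2 * \<omega> * (L2_norm U)\<^sup>2 \<le> 2 * \<omega> * Re ?G"
        using Gle \<omega>_neg by (simp add: mult_left_mono_neg)
      then have "sigma1 c k \<phi> * (L2_norm U)\<^sup>2 \<le> t + 2 * \<omega> * Re ?G"
        using t by (simp add: s1 algebra_simps)
      then show "\<exists>a \<ge> sigma1 c k \<phi> * (L2_norm U)\<^sup>2.
          (LINT x|lborel. (- SL.flux_deriv V W x + S U x) * cnj (U x)) = complex_of_real a"
        using form by blast
    qed
    then show ?thesis using neg by blast
  qed
qed

end

theorem proposition3p6:
  fixes c k :: real and \<phi> :: "real \<Rightarrow> real"
  assumes "c > 0" and "0 < k" and "k < sqrt c / 2"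
    and "solitary_profile c k \<phi>"
  shows "spectrum H2 (op_L c k \<phi>) \<subseteq> complex_of_real ` {sigma1 c k \<phi>..} \<and> sigma1 c k \<phi> < 0"
  by (rule novikov_profile.spectral_bound[OF novikov_profile.intro[OF assms]])

end
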